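(* Let $\gamma_f,\gamma_h>0$ and let $(\bar f_0,\bar g_0)=(f_0-\langle f_0\rangle,\,g_0-\langle g_0\rangle)\in(\dot H^2(\mathbb T))^2$ be the initial datum for the system $$\partial_t\bar f=-\partial_x\big[(\bar f+\langle f_0\rangle)(A_\gamma\partial_x^3\bar f+A\partial_x^3\bar g-b_\rho\partial_x\bar f-b\,\partial_x\bar g)\big],$$ $$\partial_t\bar g=-\partial_x\big[(\bar g+\langle g_0\rangle)(A_\mu\partial_x^3\bar f+A_\mu\partial_x^3\bar g-b_\mu\partial_x\bar f-b_\mu\partial_x\bar g)\big]\qquad(\mathrm M)$$ on $\mathbb T$, satisfying $$\mathcal E_0(\bar f_0,\bar g_0)<\min\{\langle f_0\rangle,\langle g_0\rangle\},\qquad \min\{\sigma_{1,A},\sigma_{2,A},\sigma_{1,b},\sigma_{2,b}\}>0$$ and in addition $$\langle g_0\rangle A_\mu-\frac{\langle f_0\rangle A+\langle g_0\rangle A_\mu}{2}-\Big(A_\gamma+\frac{13}{4}A+\frac{17}{4}A_\mu\Big)\mathcal E_0(\bar f_0,\bar g_0)>0,$$ $$\langle f_0\rangle A_\gamma-\frac{\langle f_0\rangle A+\langle g_0\rangle A_\mu}{2}-\Big(A_\gamma+\frac{13}{4}A+\frac{17}{4}A_\mu\Big)\mathcal E_0(\bar f_0,\bar g_0)>0.$$ Then there is a global weak solution $(\bar f,\bar g)$ of (M) with this initial datum which has, for every $T>0$ and every $\alpha\in[0,\frac12)$, the regularity $$\Big(L^\infty([0,T]\times\mathbb T)\cap L^{4/3}(0,T;W^{3,\infty}(\mathbb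 T))\cap L^1(0,T;C^{3+\alpha}(\mathbb T))\cap\mathcal M(0,T;W^{4,\infty}(\mathbb T))\cap L^2(0,T;\dot H^2(\mathbb T))\Big)^2,$$ satisfies $\|\bar f(T)\|_{L^\infty}+\|\bar g(T)\|_{L^\infty}\le\mathcal E_0(\bar f_0,\bar g_0)e^{-(\delta_A+\delta_b)T}$ for almost every $T>0$ with positive constants $\delta_A=\delta_A(\bar f_0,\bar g_0,\rho_\pm,\mu_\pm,\gamma_f,\gamma_h)$, $\delta_b=\delta_b(\bar f_0,\bar g_0,\rho_\pm,\mu_\pm)$, and which also satisfies, for all $T>0$, $$(\bar f,\bar g)\in\big(C([0,T];\dot H^2(\mathbb T))\cap L^2(0,T;\dot H^4(\mathbb T))\big)^2$$ together with (i) $E_2(\bar f(T),\bar g(T))+c_1\int_0^TE_4(\bar f(s),\bar g(s))\,ds\le c_2$, (ii) $E_s(\bar f(T),\bar g(T))\le c_3e^{-cT}$ for all $0\le s<2$, for certain positive constants $c=c(\bar f_0,\bar g_0,\rho_\pm,\mu_\pm,\gamma_f,\gamma_h,s)$ and $c_i=c_i(\bar f_0,\bar g_0,\rho_\pm,\mu_\pm,\gamma_f,\gamma_h)$, $i=1,2,3$.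
   Context: $\mathbb T=[-\pi,\pi]$ with periodic boundary conditions; $\langle u\rangle=\frac1{2\pi}\int_{-\pi}^{\pi}u\,dx$; $\hat u(k)=\frac1{2\pi}\int_{\mathbb T}u(x)e^{-ikx}dx$. For $\alpha\ge0$, $A^\alpha(\mathbb T)=\{u\in L^1(\mathbb T):\sum_{k\in\mathbb Z}(1+|k|^\alpha)|\hat u(k)|<\infty\}$, $A=A^0$, and $\dot A^\alpha(\mathbb T)$, $\dot H^\alpha(\mathbb T)$ are the subspaces of zero-mean functions of $A^\alpha(\mathbb T)$ and of the Sobolev space $H^\alpha(\mathbb T)$, with norms $\|u\|_{\dot A^\alpha}=\sum_k|k|^\alpha|\hat u(k)|$ and $\|u\|_{\dot H^\alpha}^2=\sum_k|k|^{2\alpha}|\hat u(k)|^2$; $\dot A=\dot A^0$. $\mathcal M(0,T;X)$ is the space of Radon measures on $[0,T]$ with values in the Banach space $X$. $\mathcal E_s(\bar f,\bar g)=\|\bar f\|_{\dot A^s}+\|\bar g\|_{\dot A^s}$ and $E_s(\bar f,\bar g)=\|\bar f\|_{\dot H^s}^2+\|\bar g\|_{\dot H^s}^2$. Parameters: $G,\mu_\pm,\rho_\pm>0$ (gravity, viscosities, densities), $\gamma_f,\gamma_h$ surface tension coefficients, and $$b=\rho_+,\quad b_\mu=\tfrac{\mu_-}{\mu_+}b,\quad b_\rho=\tfrac{\rho_-}{\rho_+}b=\rho_-,\quad A=\tfrac{\gamma_h}{G},\quad A_\mu=\tfrac{\mu_-}{\mu_+}A,\quad A_\gamma=\tfrac{\gamma_f+\gamma_h}{\gamma_h}A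 .$$ $f_0,g_0$ are positive $2\pi$-periodic functions (initial thicknesses of the two fluid layers). Moreover $$\sigma_{1,A}=\langle f_0\rangle A_\gamma-\langle g_0\rangle A_\mu-(A_\mu+2A_\gamma+2A)\mathcal E_0(\bar f_0,\bar g_0),$$ $$\sigma_{2,A}=\langle g_0\rangle A_\mu-\langle f_0\rangle A-(A_\mu+2A_\gamma+2A)\mathcal E_0(\bar f_0,\bar g_0),$$ $$\sigma_{1,b}=\langle f_0\rangle b_\rho-\langle g_0\rangle b_\mu-\mathcal E_0(\bar f_0,\bar g_0)(2b_\rho+2b+4b_\mu),$$ $$\sigma_{2,b}=\langle g_0\rangle b_\mu-\langle f_0\rangle b-\mathcal E_0(\bar f_0,\bar g_0)(2b_\rho+2b+4b_\mu).$$ Weak solution (with surface tension): a pair of zero-mean functions $(\bar f,\bar g)\in(L^1(0,T;W^{3,1}(\mathbb T)))^2$ is a weak solution of (M) on $[0,T]$ with initial datum $(\bar f_0,\bar g_0)$ if for all $\phi,\psi\in C^1_c([0,T)\times\mathbb T)$ $$-\int_{\mathbb T}\bar f_0\phi(0)dx-\int_0^T\!\!\int_{\mathbb T}\bar f\,\partial_t\phi\,dxdt=\int_0^T\!\!\int_{\mathbb T}(\bar f+\langle f_0\rangle)(A_\gamma\partial_x^3\bar f+A\partial_x^3\bar g-b_\rho\partial_x\bar f-b\partial_x\bar g)\partial_x\phi\,dxdt,$$ $$-\int_{\mathbb T}\bar g_0\psi(0)dx-\int_0^T\!\!\int_{\mathbb T}\bar g\,\partial_t\psi\,dxdt=\int_0^T\!\!\int_{\mathbb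 T}(\bar g+\langle g_0\rangle)(A_\mu\partial_x^3\bar f+A_\mu\partial_x^3\bar g-b_\mu\partial_x\bar f-b_\mu\partial_x\bar g)\partial_x\psi\,dxdt .$$ A global weak solution is a pair on $(0,\infty)\times\mathbb T$ that is a weak solution on $[0,T]$ for every $T>0$. *)

theory Defs
  imports "HOL-Analysis.Analysis" "HOL-Probability.Essential_Supremum"
begin

section \<open>Functions on the torus\<close>

text \<open>Functions on the torus are $2\pi$-periodic functions on the real line; integrals are taken
  over one period. Elements of Lebesgue and Sobolev spaces are represented by functions, not by
  equivalence classes: all their norms are invariant under changes on null sets.\<close>

abbreviation torus :: "real measure" where
  "torus \<equiv> lebesgue_on {-pi..pi}"

definition periodic :: "(real \<Rightarrow> real) \<Rightarrow> bool" where
  "periodic u \<longleftrightarrow> (\<forall>x. u (x + 2 * pi) = u x)"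

definition mean :: "(real \<Rightarrow> real) \<Rightarrow> real" where
  "mean u = (LINT x|torus. u x) / (2 * pi)"

definition fourier :: "(real \<Rightarrow> real) \<Rightarrow> int \<Rightarrow> complex" where
  "fourier u k = (LINT x|torus. complex_of_real (u x) * exp (- \<i> * of_int k * of_real x)) / (2 * pi)"

definition smooth_periodic :: "(real \<Rightarrow> real) \<Rightarrow> bool" where
  "smooth_periodic \<phi> \<longleftrightarrow> periodic \<phi> \<and> (\<forall>j x. (deriv ^^ j) \<phi> field_differentiable at x)"


section \<open>Normed spaces of functions on the torus\<close>

text \<open>The norm of a space is only meaningful on its carrier.\<close>

record fun_space =
  fcarrier :: "(real \<Rightarrow> real) set"
  fnorm :: "(real \<Rightarrow> real) \<Rightarrow> real"

definition L1 :: fun_space where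
  "L1 = \<lparr>fcarrier = {u. periodic u \<and> integrable torus u},
         fnorm = (\<lambda>u. LINT x|torus. \<bar>u x\<bar>)\<rparr>"

definition Linf :: fun_space where
  "Linf = \<lparr>fcarrier = {u. periodic u \<and> u \<in> borel_measurable torus \<and>
                          esssup torus (\<lambda>x. ereal \<bar>u x\<bar>) < \<infinity>},
           fnorm = (\<lambda>u. real_of_ereal (esssup torus (\<lambda>x. ereal \<bar>u x\<bar>)))\<rparr>"

definition has_weak_deriv :: "nat \<Rightarrow> (real \<Rightarrow> real) \<Rightarrow> (real \<Rightarrow> real) \<Rightarrow> bool" where
  "has_weak_deriv k u v \<longleftrightarrow> u \<in> fcarrier L1 \<and> v \<in> fcarrier L1 \<and>
     (\<forall>\<phi>. smooth_periodic \<phi> \<longrightarrow>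
        (LINT x|torus. u x * (deriv ^^ k) \<phi> x) = (-1) ^ k * (LINT x|torus. v x * \<phi> x))"

text \<open>Determined up to null sets whenever a weak derivative exists.\<close>

definition weak_deriv :: "nat \<Rightarrow> (real \<Rightarrow> real) \<Rightarrow> real \<Rightarrow> real" where
  "weak_deriv k u = (SOME v. has_weak_deriv k u v)"

text \<open>\<open>W k L1\<close> and \<open>W k Linf\<close> are $W^{k,1}$ and $W^{k,\infty}$.\<close>

definition W :: "nat \<Rightarrow> fun_space \<Rightarrow> fun_space" where
  "W k Y = \<lparr>fcarrier = {u \<in> fcarrier Y. \<forall>j\<le>k. \<exists>v\<in>fcarrier Y. has_weak_deriv j u v},
            fnorm = (\<lambda>u. \<Sum>j\<le>k. fnorm Y (weak_deriv j u))\<rparr>"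

text \<open>\<open>Holder k \<alpha>\<close> is $C^{k+\alpha}$; for \<open>\<alpha> = 0\<close> it is $C^k$ with an equivalent norm, as
  the Hoelder quotient is then just the oscillation. By periodicity, the supremum over pairs of real
  numbers agrees with the one taken with respect to the distance of the torus.\<close>

definition Holder :: "nat \<Rightarrow> real \<Rightarrow> fun_space" where
  "Holder k \<alpha> =
     \<lparr>fcarrier = {u. periodic u \<and> (\<forall>j<k. \<forall>x. (deriv ^^ j) u field_differentiable at x) \<and>
        continuous_on UNIV ((deriv ^^ k) u) \<and>
        (\<exists>C. \<forall>x y. x \<noteq> y \<longrightarrow> \<bar>(deriv ^^ k) u x - (deriv ^^ k) u y\<bar> / \<bar>x - y\<bar> powr \<alpha> \<le> C)},
      fnorm = (\<lambda>u. (\<Sum>j\<le>k. SUP x. \<bar>(deriv ^^ j) u x\<bar>) +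
        (SUP (x, y)\<in>{(x, y). x \<noteq> y}. \<bar>(deriv ^^ k) u x - (deriv ^^ k) u y\<bar> / \<bar>x - y\<bar> powr \<alpha>))\<rparr>"

text \<open>The convention \<open>0 powr 0 = 0\<close> does not matter below: the zeroth Fourier coefficient of a
  zero-mean function vanishes.\<close>

definition Adot :: "real \<Rightarrow> fun_space" where
  "Adot \<alpha> =
     \<lparr>fcarrier = {u \<in> fcarrier L1. mean u = 0 \<and>
        (\<lambda>k::int. (1 + \<bar>real_of_int k\<bar> powr \<alpha>) * cmod (fourier u k)) summable_on UNIV},
      fnorm = (\<lambda>u. \<Sum>\<^sub>\<infinity>k::int. \<bar>real_of_int k\<bar> powr \<alpha> * cmod (fourier u k))\<rparr>"

definition Hdot :: "real \<Rightarrow> fun_space" where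
  "Hdot \<alpha> =
     \<lparr>fcarrier = {u. periodic u \<and> u \<in> borel_measurable torus \<and> integrable torus (\<lambda>x. (u x)\<^sup>2) \<and>
        mean u = 0 \<and>
        (\<lambda>k::int. (1 + \<bar>real_of_int k\<bar> powr (2 * \<alpha>)) * (cmod (fourier u k))\<^sup>2) summable_on UNIV},
      fnorm = (\<lambda>u. sqrt (\<Sum>\<^sub>\<infinity>k::int. \<bar>real_of_int k\<bar> powr (2 * \<alpha>) * (cmod (fourier u k))\<^sup>2))\<rparr>"

definition calE :: "real \<Rightarrow> (real \<Rightarrow> real) \<Rightarrow> (real \<Rightarrow> real) \<Rightarrow> real" where
  "calE s u v = fnorm (Adot s) u + fnorm (Adot s) v"

definition E :: "real \<Rightarrow> (real \<Rightarrow> real) \<Rightarrow> (real \<Rightarrow> real) \<Rightarrow> real" where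
  "E s u v = (fnorm (Hdot s) u)\<^sup>2 + (fnorm (Hdot s) v)\<^sup>2"


section \<open>Spaces of time-dependent functions\<close>

text \<open>A function \<open>u\<close> of time \<open>t\<close> and space \<open>x\<close> is applied as \<open>u t x\<close>.\<close>

definition Linf_spacetime :: "real \<Rightarrow> (real \<Rightarrow> real \<Rightarrow> real) set" where
  "Linf_spacetime T =
     {u. (\<lambda>(t, x). u t x) \<in> borel_measurable (lebesgue_on ({0..T} \<times> {-pi..pi})) \<and>
         esssup (lebesgue_on ({0..T} \<times> {-pi..pi})) (\<lambda>(t, x). ereal \<bar>u t x\<bar>) < \<infinity>}"

text \<open>Bochner measurability: approximation by simple functions, almost everywhere in time, in the
  norm of the space.\<close>

definition strongly_measurable :: "real \<Rightarrow> fun_space \<Rightarrow> (real \<Rightarrow> real \<Rightarrow> real) \<Rightarrow> bool" where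
  "strongly_measurable T X u \<longleftrightarrow>
     (\<exists>s :: nat \<Rightarrow> real \<Rightarrow> real \<Rightarrow> real.
        (\<forall>n. simple_function (lebesgue_on {0..T}) (s n) \<and> s n ` {0..T} \<subseteq> fcarrier X) \<and>
        (AE t in lebesgue_on {0..T}. (\<lambda>n. fnorm X (\<lambda>x. u t x - s n t x)) \<longlonglongrightarrow> 0))"

definition Lp_time :: "real \<Rightarrow> real \<Rightarrow> fun_space \<Rightarrow> (real \<Rightarrow> real \<Rightarrow> real) set" where
  "Lp_time p T X =
     {u. (AE t in lebesgue_on {0..T}. u t \<in> fcarrier X) \<and> strongly_measurable T X u \<and>
         integrable (lebesgue_on {0..T}) (\<lambda>t. fnorm X (u t) powr p)}"

definition C_time :: "real \<Rightarrow> fun_space \<Rightarrow> (real \<Rightarrow> real \<Rightarrow> real) set" where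
  "C_time T X =
     {u. \<forall>t\<in>{0..T}. u t \<in> fcarrier X \<and>
           ((\<lambda>s. fnorm X (\<lambda>x. u s x - u t x)) \<longlongrightarrow> 0) (at t within {0..T})}"

text \<open>Countably additive vector measures of bounded variation on the Borel sets of $[0,T]$; on a
  compact interval these are automatically Radon.\<close>

definition vector_measure :: "real \<Rightarrow> fun_space \<Rightarrow> (real set \<Rightarrow> real \<Rightarrow> real) \<Rightarrow> bool" where
  "vector_measure T X m \<longleftrightarrow>
     (\<forall>B\<in>sets (restrict_space borel {0..T}). m B \<in> fcarrier X) \<and>
     (\<forall>F :: nat \<Rightarrow> real set. range F \<subseteq> sets (restrict_space borel {0..T}) \<and> disjoint_family F \<longrightarrow>
        (\<lambda>n. fnorm X (\<lambda>x. m (\<Union>i. F i) x - (\<Sum>i<n. m (F i) x))) \<longlonglongrightarrow> 0) \<and>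
     (\<exists>V. \<forall>P. finite P \<and> P \<subseteq> sets (restrict_space borel {0..T}) \<and> disjoint P \<longrightarrow>
        (\<Sum>B\<in>P. fnorm X (m B)) \<le> V)"

text \<open>A function \<open>u\<close> is identified with the measure $u\,dt$, that is $B \mapsto \int_B u(t)\,dt$,
  where the integral is taken in $L^1$ and tested against smooth functions.\<close>

definition M_time :: "real \<Rightarrow> fun_space \<Rightarrow> (real \<Rightarrow> real \<Rightarrow> real) set" where
  "M_time T X =
     {u \<in> Lp_time 1 T L1. \<exists>m. vector_measure T X m \<and>
        (\<forall>B\<in>sets (restrict_space borel {0..T}). \<forall>\<psi>. smooth_periodic \<psi> \<longrightarrow>
           (LINT x|torus. m B x * \<psi> x) = (LINT t|lebesgue_on B. LINT x|torus. u t x * \<psi> x))}"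


section \<open>Weak solutions\<close>

text \<open>\<open>test_fun T \<phi> \<phi>t \<phi>x\<close>: \<open>\<phi>\<close> is of class $C^1_c([0,T)\times\mathbb{T})$ with
  time derivative \<open>\<phi>t\<close> (one-sided at time zero) and space derivative \<open>\<phi>x\<close>.\<close>

definition test_fun ::
  "real \<Rightarrow> (real \<Rightarrow> real \<Rightarrow> real) \<Rightarrow> (real \<Rightarrow> real \<Rightarrow> real) \<Rightarrow> (real \<Rightarrow> real \<Rightarrow> real) \<Rightarrow> bool" where
  "test_fun T \<phi> \<phi>t \<phi>x \<longleftrightarrow>
     (\<forall>t\<in>{0..<T}. periodic (\<phi> t)) \<and>
     (\<forall>t\<in>{0..<T}. \<forall>x. ((\<lambda>s. \<phi> s x) has_real_derivative \<phi>t t x) (at t within {0..<T})) \<and>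
     (\<forall>t\<in>{0..<T}. \<forall>x. ((\<lambda>y. \<phi> t y) has_real_derivative \<phi>x t x) (at x)) \<and>
     continuous_on ({0..<T} \<times> UNIV) (\<lambda>(t, x). \<phi>t t x) \<and>
     continuous_on ({0..<T} \<times> UNIV) (\<lambda>(t, x). \<phi>x t x) \<and>
     (\<exists>T'<T. \<forall>t\<in>{0..<T}. T' \<le> t \<longrightarrow> (\<forall>x. \<phi> t x = 0))"

text \<open>Weak form of $\partial_t u = -\partial_x F$, $u(0) = u_0$. Integrability of the flux is
  part of the definition, so that its integrals are meaningful.\<close>

definition weak_equation ::
  "real \<Rightarrow> (real \<Rightarrow> real) \<Rightarrow> (real \<Rightarrow> real \<Rightarrow> real) \<Rightarrow> (real \<Rightarrow> real \<Rightarrow> real) \<Rightarrow> bool" where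
  "weak_equation T u0 u F \<longleftrightarrow> F \<in> Lp_time 1 T L1 \<and>
     (\<forall>\<phi> \<phi>t \<phi>x. test_fun T \<phi> \<phi>t \<phi>x \<longrightarrow>
        - (LINT x|torus. u0 x * \<phi> 0 x)
        - (LINT t|lebesgue_on {0..T}. LINT x|torus. u t x * \<phi>t t x)
        = (LINT t|lebesgue_on {0..T}. LINT x|torus. F t x * \<phi>x t x))"

text \<open>The arguments \<open>mf\<close>, \<open>mg\<close> are the means of the initial thicknesses.\<close>

definition weak_solution ::
  "real \<Rightarrow> real \<Rightarrow> real \<Rightarrow> real \<Rightarrow> real \<Rightarrow> real \<Rightarrow> real \<Rightarrow> real \<Rightarrow> (real \<Rightarrow> real) \<Rightarrow> (real \<Rightarrow> real) \<Rightarrow>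
   real \<Rightarrow> (real \<Rightarrow> real \<Rightarrow> real) \<Rightarrow> (real \<Rightarrow> real \<Rightarrow> real) \<Rightarrow> bool" where
  "weak_solution A A\<^sub>\<mu> A\<^sub>\<gamma> b b\<^sub>\<mu> b\<^sub>\<rho> mf mg u0 v0 T f g \<longleftrightarrow>
     f \<in> Lp_time 1 T (W 3 L1) \<and> g \<in> Lp_time 1 T (W 3 L1) \<and>
     (AE t in lebesgue_on {0..T}. mean (f t) = 0 \<and> mean (g t) = 0) \<and>
     weak_equation T u0 f (\<lambda>t x. (f t x + mf) *
       (A\<^sub>\<gamma> * weak_deriv 3 (f t) x + A * weak_deriv 3 (g t) x
        - b\<^sub>\<rho> * weak_deriv 1 (f t) x - b * weak_deriv 1 (g t) x)) \<and>
     weak_equation T v0 g (\<lambda>t x. (g t x + mg) *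
       (A\<^sub>\<mu> * weak_deriv 3 (f t) x + A\<^sub>\<mu> * weak_deriv 3 (g t) x
        - b\<^sub>\<mu> * weak_deriv 1 (f t) x - b\<^sub>\<mu> * weak_deriv 1 (g t) x))"

end

theory Submission
  imports Defs "HOL-Complex_Analysis.Great_Picard"
begin

text \<open>In Fourier variables (M) is an infinite system of ordinary differential equations. Its Galerkin
  truncations are dissipative: in the sum of the moduli of the coefficients (the Wiener norm), the
  damping of order four and two dominates the linear coupling and the quadratic terms as long as that
  norm stays below the smallness threshold, so the norm decays exponentially and its fourth-order analogue is
  integrable in time. The Sobolev norm of order two obeys an energy inequality whose
  quadratic terms are split by \<open>|l + j| \<le> |l| + |j|\<close>: their top-order part is again absorbed by the
  damping, the remainder is the energy times the integrable fourth-order norm, and Gronwall's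
  inequality applies. The modes are equicontinuous in time, a diagonal subsequence converges, and all bounds
  survive. The limit has absolutely convergent Fourier series with four derivatives
  for almost every time, which turns the required regularity into statements on sums of coefficients, and the
  weak equation into one integration by parts in time per mode.\<close>

text \<open>The quadratic field is only locally Lipschitz, and the Wiener norm is known to be small
  only at time zero. Both obstacles are met by multiplying the nonlinearity by
  \<open>\<theta>\<^sup>2\<close>, where \<open>\<theta>\<close> is the factor of the radial
  retraction onto the Wiener ball of radius \<open>a\<close>. The field becomes globally Lipschitz;
  in the estimate one factor \<open>\<theta>\<close> brings the norm below \<open>a\<close> whatever
  its size, and the other is at most one. The estimate then keeps the norm itself below
  \<open>a\<close>, so \<open>\<theta> = 1\<close> afterwards and no continuation argument occurs.
  The quadratic terms with a first derivative can be given an arbitrarily small share of the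
  damping, so the energy conditions involve the third-order coefficients only, apart from an error
  \<open>ka\<close>. Continuity in time with values in \<open>Hdot 2\<close> needs a summable
  majorant of the modes uniform in time. It comes from the time integral of the weighted products of
  the moduli of a mode and of its derivative, which the damping controls. Decay below order two is
  interpolation between the decaying Wiener norm and the bounded norm of order two.\<close>

abbreviation "mag k \<equiv> \<bar>real_of_int k\<bar>"
abbreviation "wave k x \<equiv> cis (real_of_int k * x)"
abbreviation "tint t \<equiv> integral {0..t::real}"
abbreviation "cont_nonneg \<equiv> continuous_on {0::real..}"
abbreviation "time T \<equiv> lebesgue_on {0..T::real}"

section \<open>Ordinary differential equations\<close>

lemma continuous_on_atLeast_if:
 fixes g :: "real => 'a::topological_space"
 assumes "!!T. T > a ==> continuous_on {a..T} g"
 shows "continuous_on {a..} g"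
proof -
 have "(g \<longlongrightarrow> g t) (at t within {a..})" if "t >= a" for t
 proof -
  have "(g \<longlongrightarrow> g t) (at t within {a..t+1})"
   using assms[of "t+1"] that by (auto simp: continuous_on_def)
  moreover have "at t within {a..t+1} = at t within {a..}"
   by (rule at_within_nhd[of t "{..<t+1}"]) (use that in auto)
  ultimately show ?thesis by simp
 qed
 then show ?thesis by (auto simp: continuous_on_def)
qed

lemma continuous_integrable:
 fixes f :: "real => 'a::banach"
 assumes "cont_nonneg f"
 shows "f integrable_on {0..t}"
 by (rule integrable_continuous_real, rule continuous_on_subset[OF assms]) auto

lemma FTC_atLeast:
 fixes f :: "real => 'a::banach"
 assumes "cont_nonneg f" "t > 0"
 shows "((\<lambda>s. tint s f) has_vector_derivative f t) (at t)"
proof -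
 have "((\<lambda>s. tint s f) has_vector_derivative f t) (at t within {0..t+1})"
  by (rule integral_has_vector_derivative[OF continuous_on_subset[OF assms(1)]]) (use assms in auto)
 then show ?thesis using assms(2)
  by (simp add: at_within_interior[of t "{0..t+1}"])
qed

lemma continuous_on_indefinite_integral_atLeast:
 fixes f :: "real => 'a::banach"
 assumes "cont_nonneg f"
 shows "cont_nonneg (\<lambda>s. tint s f)"
 by (rule continuous_on_atLeast_if)
  (rule indefinite_integral_continuous_1[OF continuous_integrable[OF assms]])

text \<open>The unknown is a plain function on an index type, of which only the coordinates in the
  finite set \<open>I\<close> matter, so the Picard iteration is run by hand. Measured with the
  weight \<open>exp (2 * N * t)\<close>, it contracts by one half on the whole half-line, so it need
  not be restarted on short time intervals.\<close>

lemma picard_global: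
 fixes F :: "('i => complex) => 'i => complex" and start :: "'i => complex"
 assumes fin: "finite I"
  and lip: "!!x y i. i \<in> I ==> cmod (F x i - F y i) <= L * (\<Sum>i\<in>I. cmod (x i - y i))"
 shows "\<exists>\<phi> :: real => 'i => complex. \<phi> 0 = start \<and>
  (\<forall>i\<in>I. cont_nonneg (\<lambda>t. \<phi> t i)) \<and>
  (\<forall>i\<in>I. \<forall>t>0. ((\<lambda>s. \<phi> s i) has_vector_derivative F (\<phi> t) i) (at t))"
proof -
 define d where "d x y = (\<Sum>i\<in>I. cmod (x i - y i))" for x y :: "'i => complex"
 define N where "N = \<bar>L\<bar> * card I + 1"
 have N1: "N >= 1" unfolding N_def by simp
 have d_nonneg: "d x y >= 0" for x y unfolding d_def by (simp add: sum_nonneg)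
 have comp_le: "cmod (x i - y i) <= d x y" if "i \<in> I" for x y i
  unfolding d_def using fin that by (intro member_le_sum) auto
 have lip1: "cmod (F x i - F y i) <= \<bar>L\<bar> * d x y" if "i \<in> I" for x y i
 proof -
  have "cmod (F x i - F y i) <= L * d x y" using lip[OF that, of x y] by (simp add: d_def)
  also have "... <= \<bar>L\<bar> * d x y" by (intro mult_right_mono d_nonneg) auto
  finally show ?thesis .
 qed
 have lipN: "d (F x) (F y) <= N * d x y" for x y
 proof -
  have "d (F x) (F y) <= (\<Sum>i\<in>I. \<bar>L\<bar> * d x y)"
   unfolding d_def[of "F x"] by (intro sum_mono lip1)
  also have "... <= N * d x y" using d_nonneg[of x y] by (simp add: N_def algebra_simps)
  finally show ?thesis .
 qed
 define step where "step u = (\<lambda>t i. start i + tint t (\<lambda>s. F (u s) i))"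
  for u :: "real => 'i => complex"
 define \<phi> where "\<phi> m = (step ^^ m) (\<lambda>t. start)" for m
 have \<phi>Suc: "\<phi> (Suc m) t i = start i + tint t (\<lambda>s. F (\<phi> m s) i)" for m t i
  by (simp add: \<phi>_def step_def)
 have Fcont: "cont_nonneg (\<lambda>s. F (u s) i)"
  if u: "!!i. i \<in> I ==> cont_nonneg (\<lambda>t. u t i)" and i: "i \<in> I"
  for u :: "real => 'i => complex" and i
 proof -
  have "((\<lambda>s. F (u s) i) \<longlongrightarrow> F (u t) i) (at t within {0..})" if t: "t \<in> {0..}" for t
  proof (rule Lim_null_comparison[THEN LIM_zero_cancel])
   show "\<forall>\<^sub>F s in at t within {0..}. cmod (F (u s) i - F (u t) i) <= \<bar>L\<bar> * (\<Sum>i\<in>I. cmod (u s i - u t i))"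
    using lip1[OF \<open>i \<in> I\<close>] unfolding d_def by simp
   have "((\<lambda>s. \<bar>L\<bar> * (\<Sum>i\<in>I. cmod (u s i - u t i))) \<longlongrightarrow> \<bar>L\<bar> * (\<Sum>i\<in>I. cmod (u t i - u t i))) (at t within {0..})"
    using u t by (intro tendsto_intros) (auto simp: continuous_on_def)
   then show "((\<lambda>s. \<bar>L\<bar> * (\<Sum>i\<in>I. cmod (u s i - u t i))) \<longlongrightarrow> 0) (at t within {0..})" by simp
  qed
  then show ?thesis by (simp add: continuous_on_def)
 qed
 have cont: "cont_nonneg (\<lambda>t. \<phi> m t i)" if "i \<in> I" for m i
  using that
 proof (induction m arbitrary: i)
  case 0 then show ?case by (simp add: \<phi>_def)
 next
  case (Suc m)
  show ?case unfolding \<phi>Suc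
   by (rule continuous_on_add[OF continuous_on_const
      continuous_on_indefinite_integral_atLeast[OF Fcont[OF Suc.IH Suc.prems]]])
 qed
 have cont0: "continuous_on {0..T} (\<lambda>t. \<phi> m t i)" if "i \<in> I" for m i T
  by (rule continuous_on_subset[OF cont[OF that]]) auto
 define M where "M = (\<Sum>i\<in>I. cmod (F start i))"
 have M0: "M >= 0" unfolding M_def by (simp add: sum_nonneg)
 have exp_int: "((\<lambda>s. exp (2 * N * s)) has_integral (exp (2 * N * t) - 1) / (2 * N)) {0..t}"
  if "t >= 0" for t
 proof -
  have "((\<lambda>s. exp (2 * N * s)) has_integral exp (2 * N * t) / (2 * N) - exp (2 * N * 0) / (2 * N)) {0..t}"
   by (rule fundamental_theorem_of_calculus)
    (use that N1 in \<open>auto intro!: derivative_eq_intros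
     simp flip: has_real_derivative_iff_has_vector_derivative\<close>)
  then show ?thesis by (simp add: diff_divide_distrib)
 qed
 \<comment> \<open>Integrating the weight contributes \<open>1 / (2 * N)\<close>, and
   \<open>N\<close> exceeds the Lipschitz constant summed over \<open>I\<close>; this is the factor
   one half.\<close>
 have bound: "d (\<phi> (Suc m) t) (\<phi> m t) <= M * (1/2) ^ m * exp (2 * N * t)" if "t >= 0" for m t
  using that
 proof (induction m arbitrary: t)
  case 0
  have "d (\<phi> (Suc 0) t) (\<phi> 0 t) = t * M"
   using 0 unfolding d_def M_def \<phi>Suc
   by (simp add: \<phi>_def norm_mult sum_distrib_left)
  also have "... <= exp (2 * N * t) * M"
  proof (intro mult_right_mono M0)
   have "t <= 2 * N * t" using 0 N1 mult_right_mono[of 1 "2 * N" t] by simp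
   also have "... <= exp (2 * N * t)" using exp_ge_add_one_self[of "2 * N * t"] by linarith
   finally show "t <= exp (2 * N * t)" .
  qed
  finally show ?case by (simp add: mult.commute)
 next
  case (Suc m)
  have each: "cmod (\<phi> (Suc (Suc m)) t i - \<phi> (Suc m) t i)
    <= \<bar>L\<bar> * (M * (1/2) ^ m) * ((exp (2 * N * t) - 1) / (2 * N))" if i: "i \<in> I" for i
  proof -
   have "\<phi> (Suc (Suc m)) t i - \<phi> (Suc m) t i
     = tint t (\<lambda>s. F (\<phi> (Suc m) s) i - F (\<phi> m s) i)"
    unfolding \<phi>Suc[of "Suc m"] \<phi>Suc[of m t]
    by (simp add: integral_diff[OF continuous_integrable[OF Fcont[OF cont i]]
      continuous_integrable[OF Fcont[OF cont i]]])
   moreover have "cmod ... <= \<bar>L\<bar> * (M * (1/2) ^ m) * ((exp (2 * N * t) - 1) / (2 * N))"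
   proof (rule integral_norm_bound_integral[THEN order_trans])
    show "(\<lambda>s. F (\<phi> (Suc m) s) i - F (\<phi> m s) i) integrable_on {0..t}"
     by (rule continuous_integrable[OF
        continuous_on_diff[OF Fcont[OF cont i] Fcont[OF cont i]]])
    have *: "((\<lambda>s. \<bar>L\<bar> * (M * (1/2) ^ m) * exp (2 * N * s)) has_integral
      \<bar>L\<bar> * (M * (1/2) ^ m) * ((exp (2 * N * t) - 1) / (2 * N))) {0..t}"
     by (intro has_integral_mult_right exp_int Suc.prems)
    show "(\<lambda>s. \<bar>L\<bar> * (M * (1/2) ^ m) * exp (2 * N * s)) integrable_on {0..t}"
     using * by blast
    show "tint t (\<lambda>s. \<bar>L\<bar> * (M * (1/2) ^ m) * exp (2 * N * s))
      <= \<bar>L\<bar> * (M * (1/2) ^ m) * ((exp (2 * N * t) - 1) / (2 * N))"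
     using integral_unique[OF *] by (rule eq_refl)
    show "cmod (F (\<phi> (Suc m) s) i - F (\<phi> m s) i) <= \<bar>L\<bar> * (M * (1/2) ^ m) * exp (2 * N * s)"
     if "s \<in> {0..t}" for s
    proof -
     have "cmod (F (\<phi> (Suc m) s) i - F (\<phi> m s) i) <= \<bar>L\<bar> * d (\<phi> (Suc m) s) (\<phi> m s)"
      by (rule lip1[OF i])
     also have "... <= \<bar>L\<bar> * (M * (1/2) ^ m * exp (2 * N * s))"
      using that by (intro mult_left_mono Suc.IH) auto
     finally show ?thesis by (simp add: mult.assoc)
    qed
   qed
   ultimately show ?thesis by simp
  qed
  have "d (\<phi> (Suc (Suc m)) t) (\<phi> (Suc m) t)
    <= (\<Sum>i\<in>I. \<bar>L\<bar> * (M * (1/2) ^ m) * ((exp (2 * N * t) - 1) / (2 * N)))"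
   unfolding d_def by (intro sum_mono each)
  also have "... = (M * (1/2) ^ m) * ((\<bar>L\<bar> * card I) / N * ((exp (2 * N * t) - 1) / 2))"
   by (simp add: mult_ac)
  also have "... <= (M * (1/2) ^ m) * (1 * (exp (2 * N * t) / 2))"
   using N1 Suc.prems M0
   by (intro mult_left_mono mult_mono) (auto simp: N_def divide_le_eq_1 add_nonneg_pos)
  finally show ?case by simp
 qed
 \<comment> \<open>As a telescoping series the limit is uniform on bounded intervals by the
   M-test.\<close>
 define \<psi> where "\<psi> t i = start i + (\<Sum>j. \<phi> (Suc j) t i - \<phi> j t i)" for t i
 have ul: "uniform_limit {0..T} (\<lambda>m t. \<phi> m t i) (\<lambda>t. \<psi> t i) sequentially" if i: "i \<in> I" for T i
 proof -
  have "uniform_limit {0..T} (\<lambda>m t. \<Sum>j<m. \<phi> (Suc j) t i - \<phi> j t i)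
    (\<lambda>t. \<Sum>j. \<phi> (Suc j) t i - \<phi> j t i) sequentially"
  proof (rule Weierstrass_m_test)
   show "summable (\<lambda>j. M * exp (2 * N * T) * (1/2) ^ j)"
    by (intro summable_mult summable_geometric) simp
   show "cmod (\<phi> (Suc j) t i - \<phi> j t i) <= M * exp (2 * N * T) * (1/2) ^ j" if "t \<in> {0..T}" for j t
   proof -
    have "cmod (\<phi> (Suc j) t i - \<phi> j t i) <= M * (1/2) ^ j * exp (2 * N * t)"
     using comp_le[OF i] bound that by (meson atLeastAtMost_iff order_trans)
    also have "... <= M * (1/2) ^ j * exp (2 * N * T)"
     using that N1 M0 by (intro mult_left_mono) auto
    finally show ?thesis by (simp add: mult_ac)
   qed
  qed
  then have "uniform_limit {0..T} (\<lambda>m t. start i + (\<Sum>j<m. \<phi> (Suc j) t i - \<phi> j t i)) (\<lambda>t. \<psi> t i) sequentially"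
   unfolding \<psi>_def by (intro uniform_limit_add uniform_limit_const)
  moreover have "start i + (\<Sum>j<m. \<phi> (Suc j) t i - \<phi> j t i) = \<phi> m t i" for m t
   by (subst sum_lessThan_telescope) (simp add: \<phi>_def)
  ultimately show ?thesis by simp
 qed
 have \<psi>cont: "cont_nonneg (\<lambda>t. \<psi> t i)" if i: "i \<in> I" for i
 proof (rule continuous_on_atLeast_if)
  show "continuous_on {0..T} (\<lambda>t. \<psi> t i)" for T
   by (rule uniform_limit_theorem[OF always_eventually ul[OF i]])
    (simp_all add: cont0[OF i])
 qed
 have ulF: "uniform_limit {0..T} (\<lambda>m t. F (\<phi> m t) i) (\<lambda>t. F (\<psi> t) i) sequentially" if i: "i \<in> I" for T i
 proof (rule metric_uniform_limit_imp_uniform_limit)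
  have comp: "uniform_limit {0..T} (\<lambda>m t. cmod (\<phi> m t j - \<psi> t j)) (\<lambda>t. 0) sequentially" if "j \<in> I" for j
   by (rule metric_uniform_limit_imp_uniform_limit[OF ul[OF that]]) (simp add: dist_norm)
  have "uniform_limit {0..T} (\<lambda>m t. \<Sum>j\<in>J. cmod (\<phi> m t j - \<psi> t j)) (\<lambda>t. 0) sequentially"
   if "finite J" "J \<subseteq> I" for J
   using that
  proof (induction J rule: finite_induct)
   case empty then show ?case by (simp add: uniform_limit_const)
  next
   case (insert j J)
   show ?case
    using uniform_limit_add[OF comp[of j] insert.IH] insert.hyps insert.prems by simp
  qed
  from bounded_linear.uniform_limit[OF bounded_linear_mult_right this[OF fin order_refl], of "\<bar>L\<bar>"]
  have "uniform_limit {0..T} (\<lambda>m t. \<bar>L\<bar> * (\<Sum>j\<in>I. cmod (\<phi> m t j - \<psi> t j))) (\<lambda>t. 0) sequentially"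
   by simp
  then show "uniform_limit {0..T} (\<lambda>m t. \<bar>L\<bar> * d (\<phi> m t) (\<psi> t)) (\<lambda>t. 0) sequentially"
   by (simp add: d_def)
  show "\<forall>\<^sub>F m in sequentially. \<forall>t\<in>{0..T}. dist (F (\<phi> m t) i) (F (\<psi> t) i) <= dist (\<bar>L\<bar> * d (\<phi> m t) (\<psi> t)) 0"
   using lip1[OF i] by (auto simp: dist_norm d_nonneg abs_mult intro!: always_eventually)
 qed
 have fix_eq: "\<psi> t i = start i + tint t (\<lambda>s. F (\<psi> s) i)" if i: "i \<in> I" and t: "t >= 0" for t i
 proof -
  obtain A B where A: "!!m. ((\<lambda>s. F (\<phi> m s) i) has_integral A m) {0..t}"
   and B: "((\<lambda>s. F (\<psi> s) i) has_integral B) {0..t}" and AB: "A \<longlonglongrightarrow> B"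
  proof (rule uniform_limit_integral[OF ulF[OF i]])
   show "continuous_on {0..t} (\<lambda>s. F (\<phi> m s) i)" for m
    by (rule continuous_on_subset[OF Fcont[OF cont i]]) auto
  qed auto
  have "(\<lambda>m. \<phi> (Suc m) t i) = (\<lambda>m. start i + A m)"
   unfolding \<phi>Suc by (simp add: integral_unique[OF A])
  moreover have "(\<lambda>m. \<phi> (Suc m) t i) \<longlonglongrightarrow> \<psi> t i"
   by (rule LIMSEQ_Suc, rule tendsto_uniform_limitI[OF ul[OF i, of t]]) (use t in simp)
  moreover have "(\<lambda>m. start i + A m) \<longlonglongrightarrow> start i + B" by (intro tendsto_intros AB)
  ultimately have "\<psi> t i = start i + B" using LIMSEQ_unique by metis
  then show ?thesis using B by (simp add: integral_unique)
 qed
 show ?thesis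
 proof (intro exI[of _ \<psi>] conjI ballI allI impI)
  have "\<phi> m 0 i = start i" for m i by (cases m) (simp_all add: \<phi>Suc, simp add: \<phi>_def)
  then show "\<psi> 0 = start" by (intro ext) (simp add: \<psi>_def)
  show "cont_nonneg (\<lambda>t. \<psi> t i)" if "i \<in> I" for i by (rule \<psi>cont[OF that])
  show "((\<lambda>s. \<psi> s i) has_vector_derivative F (\<psi> t) i) (at t)" if i: "i \<in> I" and t: "t > 0" for i t
  proof -
   have "((\<lambda>s. start i + tint s (\<lambda>s. F (\<psi> s) i)) has_vector_derivative 0 + F (\<psi> t) i) (at t)"
    by (rule has_vector_derivative_add[OF has_vector_derivative_const
       FTC_atLeast[OF Fcont[OF \<psi>cont i] t]])
   then have "((\<lambda>s. start i + tint s (\<lambda>s. F (\<psi> s) i)) has_vector_derivative F (\<psi> t) i) (at t)"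
    by simp
   then show ?thesis
    by (rule has_vector_derivative_transform_within_open[of _ _ _ "{0<..}"])
     (use t i fix_eq in auto)
  qed
 qed
qed

text \<open>The modulus is not differentiable at zeros of \<open>u\<close>; it is replaced by
 \<open>sqrt (|u|\<^sup>2 + \<epsilon>\<^sup>2)\<close>, which costs an error of order \<open>\<epsilon>\<close>.\<close>

lemma modulus_integral_bound:
 fixes u u' :: "real => complex" and p :: "real => real"
 assumes cu: "cont_nonneg u" and cp: "cont_nonneg p"
  and du: "!!t. t > 0 ==> (u has_vector_derivative u' t) (at t)"
  and p0: "!!t. t > 0 ==> p t >= 0" and l0: "l >= 0"
  and ineq: "!!t. t > 0 ==> Re (cnj (u t) * u' t) <= cmod (u t) * (p t - l * cmod (u t))"
  and t: "t >= 0"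
 shows "exp (\<delta> * t) * cmod (u t)
  + tint t (\<lambda>s. exp (\<delta> * s) * ((l - \<delta>) * cmod (u s) - p s)) <= cmod (u 0)"
proof -
 define h where "h s = exp (\<delta> * s) * ((l - \<delta>) * cmod (u s) - p s)" for s
 have ch: "cont_nonneg h" unfolding h_def by (intro continuous_intros cu cp)
 \<comment> \<open>Replacing \<open>cmod (u \<tau>)\<close> by \<open>s \<tau>\<close>, which
   differs from it by at most \<open>\<epsilon>\<close>, costs \<open>\<epsilon>\<close> times the
   sum of \<open>l\<close> and the modulus of \<open>\<delta>\<close> in the derivative; the
   exponential bounds the weight on \<open>[0, t]\<close>.\<close>
 define C where "C = exp (\<bar>\<delta>\<bar> * t) * (\<bar>\<delta>\<bar> + l)"
 have C0: "C >= 0" using l0 by (simp add: C_def)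
 have main: "exp (\<delta> * t) * cmod (u t) + tint t h <= cmod (u 0) + \<epsilon> * (1 + C * t)"
  if e: "\<epsilon> > 0" for \<epsilon>
 proof -
  define v w where "v \<tau> = Re (u \<tau>)" and "w \<tau> = Im (u \<tau>)" for \<tau>
  define s where "s \<tau> = sqrt ((v \<tau>)\<^sup>2 + (w \<tau>)\<^sup>2 + \<epsilon>\<^sup>2)" for \<tau>
  \<comment> \<open>The term \<open>C * \<epsilon> * \<tau>\<close> offsets this error, so that
    \<open>G\<close> decreases.\<close>
  define G where "G \<tau> = exp (\<delta> * \<tau>) * s \<tau> + integral {0..\<tau>} h - C * \<epsilon> * \<tau>" for \<tau>
  have norm_sq: "(cmod (u \<tau>))\<^sup>2 = (v \<tau>)\<^sup>2 + (w \<tau>)\<^sup>2" for \<tau>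
   unfolding v_def w_def by (rule cmod_power2)
  have spos: "(v \<tau>)\<^sup>2 + (w \<tau>)\<^sup>2 + \<epsilon>\<^sup>2 > 0" for \<tau>
   using e by (simp add: add_nonneg_pos)
  have s0: "s \<tau> > 0" for \<tau> using spos by (simp add: s_def)
  have s_ge: "cmod (u \<tau>) <= s \<tau>" for \<tau>
   unfolding s_def norm_sq[symmetric] by (rule real_le_rsqrt) simp
  have s_le: "s \<tau> <= cmod (u \<tau>) + \<epsilon>" for \<tau>
   unfolding s_def norm_sq[symmetric] using e by (intro real_le_lsqrt) (auto simp: power2_sum)
  have "G t <= G 0"
  proof (rule DERIV_nonpos_imp_decreasing_open[OF t])
   show "continuous_on {0..t} G"
    unfolding G_def s_def v_def w_def
    by (intro continuous_intros continuous_on_subset[OF cu]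
      continuous_on_subset[OF continuous_on_indefinite_integral_atLeast[OF ch]]) auto
   fix \<tau> assume \<tau>: "0 < \<tau>" "\<tau> < t"
   have dRe: "(v has_real_derivative Re (u' \<tau>)) (at \<tau>)"
    and dIm: "(w has_real_derivative Im (u' \<tau>)) (at \<tau>)"
    using bounded_linear.has_vector_derivative[OF bounded_linear_Re du[OF \<tau>(1)]]
     bounded_linear.has_vector_derivative[OF bounded_linear_Im du[OF \<tau>(1)]]
    by (simp_all add: has_real_derivative_iff_has_vector_derivative v_def[abs_def] w_def[abs_def])
   have dI: "((\<lambda>\<tau>. integral {0..\<tau>} h) has_real_derivative h \<tau>) (at \<tau>)"
    using FTC_atLeast[OF ch \<tau>(1)] by (simp add: has_real_derivative_iff_has_vector_derivative)
   let ?r = "Re (cnj (u \<tau>) * u' \<tau>)"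
   have ds: "(s has_real_derivative ?r / s \<tau>) (at \<tau>)"
    unfolding s_def[abs_def] using spos[of \<tau>]
    by (auto intro!: derivative_eq_intros dRe dIm simp: divide_simps) (simp add: v_def w_def algebra_simps)
   have dG: "(G has_real_derivative
     (\<delta> * exp (\<delta> * \<tau>) * s \<tau> + exp (\<delta> * \<tau>) * (?r / s \<tau>)) + h \<tau> - C * \<epsilon>) (at \<tau>)"
    unfolding G_def by (auto intro!: derivative_eq_intros ds dI)
   have "\<delta> * s \<tau> + ?r / s \<tau> + ((l - \<delta>) * cmod (u \<tau>) - p \<tau>) <= (\<bar>\<delta>\<bar> + l) * \<epsilon>"
   proof -
    let ?x = "cmod (u \<tau>)"
    have "?r / s \<tau> <= ?x * (p \<tau> - l * ?x) / s \<tau>"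
     using ineq[OF \<tau>(1)] s0[of \<tau>] by (intro divide_right_mono) auto
    also have "... = ?x * p \<tau> / s \<tau> - l * (?x * ?x / s \<tau>)"
     by (simp add: algebra_simps diff_divide_distrib)
    also have "... <= p \<tau> - l * (?x - \<epsilon>)"
    proof -
     have "?x * p \<tau> / s \<tau> <= p \<tau>"
      using s_ge[of \<tau>] s0[of \<tau>] p0[OF \<tau>(1)]
      by (simp add: divide_simps mult.commute mult_left_mono)
     \<comment> \<open>From \<open>s \<tau> \<le> ?x + \<epsilon>\<close> if
       \<open>?x \<ge> \<epsilon>\<close>; otherwise the left side is negative. Near zeros of
       \<open>u\<close> the damping is lost only up to \<open>\<epsilon>\<close>.\<close>
     moreover have "?x - \<epsilon> <= ?x * ?x / s \<tau>"
     proof -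
      have "(?x - \<epsilon>) * s \<tau> <= ?x * ?x"
      proof (cases "?x >= \<epsilon>")
       case True
       then have "(?x - \<epsilon>) * s \<tau> <= (?x - \<epsilon>) * (?x + \<epsilon>)"
        by (intro mult_left_mono s_le) auto
       also have "... <= ?x * ?x" by (simp add: algebra_simps)
       finally show ?thesis .
      next
       case False
       then have "(?x - \<epsilon>) * s \<tau> <= 0" using s0[of \<tau>]
        by (intro mult_nonpos_nonneg) auto
       then show ?thesis using order_trans zero_le_square by blast
      qed
      then show ?thesis using s0[of \<tau>] by (simp add: divide_simps)
     qed
     ultimately show ?thesis using mult_left_mono[OF _ l0] by fastforce
    qed
    finally have "\<delta> * s \<tau> + ?r / s \<tau> + ((l - \<delta>) * ?x - p \<tau>) <= \<delta> * (s \<tau> - ?x) + l * \<epsilon>"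
     by (simp add: algebra_simps)
    also have "\<delta> * (s \<tau> - ?x) <= \<bar>\<delta>\<bar> * \<epsilon>"
     using s_ge[of \<tau>] s_le[of \<tau>] by (intro mult_mono) auto
    finally show ?thesis by (simp add: algebra_simps)
   qed
   then have "exp (\<delta> * \<tau>) * (\<delta> * s \<tau> + ?r / s \<tau> + ((l - \<delta>) * cmod (u \<tau>) - p \<tau>))
     <= exp (\<delta> * \<tau>) * ((\<bar>\<delta>\<bar> + l) * \<epsilon>)" by (intro mult_left_mono) auto
   also have "... <= exp (\<bar>\<delta>\<bar> * t) * ((\<bar>\<delta>\<bar> + l) * \<epsilon>)"
   proof (intro mult_right_mono)
    have "\<delta> * \<tau> <= \<bar>\<delta>\<bar> * t" using \<tau> by (intro mult_mono) auto
    then show "exp (\<delta> * \<tau>) <= exp (\<bar>\<delta>\<bar> * t)" by simp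
   qed (use e l0 in auto)
   finally have "(\<delta> * exp (\<delta> * \<tau>) * s \<tau> + exp (\<delta> * \<tau>) * (?r / s \<tau>)) + h \<tau> - C * \<epsilon> <= 0"
    by (simp add: h_def C_def algebra_simps)
   with dG show "\<exists>y. (G has_real_derivative y) (at \<tau>) \<and> y <= 0" by blast
  qed
  moreover note s_le[of 0]
  moreover have "exp (\<delta> * t) * cmod (u t) <= exp (\<delta> * t) * s t"
   by (rule mult_left_mono[OF s_ge]) simp
  moreover have "\<epsilon> * (1 + C * t) = \<epsilon> + C * \<epsilon> * t" by (simp add: algebra_simps)
  moreover have "G t = exp (\<delta> * t) * s t + tint t h - C * \<epsilon> * t" "G 0 = s 0"
   by (simp_all add: G_def)
  ultimately show ?thesis by linarith
 qed
 have "exp (\<delta> * t) * cmod (u t) + tint t h <= cmod (u 0)"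
 proof (rule field_le_epsilon)
  fix e :: real assume e: "e > 0"
  have "1 + C * t > 0" using C0 t by (simp add: add_pos_nonneg)
  then show "exp (\<delta> * t) * cmod (u t) + tint t h <= cmod (u 0) + e"
   using main[of "e / (1 + C * t)"] e by simp
 qed
 then show ?thesis unfolding h_def .
qed

section \<open>Multilinear estimates\<close>

definition modes :: "nat => int set" where
 "modes n = {- int n..int n}"

lemma finite_modes [simp]: "finite (modes n)"
 by (simp add: modes_def)

lemma mem_modes: "k \<in> modes n \<longleftrightarrow> \<bar>k\<bar> <= int n"
 by (auto simp: modes_def)

lemma uminus_mem_modes [simp]: "- k \<in> modes n \<longleftrightarrow> k \<in> modes n"
 by (auto simp: modes_def)

lemma sum_modes_uminus: "(\<Sum>k\<in>modes n. g (- k)) = (\<Sum>k\<in>modes n. g k)"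
 by (rule sum.reindex_bij_witness[of _ uminus uminus]) auto

text \<open>The shifted window can leave the band, but \<open>g\<close> vanishes there; what remains
  is part of the full sum.\<close>

lemma sum_shift_le:
 fixes g :: "int => real"
 assumes "!!l. g l >= 0" "!!l. l \<notin> modes n ==> g l = 0"
 shows "(\<Sum>k\<in>modes n. g (k - j)) <= (\<Sum>l\<in>modes n. g l)"
proof -
 have "(\<Sum>k\<in>modes n. g (k - j)) = (\<Sum>l\<in>(\<lambda>k. k - j) ` modes n. g l)"
  by (subst sum.reindex) (auto simp: inj_on_def)
 also have "... = (\<Sum>l\<in>(\<lambda>k. k - j) ` modes n \<inter> modes n. g l)"
  using assms(2) by (intro sum.mono_neutral_right) auto
 also have "... <= (\<Sum>l\<in>modes n. g l)"
  using assms(1) by (intro sum_mono2) auto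
 finally show ?thesis .
qed

lemma sum_reflect_le:
 fixes g :: "int => real"
 assumes "!!l. g l >= 0" "!!l. l \<notin> modes n ==> g l = 0"
 shows "(\<Sum>j\<in>modes n. g (k - j)) <= (\<Sum>l\<in>modes n. g l)"
proof -
 have "(\<Sum>j\<in>modes n. g (k - j)) = (\<Sum>j\<in>modes n. g (- (j - k)))" by simp
 also have "... <= (\<Sum>l\<in>modes n. g (- l))"
  using sum_shift_le[of "\<lambda>l. g (- l)" n k] assms by simp
 finally show ?thesis by (simp add: sum_modes_uminus)
qed

text \<open>Averaging over the sign of \<open>l\<close> replaces \<open>|l + j|\<close> by \<open>max |l| |j|\<close>. Without
 this gain the smallness conditions of the theorem would not absorb the nonlinearity.\<close>

lemma wiener_bilinear:
 fixes x y :: "int => real"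
 assumes x: "!!l. x l >= 0" "!!l. l \<notin> modes n ==> x l = 0" "!!l. x (- l) = x l"
  and y: "!!l. y l >= 0"
 shows "(\<Sum>k\<in>modes n. mag k * (\<Sum>j\<in>modes n. x (k - j) * (mag j ^ p * y j)))
  <= (\<Sum>l\<in>modes n. mag l ^ (p + 1) * x l) * (\<Sum>j\<in>modes n. y j)
   + (\<Sum>l\<in>modes n. x l) * (\<Sum>j\<in>modes n. mag j ^ (p + 1) * y j)"
proof -
 let ?J = "modes n"
 have each: "(\<Sum>k\<in>?J. mag k * x (k - j)) <= (\<Sum>l\<in>?J. max (mag l) (mag j) * x l)" for j
 proof -
  have "(\<Sum>k\<in>?J. mag k * x (k - j)) = (\<Sum>k\<in>?J. \<bar>real_of_int (k - j + j)\<bar> * x (k - j))" by simp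
  also have "... <= (\<Sum>l\<in>?J. \<bar>real_of_int (l + j)\<bar> * x l)"
   by (rule sum_shift_le[of "\<lambda>l. \<bar>real_of_int (l + j)\<bar> * x l"]) (auto simp: x)
  finally have 1: "(\<Sum>k\<in>?J. mag k * x (k - j)) <= (\<Sum>l\<in>?J. \<bar>real_of_int (l + j)\<bar> * x l)" .
  have "(\<Sum>l\<in>?J. \<bar>real_of_int (l + j)\<bar> * x l) = (\<Sum>l\<in>?J. \<bar>real_of_int (- l + j)\<bar> * x (- l))"
   by (rule sum_modes_uminus[symmetric])
  also have "... = (\<Sum>l\<in>?J. \<bar>real_of_int (j - l)\<bar> * x l)" by (simp add: x)
  finally have "2 * (\<Sum>l\<in>?J. \<bar>real_of_int (l + j)\<bar> * x l)
   = (\<Sum>l\<in>?J. (\<bar>real_of_int (l + j)\<bar> + \<bar>real_of_int (j - l)\<bar>) * x l)"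
   by (simp add: sum.distrib distrib_right)
  also have "... = (\<Sum>l\<in>?J. 2 * (max (mag l) (mag j) * x l))"
   by (intro sum.cong refl) (auto simp: max_def abs_if)
  finally show ?thesis using 1 by (simp flip: sum_distrib_left)
 qed
 have "(\<Sum>k\<in>?J. mag k * (\<Sum>j\<in>?J. x (k - j) * (mag j ^ p * y j)))
   = (\<Sum>k\<in>?J. \<Sum>j\<in>?J. (mag k * x (k - j)) * (mag j ^ p * y j))"
  by (simp add: sum_distrib_left mult.assoc)
 also have "... = (\<Sum>j\<in>?J. (\<Sum>k\<in>?J. mag k * x (k - j)) * (mag j ^ p * y j))"
  by (subst sum.swap) (simp add: sum_distrib_right)
 also have "... <= (\<Sum>j\<in>?J. (\<Sum>l\<in>?J. max (mag l) (mag j) * x l) * (mag j ^ p * y j))"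
  by (intro sum_mono mult_right_mono each) (auto simp: y)
 also have "... = (\<Sum>j\<in>?J. \<Sum>l\<in>?J. (max (mag l) (mag j) * mag j ^ p) * (x l * y j))"
  by (simp add: sum_distrib_right sum_distrib_left mult_ac)
 also have "... <= (\<Sum>j\<in>?J. \<Sum>l\<in>?J. (mag l ^ (p + 1) + mag j ^ (p + 1)) * (x l * y j))"
 proof (intro sum_mono mult_right_mono)
  fix j l
  show "max (mag l) (mag j) * mag j ^ p <= mag l ^ (p + 1) + mag j ^ (p + 1)"
  proof (cases "mag l <= mag j")
   case True then show ?thesis by (simp add: max_def)
  next
   case False
   then have "mag l * mag j ^ p <= mag l * mag l ^ p"
    by (intro mult_left_mono power_mono) auto
   then show ?thesis using False by (simp add: max_def add_increasing2)
  qed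
 qed (auto simp: x y)
 also have "... = (\<Sum>j\<in>?J. \<Sum>l\<in>?J. (mag l ^ (p + 1) * x l) * y j)
   + (\<Sum>j\<in>?J. \<Sum>l\<in>?J. x l * (mag j ^ (p + 1) * y j))"
  by (simp add: sum.distrib[symmetric] algebra_simps)
 also have "... = (\<Sum>l\<in>?J. mag l ^ (p + 1) * x l) * (\<Sum>j\<in>?J. y j)
   + (\<Sum>l\<in>?J. x l) * (\<Sum>j\<in>?J. mag j ^ (p + 1) * y j)"
  by (subst (1 2) sum.swap) (simp add: sum_product)
 finally show ?thesis .
qed

text \<open>Young's inequality for convolutions in a symmetric form: each product is split into half
  squares, and summing \<open>x (k - j)\<close> over either index gives at most its full sum. The
  halves reappear in the coefficients of \<open>a\<close> in \<open>e1\<close> and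
  \<open>e2\<close>.\<close>

lemma convolution_quadratic_bound:
 fixes x y z :: "int => real"
 assumes x: "!!l. x l >= 0" "!!l. l \<notin> modes n ==> x l = 0"
 shows "(\<Sum>k\<in>modes n. \<Sum>j\<in>modes n. z k * x (k - j) * y j)
  <= (\<Sum>l\<in>modes n. x l) * (((\<Sum>k\<in>modes n. (z k)\<^sup>2) + (\<Sum>k\<in>modes n. (y k)\<^sup>2)) / 2)"
proof -
 let ?J = "modes n" and ?X = "\<Sum>l\<in>modes n. x l"
 have "(\<Sum>k\<in>?J. \<Sum>j\<in>?J. z k * x (k - j) * y j)
   <= (\<Sum>k\<in>?J. \<Sum>j\<in>?J. x (k - j) * ((z k)\<^sup>2 / 2) + x (k - j) * ((y j)\<^sup>2 / 2))"
 proof (intro sum_mono)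
  fix k j
  have "z k * y j <= (z k)\<^sup>2 / 2 + (y j)\<^sup>2 / 2"
   using sum_squares_bound[of "z k" "y j"] by simp
  from mult_left_mono[OF this x(1)[of "k - j"]]
  show "z k * x (k - j) * y j <= x (k - j) * ((z k)\<^sup>2 / 2) + x (k - j) * ((y j)\<^sup>2 / 2)"
   by (simp add: algebra_simps)
 qed
 also have "... = (\<Sum>k\<in>?J. (\<Sum>j\<in>?J. x (k - j)) * ((z k)\<^sup>2 / 2))
   + (\<Sum>j\<in>?J. (\<Sum>k\<in>?J. x (k - j)) * ((y j)\<^sup>2 / 2))"
  unfolding sum.distrib
  by (subst (2) sum.swap) (simp only: sum_distrib_right)
 also have "... <= (\<Sum>k\<in>?J. ?X * ((z k)\<^sup>2 / 2)) + (\<Sum>j\<in>?J. ?X * ((y j)\<^sup>2 / 2))"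
  by (intro add_mono sum_mono mult_right_mono sum_reflect_le sum_shift_le x) auto
 also have "... = ?X * (((\<Sum>k\<in>?J. (z k)\<^sup>2) + (\<Sum>k\<in>?J. (y k)\<^sup>2)) / 2)"
  by (simp add: sum_distrib_left[symmetric] sum_divide_distrib[symmetric] algebra_simps add_divide_distrib)
 finally show ?thesis .
qed

text \<open>Of the eight derivatives five fall on the tested factor and three on the factor
  \<open>j\<close>, while the damping controls four on each. If \<open>l\<close> is at most
  \<open>e\<close> times \<open>j\<close>, the excess is an \<open>e\<close>-fraction of the
  damping; otherwise \<open>l\<close> dominates both \<open>k\<close> and \<open>j\<close>, and four
  derivatives can be moved to \<open>l\<close>. The leading coefficient must be close to one, since
  it multiplies the smallness threshold in the energy conditions.\<close>

lemma weight_cubic: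
 fixes k l j :: real
 assumes e: "0 < e" and kl: "\<bar>k\<bar> <= \<bar>l\<bar> + \<bar>j\<bar>"
 shows "\<bar>k\<bar> ^ 5 * \<bar>j\<bar> ^ 3 <= (1 + e) * (k ^ 4 * j ^ 4) + (1 + 1 / e)\<^sup>2 / e * (l ^ 4 * (k\<^sup>2 * j\<^sup>2))"
proof -
 have "\<bar>k\<bar> * (k\<^sup>2 * \<bar>j\<bar>) <= (\<bar>l\<bar> + \<bar>j\<bar>) * (k\<^sup>2 * \<bar>j\<bar>)" by (intro mult_right_mono kl) auto
 also have "... = k\<^sup>2 * j\<^sup>2 + k\<^sup>2 * \<bar>l\<bar> * \<bar>j\<bar>" by (simp add: algebra_simps power2_eq_square flip: abs_mult)
 also have "k\<^sup>2 * \<bar>l\<bar> * \<bar>j\<bar> <= e * (k\<^sup>2 * j\<^sup>2) + (1 + 1 / e)\<^sup>2 / e * l ^ 4"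
 proof (cases "\<bar>l\<bar> <= e * \<bar>j\<bar>")
  case True
  then have "(k\<^sup>2 * \<bar>j\<bar>) * \<bar>l\<bar> <= (k\<^sup>2 * \<bar>j\<bar>) * (e * \<bar>j\<bar>)" by (intro mult_left_mono) auto
  also have "... = e * (k\<^sup>2 * j\<^sup>2)" by (simp add: power2_eq_square flip: abs_mult)
  finally show ?thesis using e by (simp add: mult_ac add_increasing2)
 next
  case False
  then have j: "\<bar>j\<bar> <= \<bar>l\<bar> / e" using e by (simp add: field_simps)
  then have "\<bar>k\<bar> <= (1 + 1 / e) * \<bar>l\<bar>" using kl by (simp add: algebra_simps)
  then have "\<bar>k\<bar>\<^sup>2 <= ((1 + 1 / e) * \<bar>l\<bar>)\<^sup>2" by (intro power_mono) auto
  then have "k\<^sup>2 * \<bar>l\<bar> * \<bar>j\<bar> <= ((1 + 1 / e) * \<bar>l\<bar>)\<^sup>2 * \<bar>l\<bar> * (\<bar>l\<bar> / e)"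
   using j e by (intro mult_mono) auto
  also have "... = (1 + 1 / e)\<^sup>2 / e * l ^ 4"
   by (simp add: power_mult_distrib power2_eq_square power4_eq_xxxx flip: abs_mult)
  finally show ?thesis using e by (simp add: add_increasing)
 qed
 finally have "\<bar>k\<bar> * (k\<^sup>2 * \<bar>j\<bar>) <= (1 + e) * (k\<^sup>2 * j\<^sup>2) + (1 + 1 / e)\<^sup>2 / e * l ^ 4"
  by (simp add: algebra_simps)
 from mult_right_mono[OF this, of "k\<^sup>2 * j\<^sup>2"] 
 have "\<bar>k\<bar> * (k\<^sup>2 * \<bar>j\<bar>) * (k\<^sup>2 * j\<^sup>2) <= ((1 + e) * (k\<^sup>2 * j\<^sup>2) + (1 + 1 / e)\<^sup>2 / e * l ^ 4) * (k\<^sup>2 * j\<^sup>2)"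
  by simp
 moreover have "\<bar>k\<bar> * (k\<^sup>2 * \<bar>j\<bar>) * (k\<^sup>2 * j\<^sup>2) = \<bar>k\<bar> ^ 5 * \<bar>j\<bar> ^ 3"
  by (simp add: eval_nat_numeral abs_mult[symmetric] mult_ac)
 moreover have "((1 + e) * (k\<^sup>2 * j\<^sup>2) + (1 + 1 / e)\<^sup>2 / e * l ^ 4) * (k\<^sup>2 * j\<^sup>2)
  = (1 + e) * (k ^ 4 * j ^ 4) + (1 + 1 / e)\<^sup>2 / e * (l ^ 4 * (k\<^sup>2 * j\<^sup>2))"
 proof -
  have "(c * (k\<^sup>2 * j\<^sup>2) + d * l ^ 4) * (k\<^sup>2 * j\<^sup>2) = c * (k ^ 4 * j ^ 4) + d * (l ^ 4 * (k\<^sup>2 * j\<^sup>2))" for c d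
   by (simp add: algebra_simps eval_nat_numeral)
  then show ?thesis .
 qed
 ultimately show ?thesis by simp
qed

text \<open>With one derivative on \<open>j\<close> the total order is two below the damping, so
  even the leading coefficient can be made small. Where \<open>j\<close> dominates \<open>l\<close>,
  the frequencies with \<open>e * j\<^sup>2 \<ge> 2\<close> are absorbed by the damping; for the
  others \<open>j\<^sup>2\<close> is bounded by \<open>2 / e\<close>.\<close>

lemma weight_linear:
 fixes k l j :: real
 assumes e: "0 < e" and kl: "\<bar>k\<bar> <= \<bar>l\<bar> + \<bar>j\<bar>" and l1: "\<bar>l\<bar> >= 1" and j1: "\<bar>j\<bar> >= 1"
 shows "\<bar>k\<bar> ^ 5 * \<bar>j\<bar> <= e * (k ^ 4 * j ^ 4) + (8 + 16 / e) * (l ^ 4 * (k\<^sup>2 * j\<^sup>2))"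
proof -
 have l34: "\<bar>l\<bar> ^ 3 <= l ^ 4" using power_increasing[of 3 4 "\<bar>l\<bar>"] l1 by simp
 have l41: "1 <= l ^ 4" using one_le_power[OF l1, of 4] by simp
 have key: "\<bar>k\<bar> ^ 3 <= e * (k\<^sup>2 * \<bar>j\<bar> ^ 3) + (8 + 16 / e) * (l ^ 4 * \<bar>j\<bar>)"
 proof (cases "\<bar>l\<bar> > \<bar>j\<bar>")
  case True
  then have "\<bar>k\<bar> ^ 3 <= (2 * \<bar>l\<bar>) ^ 3" using kl by (intro power_mono) auto
  also have "... = 8 * \<bar>l\<bar> ^ 3" by (simp add: power_mult_distrib)
  also have "... <= 8 * (l ^ 4 * \<bar>j\<bar>)"
   using l34 mult_left_mono[OF j1, of "l ^ 4"] by simp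
  also have "... <= (8 + 16 / e) * (l ^ 4 * \<bar>j\<bar>)" using e by (intro mult_right_mono) auto
  finally show ?thesis using e by (simp add: add_increasing)
 next
  case lj: False
  then have k2: "\<bar>k\<bar> <= 2 * \<bar>j\<bar>" using kl by simp
  show ?thesis
  proof (cases "e * j\<^sup>2 >= 2")
   case True
   have "\<bar>k\<bar> ^ 3 = k\<^sup>2 * \<bar>k\<bar>" by (simp add: eval_nat_numeral flip: abs_mult)
   also have "... <= k\<^sup>2 * (2 * \<bar>j\<bar>)" by (intro mult_left_mono k2) auto
   also have "... <= k\<^sup>2 * ((e * j\<^sup>2) * \<bar>j\<bar>)" by (intro mult_left_mono mult_right_mono True) auto
   also have "... = e * (k\<^sup>2 * \<bar>j\<bar> ^ 3)" by (simp add: eval_nat_numeral flip: abs_mult)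
   finally show ?thesis using e by (simp add: add_increasing2)
  next
   case False
   then have j2: "j\<^sup>2 <= 2 / e" using e by (simp add: field_simps)
   have "\<bar>k\<bar> ^ 3 <= (2 * \<bar>j\<bar>) ^ 3" by (intro power_mono k2) auto
   also have "... = 8 * \<bar>j\<bar> * j\<^sup>2" by (simp add: eval_nat_numeral flip: abs_mult)
   also have "... <= 8 * \<bar>j\<bar> * (2 / e)" by (intro mult_left_mono j2) auto
   also have "... = 16 / e * (1 * \<bar>j\<bar>)" by simp
   also have "... <= (8 + 16 / e) * (l ^ 4 * \<bar>j\<bar>)"
    using e by (intro mult_mono l41) auto
   finally show ?thesis using e by (simp add: add_increasing)
  qed
 qed
 from mult_right_mono[OF this, of "k\<^sup>2 * \<bar>j\<bar>"]
 have "\<bar>k\<bar> ^ 3 * (k\<^sup>2 * \<bar>j\<bar>) <= (e * (k\<^sup>2 * \<bar>j\<bar> ^ 3) + (8 + 16 / e) * (l ^ 4 * \<bar>j\<bar>)) * (k\<^sup>2 * \<bar>j\<bar>)" by simp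
 moreover have "\<bar>k\<bar> ^ 3 * (k\<^sup>2 * \<bar>j\<bar>) = \<bar>k\<bar> ^ 5 * \<bar>j\<bar>"
  by (simp add: eval_nat_numeral abs_mult[symmetric] mult_ac)
 moreover have "(e * (k\<^sup>2 * \<bar>j\<bar> ^ 3) + (8 + 16 / e) * (l ^ 4 * \<bar>j\<bar>)) * (k\<^sup>2 * \<bar>j\<bar>)
  = e * (k ^ 4 * j ^ 4) + (8 + 16 / e) * (l ^ 4 * (k\<^sup>2 * j\<^sup>2))"
 proof -
  have "\<bar>j\<bar> ^ 3 * \<bar>j\<bar> = j ^ 4" "\<bar>j\<bar> * \<bar>j\<bar> = j\<^sup>2" "k\<^sup>2 * k\<^sup>2 = k ^ 4"
   by (simp_all add: eval_nat_numeral flip: abs_mult)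
  moreover have "(c * (k\<^sup>2 * \<bar>j\<bar> ^ 3) + d * (l ^ 4 * \<bar>j\<bar>)) * (k\<^sup>2 * \<bar>j\<bar>)
    = c * ((k\<^sup>2 * k\<^sup>2) * (\<bar>j\<bar> ^ 3 * \<bar>j\<bar>)) + d * (l ^ 4 * (k\<^sup>2 * (\<bar>j\<bar> * \<bar>j\<bar>)))" for c d
   by (simp only: distrib_right distrib_left mult_ac)
  ultimately show ?thesis by (simp only:)
 qed
 ultimately show ?thesis by simp
qed

definition wsum :: "nat => nat => (int => real) => real" where
 "wsum n p x = (\<Sum>k\<in>modes n. mag k ^ p * x k)"

lemma wsum_nonneg: "(!!k. x k >= 0) ==> wsum n p x >= 0"
 unfolding wsum_def by (intro sum_nonneg) auto

text \<open>The condition at \<open>0\<close> concerns \<open>p = 0\<close>, where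
  \<open>0 ^ 0 = 1\<close> would count the zeroth coefficient.\<close>

lemma wsum_mono:
 assumes "!!k. x k >= 0" "x 0 = 0" "p <= q"
 shows "wsum n p x <= wsum n q x"
 unfolding wsum_def
proof (intro sum_mono)
 fix k
 show "mag k ^ p * x k <= mag k ^ q * x k"
 proof (cases "k = 0")
  case False
  then have "mag k >= 1" by linarith
  then show ?thesis using assms by (intro mult_right_mono power_increasing)
 qed (simp add: assms)
qed

text \<open>The weight inequality is asked only where both factors are nonzero, because the estimate
  for first derivatives needs nonzero frequencies. Its first term pairs the plain sum of
  \<open>x\<close> with the damping; its second moves four derivatives onto \<open>x\<close> and
  leaves the energy, which is the form for Gronwall's inequality.\<close>

lemma energy_trilinear:
 fixes x y z :: "int => real"
 assumes x: "!!l. x l >= 0" "!!l. l \<notin> modes n ==> x l = 0"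
  and yz: "!!l. y l >= 0" "!!l. z l >= 0"
  and wt: "!!k j. x (k - j) \<noteq> 0 ==> y j \<noteq> 0 ==> mag k ^ 5 * mag j ^ p
   <= c * (real_of_int k ^ 4 * real_of_int j ^ 4)
    + C * (real_of_int (k - j) ^ 4 * ((real_of_int k)\<^sup>2 * (real_of_int j)\<^sup>2))"
  and c: "c >= 0" "C >= 0"
 shows "(\<Sum>k\<in>modes n. real_of_int k ^ 4 * z k * (mag k * (\<Sum>j\<in>modes n. x (k - j) * (mag j ^ p * y j))))
  <= c * wsum n 0 x * ((wsum n 8 (\<lambda>k. (z k)\<^sup>2) + wsum n 8 (\<lambda>k. (y k)\<^sup>2)) / 2)
   + C * wsum n 4 x * ((wsum n 4 (\<lambda>k. (z k)\<^sup>2) + wsum n 4 (\<lambda>k. (y k)\<^sup>2)) / 2)"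
proof -
 let ?J = "modes n"
 have "(\<Sum>k\<in>?J. real_of_int k ^ 4 * z k * (mag k * (\<Sum>j\<in>?J. x (k - j) * (mag j ^ p * y j))))
  = (\<Sum>k\<in>?J. \<Sum>j\<in>?J. (mag k ^ 5 * mag j ^ p) * (z k * x (k - j) * y j))"
  unfolding sum_distrib_left
  by (intro sum.cong refl) (simp add: eval_nat_numeral mult_ac flip: abs_mult)
 also have "... <= (\<Sum>k\<in>?J. \<Sum>j\<in>?J. c * ((real_of_int k ^ 4 * z k) * x (k - j) * (real_of_int j ^ 4 * y j))
   + C * (((real_of_int k)\<^sup>2 * z k) * (real_of_int (k - j) ^ 4 * x (k - j)) * ((real_of_int j)\<^sup>2 * y j)))"
 proof (intro sum_mono)
  fix k j
  show "(mag k ^ 5 * mag j ^ p) * (z k * x (k - j) * y j)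
   <= c * ((real_of_int k ^ 4 * z k) * x (k - j) * (real_of_int j ^ 4 * y j))
   + C * (((real_of_int k)\<^sup>2 * z k) * (real_of_int (k - j) ^ 4 * x (k - j)) * ((real_of_int j)\<^sup>2 * y j))"
  proof (cases "x (k - j) = 0 \<or> y j = 0")
   case False
   then have "(mag k ^ 5 * mag j ^ p) * (z k * x (k - j) * y j)
    <= (c * (real_of_int k ^ 4 * real_of_int j ^ 4)
    + C * (real_of_int (k - j) ^ 4 * ((real_of_int k)\<^sup>2 * (real_of_int j)\<^sup>2))) * (z k * x (k - j) * y j)"
    using x yz by (intro mult_right_mono wt) auto
   also have "... = c * ((real_of_int k ^ 4 * z k) * x (k - j) * (real_of_int j ^ 4 * y j))
   + C * (((real_of_int k)\<^sup>2 * z k) * (real_of_int (k - j) ^ 4 * x (k - j)) * ((real_of_int j)\<^sup>2 * y j))"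
    by (simp only: distrib_right distrib_left mult_ac)
   finally show ?thesis .
  qed auto
 qed
 also have "... = c * (\<Sum>k\<in>?J. \<Sum>j\<in>?J. (real_of_int k ^ 4 * z k) * x (k - j) * (real_of_int j ^ 4 * y j))
  + C * (\<Sum>k\<in>?J. \<Sum>j\<in>?J. ((real_of_int k)\<^sup>2 * z k) * (real_of_int (k - j) ^ 4 * x (k - j)) * ((real_of_int j)\<^sup>2 * y j))"
  by (simp add: sum.distrib sum_distrib_left)
 also have "... <= c * ((\<Sum>l\<in>?J. x l) * (((\<Sum>k\<in>?J. (real_of_int k ^ 4 * z k)\<^sup>2) + (\<Sum>k\<in>?J. (real_of_int k ^ 4 * y k)\<^sup>2)) / 2))
  + C * ((\<Sum>l\<in>?J. real_of_int l ^ 4 * x l) * (((\<Sum>k\<in>?J. ((real_of_int k)\<^sup>2 * z k)\<^sup>2) + (\<Sum>k\<in>?J. ((real_of_int k)\<^sup>2 * y k)\<^sup>2)) / 2))"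
  using x c
  by (intro add_mono mult_left_mono convolution_quadratic_bound[where x = x]
    convolution_quadratic_bound[where x = "\<lambda>l. real_of_int l ^ 4 * x l"]) auto
 also have "... = c * wsum n 0 x * ((wsum n 8 (\<lambda>k. (z k)\<^sup>2) + wsum n 8 (\<lambda>k. (y k)\<^sup>2)) / 2)
   + C * wsum n 4 x * ((wsum n 4 (\<lambda>k. (z k)\<^sup>2) + wsum n 4 (\<lambda>k. (y k)\<^sup>2)) / 2)"
  by (simp add: wsum_def power_mult_distrib flip: power_mult)
 finally show ?thesis .
qed

section \<open>The truncated system\<close>

text \<open>The bound involves the coordinates in \<open>I\<close> alone, as
  \<open>picard_global\<close> demands; the closure properties below reduce the Lipschitz condition
  of the field to single coordinates.\<close>

definition lipschitz_coord :: "'i set => (('i => complex) => complex) => bool" where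
 "lipschitz_coord I g \<longleftrightarrow> (\<exists>L\<ge>0. \<forall>x y. cmod (g x - g y) <= L * (\<Sum>i\<in>I. cmod (x i - y i)))"

lemma lipschitz_coordE:
 assumes "lipschitz_coord I g"
 obtains L where "L >= 0" "!!x y. cmod (g x - g y) <= L * (\<Sum>i\<in>I. cmod (x i - y i))"
 using assms unfolding lipschitz_coord_def by blast

lemma lipschitz_coord_const: "lipschitz_coord I (\<lambda>x. c)"
 unfolding lipschitz_coord_def by (intro exI[of _ 0]) simp

lemma lipschitz_coord_proj:
 assumes "finite I" "i \<in> I" shows "lipschitz_coord I (\<lambda>x. x i)"
 unfolding lipschitz_coord_def
proof (intro exI[of _ 1] conjI allI)
 show "cmod (x i - y i) <= 1 * (\<Sum>i\<in>I. cmod (x i - y i))" for x y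
  using member_le_sum[of i I "\<lambda>i. cmod (x i - y i)"] assms by simp
qed simp

lemma lipschitz_coord_cnj:
 assumes "lipschitz_coord I g" shows "lipschitz_coord I (\<lambda>x. cnj (g x))"
proof -
 have "cmod (cnj (g x) - cnj (g y)) = cmod (g x - g y)" for x y
  by (metis complex_cnj_diff complex_mod_cnj)
 with assms show ?thesis unfolding lipschitz_coord_def by simp
qed

lemma lipschitz_coord_add:
 assumes "lipschitz_coord I g" "lipschitz_coord I h"
 shows "lipschitz_coord I (\<lambda>x. g x + h x)"
proof -
 obtain L where L: "L >= 0" "!!x y. cmod (g x - g y) <= L * (\<Sum>i\<in>I. cmod (x i - y i))"
  using assms(1) by (rule lipschitz_coordE) blast
 obtain M where M: "M >= 0" "!!x y. cmod (h x - h y) <= M * (\<Sum>i\<in>I. cmod (x i - y i))"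
  using assms(2) by (rule lipschitz_coordE) blast
 have "cmod (g x + h x - (g y + h y)) <= (L + M) * (\<Sum>i\<in>I. cmod (x i - y i))" for x y
 proof -
  have "cmod (g x + h x - (g y + h y)) <= cmod (g x - g y) + cmod (h x - h y)"
   by (metis add_diff_add norm_triangle_ineq)
  then show ?thesis using L(2)[of x y] M(2)[of x y] by (simp add: distrib_right)
 qed
 with L(1) M(1) show ?thesis unfolding lipschitz_coord_def by (intro exI[of _ "L + M"]) simp
qed

lemma lipschitz_coord_mult:
 assumes "lipschitz_coord I g" "lipschitz_coord I h"
  and "!!x. cmod (g x) <= B" "!!x. cmod (h x) <= B"
 shows "lipschitz_coord I (\<lambda>x. g x * h x)"
proof -
 obtain L where L: "L >= 0" "!!x y. cmod (g x - g y) <= L * (\<Sum>i\<in>I. cmod (x i - y i))"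
  using assms(1) by (rule lipschitz_coordE) blast
 obtain M where M: "M >= 0" "!!x y. cmod (h x - h y) <= M * (\<Sum>i\<in>I. cmod (x i - y i))"
  using assms(2) by (rule lipschitz_coordE) blast
 have B: "B >= 0" using assms(3) norm_ge_zero order_trans by blast
 have "cmod (g x * h x - g y * h y) <= (L * B + B * M) * (\<Sum>i\<in>I. cmod (x i - y i))" for x y
 proof -
  let ?d = "\<Sum>i\<in>I. cmod (x i - y i)"
  have "g x * h x - g y * h y = (g x - g y) * h x + g y * (h x - h y)" by (simp add: algebra_simps)
  then have "cmod (g x * h x - g y * h y) <= cmod (g x - g y) * cmod (h x) + cmod (g y) * cmod (h x - h y)"
   by (metis norm_mult norm_triangle_ineq)
  also have "... <= (L * ?d) * B + B * (M * ?d)"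
   using L(1) B sum_nonneg[of I "\<lambda>i. cmod (x i - y i)"]
   by (intro add_mono mult_mono L M assms) auto
  finally show ?thesis by (simp add: algebra_simps)
 qed
 with L(1) M(1) B show ?thesis
  unfolding lipschitz_coord_def by (intro exI[of _ "L * B + B * M"]) simp
qed

lemma lipschitz_coord_cmult:
 assumes "lipschitz_coord I g" shows "lipschitz_coord I (\<lambda>x. c * g x)"
proof -
 obtain L where L: "L >= 0" "!!x y. cmod (g x - g y) <= L * (\<Sum>i\<in>I. cmod (x i - y i))"
  using assms(1) by (rule lipschitz_coordE) blast
 have "cmod (c * g x - c * g y) <= (cmod c * L) * (\<Sum>i\<in>I. cmod (x i - y i))" for x y
  using mult_left_mono[OF L(2), of "cmod c" x y]
  by (simp add: norm_mult mult.assoc flip: right_diff_distrib)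
 with L(1) show ?thesis
  unfolding lipschitz_coord_def by (intro exI[of _ "cmod c * L"]) simp
qed

lemma lipschitz_coord_sum:
 assumes "!!j. j \<in> J ==> lipschitz_coord I (\<lambda>x. g x j)"
 shows "lipschitz_coord I (\<lambda>x. \<Sum>j\<in>J. g x j)"
 using assms
 by (induction J rule: infinite_finite_induct) (auto intro: lipschitz_coord_const lipschitz_coord_add)

text \<open>Factor of the radial retraction onto the ball of radius \<open>a\<close>. The 2 accounts
  for the negative frequencies: the coordinates are the positive ones only, and by
  \<open>sum_extend\<close> twice their sum is the Wiener norm.\<close>

definition cutoff :: "'i set => real => ('i => complex) => real" where
 "cutoff I a x = a / max a (2 * (\<Sum>i\<in>I. cmod (x i)))"

lemma cutoff_bounds:
 assumes "a > 0"
 shows "0 <= cutoff I a x" "cutoff I a x <= 1" "cutoff I a x * (2 * (\<Sum>i\<in>I. cmod (x i))) <= a"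
  "2 * (\<Sum>i\<in>I. cmod (x i)) <= a ==> cutoff I a x = 1"
proof -
 let ?S = "2 * (\<Sum>i\<in>I. cmod (x i))"
 have m: "max a ?S > 0" using assms by simp
 show "0 <= cutoff I a x" "cutoff I a x <= 1"
  using assms by (simp_all add: cutoff_def divide_le_eq_1 max_def)
 have "a * ?S <= a * max a ?S" using assms by (intro mult_left_mono) auto
 then show "cutoff I a x * ?S <= a" using m by (simp add: cutoff_def pos_divide_le_eq)
 show "cutoff I a x = 1" if "?S <= a" using that assms by (simp add: cutoff_def max_def)
qed

lemma lipschitz_coord_cutoff:
 assumes fin: "finite I" and i: "i \<in> I" and a: "a > 0"
 shows "lipschitz_coord I (\<lambda>x. of_real (cutoff I a x) * x i)"
proof -
 have "cmod (of_real (cutoff I a x) * x i - of_real (cutoff I a y) * y i)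
   <= 3 * (\<Sum>i\<in>I. cmod (x i - y i))" for x y
 proof -
  define p where "p = max a (2 * (\<Sum>i\<in>I. cmod (x i)))"
  define q where "q = max a (2 * (\<Sum>i\<in>I. cmod (y i)))"
  let ?d = "\<Sum>i\<in>I. cmod (x i - y i)"
  have pq: "p > 0" "q > 0" "a <= p" "a <= q" using a by (auto simp: p_def q_def)
  have yi: "cmod (y i) <= q"
   using member_le_sum[of i I "\<lambda>i. cmod (y i)"] fin i sum_nonneg[of I "\<lambda>i. cmod (y i)"]
   by (auto simp: q_def)
  have di: "cmod (x i - y i) <= ?d"
   using member_le_sum[of i I "\<lambda>i. cmod (x i - y i)"] fin i by auto
  have "\<bar>(\<Sum>i\<in>I. cmod (x i)) - (\<Sum>i\<in>I. cmod (y i))\<bar> <= ?d"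
   unfolding sum_subtractf[symmetric]
   by (rule order_trans[OF sum_abs]) (auto intro!: sum_mono norm_triangle_ineq3)
  then have qp: "\<bar>q - p\<bar> <= 2 * ?d" by (auto simp: p_def q_def max_def)
  \<comment> \<open>One term for the change of the point, one for the change of the factor. As
    \<open>cmod (y i) \<le> q\<close>, the second is at most twice the distance, which explains the
    constant 3.\<close>
  have "of_real (cutoff I a x) * x i - of_real (cutoff I a y) * y i
    = of_real (a / p) * (x i - y i) + of_real (a / p * ((q - p) / q)) * y i"
   using pq by (simp add: cutoff_def p_def[symmetric] q_def[symmetric] field_simps)
  then have "cmod (of_real (cutoff I a x) * x i - of_real (cutoff I a y) * y i)
    <= \<bar>a / p\<bar> * cmod (x i - y i) + \<bar>a / p * ((q - p) / q)\<bar> * cmod (y i)"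
   by (metis norm_mult norm_of_real norm_triangle_ineq)
  also have "... = a / p * (cmod (x i - y i) + \<bar>q - p\<bar> * (cmod (y i) / q))"
   using pq a by (simp add: abs_mult distrib_left)
  also have "... <= 1 * (?d + (2 * ?d) * 1)"
   using pq a yi di qp by (intro mult_mono add_mono) (auto simp: divide_le_eq_1)
  finally show ?thesis by simp
 qed
 then show ?thesis unfolding lipschitz_coord_def by (intro exI[of _ 3]) simp
qed

text \<open>Up to the factor \<open>- \<i>\<close>, the Fourier coefficients of the bracket in (M),
  with \<open>a3\<close>, \<open>b3\<close> before the third and \<open>- a1\<close>,
  \<open>- b1\<close> before the first derivatives. With that factor taken out the symbol is real
  and the damping is visible as \<open>- of_int k * lin\<close>.\<close>

definition lin :: "real => real => real => real => (int => complex) => (int => complex) => int => complex" where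
 "lin a3 a1 b3 b1 f g j = of_real (a3 * real_of_int j ^ 3 + a1 * real_of_int j) * f j
  + of_real (b3 * real_of_int j ^ 3 + b1 * real_of_int j) * g j"

text \<open>Only the index of the differentiated factor is restricted; for \<open>h\<close>
  supported in the band this is the full convolution.\<close>

definition gconv :: "nat => (int => complex) => (int => complex) => int => complex" where
 "gconv n f h k = (\<Sum>j\<in>modes n. f (k - j) * h j)"

definition hermitian :: "(int => complex) => bool" where
 "hermitian c \<longleftrightarrow> (\<forall>k. c (- k) = cnj (c k))"

lemma hermitianD: "hermitian c ==> c (- k) = cnj (c k)"
 by (simp add: hermitian_def)

lemma lin_uminus:
 assumes "hermitian f" "hermitian g"
 shows "lin a3 a1 b3 b1 f g (- j) = - cnj (lin a3 a1 b3 b1 f g j)"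
 using assms by (simp add: lin_def hermitianD algebra_simps)

lemma gconv_lin_uminus:
 assumes "hermitian f" "hermitian g" "hermitian u"
 shows "gconv n u (lin a3 a1 b3 b1 f g) (- k) = - cnj (gconv n u (lin a3 a1 b3 b1 f g) k)"
proof -
 have "gconv n u (lin a3 a1 b3 b1 f g) (- k) = (\<Sum>j\<in>modes n. u (- k - - j) * lin a3 a1 b3 b1 f g (- j))"
  unfolding gconv_def by (rule sum_modes_uminus[symmetric])
 also have "... = (\<Sum>j\<in>modes n. - cnj (u (k - j) * lin a3 a1 b3 b1 f g j))"
 proof (intro sum.cong refl)
  fix j
  have "u (- k - - j) = cnj (u (k - j))" using hermitianD[OF assms(3), of "k - j"] by simp
  then show "u (- k - - j) * lin a3 a1 b3 b1 f g (- j) = - cnj (u (k - j) * lin a3 a1 b3 b1 f g j)"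
   by (simp add: lin_uminus[OF assms(1,2)])
 qed
 also have "... = - cnj (gconv n u (lin a3 a1 b3 b1 f g) k)"
  by (simp add: gconv_def sum_negf cnj_sum)
 finally show ?thesis .
qed

text \<open>The unknowns are the positive frequencies, with \<open>True\<close> for the first and
  \<open>False\<close> for the second component. Reality and mean zero hold by construction, so the
  flow need not be shown to preserve them.\<close>

definition extend :: "nat => (bool \<times> int => complex) => bool => int => complex" where
 "extend n x s k = (if 0 < k \<and> k <= int n then x (s, k)
  else if k < 0 \<and> - int n <= k then cnj (x (s, - k)) else 0)"

lemma hermitian_extend: "hermitian (extend n x s)"
 by (auto simp: hermitian_def extend_def)

lemma extend_outside: "k \<notin> modes n ==> extend n x s k = 0"
 by (auto simp: extend_def mem_modes)

lemma sum_extend: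
 "wsum n 0 (\<lambda>k. cmod (extend n x True k)) + wsum n 0 (\<lambda>k. cmod (extend n x False k))
  = 2 * (\<Sum>i\<in>UNIV \<times> {1..int n}. cmod (x i))"
proof -
 have *: "wsum n 0 (\<lambda>k. cmod (extend n x s k)) = 2 * (\<Sum>k\<in>{1..int n}. cmod (x (s, k)))" for s
 proof -
  have "modes n = {1..int n} \<union> ({- int n..-1} \<union> {0})" by (auto simp: modes_def)
  then have "wsum n 0 (\<lambda>k. cmod (extend n x s k))
    = (\<Sum>k\<in>{1..int n} \<union> ({- int n..-1} \<union> {0}). cmod (extend n x s k))"
   by (simp add: wsum_def)
  also have "... = (\<Sum>k\<in>{1..int n}. cmod (extend n x s k)) + (\<Sum>k\<in>{- int n..-1}. cmod (extend n x s k))"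
   by (subst sum.union_disjoint, simp, simp, force, subst sum.union_disjoint)
    (auto simp: extend_def)
  also have "(\<Sum>k\<in>{- int n..-1}. cmod (extend n x s k)) = (\<Sum>k\<in>{1..int n}. cmod (extend n x s k))"
   by (rule sum.reindex_bij_witness[of _ uminus uminus]) (auto simp: extend_def)
  also have "(\<Sum>k\<in>{1..int n}. cmod (extend n x s k)) = (\<Sum>k\<in>{1..int n}. cmod (x (s, k)))"
   by (intro sum.cong) (auto simp: extend_def)
  finally show ?thesis by simp
 qed
 have "(\<Sum>i\<in>UNIV \<times> {1..int n}. cmod (x i)) = (\<Sum>s\<in>UNIV. \<Sum>k\<in>{1..int n}. cmod (x (s, k)))"
  by (simp add: sum.cartesian_product)
 also have "... = (\<Sum>k\<in>{1..int n}. cmod (x (True, k))) + (\<Sum>k\<in>{1..int n}. cmod (x (False, k)))"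
  by (simp add: UNIV_bool)
 finally show ?thesis by (simp add: *)
qed

lemma lipschitz_coord_lin:
 assumes "!!s k. lipschitz_coord I (\<lambda>x. u x s k)"
 shows "lipschitz_coord I (\<lambda>x. lin a3 a1 b3 b1 (u x True) (u x False) k)"
 unfolding lin_def by (intro lipschitz_coord_add lipschitz_coord_cmult assms)

lemma lipschitz_coord_extend: "lipschitz_coord (UNIV \<times> {1..int n}) (\<lambda>x. extend n x s k)"
 by (cases "0 < k \<and> k <= int n"; cases "k < 0 \<and> - int n <= k")
  (auto simp: extend_def[abs_def]
   intro!: lipschitz_coord_proj lipschitz_coord_cnj lipschitz_coord_const)

lemma lipschitz_coord_cutoff_extend:
 assumes "a > 0"
 shows "lipschitz_coord (UNIV \<times> {1..int n})
  (\<lambda>x. of_real (cutoff (UNIV \<times> {1..int n}) a x) * extend n x s k)"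
proof -
 let ?I = "UNIV \<times> {1..int n}" and ?c = "\<lambda>x. complex_of_real (cutoff (UNIV \<times> {1..int n}) a x)"
 consider "0 < k" "k <= int n" | "k < 0" "- int n <= k" | "k = 0 \<or> k > int n \<or> k < - int n" by linarith
 then show ?thesis
 proof cases
  case 1
  then have "(\<lambda>x. ?c x * extend n x s k) = (\<lambda>x. ?c x * x (s, k))" by (simp add: extend_def)
  then show ?thesis using lipschitz_coord_cutoff[of ?I "(s, k)" a] assms 1 by simp
 next
  case 2
  then have "(\<lambda>x. ?c x * extend n x s k) = (\<lambda>x. cnj (?c x * x (s, - k)))" by (simp add: extend_def)
  then show ?thesis
   using lipschitz_coord_cnj[OF lipschitz_coord_cutoff[of ?I "(s, - k)" a]] assms 2 by simp
 next
  case 3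
  then have "(\<lambda>x. ?c x * extend n x s k) = (\<lambda>x. 0)" by (auto simp: extend_def)
  then show ?thesis by (simp add: lipschitz_coord_const)
 qed
qed

lemma cutoff_extend_bound:
 assumes "a > 0"
 shows "cmod (of_real (cutoff (UNIV \<times> {1..int n}) a x) * extend n x s k) <= a"
proof (cases "extend n x s k = 0")
 case False
 let ?I = "UNIV \<times> {1..int n}"
 obtain i where i: "i \<in> ?I" "cmod (extend n x s k) = cmod (x i)"
 proof (cases "k > 0")
  case True
  then show ?thesis using False that[of "(s, k)"] by (simp add: extend_def split: if_splits)
 next
  case neg: False
  then show ?thesis using False that[of "(s, - k)"] by (simp add: extend_def split: if_splits)
 qed
 have "cmod (x i) <= (\<Sum>i\<in>?I. cmod (x i))" using i by (intro member_le_sum) auto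
 moreover have "(\<Sum>i\<in>?I. cmod (x i)) >= 0" by (intro sum_nonneg) auto
 ultimately have "cmod (x i) <= 2 * (\<Sum>i\<in>?I. cmod (x i))" by linarith
 then have "cutoff ?I a x * cmod (x i) <= cutoff ?I a x * (2 * (\<Sum>i\<in>?I. cmod (x i)))"
  using cutoff_bounds[OF assms] by (intro mult_left_mono)
 also have "... <= a" by (rule cutoff_bounds[OF assms])
 finally show ?thesis
  using i by (simp add: norm_mult abs_of_nonneg[OF cutoff_bounds(1)[OF assms]])
qed (use assms in simp)

lemma lin_bound:
 assumes "!!j. cmod (f j) <= a" "!!j. cmod (g j) <= a"
 shows "cmod (lin a3 a1 b3 b1 f g j)
  <= (\<bar>a3 * real_of_int j ^ 3 + a1 * real_of_int j\<bar> + \<bar>b3 * real_of_int j ^ 3 + b1 * real_of_int j\<bar>) * a"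
proof -
 have "cmod (lin a3 a1 b3 b1 f g j) <= \<bar>a3 * real_of_int j ^ 3 + a1 * real_of_int j\<bar> * cmod (f j)
   + \<bar>b3 * real_of_int j ^ 3 + b1 * real_of_int j\<bar> * cmod (g j)"
  unfolding lin_def by (rule order_trans[OF norm_triangle_ineq]) (simp only: norm_mult norm_of_real order_refl)
 also have "... <= \<bar>a3 * real_of_int j ^ 3 + a1 * real_of_int j\<bar> * a
   + \<bar>b3 * real_of_int j ^ 3 + b1 * real_of_int j\<bar> * a"
  by (intro add_mono mult_left_mono assms) auto
 finally show ?thesis by (simp add: distrib_right)
qed

text \<open>The truncated system with nonlinearity \<open>\<theta>\<^sup>2\<close> times the original one, where
 \<open>\<theta>\<close> is the factor of the radial retraction onto the ball of radius \<open>a\<close>.\<close>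

lemma truncated_system:
 fixes f0 g0 :: "int => complex" and La Lb :: "(int => complex) => (int => complex) => int => complex"
 assumes a: "a > 0" and h0: "hermitian f0" "hermitian g0" "f0 0 = 0" "g0 0 = 0"
  and La: "La = lin p3 p1 q3 q1" and Lb: "Lb = lin r3 r1 s3 s1"
 obtains f g :: "real => int => complex" and \<theta> :: "real => real"
 where "!!t. hermitian (f t)" "!!t. hermitian (g t)"
  "!!t k. k = 0 \<or> k \<notin> modes n ==> f t k = 0" "!!t k. k = 0 \<or> k \<notin> modes n ==> g t k = 0"
  "!!k. k \<in> modes n ==> f 0 k = f0 k" "!!k. k \<in> modes n ==> g 0 k = g0 k"
  "!!k. cont_nonneg (\<lambda>t. f t k)" "!!k. cont_nonneg (\<lambda>t. g t k)"
  "cont_nonneg \<theta>" "!!t. 0 <= \<theta> t" "!!t. \<theta> t <= 1"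
  "!!t. \<theta> t * (wsum n 0 (\<lambda>k. cmod (f t k)) + wsum n 0 (\<lambda>k. cmod (g t k))) <= a"
  "!!t. wsum n 0 (\<lambda>k. cmod (f t k)) + wsum n 0 (\<lambda>k. cmod (g t k)) <= a ==> \<theta> t = 1"
  "!!t k. t > 0 ==> k \<in> modes n ==> ((\<lambda>s. f s k) has_vector_derivative
   - of_int k * (of_real m1 * La (f t) (g t) k + of_real ((\<theta> t)\<^sup>2) * gconv n (f t) (La (f t) (g t)) k)) (at t)"
  "!!t k. t > 0 ==> k \<in> modes n ==> ((\<lambda>s. g s k) has_vector_derivative
   - of_int k * (of_real m2 * Lb (f t) (g t) k + of_real ((\<theta> t)\<^sup>2) * gconv n (g t) (Lb (f t) (g t)) k)) (at t)"
proof -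
 let ?I = "UNIV \<times> {1..int n} :: (bool \<times> int) set"
 define c where "c x = complex_of_real (cutoff ?I a x)" for x
 define L where "L s = (if s then La else Lb)" for s
 define m where "m s = complex_of_real (if s then m1 else m2)" for s
 \<comment> \<open>The nonlinearity is evaluated at the retracted point; its arguments are bounded,
   which makes the products Lipschitz. Since it is quadratic, this equals
   \<open>\<theta>\<^sup>2\<close> times the nonlinearity at the point itself (fact
   \<open>scale\<close> below).\<close>
 define R where "R x s k = - of_int k * (m s * L s (extend n x True) (extend n x False) k
  + gconv n (\<lambda>k. c x * extend n x s k) (L s (\<lambda>k. c x * extend n x True k) (\<lambda>k. c x * extend n x False k)) k)"
  for x s k
 define F where "F x i = R x (fst i) (snd i)" for x i
 have lipL: "lipschitz_coord ?I (\<lambda>x. L s (extend n x True) (extend n x False) k)" for s k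
  unfolding L_def La Lb
  by (cases s) (simp_all add: lipschitz_coord_lin[where u = "\<lambda>x. extend n x"] lipschitz_coord_extend)
 have lipLc: "lipschitz_coord ?I (\<lambda>x. L s (\<lambda>k. c x * extend n x True k) (\<lambda>k. c x * extend n x False k) k)" for s k
  unfolding L_def La Lb c_def
  by (cases s) (simp_all add: lipschitz_coord_lin[where u = "\<lambda>x s k. of_real (cutoff ?I a x) * extend n x s k"]
    lipschitz_coord_cutoff_extend[OF a])
 have "\<exists>B. \<forall>x. cmod (L s (\<lambda>k. c x * extend n x True k) (\<lambda>k. c x * extend n x False k) k) <= B" for s k
  unfolding L_def La Lb c_def
  by (cases s) (auto intro!: exI lin_bound cutoff_extend_bound[OF a])
 then obtain B where B: "!!x s k. cmod (L s (\<lambda>k. c x * extend n x True k) (\<lambda>k. c x * extend n x False k) k) <= B s k"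
  by metis
 have lipR: "lipschitz_coord ?I (\<lambda>x. R x s k)" for s k
  unfolding R_def gconv_def
 proof (intro lipschitz_coord_cmult lipschitz_coord_add lipschitz_coord_sum lipL)
  fix j
  show "lipschitz_coord ?I (\<lambda>x. (c x * extend n x s (k - j)) *
    L s (\<lambda>k. c x * extend n x True k) (\<lambda>k. c x * extend n x False k) j)"
  proof (rule lipschitz_coord_mult[OF _ lipLc, where B = "max a (B s j)"])
   show "lipschitz_coord ?I (\<lambda>x. c x * extend n x s (k - j))"
    unfolding c_def by (rule lipschitz_coord_cutoff_extend[OF a])
   show "cmod (c x * extend n x s (k - j)) <= max a (B s j)" for x
    unfolding c_def using cutoff_extend_bound[OF a] by (simp add: le_max_iff_disj)
   show "cmod (L s (\<lambda>k. c x * extend n x True k) (\<lambda>k. c x * extend n x False k) j) <= max a (B s j)" for x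
    using B by (simp add: le_max_iff_disj)
  qed
 qed
 then have "\<forall>i. \<exists>K. K >= 0 \<and> (\<forall>x y. cmod (F x i - F y i) <= K * (\<Sum>i\<in>?I. cmod (x i - y i)))"
  unfolding F_def lipschitz_coord_def by blast
 then obtain K where K: "!!i. K i >= 0" "!!i x y. cmod (F x i - F y i) <= K i * (\<Sum>i\<in>?I. cmod (x i - y i))"
  by metis
 have lip: "cmod (F x i - F y i) <= (\<Sum>i\<in>?I. K i) * (\<Sum>i\<in>?I. cmod (x i - y i))" if "i \<in> ?I" for x y i
 proof -
  have "K i <= (\<Sum>i\<in>?I. K i)" using that K(1) by (intro member_le_sum) auto
  then show ?thesis using K(2)[of x i y]
   by (meson mult_right_mono norm_ge_zero order_trans sum_nonneg)
 qed
 have finI: "finite ?I" by simp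
 define x0 where "x0 i = (if fst i then f0 (snd i) else g0 (snd i))" for i
 have "\<exists>\<phi>. \<phi> 0 = x0 \<and> (\<forall>i\<in>?I. cont_nonneg (\<lambda>t. \<phi> t i)) \<and>
  (\<forall>i\<in>?I. \<forall>t>0. ((\<lambda>s. \<phi> s i) has_vector_derivative F (\<phi> t) i) (at t))"
  by (rule picard_global[OF finI, of F]) (rule lip)
 then obtain \<phi> where "\<phi> 0 = x0" "\<forall>i\<in>?I. cont_nonneg (\<lambda>t. \<phi> t i)"
  "\<forall>i\<in>?I. \<forall>t>0. ((\<lambda>s. \<phi> s i) has_vector_derivative F (\<phi> t) i) (at t)"
  by (elim exE conjE)
 then have \<phi>: "!!i. \<phi> 0 i = x0 i" "!!i. i \<in> ?I ==> cont_nonneg (\<lambda>t. \<phi> t i)"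
  "!!i t. i \<in> ?I ==> t > 0 ==> ((\<lambda>s. \<phi> s i) has_vector_derivative F (\<phi> t) i) (at t)"
  by (simp, blast+)
 define u where "u s t = extend n (\<phi> t) s" for s t
 define \<theta> where "\<theta> t = cutoff ?I a (\<phi> t)" for t
 have herm: "hermitian (u s t)" for s t unfolding u_def by (rule hermitian_extend)
 have cont: "cont_nonneg (\<lambda>t. u s t k)" for s k
  unfolding u_def extend_def
  by (cases "0 < k \<and> k <= int n"; cases "k < 0 \<and> - int n <= k")
   (auto intro!: \<phi>(2) continuous_on_cnj)
 have Lneg: "L s (u True t) (u False t) (- k) = - cnj (L s (u True t) (u False t) k)" for s t k
  unfolding L_def La Lb by (cases s) (simp_all add: lin_uminus herm)
 have cneg: "gconv n (u s t) (L s (u True t) (u False t)) (- k) = - cnj (gconv n (u s t) (L s (u True t) (u False t)) k)" for s t k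
  unfolding L_def La Lb by (cases s) (simp_all add: gconv_lin_uminus herm)
 have scale: "gconv n (\<lambda>k. c (\<phi> t) * u s t k) (L s (\<lambda>k. c (\<phi> t) * u True t k) (\<lambda>k. c (\<phi> t) * u False t k)) k
   = of_real ((\<theta> t)\<^sup>2) * gconv n (u s t) (L s (u True t) (u False t)) k" for s t k
  unfolding gconv_def L_def La Lb c_def \<theta>_def lin_def
  by (cases s) (simp_all add: sum_distrib_left power2_eq_square algebra_simps)
 let ?rhs = "\<lambda>s t k. - of_int k * (m s * L s (u True t) (u False t) k
   + of_real ((\<theta> t)\<^sup>2) * gconv n (u s t) (L s (u True t) (u False t)) k)"
 have Req: "R (\<phi> t) s k = ?rhs s t k" for t s k
  using scale by (simp add: R_def u_def)
 have deriv: "((\<lambda>\<tau>. u s \<tau> k) has_vector_derivative ?rhs s t k) (at t)"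
  if t: "t > 0" and k: "k \<in> modes n" for s t k
 proof -
  consider "0 < k" | "k < 0" | "k = 0" by linarith
  then show ?thesis
  proof cases
   case 1
   then have "(\<lambda>\<tau>. u s \<tau> k) = (\<lambda>\<tau>. \<phi> \<tau> (s, k))" using k by (auto simp: u_def extend_def mem_modes)
   then show ?thesis using \<phi>(3)[of "(s, k)" t] t 1 k by (simp add: F_def Req mem_modes)
  next
   case 2
   then have eq: "(\<lambda>\<tau>. u s \<tau> k) = (\<lambda>\<tau>. cnj (\<phi> \<tau> (s, - k)))" using k by (auto simp: u_def extend_def mem_modes)
   have "((\<lambda>\<tau>. \<phi> \<tau> (s, - k)) has_vector_derivative ?rhs s t (- k)) (at t)"
    using \<phi>(3)[of "(s, - k)" t] t 2 k by (simp add: F_def Req mem_modes)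
   from bounded_linear.has_vector_derivative[OF bounded_linear_cnj this]
   have "((\<lambda>\<tau>. u s \<tau> k) has_vector_derivative cnj (?rhs s t (- k))) (at t)" by (simp add: eq)
   \<comment> \<open>From \<open>k\<close> to \<open>- k\<close> both \<open>L\<close> and its
     convolution are conjugated and change sign, and so does the prefactor; hence the right-hand
     side is Hermitian.\<close>
   moreover have "cnj (?rhs s t (- k)) = ?rhs s t k"
    unfolding Lneg cneg by (simp add: m_def algebra_simps)
   ultimately show ?thesis by simp
  next
   case 3
   then show ?thesis by (simp add: u_def extend_def)
  qed
 qed
 have S: "wsum n 0 (\<lambda>k. cmod (u True t k)) + wsum n 0 (\<lambda>k. cmod (u False t k)) = 2 * (\<Sum>i\<in>?I. cmod (\<phi> t i))" for t
  unfolding u_def by (rule sum_extend)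
 show ?thesis
 proof (rule that[of "u True" "u False" \<theta>])
  show "hermitian (u True t)" "hermitian (u False t)" for t by (rule herm)+
  show "u True t k = 0" "u False t k = 0" if "k = 0 \<or> k \<notin> modes n" for t k
   using that by (auto simp: u_def extend_outside) (auto simp: extend_def)
  have init: "u s 0 k = (if s then f0 k else g0 k)" if "k \<in> modes n" for s k
   using that hermitianD[OF h0(1), of "-k"] hermitianD[OF h0(2), of "-k"] h0
   by (auto simp: u_def extend_def mem_modes \<phi>(1) x0_def not_less)
  show "u True 0 k = f0 k" "u False 0 k = g0 k" if "k \<in> modes n" for k
   using init[OF that] by simp_all
  show "cont_nonneg (\<lambda>t. u True t k)" "cont_nonneg (\<lambda>t. u False t k)" for k
   by (rule cont)+
  have nz: "max a (2 * (\<Sum>i\<in>?I. cmod (\<phi> t i))) \<noteq> 0" for t using a by linarith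
  have "cont_nonneg (\<lambda>t. \<Sum>i\<in>?I. cmod (\<phi> t i))"
   by (intro continuous_on_sum continuous_on_norm \<phi>(2))
  then show "cont_nonneg \<theta>"
   unfolding \<theta>_def cutoff_def
   by (intro continuous_on_divide continuous_on_const continuous_on_max continuous_on_mult_left)
    (use nz in auto)
  show "0 <= \<theta> t" "\<theta> t <= 1"
   "\<theta> t * (wsum n 0 (\<lambda>k. cmod (u True t k)) + wsum n 0 (\<lambda>k. cmod (u False t k))) <= a" for t
   unfolding \<theta>_def S by (rule cutoff_bounds[OF a])+
  show "\<theta> t = 1" if "wsum n 0 (\<lambda>k. cmod (u True t k)) + wsum n 0 (\<lambda>k. cmod (u False t k)) <= a" for t
   unfolding \<theta>_def using that unfolding S by (rule cutoff_bounds[OF a])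
  show "((\<lambda>s. u True s k) has_vector_derivative
   - of_int k * (of_real m1 * La (u True t) (u False t) k
    + of_real ((\<theta> t)\<^sup>2) * gconv n (u True t) (La (u True t) (u False t)) k)) (at t)"
   if "t > 0" "k \<in> modes n" for t k
   using deriv[OF that, of True] by (simp add: L_def m_def)
  show "((\<lambda>s. u False s k) has_vector_derivative
   - of_int k * (of_real m2 * Lb (u True t) (u False t) k
    + of_real ((\<theta> t)\<^sup>2) * gconv n (u False t) (Lb (u True t) (u False t)) k)) (at t)"
   if "t > 0" "k \<in> modes n" for t k
   using deriv[OF that, of False] by (simp add: L_def m_def)
 qed
qed

section \<open>A priori estimates\<close>

definition asum :: "nat => nat => (int => complex) => real" where
 "asum n p c = wsum n p (\<lambda>k. cmod (c k))"

text \<open>The exponent is the weight on the square: \<open>qsum n 4\<close> is the square of the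
  truncated \<open>Hdot 2\<close> norm and \<open>qsum n 8\<close> that of the \<open>Hdot 4\<close>
  norm.\<close>

definition qsum :: "nat => nat => (int => complex) => real" where
 "qsum n p c = wsum n p (\<lambda>k. (cmod (c k))\<^sup>2)"

abbreviation "asum2 n p c d \<equiv> asum n p c + asum n p d"
abbreviation "qsum2 n p c d \<equiv> qsum n p c + qsum n p d"

lemma asum_nonneg: "asum n p c >= 0"
 unfolding asum_def by (rule wsum_nonneg) simp

lemma qsum_nonneg: "qsum n p c >= 0"
 unfolding qsum_def by (rule wsum_nonneg) simp

lemma asum_mono: "c 0 = 0 ==> p <= q ==> asum n p c <= asum n q c"
 unfolding asum_def by (rule wsum_mono) simp_all

lemma continuous_on_asum:
 assumes "!!k. continuous_on S (\<lambda>t. c t k)" shows "continuous_on S (\<lambda>t. asum n p (c t))"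
 unfolding asum_def wsum_def
 by (intro continuous_on_sum continuous_on_mult_left continuous_on_norm assms)

lemma continuous_on_qsum:
 assumes "!!k. continuous_on S (\<lambda>t. c t k)" shows "continuous_on S (\<lambda>t. qsum n p (c t))"
 unfolding qsum_def wsum_def
 by (intro continuous_on_sum continuous_on_mult_left continuous_on_power continuous_on_norm assms)

section \<open>Moduli of the linear and quadratic terms\<close>

lemma cmod_lin_le:
 assumes "a3 >= 0" "a1 >= 0" "b3 >= 0" "b1 >= 0"
 shows "cmod (lin a3 a1 b3 b1 f g j) <= a3 * (mag j ^ 3 * cmod (f j)) + a1 * (mag j ^ 1 * cmod (f j))
  + b3 * (mag j ^ 3 * cmod (g j)) + b1 * (mag j ^ 1 * cmod (g j))"
proof -
 have *: "\<bar>c3 * real_of_int j ^ 3 + c1 * real_of_int j\<bar> <= c3 * mag j ^ 3 + c1 * mag j"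
  if "c3 >= 0" "c1 >= 0" for c3 c1
  using abs_triangle_ineq[of "c3 * real_of_int j ^ 3" "c1 * real_of_int j"] that
  by (simp add: abs_mult power_abs)
 have "cmod (lin a3 a1 b3 b1 f g j) <= \<bar>a3 * real_of_int j ^ 3 + a1 * real_of_int j\<bar> * cmod (f j)
   + \<bar>b3 * real_of_int j ^ 3 + b1 * real_of_int j\<bar> * cmod (g j)"
  unfolding lin_def by (rule order_trans[OF norm_triangle_ineq]) (simp only: norm_mult norm_of_real order_refl)
 also have "... <= (a3 * mag j ^ 3 + a1 * mag j) * cmod (f j)
   + (b3 * mag j ^ 3 + b1 * mag j) * cmod (g j)"
  by (intro add_mono mult_right_mono * assms) auto
 finally show ?thesis by (simp add: algebra_simps)
qed

lemma cmod_gconv_lin_le: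
 fixes u :: "int => complex" and n :: nat
 assumes "a3 >= 0" "a1 >= 0" "b3 >= 0" "b1 >= 0"
 defines "S \<equiv> \<lambda>k p h. \<Sum>j\<in>modes n. cmod (u (k - j)) * (mag j ^ p * cmod (h j))"
 shows "cmod (gconv n u (lin a3 a1 b3 b1 f g) k) <= a3 * S k 3 f + a1 * S k 1 f + b3 * S k 3 g + b1 * S k 1 g"
proof -
 have "cmod (gconv n u (lin a3 a1 b3 b1 f g) k) <= (\<Sum>j\<in>modes n. cmod (u (k - j)) * cmod (lin a3 a1 b3 b1 f g j))"
  unfolding gconv_def by (rule order_trans[OF norm_sum]) (simp add: norm_mult)
 also have "... <= (\<Sum>j\<in>modes n. cmod (u (k - j)) * (a3 * (mag j ^ 3 * cmod (f j)) + a1 * (mag j ^ 1 * cmod (f j))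
  + b3 * (mag j ^ 3 * cmod (g j)) + b1 * (mag j ^ 1 * cmod (g j))))"
  by (intro sum_mono mult_left_mono cmod_lin_le assms) auto
 also have "... = a3 * S k 3 f + a1 * S k 1 f + b3 * S k 3 g + b1 * S k 1 g"
  unfolding S_def sum_distrib_left sum.distrib[symmetric]
  by (intro sum.cong refl) (simp only: distrib_left mult.left_commute)
 finally show ?thesis .
qed

text \<open>The moduli of a Hermitian sequence are even, so \<open>wiener_bilinear\<close> applies,
  with \<open>p = 3\<close> for the third and \<open>p = 1\<close> for the first
  derivatives.\<close>

lemma wiener_convolution:
 assumes "a3 >= 0" "a1 >= 0" "b3 >= 0" "b1 >= 0" "hermitian u" "!!l. l \<notin> modes n ==> u l = 0"
 shows "(\<Sum>k\<in>modes n. mag k * cmod (gconv n u (lin a3 a1 b3 b1 f g) k))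
  <= a3 * (asum n 4 u * asum n 0 f + asum n 0 u * asum n 4 f)
  + a1 * (asum n 2 u * asum n 0 f + asum n 0 u * asum n 2 f)
  + b3 * (asum n 4 u * asum n 0 g + asum n 0 u * asum n 4 g)
  + b1 * (asum n 2 u * asum n 0 g + asum n 0 u * asum n 2 g)"
proof -
 define S where "S k p h = (\<Sum>j\<in>modes n. cmod (u (k - j)) * (mag j ^ p * cmod (h j)))"
  for k p and h :: "int => complex"
 have bil: "(\<Sum>k\<in>modes n. mag k * S k p h) <= asum n (p + 1) u * asum n 0 h + asum n 0 u * asum n (p + 1) h" for p h
  using wiener_bilinear[of "\<lambda>l. cmod (u l)" n "\<lambda>l. cmod (h l)" p] assms(5,6)
  by (simp add: S_def asum_def wsum_def hermitianD)
 have "(\<Sum>k\<in>modes n. mag k * cmod (gconv n u (lin a3 a1 b3 b1 f g) k))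
  <= (\<Sum>k\<in>modes n. mag k * (a3 * S k 3 f + a1 * S k 1 f + b3 * S k 3 g + b1 * S k 1 g))"
  unfolding S_def by (intro sum_mono mult_left_mono cmod_gconv_lin_le assms) auto
 also have "... = a3 * (\<Sum>k\<in>modes n. mag k * S k 3 f) + a1 * (\<Sum>k\<in>modes n. mag k * S k 1 f)
  + b3 * (\<Sum>k\<in>modes n. mag k * S k 3 g) + b1 * (\<Sum>k\<in>modes n. mag k * S k 1 g)"
  unfolding sum_distrib_left sum.distrib[symmetric]
  by (intro sum.cong refl) (simp only: distrib_left mult.left_commute)
 also have "... <= a3 * (asum n (3+1) u * asum n 0 f + asum n 0 u * asum n (3+1) f)
  + a1 * (asum n (1+1) u * asum n 0 f + asum n 0 u * asum n (1+1) f)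
  + b3 * (asum n (3+1) u * asum n 0 g + asum n 0 u * asum n (3+1) g)
  + b1 * (asum n (1+1) u * asum n 0 g + asum n 0 u * asum n (1+1) g)"
  by (intro add_mono mult_left_mono bil assms)
 finally show ?thesis by (simp add: numeral_Bit0 numeral_Bit1)
qed

text \<open>\<open>weight_cubic\<close> serves the third derivatives and
  \<open>weight_linear\<close> the first ones, with the same \<open>e\<close>; the vanishing zeroth
  coefficients keep the frequencies nonzero for the latter.\<close>

lemma energy_convolution:
 assumes nn: "a3 >= 0" "a1 >= 0" "b3 >= 0" "b1 >= 0"
  and u: "!!l. l = 0 \<or> l \<notin> modes n ==> u l = 0" and f0: "f 0 = 0" and g0: "g 0 = 0" and e: "e > 0"
 defines "C3 \<equiv> (1 + 1 / e)\<^sup>2 / e" and "C1 \<equiv> 8 + 16 / e"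
 shows "(\<Sum>k\<in>modes n. real_of_int k ^ 4 * cmod (z k) * (mag k * cmod (gconv n u (lin a3 a1 b3 b1 f g) k)))
  <= asum n 0 u * ((a3 * (1 + e) + a1 * e) * (qsum2 n 8 z f / 2)
    + (b3 * (1 + e) + b1 * e) * (qsum2 n 8 z g / 2))
  + asum n 4 u * ((a3 * C3 + a1 * C1) * (qsum2 n 4 z f / 2)
    + (b3 * C3 + b1 * C1) * (qsum2 n 4 z g / 2))"
proof -
 define S where "S k p h = (\<Sum>j\<in>modes n. cmod (u (k - j)) * (mag j ^ p * cmod (h j)))"
  for k p and h :: "int => complex"
 have kj: "mag k <= \<bar>real_of_int (k - j)\<bar> + mag j" for k j by linarith
 let ?T = "\<lambda>p h. (\<Sum>k\<in>modes n. real_of_int k ^ 4 * cmod (z k) * (mag k * S k p h))"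
 have T3: "?T 3 h <= (1 + e) * asum n 0 u * (qsum2 n 8 z h / 2)
   + C3 * asum n 4 u * (qsum2 n 4 z h / 2)" for h
  unfolding S_def asum_def qsum_def
 proof (rule energy_trilinear)
  show "mag k ^ 5 * mag j ^ 3 <= (1 + e) * (real_of_int k ^ 4 * real_of_int j ^ 4)
   + C3 * (real_of_int (k - j) ^ 4 * ((real_of_int k)\<^sup>2 * (real_of_int j)\<^sup>2))" for k j
   unfolding C3_def by (rule weight_cubic[OF e kj])
 qed (use u e in \<open>auto simp: C3_def\<close>)
 have T1: "?T 1 h <= e * asum n 0 u * (qsum2 n 8 z h / 2)
   + C1 * asum n 4 u * (qsum2 n 4 z h / 2)" if "h 0 = 0" for h
  unfolding S_def asum_def qsum_def
 proof (rule energy_trilinear)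
  fix k j assume "cmod (u (k - j)) \<noteq> 0" "cmod (h j) \<noteq> 0"
  then have "k - j \<noteq> 0" "j \<noteq> 0" using u[of 0] that by auto
  then have "\<bar>real_of_int (k - j)\<bar> >= 1" "mag j >= 1" by linarith+
  from weight_linear[OF e kj this]
  show "mag k ^ 5 * mag j ^ 1 <= e * (real_of_int k ^ 4 * real_of_int j ^ 4)
   + C1 * (real_of_int (k - j) ^ 4 * ((real_of_int k)\<^sup>2 * (real_of_int j)\<^sup>2))"
   unfolding C1_def power_one_right .
 qed (use u e in \<open>auto simp: C1_def\<close>)
 have "(\<Sum>k\<in>modes n. real_of_int k ^ 4 * cmod (z k) * (mag k * cmod (gconv n u (lin a3 a1 b3 b1 f g) k)))
  <= (\<Sum>k\<in>modes n. real_of_int k ^ 4 * cmod (z k) * (mag k *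
    (a3 * S k 3 f + a1 * S k 1 f + b3 * S k 3 g + b1 * S k 1 g)))"
  unfolding S_def by (intro sum_mono mult_left_mono cmod_gconv_lin_le nn) auto
 also have "... = a3 * ?T 3 f + a1 * ?T 1 f + b3 * ?T 3 g + b1 * ?T 1 g"
  unfolding sum_distrib_left sum.distrib[symmetric]
  by (intro sum.cong refl) (simp only: distrib_left mult.left_commute)
 also have "... <= a3 * ((1 + e) * asum n 0 u * (qsum2 n 8 z f / 2)
   + C3 * asum n 4 u * (qsum2 n 4 z f / 2))
  + a1 * (e * asum n 0 u * (qsum2 n 8 z f / 2)
   + C1 * asum n 4 u * (qsum2 n 4 z f / 2))
  + b3 * ((1 + e) * asum n 0 u * (qsum2 n 8 z g / 2)
   + C3 * asum n 4 u * (qsum2 n 4 z g / 2))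
  + b1 * (e * asum n 0 u * (qsum2 n 8 z g / 2)
   + C1 * asum n 4 u * (qsum2 n 4 z g / 2))"
  by (intro add_mono mult_left_mono nn T3 T1 f0 g0)
 also have "... = asum n 0 u * ((a3 * (1 + e) + a1 * e) * (qsum2 n 8 z f / 2)
    + (b3 * (1 + e) + b1 * e) * (qsum2 n 8 z g / 2))
  + asum n 4 u * ((a3 * C3 + a1 * C1) * (qsum2 n 4 z f / 2)
    + (b3 * C3 + b1 * C1) * (qsum2 n 4 z g / 2))"
  by (simp only: distrib_left distrib_right mult_ac add_ac)
 finally show ?thesis .
qed

text \<open>The form that \<open>modulus_integral_bound\<close> expects: the diagonal symbol keeps
  its sign and damps, whereas coupling and nonlinearity enter with absolute values.\<close>

lemma Re_cnj_mode_le: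
 assumes nn: "m >= 0" "b3 >= 0" "b1 >= 0" and "\<tau> >= 0"
  and u': "u' = - of_int k * (of_real m * (of_real (a3 * real_of_int k ^ 3 + a1 * real_of_int k) * u
   + of_real (b3 * real_of_int k ^ 3 + b1 * real_of_int k) * v) + of_real \<tau> * N)"
 shows "Re (cnj u * u') <= cmod u * ((m * (b3 * real_of_int k ^ 4 + b1 * (real_of_int k)\<^sup>2) * cmod v
   + \<tau> * (mag k * cmod N)) - m * (a3 * real_of_int k ^ 4 + a1 * (real_of_int k)\<^sup>2) * cmod u)"
proof -
 define K where "K = real_of_int k"
 have "cnj u * u' = of_real (- m * (a3 * K ^ 4 + a1 * K\<^sup>2)) * (cnj u * u)
   + of_real (- m * (b3 * K ^ 4 + b1 * K\<^sup>2)) * (cnj u * v) + of_real (- \<tau> * K) * (cnj u * N)"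
  unfolding u' K_def by (simp add: algebra_simps eval_nat_numeral)
 moreover have "cnj u * u = of_real ((cmod u)\<^sup>2)" by (metis complex_norm_square mult.commute)
 moreover have "Re (of_real \<alpha> * of_real r + of_real \<beta> * x + of_real \<gamma> * y) = \<alpha> * r + \<beta> * Re x + \<gamma> * Re y"
  for \<alpha> \<beta> \<gamma> r x y by simp
 ultimately have "Re (cnj u * u') = - m * (a3 * K ^ 4 + a1 * K\<^sup>2) * (cmod u)\<^sup>2
   + - m * (b3 * K ^ 4 + b1 * K\<^sup>2) * Re (cnj u * v) + (- \<tau> * K) * Re (cnj u * N)"
  by (simp only:)
 also have "... <= - m * (a3 * K ^ 4 + a1 * K\<^sup>2) * (cmod u)\<^sup>2
   + m * (b3 * K ^ 4 + b1 * K\<^sup>2) * (cmod u * cmod v) + \<tau> * \<bar>K\<bar> * (cmod u * cmod N)"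
 proof (intro add_mono order_refl)
  have 1: "- Re (cnj u * w) <= cmod u * cmod w" "\<bar>Re (cnj u * w)\<bar> <= cmod u * cmod w" for w
   using abs_Re_le_cmod[of "cnj u * w"] by (simp_all add: norm_mult)
  have "m * (b3 * K ^ 4 + b1 * K\<^sup>2) * (- Re (cnj u * v)) <= m * (b3 * K ^ 4 + b1 * K\<^sup>2) * (cmod u * cmod v)"
   by (intro mult_left_mono 1) (use nn in auto)
  then show "- m * (b3 * K ^ 4 + b1 * K\<^sup>2) * Re (cnj u * v) <= m * (b3 * K ^ 4 + b1 * K\<^sup>2) * (cmod u * cmod v)"
   by (simp only: mult_minus_left mult_minus_right)
  have "(- \<tau> * K) * Re (cnj u * N) <= \<bar>(- \<tau> * K) * Re (cnj u * N)\<bar>" by (rule abs_ge_self)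
  also have "... = \<tau> * \<bar>K\<bar> * \<bar>Re (cnj u * N)\<bar>" using assms by (simp add: abs_mult)
  also have "... <= \<tau> * \<bar>K\<bar> * (cmod u * cmod N)" by (intro mult_left_mono 1) (use assms in auto)
  finally show "(- \<tau> * K) * Re (cnj u * N) <= \<tau> * \<bar>K\<bar> * (cmod u * cmod N)" .
 qed
 finally show ?thesis unfolding K_def[symmetric] by (simp add: algebra_simps power2_eq_square)
qed

text \<open>\<open>Ag\<close>, \<open>Am\<close>, \<open>br\<close>, \<open>bm\<close> stand for
  \<open>A\<^sub>\<gamma>\<close>, \<open>A\<^sub>\<mu>\<close>, \<open>b\<^sub>\<rho>\<close>,
  \<open>b\<^sub>\<mu>\<close>; \<open>w1\<close> to \<open>w4\<close> serve the Wiener estimate,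
  \<open>e1\<close> and \<open>e2\<close> the energy estimate. The margin \<open>2 * dA\<close> is
  spent twice: one \<open>dA\<close> pays for the decay, the other leaves the fourth-order norm
  integrable in time. Likewise one \<open>ka\<close> absorbs the errors of size \<open>e0\<close>,
  and the other is the dissipation that remains.\<close>

locale film =
 fixes mf mg Ag A Am br b bm a dA dB ka :: real
 assumes pos: "mf > 0" "mg > 0" "Ag > 0" "A > 0" "Am > 0" "br > 0" "b > 0" "bm > 0" "a > 0"
   "dA > 0" "dB > 0" "ka > 0"
  and w1: "mf * Ag - mg * Am - (2 * Ag + A + Am) * a >= 2 * dA"
  and w2: "mg * Am - mf * A - (A + 2 * Am) * a >= 2 * dA"
  and w3: "mf * br - mg * bm - (2 * br + b + bm) * a >= dB"
  and w4: "mg * bm - mf * b - (b + 2 * bm) * a >= dB"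
  and e1: "mf * Ag - (mf * A + mg * Am) / 2 - (Ag + A / 2 + Am / 2) * a >= 2 * ka"
  and e2: "mg * Am - (mf * A + mg * Am) / 2 - (A / 2 + 3 / 2 * Am) * a >= 2 * ka"
begin

abbreviation "La \<equiv> lin Ag br A b"
abbreviation "Lb \<equiv> lin Am bm Am bm"

lemmas nn = pos[THEN less_imp_le]

text \<open>The smallness conditions enter here.\<close>

lemma wiener_dissipation:
 assumes F: "0 <= F0" "F0 <= F2" "F2 <= F4" "0 <= G0" "G0 <= G2" "G2 <= G4"
  and \<tau>: "0 <= \<tau>" "\<tau> <= 1" "\<tau> * (F0 + G0) <= a"
 shows "\<tau>\<^sup>2 * (Ag * (F4 * F0 + F0 * F4) + br * (F2 * F0 + F0 * F2) + A * (F4 * G0 + F0 * G4) + b * (F2 * G0 + F0 * G2)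
   + (Am * (G4 * F0 + G0 * F4) + bm * (G2 * F0 + G0 * F2) + Am * (G4 * G0 + G0 * G4) + bm * (G2 * G0 + G0 * G2)))
  + (mf * (A * G4 + b * G2) + mg * (Am * F4 + bm * F2)) + (dA + dB) * (F0 + G0) + dA * (F4 + G4)
  <= mf * (Ag * F4 + br * F2) + mg * (Am * G4 + bm * G2)"
proof -
 \<comment> \<open>One factor \<open>\<tau>\<close> is spent here: \<open>X + Y \<le> a\<close>
   holds without any bound on \<open>F0 + G0\<close> itself. The other factor is estimated by
   one.\<close>
 define X Y where "X = \<tau> * F0" and "Y = \<tau> * G0"
 have XY: "0 <= X" "0 <= Y" "X + Y <= a" using F \<tau> by (auto simp: X_def Y_def algebra_simps)
 have F': "0 <= F2" "0 <= F4" "0 <= G2" "0 <= G4" using F by linarith+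
 let ?N = "F4 * (2 * Ag * X + (A + Am) * Y) + G4 * ((A + Am) * X + 2 * Am * Y)
   + (F2 * (2 * br * X + (b + bm) * Y) + G2 * ((b + bm) * X + 2 * bm * Y))"
 have N0: "?N >= 0" using F' XY nn by (intro add_nonneg_nonneg mult_nonneg_nonneg) auto
 have "\<tau>\<^sup>2 * (Ag * (F4 * F0 + F0 * F4) + br * (F2 * F0 + F0 * F2) + A * (F4 * G0 + F0 * G4) + b * (F2 * G0 + F0 * G2)
   + (Am * (G4 * F0 + G0 * F4) + bm * (G2 * F0 + G0 * F2) + Am * (G4 * G0 + G0 * G4) + bm * (G2 * G0 + G0 * G2)))
  = \<tau> * ?N"
  by (simp add: X_def Y_def power2_eq_square algebra_simps)
 also have "... <= 1 * ?N" by (intro mult_right_mono \<tau> N0)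
 also have "... <= F4 * ((2 * Ag + A + Am) * a) + G4 * ((A + 2 * Am) * a)
   + (F2 * ((2 * br + b + bm) * a) + G2 * ((b + 2 * bm) * a))"
 proof -
  have *: "p * X + q * Y <= r * a" if "0 <= p" "0 <= q" "p <= r" "q <= r" for p q r
  proof -
   have "p * X + q * Y <= r * X + r * Y" using that XY by (intro add_mono mult_right_mono)
   also have "... = r * (X + Y)" by (simp add: algebra_simps)
   also have "... <= r * a" using that XY by (intro mult_left_mono) auto
   finally show ?thesis .
  qed
  have 1: "2 * Ag * X + (A + Am) * Y <= (2 * Ag + A + Am) * a" by (rule *) (use pos in linarith)+
  have 2: "(A + Am) * X + 2 * Am * Y <= (A + 2 * Am) * a" by (rule *) (use pos in linarith)+
  have 3: "2 * br * X + (b + bm) * Y <= (2 * br + b + bm) * a" by (rule *) (use pos in linarith)+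
  have 4: "(b + bm) * X + 2 * bm * Y <= (b + 2 * bm) * a" by (rule *) (use pos in linarith)+
  show ?thesis unfolding mult_1
   by (intro add_mono mult_left_mono 1 2 3 4 F')
 qed
 also have "... <= F4 * (mf * Ag - mg * Am - 2 * dA) + G4 * (mg * Am - mf * A - 2 * dA)
   + (F2 * (mf * br - mg * bm - dB) + G2 * (mg * bm - mf * b - dB))"
  using w1 w2 w3 w4 by (intro add_mono mult_left_mono F') linarith+
 finally have main: "\<tau>\<^sup>2 * (Ag * (F4 * F0 + F0 * F4) + br * (F2 * F0 + F0 * F2) + A * (F4 * G0 + F0 * G4) + b * (F2 * G0 + F0 * G2)
   + (Am * (G4 * F0 + G0 * F4) + bm * (G2 * F0 + G0 * F2) + Am * (G4 * G0 + G0 * G4) + bm * (G2 * G0 + G0 * G2)))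
  <= F4 * (mf * Ag - mg * Am - 2 * dA) + G4 * (mg * Am - mf * A - 2 * dA)
   + (F2 * (mf * br - mg * bm - dB) + G2 * (mg * bm - mf * b - dB))" .
 have "dA * (F0 + G0) <= dA * (F4 + G4)" "dB * (F0 + G0) <= dB * (F2 + G2)"
  using F nn by (intro mult_left_mono; simp)+
 with main show ?thesis by (simp add: algebra_simps)
qed

text \<open>So small that the terms with a factor \<open>e0\<close> in the energy inequality amount
  to at most \<open>ka\<close> times the damping quantity of either component.\<close>

definition "e0 = ka / (a * (Ag + A + 2 * Am + (br + b + 2 * bm)))"
definition "C3 = (1 + 1 / e0)\<^sup>2 / e0"
definition "C1 = 8 + 16 / e0"
definition "CE = (Ag + A + 2 * Am) * C3 + (br + b + 2 * bm) * C1"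
text \<open>Collects the linear coefficients, the top-order quadratic ones and the Gronwall
  coefficient \<open>CE\<close> for \<open>power_estimate\<close>, where nothing is
  absorbed.\<close>

definition "CD = mf * (Ag + br + A + b) + mg * (2 * Am + 2 * bm) + a * (Ag + A + 2 * Am) + ka + CE"

lemma e0_pos: "e0 > 0"
 unfolding e0_def using pos by (intro divide_pos_pos mult_pos_pos add_pos_pos) auto

lemma CE_nonneg: "CE >= 0"
 unfolding CE_def C3_def C1_def using nn e0_pos
 by (intro add_nonneg_nonneg mult_nonneg_nonneg divide_nonneg_pos) auto

lemma e0_small: "e0 * (Ag + A + 2 * Am + (br + b + 2 * bm)) * a = ka"
proof -
 have "Ag + A + 2 * Am + (br + b + 2 * bm) > 0" using pos by linarith
 then show ?thesis using pos by (simp add: e0_def)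
qed

text \<open>Sorted by \<open>F8q\<close> and \<open>G8q\<close>, the terms free of \<open>e0\<close>
  give the coefficients of \<open>a\<close> in \<open>e1\<close> and \<open>e2\<close>: as
  \<open>F0 + G0 \<le> a\<close>, a combination \<open>p * F0 + q * G0\<close> is at most
  \<open>r * a\<close> for any \<open>r\<close> above \<open>p\<close> and \<open>q\<close>. The
  terms with \<open>e0\<close> cost \<open>ka\<close>, and the rest is energy times the fourth-order
  Wiener norm.\<close>

lemma energy_nonlinearity:
 fixes F0 G0 F4 G4 F8q G8q F4q G4q :: real
 assumes P: "0 <= F0" "0 <= G0" "F0 + G0 <= a" "0 <= F4" "0 <= G4" "0 <= F8q" "0 <= G8q" "0 <= F4q" "0 <= G4q"
 shows "(F0 * ((Ag * (1 + e0) + br * e0) * ((F8q + F8q) / 2) + (A * (1 + e0) + b * e0) * ((F8q + G8q) / 2))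
    + F4 * ((Ag * C3 + br * C1) * ((F4q + F4q) / 2) + (A * C3 + b * C1) * ((F4q + G4q) / 2)))
  + (G0 * ((Am * (1 + e0) + bm * e0) * ((G8q + F8q) / 2) + (Am * (1 + e0) + bm * e0) * ((G8q + G8q) / 2))
    + G4 * ((Am * C3 + bm * C1) * ((G4q + F4q) / 2) + (Am * C3 + bm * C1) * ((G4q + G4q) / 2)))
  <= ((Ag + A / 2 + Am / 2) * a + ka) * F8q + ((A / 2 + 3 / 2 * Am) * a + ka) * G8q + CE * ((F4 + G4) * (F4q + G4q))"
proof -
 have c: "C3 >= 0" "C1 >= 0" using e0_pos by (auto simp: C3_def C1_def)
 have aF: "F0 <= a" "G0 <= a" using P by linarith+
 have lc: "p * F0 + q * G0 <= r * a" if "0 <= p" "0 <= q" "p <= r" "q <= r" for p q r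
 proof -
  have "p * F0 + q * G0 <= r * F0 + r * G0" using that P by (intro add_mono mult_right_mono)
  also have "... = r * (F0 + G0)" by (simp add: algebra_simps)
  also have "... <= r * a" using that P by (intro mult_left_mono) auto
  finally show ?thesis .
 qed
 let ?s = "Ag + A + 2 * Am + (br + b + 2 * bm)"
 have f8: "F0 * (Ag + A / 2) + G0 * (Am / 2) + e0 * (F0 * (Ag + br + (A + b) / 2) + G0 * ((Am + bm) / 2))
   <= (Ag + A / 2 + Am / 2) * a + ka"
 proof -
  have "e0 * (F0 * (Ag + br + (A + b) / 2) + G0 * ((Am + bm) / 2)) <= e0 * (?s * a)"
   using lc[of "Ag + br + (A + b) / 2" "(Am + bm) / 2" ?s] e0_pos pos
   by (intro mult_left_mono) (simp_all add: mult.commute)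
  moreover have "F0 * (Ag + A / 2) + G0 * (Am / 2) <= (Ag + A / 2 + Am / 2) * a"
   using lc[of "Ag + A / 2" "Am / 2" "Ag + A / 2 + Am / 2"] pos by (simp add: mult.commute)
  ultimately show ?thesis using e0_small by (simp add: mult.assoc)
 qed
 have g8: "F0 * (A / 2) + G0 * (3 / 2 * Am) + e0 * (F0 * ((A + b) / 2) + G0 * (3 / 2 * (Am + bm)))
   <= (A / 2 + 3 / 2 * Am) * a + ka"
 proof -
  have "e0 * (F0 * ((A + b) / 2) + G0 * (3 / 2 * (Am + bm))) <= e0 * (?s * a)"
   using lc[of "(A + b) / 2" "3 / 2 * (Am + bm)" ?s] e0_pos pos
   by (intro mult_left_mono) (simp_all add: mult.commute)
  moreover have "F0 * (A / 2) + G0 * (3 / 2 * Am) <= (A / 2 + 3 / 2 * Am) * a"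
   using lc[of "A / 2" "3 / 2 * Am" "A / 2 + 3 / 2 * Am"] pos by (simp add: mult.commute)
  ultimately show ?thesis using e0_small by (simp add: mult.assoc)
 qed
 have low: "H * (p * Z1 + q * Z2) <= (p + q) * (H * (F4q + G4q))"
  if "0 <= H" "0 <= p" "0 <= q" "Z1 <= F4q + G4q" "Z2 <= F4q + G4q" for H p q Z1 Z2
 proof -
  have "p * Z1 + q * Z2 <= p * (F4q + G4q) + q * (F4q + G4q)"
   using that by (intro add_mono mult_left_mono)
  from mult_left_mono[OF this \<open>0 <= H\<close>] show ?thesis by (simp add: algebra_simps)
 qed
 have l1: "F4 * ((Ag * C3 + br * C1) * ((F4q + F4q) / 2) + (A * C3 + b * C1) * ((F4q + G4q) / 2)) <= CE * (F4 * (F4q + G4q))"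
 proof -
  have "F4 * ((Ag * C3 + br * C1) * ((F4q + F4q) / 2) + (A * C3 + b * C1) * ((F4q + G4q) / 2))
   <= ((Ag * C3 + br * C1) + (A * C3 + b * C1)) * (F4 * (F4q + G4q))"
   using P c nn by (intro low add_nonneg_nonneg mult_nonneg_nonneg) auto
  also have "... <= CE * (F4 * (F4q + G4q))"
   using P c nn by (intro mult_right_mono) (auto simp: CE_def algebra_simps)
  finally show ?thesis .
 qed
 have l2: "G4 * ((Am * C3 + bm * C1) * ((G4q + F4q) / 2) + (Am * C3 + bm * C1) * ((G4q + G4q) / 2)) <= CE * (G4 * (F4q + G4q))"
 proof -
  have "G4 * ((Am * C3 + bm * C1) * ((G4q + F4q) / 2) + (Am * C3 + bm * C1) * ((G4q + G4q) / 2))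
   <= ((Am * C3 + bm * C1) + (Am * C3 + bm * C1)) * (G4 * (F4q + G4q))"
   using P c nn by (intro low add_nonneg_nonneg mult_nonneg_nonneg) auto
  also have "... <= CE * (G4 * (F4q + G4q))"
   using P c nn by (intro mult_right_mono) (auto simp: CE_def algebra_simps)
  finally show ?thesis .
 qed
 have "F0 * ((Ag * (1 + e0) + br * e0) * ((F8q + F8q) / 2) + (A * (1 + e0) + b * e0) * ((F8q + G8q) / 2))
   + G0 * ((Am * (1 + e0) + bm * e0) * ((G8q + F8q) / 2) + (Am * (1 + e0) + bm * e0) * ((G8q + G8q) / 2))
  = (F0 * (Ag + A / 2) + G0 * (Am / 2) + e0 * (F0 * (Ag + br + (A + b) / 2) + G0 * ((Am + bm) / 2))) * F8q
   + (F0 * (A / 2) + G0 * (3 / 2 * Am) + e0 * (F0 * ((A + b) / 2) + G0 * (3 / 2 * (Am + bm)))) * G8q"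
  by (simp add: algebra_simps add_divide_distrib)
 also have "... <= ((Ag + A / 2 + Am / 2) * a + ka) * F8q + ((A / 2 + 3 / 2 * Am) * a + ka) * G8q"
  by (intro add_mono mult_right_mono f8 g8 P)
 finally have "F0 * ((Ag * (1 + e0) + br * e0) * ((F8q + F8q) / 2) + (A * (1 + e0) + b * e0) * ((F8q + G8q) / 2))
   + G0 * ((Am * (1 + e0) + bm * e0) * ((G8q + F8q) / 2) + (Am * (1 + e0) + bm * e0) * ((G8q + G8q) / 2))
  <= ((Ag + A / 2 + Am / 2) * a + ka) * F8q + ((A / 2 + 3 / 2 * Am) * a + ka) * G8q" .
 moreover have "CE * ((F4 + G4) * (F4q + G4q)) = CE * (F4 * (F4q + G4q)) + CE * (G4 * (F4q + G4q))"
  by (simp only: distrib_left distrib_right)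
 ultimately show ?thesis using l1 l2 by linarith
qed

text \<open>The fourth-order coupling is the mean subtracted in \<open>e1\<close> and
  \<open>e2\<close>. The second-order coupling is absorbed through \<open>w3\<close> and
  \<open>w4\<close>: they order \<open>mf * b \<le> mg * bm \<le> mf * br\<close>, so the mean of
  the first two lies below both diagonal coefficients.\<close>

lemma energy_linear:
 fixes F8q G8q F6q G6q c8 c6 :: real
 assumes "0 <= F8q" "0 <= G8q" "0 <= F6q" "0 <= G6q"
  and "c8 <= (F8q + G8q) / 2" "c6 <= (F6q + G6q) / 2"
 shows "(mf * A + mg * Am) * c8 + (mf * b + mg * bm) * c6
  + ((Ag + A / 2 + Am / 2) * a + ka) * F8q + ((A / 2 + 3 / 2 * Am) * a + ka) * G8q + ka * (F8q + G8q)
  <= mf * (Ag * F8q + br * F6q) + mg * (Am * G8q + bm * G6q)"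
proof -
 have "(mf * A + mg * Am) * c8 <= (mf * A + mg * Am) * ((F8q + G8q) / 2)"
  using assms nn by (intro mult_left_mono add_nonneg_nonneg mult_nonneg_nonneg) auto
 moreover have "(mf * b + mg * bm) * c6 <= mf * br * F6q + mg * bm * G6q"
 proof -
  have "(mf * b + mg * bm) * c6 <= (mf * b + mg * bm) * ((F6q + G6q) / 2)"
   using assms nn by (intro mult_left_mono add_nonneg_nonneg mult_nonneg_nonneg) auto
  also have "... = (mf * b + mg * bm) / 2 * F6q + (mf * b + mg * bm) / 2 * G6q" by (simp add: algebra_simps add_divide_distrib)
  also have "... <= mf * br * F6q + mg * bm * G6q"
  proof (intro add_mono mult_right_mono assms)
   have "0 <= (b + 2 * bm) * a" "0 <= (2 * br + b + bm) * a" using nn by auto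
   then have "dB <= mf * br - mg * bm" "dB <= mg * bm - mf * b" using w3 w4 by simp_all
   then have *: "mf * b <= mg * bm" "mg * bm <= mf * br" using pos(11) by argo+
   have avg: "(x + y) / 2 <= y" "y <= z ==> (x + y) / 2 <= z" if "x <= y" for x y z :: real
    using that by simp_all
   show "(mf * b + mg * bm) / 2 <= mf * br" "(mf * b + mg * bm) / 2 <= mg * bm"
    by (rule avg * )+
  qed
  finally show ?thesis .
 qed
 moreover have "(mf * Ag - (mf * A + mg * Am) / 2 - (Ag + A / 2 + Am / 2) * a) * F8q >= 2 * ka * F8q"
  by (intro mult_right_mono e1 assms)
 moreover have "(mg * Am - (mf * A + mg * Am) / 2 - (A / 2 + 3 / 2 * Am) * a) * G8q >= 2 * ka * G8q"
  by (intro mult_right_mono e2 assms)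
 ultimately show ?thesis by (simp add: algebra_simps add_divide_distrib diff_divide_distrib)
qed

end

section \<open>Uniform estimates for the truncated solutions\<close>

lemma wsum_linear:
 "(\<Sum>k\<in>modes n. (c4 * real_of_int k ^ 4 + c2 * (real_of_int k)\<^sup>2) * x k) = c4 * wsum n 4 x + c2 * wsum n 2 x"
 by (simp add: wsum_def sum_distrib_left sum.distrib[symmetric] distrib_right mult.assoc)

lemma integral_sum_continuous:
 fixes h :: "real => 'i => real"
 assumes "finite J" "!!k. k \<in> J ==> cont_nonneg (\<lambda>s. h s k)"
 shows "(\<Sum>k\<in>J. tint t (\<lambda>s. h s k)) = tint t (\<lambda>s. \<Sum>k\<in>J. h s k)"
 by (subst integral_sum) (auto intro!: assms continuous_integrable)

text \<open>Exponent in Gronwall's inequality: \<open>a / dA\<close> bounds the time integral of the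
  fourth-order Wiener norm.\<close>

definition (in film) "KE = 2 * CE * (a / dA)"

locale galerkin = film +
 fixes n :: nat and f g :: "real => int => complex" and \<theta> :: "real => real"
 assumes herm: "hermitian (f t)" "hermitian (g t)"
  and supp: "k = 0 \<or> k \<notin> modes n ==> f t k = 0" "k = 0 \<or> k \<notin> modes n ==> g t k = 0"
  and cont: "cont_nonneg (\<lambda>t. f t k)" "cont_nonneg (\<lambda>t. g t k)"
  and \<theta>: "cont_nonneg \<theta>" "0 <= \<theta> t" "\<theta> t <= 1" "\<theta> t * asum2 n 0 (f t) (g t) <= a"
  and start: "asum2 n 0 (f 0) (g 0) <= a"
  and theta_one: "asum2 n 0 (f t) (g t) <= a ==> \<theta> t = 1"
  and df: "t > 0 ==> k \<in> modes n ==> ((\<lambda>s. f s k) has_vector_derivative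
   - of_int k * (of_real mf * La (f t) (g t) k + of_real ((\<theta> t)\<^sup>2) * gconv n (f t) (La (f t) (g t)) k)) (at t)"
  and dg: "t > 0 ==> k \<in> modes n ==> ((\<lambda>s. g s k) has_vector_derivative
   - of_int k * (of_real mg * Lb (f t) (g t) k + of_real ((\<theta> t)\<^sup>2) * gconv n (g t) (Lb (f t) (g t)) k)) (at t)"
begin

lemma cont_lin: "cont_nonneg (\<lambda>t. lin a3 a1 b3 b1 (f t) (g t) k)"
 unfolding lin_def by (intro continuous_on_add continuous_on_mult_left cont)

lemma cont_gconv:
 assumes "!!k. cont_nonneg (\<lambda>t. u t k)"
 shows "cont_nonneg (\<lambda>t. gconv n (u t) (lin a3 a1 b3 b1 (f t) (g t)) k)"
 unfolding gconv_def by (intro continuous_on_sum continuous_on_mult cont_lin assms)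

lemma asum_chain:
 "asum n 0 (f t) <= asum n 2 (f t)" "asum n 2 (f t) <= asum n 4 (f t)"
 "asum n 0 (g t) <= asum n 2 (g t)" "asum n 2 (g t) <= asum n 4 (g t)"
 using supp by (auto intro!: asum_mono)

lemma Re_f:
 assumes "t > 0" "k \<in> modes n"
 shows "Re (cnj (f t k) * (- of_int k * (of_real mf * La (f t) (g t) k + of_real ((\<theta> t)\<^sup>2) * gconv n (f t) (La (f t) (g t)) k)))
  <= cmod (f t k) * ((mf * (A * real_of_int k ^ 4 + b * (real_of_int k)\<^sup>2) * cmod (g t k)
   + (\<theta> t)\<^sup>2 * (mag k * cmod (gconv n (f t) (La (f t) (g t)) k)))
   - mf * (Ag * real_of_int k ^ 4 + br * (real_of_int k)\<^sup>2) * cmod (f t k))"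
 by (rule Re_cnj_mode_le) (use nn in \<open>auto simp: lin_def\<close>)

lemma Re_g:
 assumes "t > 0" "k \<in> modes n"
 shows "Re (cnj (g t k) * (- of_int k * (of_real mg * Lb (f t) (g t) k + of_real ((\<theta> t)\<^sup>2) * gconv n (g t) (Lb (f t) (g t)) k)))
  <= cmod (g t k) * ((mg * (Am * real_of_int k ^ 4 + bm * (real_of_int k)\<^sup>2) * cmod (f t k)
   + (\<theta> t)\<^sup>2 * (mag k * cmod (gconv n (g t) (Lb (f t) (g t)) k)))
   - mg * (Am * real_of_int k ^ 4 + bm * (real_of_int k)\<^sup>2) * cmod (g t k))"
 by (rule Re_cnj_mode_le) (use nn in \<open>auto simp: lin_def add.commute\<close>)

text \<open>Valid before the cutoff is known to be inactive, since \<open>wiener_dissipation\<close>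
  asks only that \<open>\<theta>\<close> times the norm be at most \<open>a\<close>. A single mode
  may gain from the coupling; only the sum over all modes of both components is dissipative, so the
  time integrals are kept until after the summation.\<close>

theorem wiener_estimate:
 assumes t: "t >= 0"
 shows "exp ((dA + dB) * t) * asum2 n 0 (f t) (g t)
  + dA * tint t (\<lambda>s. exp ((dA + dB) * s) * asum2 n 4 (f s) (g s))
  <= asum2 n 0 (f 0) (g 0)"
proof -
 let ?\<delta> = "dA + dB" and ?J = "modes n"
 define lf lg :: "int => real" where "lf k = mf * (Ag * real_of_int k ^ 4 + br * (real_of_int k)\<^sup>2)"
  and "lg k = mg * (Am * real_of_int k ^ 4 + bm * (real_of_int k)\<^sup>2)" for k
 define Nf Ng where "Nf s k = (\<theta> s)\<^sup>2 * (mag k * cmod (gconv n (f s) (La (f s) (g s)) k))"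
  and "Ng s k = (\<theta> s)\<^sup>2 * (mag k * cmod (gconv n (g s) (Lb (f s) (g s)) k))" for s k
 define pf pg where "pf s k = mf * (A * real_of_int k ^ 4 + b * (real_of_int k)\<^sup>2) * cmod (g s k) + Nf s k"
  and "pg s k = mg * (Am * real_of_int k ^ 4 + bm * (real_of_int k)\<^sup>2) * cmod (f s k) + Ng s k" for s k
 have cN: "cont_nonneg (\<lambda>s. Nf s k)" "cont_nonneg (\<lambda>s. Ng s k)" for k
  unfolding Nf_def Ng_def
  by (intro continuous_on_mult continuous_on_power continuous_on_norm continuous_on_const \<theta>(1) cont_gconv cont)+
 have cp: "cont_nonneg (\<lambda>s. pf s k)" "cont_nonneg (\<lambda>s. pg s k)" for k
  unfolding pf_def pg_def
  by (intro continuous_on_add continuous_on_mult_left continuous_on_norm cN cont)+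
 have l0: "lf k >= 0" "lg k >= 0" for k unfolding lf_def lg_def using nn by auto
 have p0: "pf s k >= 0" "pg s k >= 0" for s k unfolding pf_def pg_def Nf_def Ng_def using nn \<theta>(2) by auto
 define hf hg where "hf s k = exp (?\<delta> * s) * ((lf k - ?\<delta>) * cmod (f s k) - pf s k)"
  and "hg s k = exp (?\<delta> * s) * ((lg k - ?\<delta>) * cmod (g s k) - pg s k)" for s k
 have cexp: "cont_nonneg (\<lambda>s. exp (?\<delta> * s))" by (intro continuous_intros)
 have ch: "cont_nonneg (\<lambda>s. hf s k)" "cont_nonneg (\<lambda>s. hg s k)" for k
  unfolding hf_def hg_def
  by (intro continuous_on_mult cexp continuous_on_diff continuous_on_mult_left continuous_on_norm cp cont)+
 have mode_f: "exp (?\<delta> * t) * cmod (f t k) + tint t (\<lambda>s. hf s k) <= cmod (f 0 k)" if k: "k \<in> ?J" for k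
  unfolding hf_def
  by (rule modulus_integral_bound[OF cont(1) cp(1) df[OF _ k] p0(1) l0(1) _ t])
   (use Re_f[OF _ k] in \<open>auto simp: pf_def Nf_def lf_def\<close>)
 have mode_g: "exp (?\<delta> * t) * cmod (g t k) + tint t (\<lambda>s. hg s k) <= cmod (g 0 k)" if k: "k \<in> ?J" for k
  unfolding hg_def
  by (rule modulus_integral_bound[OF cont(2) cp(2) dg[OF _ k] p0(2) l0(2) _ t])
   (use Re_g[OF _ k] in \<open>auto simp: pg_def Ng_def lg_def\<close>)
 have a0: "asum n 0 c = (\<Sum>k\<in>?J. cmod (c k))" for c by (simp add: asum_def wsum_def)
 have "(\<Sum>k\<in>?J. exp (?\<delta> * t) * cmod (f t k) + tint t (\<lambda>s. hf s k)) <= (\<Sum>k\<in>?J. cmod (f 0 k))"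
  "(\<Sum>k\<in>?J. exp (?\<delta> * t) * cmod (g t k) + tint t (\<lambda>s. hg s k)) <= (\<Sum>k\<in>?J. cmod (g 0 k))"
  by (intro sum_mono mode_f mode_g; assumption)+
 then have "exp (?\<delta> * t) * asum n 0 (f t) + tint t (\<lambda>s. \<Sum>k\<in>?J. hf s k) <= asum n 0 (f 0)"
  "exp (?\<delta> * t) * asum n 0 (g t) + tint t (\<lambda>s. \<Sum>k\<in>?J. hg s k) <= asum n 0 (g 0)"
  unfolding a0 by (simp_all add: sum.distrib sum_distrib_left integral_sum_continuous ch)
 moreover have "dA * tint t (\<lambda>s. exp (?\<delta> * s) * asum2 n 4 (f s) (g s))
   <= tint t (\<lambda>s. \<Sum>k\<in>?J. hf s k) + tint t (\<lambda>s. \<Sum>k\<in>?J. hg s k)"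
 proof -
  have csum: "cont_nonneg (\<lambda>s. \<Sum>k\<in>?J. hf s k)" "cont_nonneg (\<lambda>s. \<Sum>k\<in>?J. hg s k)"
   by (intro continuous_on_sum ch)+
  have cV: "cont_nonneg (\<lambda>s. dA * (exp (?\<delta> * s) * asum2 n 4 (f s) (g s)))"
   by (intro continuous_on_mult continuous_on_const cexp continuous_on_add continuous_on_asum cont)
  have "dA * tint t (\<lambda>s. exp (?\<delta> * s) * asum2 n 4 (f s) (g s))
   = tint t (\<lambda>s. dA * (exp (?\<delta> * s) * asum2 n 4 (f s) (g s)))" by simp
  also have "... <= tint t (\<lambda>s. (\<Sum>k\<in>?J. hf s k) + (\<Sum>k\<in>?J. hg s k))"
  proof (rule integral_le)
   fix s assume s: "s \<in> {0..t}"
   have sumf: "(\<Sum>k\<in>?J. (lf k - ?\<delta>) * cmod (f s k) - pf s k)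
    = mf * (Ag * asum n 4 (f s) + br * asum n 2 (f s)) - ?\<delta> * asum n 0 (f s)
     - mf * (A * asum n 4 (g s) + b * asum n 2 (g s)) - (\<Sum>k\<in>?J. Nf s k)"
    unfolding pf_def lf_def a0 asum_def[of n 4] asum_def[of n 2] wsum_linear[symmetric]
    by (simp add: sum_subtractf sum.distrib sum_distrib_left left_diff_distrib mult.assoc)
   have sumg: "(\<Sum>k\<in>?J. (lg k - ?\<delta>) * cmod (g s k) - pg s k)
    = mg * (Am * asum n 4 (g s) + bm * asum n 2 (g s)) - ?\<delta> * asum n 0 (g s)
     - mg * (Am * asum n 4 (f s) + bm * asum n 2 (f s)) - (\<Sum>k\<in>?J. Ng s k)"
    unfolding pg_def lg_def a0 asum_def[of n 4] asum_def[of n 2] wsum_linear[symmetric]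
    by (simp add: sum_subtractf sum.distrib sum_distrib_left left_diff_distrib mult.assoc)
   let ?F = "\<lambda>p. asum n p (f s)" and ?G = "\<lambda>p. asum n p (g s)"
   have "(\<Sum>k\<in>?J. Nf s k) + (\<Sum>k\<in>?J. Ng s k)
    <= (\<theta> s)\<^sup>2 * (Ag * (?F 4 * ?F 0 + ?F 0 * ?F 4) + br * (?F 2 * ?F 0 + ?F 0 * ?F 2)
      + A * (?F 4 * ?G 0 + ?F 0 * ?G 4) + b * (?F 2 * ?G 0 + ?F 0 * ?G 2)
     + (Am * (?G 4 * ?F 0 + ?G 0 * ?F 4) + bm * (?G 2 * ?F 0 + ?G 0 * ?F 2)
      + Am * (?G 4 * ?G 0 + ?G 0 * ?G 4) + bm * (?G 2 * ?G 0 + ?G 0 * ?G 2)))"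
    unfolding Nf_def Ng_def sum_distrib_left[symmetric] distrib_left[of "(\<theta> s)\<^sup>2", symmetric]
    by (intro mult_left_mono add_mono wiener_convolution) (use nn herm supp in auto)
   with wiener_dissipation[of "?F 0" "?F 2" "?F 4" "?G 0" "?G 2" "?G 4" "\<theta> s"]
   have "dA * (?F 4 + ?G 4) <= (\<Sum>k\<in>?J. (lf k - ?\<delta>) * cmod (f s k) - pf s k)
     + (\<Sum>k\<in>?J. (lg k - ?\<delta>) * cmod (g s k) - pg s k)"
    unfolding sumf sumg using asum_chain asum_nonneg \<theta>
    by (simp add: distrib_left add.assoc)
   from mult_left_mono[OF this, of "exp (?\<delta> * s)"]
   show "dA * (exp (?\<delta> * s) * asum2 n 4 (f s) (g s)) <= (\<Sum>k\<in>?J. hf s k) + (\<Sum>k\<in>?J. hg s k)"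
    unfolding hf_def hg_def sum_distrib_left[symmetric] by (simp add: distrib_left mult.left_commute)
  qed (rule continuous_integrable, rule cV continuous_on_add[OF csum])+
  also have "... = tint t (\<lambda>s. \<Sum>k\<in>?J. hf s k) + tint t (\<lambda>s. \<Sum>k\<in>?J. hg s k)"
   by (intro integral_add continuous_integrable csum)
  finally show ?thesis .
 qed
 ultimately show ?thesis by (simp add: distrib_left)
qed

lemma cont_V4: "cont_nonneg (\<lambda>t. asum2 n 4 (f t) (g t))"
 by (intro continuous_on_add continuous_on_asum cont)

lemma cont_E2: "cont_nonneg (\<lambda>t. qsum n p (f t) + qsum n p (g t))"
 by (intro continuous_on_add continuous_on_qsum cont)

lemma integral_V4_nonneg: "tint t (\<lambda>s. asum2 n 4 (f s) (g s)) >= 0"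
 by (intro integral_nonneg continuous_integrable cont_V4)
  (simp add: asum_nonneg add_nonneg_nonneg)

text \<open>This removes the cutoff: the norm never exceeds \<open>a\<close>, so
  \<open>theta_one\<close> applies at all times. The time integral is what Gronwall's inequality
  will need.\<close>

lemma V_le_and_integral_V4_le:
 assumes t: "t >= 0"
 shows "asum2 n 0 (f t) (g t) <= a"
  "dA * tint t (\<lambda>s. asum2 n 4 (f s) (g s)) <= a"
proof -
 let ?\<delta> = "dA + dB"
 have \<delta>: "?\<delta> >= 0" using nn by simp
 have c: "cont_nonneg (\<lambda>s. exp (?\<delta> * s) * asum2 n 4 (f s) (g s))"
  by (rule continuous_on_mult[OF _ cont_V4]) (intro continuous_intros)
 have "tint t (\<lambda>s. asum2 n 4 (f s) (g s))
   <= tint t (\<lambda>s. exp (?\<delta> * s) * asum2 n 4 (f s) (g s))"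
 proof (rule integral_le)
  fix s assume "s \<in> {0..t}"
  then have "1 <= exp (?\<delta> * s)" using \<delta> by simp
  then have "1 * asum2 n 4 (f s) (g s) <= exp (?\<delta> * s) * asum2 n 4 (f s) (g s)"
   by (intro mult_right_mono) (simp_all add: asum_nonneg add_nonneg_nonneg)
  then show "asum2 n 4 (f s) (g s) <= exp (?\<delta> * s) * asum2 n 4 (f s) (g s)"
   by simp
 qed (rule continuous_integrable, rule cont_V4 c)+
 then have I: "dA * tint t (\<lambda>s. asum2 n 4 (f s) (g s))
   <= dA * tint t (\<lambda>s. exp (?\<delta> * s) * asum2 n 4 (f s) (g s))"
  using nn by (intro mult_left_mono)
 have V0: "0 <= asum2 n 0 (f t) (g t)" by (simp add: asum_nonneg add_nonneg_nonneg)
 have "1 <= exp (?\<delta> * t)" using \<delta> t by simp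
 then have "1 * asum2 n 0 (f t) (g t) <= exp (?\<delta> * t) * asum2 n 0 (f t) (g t)"
  by (intro mult_right_mono V0)
 moreover have "0 <= dA * tint t (\<lambda>s. asum2 n 4 (f s) (g s))"
  using nn by (intro mult_nonneg_nonneg integral_V4_nonneg)
 ultimately show "asum2 n 0 (f t) (g t) <= a"
  "dA * tint t (\<lambda>s. asum2 n 4 (f s) (g s)) <= a"
  using wiener_estimate[OF t] start I V0 by argo+
qed

definition "Rf t k = - of_int k * (of_real mf * La (f t) (g t) k + gconv n (f t) (La (f t) (g t)) k)"
definition "Rg t k = - of_int k * (of_real mg * Lb (f t) (g t) k + gconv n (g t) (Lb (f t) (g t)) k)"

lemma derivative:
 assumes "t > 0" "k \<in> modes n"
 shows "((\<lambda>s. f s k) has_vector_derivative Rf t k) (at t)" "((\<lambda>s. g s k) has_vector_derivative Rg t k) (at t)"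
 using df[OF assms] dg[OF assms] theta_one[OF V_le_and_integral_V4_le(1)] assms
 by (simp_all add: Rf_def Rg_def)

definition "cross p t = wsum n p (\<lambda>k. cmod (f t k) * cmod (g t k))"

lemma cross_le: "cross p t <= (qsum n p (f t) + qsum n p (g t)) / 2"
proof -
 have "cross p t <= (\<Sum>k\<in>modes n. mag k ^ p * (((cmod (f t k))\<^sup>2 + (cmod (g t k))\<^sup>2) / 2))"
  unfolding cross_def wsum_def
 proof (intro sum_mono mult_left_mono)
  show "cmod (f t k) * cmod (g t k) <= ((cmod (f t k))\<^sup>2 + (cmod (g t k))\<^sup>2) / 2" for k
   using sum_squares_bound[of "cmod (f t k)" "cmod (g t k)"] by simp
 qed auto
 also have "... = (qsum n p (f t) + qsum n p (g t)) / 2"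
  by (simp add: qsum_def wsum_def sum.distrib[symmetric] sum_divide_distrib add_divide_distrib distrib_left)
 finally show ?thesis .
qed

definition "Nf t = (\<Sum>k\<in>modes n. real_of_int k ^ 4 * cmod (f t k) * (mag k * cmod (gconv n (f t) (La (f t) (g t)) k)))"
definition "Ng t = (\<Sum>k\<in>modes n. real_of_int k ^ 4 * cmod (g t k) * (mag k * cmod (gconv n (g t) (Lb (f t) (g t)) k)))"

lemma N_le:
 assumes t: "t >= 0"
 shows "Nf t + Ng t <= ((Ag + A / 2 + Am / 2) * a + ka) * qsum n 8 (f t) + ((A / 2 + 3 / 2 * Am) * a + ka) * qsum n 8 (g t)
  + CE * ((asum2 n 4 (f t) (g t)) * qsum2 n 4 (f t) (g t))"
proof -
 have "Nf t + Ng t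
  <= (asum n 0 (f t) * ((Ag * (1 + e0) + br * e0) * (qsum2 n 8 (f t) (f t) / 2)
    + (A * (1 + e0) + b * e0) * (qsum2 n 8 (f t) (g t) / 2))
   + asum n 4 (f t) * ((Ag * C3 + br * C1) * (qsum2 n 4 (f t) (f t) / 2)
    + (A * C3 + b * C1) * (qsum2 n 4 (f t) (g t) / 2)))
  + (asum n 0 (g t) * ((Am * (1 + e0) + bm * e0) * (qsum2 n 8 (g t) (f t) / 2)
    + (Am * (1 + e0) + bm * e0) * (qsum2 n 8 (g t) (g t) / 2))
   + asum n 4 (g t) * ((Am * C3 + bm * C1) * (qsum2 n 4 (g t) (f t) / 2)
    + (Am * C3 + bm * C1) * (qsum2 n 4 (g t) (g t) / 2)))"
  unfolding Nf_def Ng_def C3_def C1_def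
  by (intro add_mono energy_convolution) (use nn supp e0_pos in auto)
 also have "... <= ((Ag + A / 2 + Am / 2) * a + ka) * qsum n 8 (f t) + ((A / 2 + 3 / 2 * Am) * a + ka) * qsum n 8 (g t)
  + CE * ((asum2 n 4 (f t) (g t)) * qsum2 n 4 (f t) (g t))"
  by (rule energy_nonlinearity) (use V_le_and_integral_V4_le(1)[OF t] asum_nonneg qsum_nonneg in auto)
 finally show ?thesis .
qed

lemma cmod_square_derivative:
 fixes u :: "real => complex"
 assumes "(u has_vector_derivative u') (at t)"
 shows "((\<lambda>s. (cmod (u s))\<^sup>2) has_real_derivative 2 * Re (cnj (u t) * u')) (at t)"
proof -
 define v w where "v s = Re (u s)" and "w s = Im (u s)" for s
 have "(v has_real_derivative Re u') (at t)" "(w has_real_derivative Im u') (at t)"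
  using bounded_linear.has_vector_derivative[OF bounded_linear_Re assms]
   bounded_linear.has_vector_derivative[OF bounded_linear_Im assms]
  by (simp_all add: has_real_derivative_iff_has_vector_derivative v_def[abs_def] w_def[abs_def])
 then have "((\<lambda>s. (v s)\<^sup>2 + (w s)\<^sup>2) has_real_derivative 2 * (v t * Re u' + w t * Im u')) (at t)"
  by (auto intro!: derivative_eq_intros)
 then show ?thesis by (simp add: cmod_power2 v_def w_def)
qed

lemma energy_derivative:
 assumes t: "t > 0"
 obtains D where "((\<lambda>s. qsum2 n 4 (f s) (g s)) has_real_derivative D) (at t)"
  "D <= 2 * CE * ((asum2 n 4 (f t) (g t)) * qsum2 n 4 (f t) (g t))
   - 2 * ka * qsum2 n 8 (f t) (g t)"
proof -
 let ?J = "modes n"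
 define D where "D = (\<Sum>k\<in>?J. mag k ^ 4 * (2 * Re (cnj (f t k) * Rf t k)))
  + (\<Sum>k\<in>?J. mag k ^ 4 * (2 * Re (cnj (g t k) * Rg t k)))"
 have "((\<lambda>s. qsum2 n 4 (f s) (g s)) has_real_derivative D) (at t)"
  unfolding qsum_def wsum_def D_def
  by (intro DERIV_add DERIV_sum DERIV_cmult cmod_square_derivative derivative t)
 moreover have "D <= 2 * CE * ((asum2 n 4 (f t) (g t)) * qsum2 n 4 (f t) (g t))
   - 2 * ka * qsum2 n 8 (f t) (g t)"
 proof -
  have \<theta>1: "(\<theta> t)\<^sup>2 = 1" using theta_one[OF V_le_and_integral_V4_le(1)] t by simp
  have f: "(\<Sum>k\<in>?J. mag k ^ 4 * Re (cnj (f t k) * Rf t k))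
   <= mf * (A * cross 8 t + b * cross 6 t) + Nf t - mf * (Ag * qsum n 8 (f t) + br * qsum n 6 (f t))"
  proof -
   have "(\<Sum>k\<in>?J. mag k ^ 4 * Re (cnj (f t k) * Rf t k))
    <= (\<Sum>k\<in>?J. mag k ^ 4 * (cmod (f t k) * ((mf * (A * real_of_int k ^ 4 + b * (real_of_int k)\<^sup>2) * cmod (g t k)
   + 1 * (mag k * cmod (gconv n (f t) (La (f t) (g t)) k)))
   - mf * (Ag * real_of_int k ^ 4 + br * (real_of_int k)\<^sup>2) * cmod (f t k))))"
    using Re_f[OF t] unfolding \<theta>1 Rf_def of_real_1 mult_1
    by (intro sum_mono mult_left_mono) auto
   also have "... = mf * (A * cross 8 t + b * cross 6 t) + Nf t - mf * (Ag * qsum n 8 (f t) + br * qsum n 6 (f t))"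
    unfolding cross_def Nf_def qsum_def wsum_def sum_distrib_left sum.distrib[symmetric] sum_subtractf[symmetric]
    by (intro sum.cong refl) (simp add: algebra_simps eval_nat_numeral)
   finally show ?thesis .
  qed
  have g: "(\<Sum>k\<in>?J. mag k ^ 4 * Re (cnj (g t k) * Rg t k))
   <= mg * (Am * cross 8 t + bm * cross 6 t) + Ng t - mg * (Am * qsum n 8 (g t) + bm * qsum n 6 (g t))"
  proof -
   have "(\<Sum>k\<in>?J. mag k ^ 4 * Re (cnj (g t k) * Rg t k))
    <= (\<Sum>k\<in>?J. mag k ^ 4 * (cmod (g t k) * ((mg * (Am * real_of_int k ^ 4 + bm * (real_of_int k)\<^sup>2) * cmod (f t k)
   + 1 * (mag k * cmod (gconv n (g t) (Lb (f t) (g t)) k)))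
   - mg * (Am * real_of_int k ^ 4 + bm * (real_of_int k)\<^sup>2) * cmod (g t k))))"
    using Re_g[OF t] unfolding \<theta>1 Rg_def of_real_1 mult_1
    by (intro sum_mono mult_left_mono) auto
   also have "... = mg * (Am * cross 8 t + bm * cross 6 t) + Ng t - mg * (Am * qsum n 8 (g t) + bm * qsum n 6 (g t))"
    unfolding cross_def Ng_def qsum_def wsum_def sum_distrib_left sum.distrib[symmetric] sum_subtractf[symmetric]
    by (intro sum.cong refl) (simp add: algebra_simps eval_nat_numeral)
   finally show ?thesis .
  qed
  have D: "D = 2 * ((\<Sum>k\<in>?J. mag k ^ 4 * Re (cnj (f t k) * Rf t k))
    + (\<Sum>k\<in>?J. mag k ^ 4 * Re (cnj (g t k) * Rg t k)))"
   unfolding D_def distrib_left sum_distrib_left by (simp only: mult.left_commute)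
  have c: "(mf * A + mg * Am) * cross 8 t + (mf * b + mg * bm) * cross 6 t
    = mf * (A * cross 8 t + b * cross 6 t) + mg * (Am * cross 8 t + bm * cross 6 t)"
   by (simp add: algebra_simps)
  have arith: "D' <= 2 * p - 2 * q"
   if "D' = 2 * (x + y)" "c8 + c6 = X1 + X2" "x <= X1 + n1 - Y1" "y <= X2 + n2 - Y2" "n1 + n2 <= u + v + p"
    "c8 + c6 + u + v + q <= Y1 + Y2" for D' p q x y c8 c6 X1 X2 n1 n2 u v Y1 Y2 :: real
   using that by argo
  have "D <= 2 * (CE * ((asum2 n 4 (f t) (g t)) * qsum2 n 4 (f t) (g t)))
   - 2 * (ka * qsum2 n 8 (f t) (g t))"
   by (rule arith[OF D c f g N_le[OF less_imp_le[OF t]]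
    energy_linear[OF qsum_nonneg qsum_nonneg qsum_nonneg qsum_nonneg cross_le[of 8 t] cross_le[of 6 t]]])
  then show ?thesis by (simp only: mult.assoc)
 qed
 ultimately show ?thesis by (rule that)
qed

theorem energy_estimate:
 assumes t: "t >= 0"
 shows "qsum n 4 (f t) + qsum n 4 (g t) + 2 * ka * tint t (\<lambda>s. qsum2 n 8 (f s) (g s))
  <= exp KE * qsum2 n 4 (f 0) (g 0)"
proof -
 define V4 where "V4 s = asum n 4 (f s) + asum n 4 (g s)" for s
 define E2 where "E2 s = qsum n 4 (f s) + qsum n 4 (g s)" for s
 define E8 where "E8 s = qsum n 8 (f s) + qsum n 8 (g s)" for s
 have cV: "cont_nonneg V4" and cE: "cont_nonneg E2" and c8: "cont_nonneg E8"
  unfolding V4_def[abs_def] E2_def[abs_def] E8_def[abs_def] by (rule cont_V4 cont_E2)+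
 have E0: "E2 s >= 0" "E8 s >= 0" for s unfolding E2_def E8_def by (simp_all add: qsum_nonneg add_nonneg_nonneg)
 define I where "I s = tint s V4" for s
 \<comment> \<open>The energy with its integrating factor plus the dissipation so far. The latter
   carries the lower bound \<open>exp (- KE)\<close> of the integrating factor, so its derivative is
   outweighed by the damping term.\<close>
 define \<Phi> where "\<Phi> s = E2 s * exp (- 2 * CE * I s) + 2 * ka * exp (- KE) * tint s E8" for s
 have cI: "cont_nonneg I" "cont_nonneg (\<lambda>s. tint s E8)"
  unfolding I_def[abs_def] by (intro continuous_on_indefinite_integral_atLeast cV c8)+
 have I_le: "2 * CE * I s <= KE" if "s >= 0" for s
 proof -
  have "I s <= a / dA"
   using V_le_and_integral_V4_le(2)[OF that] pos by (simp add: I_def V4_def[abs_def] field_simps)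
  then show ?thesis unfolding KE_def using CE_nonneg by (intro mult_left_mono) auto
 qed
 have "\<Phi> t <= \<Phi> 0"
 proof (rule DERIV_nonpos_imp_decreasing_open[OF t])
  have "cont_nonneg \<Phi>"
   unfolding \<Phi>_def[abs_def] by (intro continuous_intros cE cI)
  then show "continuous_on {0..t} \<Phi>" by (rule continuous_on_subset) auto
  fix s assume s: "0 < s" "s < t"
  obtain D where D: "(E2 has_real_derivative D) (at s)" "D <= 2 * CE * (V4 s * E2 s) - 2 * ka * E8 s"
   using energy_derivative[OF s(1)] unfolding E2_def[abs_def] V4_def E8_def by blast
  have dI: "(I has_real_derivative V4 s) (at s)" "((\<lambda>s. tint s E8) has_real_derivative E8 s) (at s)"
   using FTC_atLeast[OF cV s(1)] FTC_atLeast[OF c8 s(1)]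
   by (simp_all add: I_def[abs_def] has_real_derivative_iff_has_vector_derivative)
  let ?x = "exp (- 2 * CE * I s)"
  have "(\<Phi> has_real_derivative (D * ?x + (?x * (- 2 * CE * V4 s)) * E2 s + 2 * ka * exp (- KE) * E8 s)) (at s)"
   unfolding \<Phi>_def[abs_def] by (auto intro!: derivative_eq_intros D(1) dI)
  moreover have "D * ?x + (?x * (- 2 * CE * V4 s)) * E2 s + 2 * ka * exp (- KE) * E8 s <= 0"
  proof -
   have "D * ?x <= (2 * CE * (V4 s * E2 s) - 2 * ka * E8 s) * ?x" by (intro mult_right_mono D) auto
   moreover have "2 * ka * exp (- KE) * E8 s <= 2 * ka * E8 s * ?x"
   proof -
    have "exp (- KE) <= ?x" using I_le[of s] s by simp
    then have "(2 * ka * E8 s) * exp (- KE) <= (2 * ka * E8 s) * ?x" using nn E0 by (intro mult_left_mono) auto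
    then show ?thesis by (simp only: mult.assoc mult.commute[of "exp (- KE)" "E8 s"])
   qed
   moreover have "(?x * (- 2 * CE * V4 s)) * E2 s = - (2 * CE * (V4 s * E2 s) * ?x)"
    by (simp only: mult_minus_left mult_minus_right) (simp only: mult_ac)
   ultimately show ?thesis unfolding left_diff_distrib by argo
  qed
  ultimately show "\<exists>y. (\<Phi> has_real_derivative y) (at s) \<and> y <= 0" by blast
 qed
 moreover have "\<Phi> 0 = E2 0" by (simp add: \<Phi>_def I_def)
 moreover have "E2 t * exp (- KE) <= E2 t * exp (- 2 * CE * I t)"
  using I_le[OF t] E0 by (intro mult_left_mono) auto
 moreover have "\<Phi> t = E2 t * exp (- 2 * CE * I t) + exp (- KE) * (2 * ka * tint t E8)"
  by (simp add: \<Phi>_def)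
 moreover have "exp (- KE) * (E2 t + 2 * ka * tint t E8)
   = E2 t * exp (- KE) + exp (- KE) * (2 * ka * tint t E8)"
  by (simp only: distrib_left mult.commute)
 ultimately have "exp (- KE) * (E2 t + 2 * ka * tint t E8) <= E2 0"
  by argo
 then have "E2 t + 2 * ka * tint t E8 <= exp KE * E2 0"
  by (simp add: exp_minus inverse_eq_divide pos_divide_le_eq mult.commute)
 then show ?thesis by (simp add: E2_def E8_def[abs_def])
qed

lemma cmod_R_le:
 "cmod (Rf t k) <= mag k * (mf * cmod (La (f t) (g t) k) + cmod (gconv n (f t) (La (f t) (g t)) k))"
 "cmod (Rg t k) <= mag k * (mg * cmod (Lb (f t) (g t) k) + cmod (gconv n (g t) (Lb (f t) (g t)) k))"
proof -
 have *: "cmod (- of_int k * (of_real m * x + y)) <= mag k * (m * cmod x + cmod y)" if "m >= 0" for m x y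
  using norm_triangle_ineq[of "of_real m * x" y] that by (simp add: norm_mult mult_left_mono)
 show "cmod (Rf t k) <= mag k * (mf * cmod (La (f t) (g t) k) + cmod (gconv n (f t) (La (f t) (g t)) k))"
  "cmod (Rg t k) <= mag k * (mg * cmod (Lb (f t) (g t) k) + cmod (gconv n (g t) (Lb (f t) (g t)) k))"
  unfolding Rf_def Rg_def by (intro * nn)+
qed

text \<open>No cancellation is used: the weighted products of \<open>cmod u\<close> and the modulus
  of its derivative control the variation of every mode of the energy separately. Their
  integrability in time is the source of the majorant for continuity in
  \<open>Hdot 2\<close>.\<close>

lemma power_estimate:
 assumes t: "t >= 0"
 shows "wsum n 4 (\<lambda>k. cmod (f t k) * cmod (Rf t k)) + wsum n 4 (\<lambda>k. cmod (g t k) * cmod (Rg t k))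
  <= CD * ((qsum2 n 8 (f t) (g t)) + asum2 n 4 (f t) (g t) * qsum2 n 4 (f t) (g t))"
proof -
 let ?J = "modes n" and ?Q = "qsum2 n 8 (f t) (g t)"
 have lin_part: "(\<Sum>k\<in>?J. mag k ^ 4 * cmod (u k) * (mag k * cmod (lin a3 a1 b3 b1 (f t) (g t) k))) <= (a3 + a1 + b3 + b1) * ?Q"
  if c: "a3 >= 0" "a1 >= 0" "b3 >= 0" "b1 >= 0" and u: "u = f t \<or> u = g t" for u a3 a1 b3 b1
 proof -
  have "(\<Sum>k\<in>?J. mag k ^ 4 * cmod (u k) * (mag k * cmod (lin a3 a1 b3 b1 (f t) (g t) k)))
   <= (\<Sum>k\<in>?J. (a3 + a1 + b3 + b1) * (mag k ^ 8 * ((cmod (f t k))\<^sup>2 + (cmod (g t k))\<^sup>2)))"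
  proof (rule sum_mono)
   fix k
   let ?k = "mag k" and ?x = "cmod (f t k)" and ?y = "cmod (g t k)"
   show "?k ^ 4 * cmod (u k) * (?k * cmod (lin a3 a1 b3 b1 (f t) (g t) k)) <= (a3 + a1 + b3 + b1) * (?k ^ 8 * (?x\<^sup>2 + ?y\<^sup>2))"
   proof (cases "k = 0")
    case False
    then have k1: "?k >= 1" by linarith
    have k24: "?k ^ 2 <= ?k ^ 4" using k1 by (intro power_increasing) auto
    have sq: "p * q <= p\<^sup>2 + q\<^sup>2" "p * p <= p\<^sup>2 + q\<^sup>2" "q * q <= p\<^sup>2 + q\<^sup>2"
     if "p >= 0" "q >= 0" for p q :: real
    proof -
     show "p * q <= p\<^sup>2 + q\<^sup>2"
      using sum_squares_bound[of p q] mult_nonneg_nonneg[OF that] by linarith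
    qed (simp_all add: power2_eq_square)
    have xu: "cmod (u k) * ?x <= ?x\<^sup>2 + ?y\<^sup>2" "cmod (u k) * ?y <= ?x\<^sup>2 + ?y\<^sup>2"
     using u sq[of ?x ?y] by (auto simp: mult.commute[of ?y ?x])
    have "?k ^ 4 * cmod (u k) * (?k * cmod (lin a3 a1 b3 b1 (f t) (g t) k))
     <= ?k ^ 4 * cmod (u k) * (?k * (a3 * (?k ^ 3 * ?x) + a1 * (?k ^ 1 * ?x) + b3 * (?k ^ 3 * ?y) + b1 * (?k ^ 1 * ?y)))"
     by (intro mult_left_mono cmod_lin_le c) auto
    also have "... = a3 * (?k ^ 8 * (cmod (u k) * ?x)) + a1 * (?k ^ 4 * ?k ^ 2 * (cmod (u k) * ?x))
      + b3 * (?k ^ 8 * (cmod (u k) * ?y)) + b1 * (?k ^ 4 * ?k ^ 2 * (cmod (u k) * ?y))"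
     by (simp add: eval_nat_numeral distrib_left mult_ac del: abs_mult_self_eq)
    also have "... <= a3 * (?k ^ 8 * (?x\<^sup>2 + ?y\<^sup>2)) + a1 * (?k ^ 4 * ?k ^ 4 * (?x\<^sup>2 + ?y\<^sup>2))
      + b3 * (?k ^ 8 * (?x\<^sup>2 + ?y\<^sup>2)) + b1 * (?k ^ 4 * ?k ^ 4 * (?x\<^sup>2 + ?y\<^sup>2))"
     by (intro add_mono mult_left_mono mult_mono xu k24 c order_refl) auto
    also have "... = (a3 + a1 + b3 + b1) * (?k ^ 8 * (?x\<^sup>2 + ?y\<^sup>2))"
     by (simp add: algebra_simps flip: power_add)
    finally show ?thesis .
   qed simp
  qed
  also have "... = (a3 + a1 + b3 + b1) * ?Q"
   by (simp add: qsum_def wsum_def sum_distrib_left[symmetric] sum.distrib distrib_left)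
  finally show ?thesis .
 qed
 have "wsum n 4 (\<lambda>k. cmod (f t k) * cmod (Rf t k))
  <= mf * (\<Sum>k\<in>?J. mag k ^ 4 * cmod (f t k) * (mag k * cmod (La (f t) (g t) k))) + Nf t"
 proof -
  have "wsum n 4 (\<lambda>k. cmod (f t k) * cmod (Rf t k))
   <= (\<Sum>k\<in>?J. mag k ^ 4 * (cmod (f t k) * (mag k * (mf * cmod (La (f t) (g t) k) + cmod (gconv n (f t) (La (f t) (g t)) k)))))"
   unfolding wsum_def by (intro sum_mono mult_left_mono cmod_R_le) auto
  also have "... = mf * (\<Sum>k\<in>?J. mag k ^ 4 * cmod (f t k) * (mag k * cmod (La (f t) (g t) k))) + Nf t"
   unfolding Nf_def sum_distrib_left sum.distrib[symmetric]
   by (intro sum.cong refl) (simp add: algebra_simps)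
  finally show ?thesis .
 qed
 also have "... <= mf * ((Ag + br + A + b) * ?Q) + Nf t"
  using nn by (intro add_mono mult_left_mono lin_part) auto
 finally have f: "wsum n 4 (\<lambda>k. cmod (f t k) * cmod (Rf t k)) <= mf * ((Ag + br + A + b) * ?Q) + Nf t" .
 have "wsum n 4 (\<lambda>k. cmod (g t k) * cmod (Rg t k))
  <= mg * (\<Sum>k\<in>?J. mag k ^ 4 * cmod (g t k) * (mag k * cmod (Lb (f t) (g t) k))) + Ng t"
 proof -
  have "wsum n 4 (\<lambda>k. cmod (g t k) * cmod (Rg t k))
   <= (\<Sum>k\<in>?J. mag k ^ 4 * (cmod (g t k) * (mag k * (mg * cmod (Lb (f t) (g t) k) + cmod (gconv n (g t) (Lb (f t) (g t)) k)))))"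
   unfolding wsum_def by (intro sum_mono mult_left_mono cmod_R_le) auto
  also have "... = mg * (\<Sum>k\<in>?J. mag k ^ 4 * cmod (g t k) * (mag k * cmod (Lb (f t) (g t) k))) + Ng t"
   unfolding Ng_def sum_distrib_left sum.distrib[symmetric]
   by (intro sum.cong refl) (simp add: algebra_simps)
  finally show ?thesis .
 qed
 also have "... <= mg * ((Am + bm + Am + bm) * ?Q) + Ng t"
  using nn by (intro add_mono mult_left_mono lin_part) auto
 finally have g: "wsum n 4 (\<lambda>k. cmod (g t k) * cmod (Rg t k)) <= mg * ((Am + bm + Am + bm) * ?Q) + Ng t" .
 let ?P = "(asum2 n 4 (f t) (g t)) * qsum2 n 4 (f t) (g t)"
 have Q: "qsum n 8 (f t) >= 0" "qsum n 8 (g t) >= 0" by (rule qsum_nonneg)+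
 have P: "?P >= 0" by (intro mult_nonneg_nonneg add_nonneg_nonneg asum_nonneg qsum_nonneg)
 have "((Ag + A / 2 + Am / 2) * a + ka) * qsum n 8 (f t) + ((A / 2 + 3 / 2 * Am) * a + ka) * qsum n 8 (g t)
  <= (a * (Ag + A + 2 * Am) + ka) * qsum n 8 (f t) + (a * (Ag + A + 2 * Am) + ka) * qsum n 8 (g t)"
 proof (intro add_mono mult_right_mono order_refl Q)
  show "(Ag + A / 2 + Am / 2) * a <= a * (Ag + A + 2 * Am)" "(A / 2 + 3 / 2 * Am) * a <= a * (Ag + A + 2 * Am)"
   unfolding mult.commute[of _ a] using nn by (intro mult_left_mono; simp)+
 qed
 also have "... = (a * (Ag + A + 2 * Am) + ka) * ?Q" by (simp only: distrib_left)
 finally have N: "Nf t + Ng t <= (a * (Ag + A + 2 * Am) + ka) * ?Q + CE * ?P"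
  using N_le[OF t] by argo
 have "mf * ((Ag + br + A + b) * ?Q) + mg * ((Am + bm + Am + bm) * ?Q) + ((a * (Ag + A + 2 * Am) + ka) * ?Q + CE * ?P)
   <= CD * ?Q + CD * ?P"
 proof -
  have "CD - CE = mf * (Ag + br + A + b) + mg * (2 * Am + 2 * bm) + a * (Ag + A + 2 * Am) + ka" by (simp add: CD_def)
  also have "... >= 0" using nn by simp
  finally have c: "CE <= CD" by simp
  have "mf * ((Ag + br + A + b) * ?Q) + mg * ((Am + bm + Am + bm) * ?Q) + (a * (Ag + A + 2 * Am) + ka) * ?Q = (CD - CE) * ?Q"
   unfolding \<open>CD - CE = _\<close> by (simp only: distrib_right mult.assoc) (simp add: algebra_simps)
  also have "... <= CD * ?Q" using CE_nonneg Q by (intro mult_right_mono) auto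
  finally show ?thesis using mult_right_mono[OF c P] by argo
 qed
 with f g N show ?thesis unfolding distrib_left[of CD] by argo
qed

end

section \<open>Passage to the limit\<close>

lemma finite_subset_modes:
 assumes "finite X" shows "\<exists>n. X \<subseteq> modes n"
proof -
 obtain B where B: "!!k. k \<in> X ==> \<bar>k\<bar> <= B"
  using finite_imageI[OF assms, of abs] by (meson Max_ge finite_imageI assms imageI)
 then have "X \<subseteq> modes (nat B)" by (force simp: mem_modes)
 then show ?thesis by blast
qed

lemma modes_bounded:
 fixes h :: "int => real"
 assumes nn: "!!k. h k >= 0" and B: "!!n. (\<Sum>k\<in>modes n. h k) <= B"
 shows "h summable_on UNIV" "infsum h UNIV <= B"
proof -
 have le: "sum h X <= B" if "finite X" for X
 proof -
  obtain n where "X \<subseteq> modes n" using finite_subset_modes[OF \<open>finite X\<close>] by blast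
  then have "sum h X <= sum h (modes n)" using nn by (intro sum_mono2) auto
  then show ?thesis using B[of n] by linarith
 qed
 then show "h summable_on UNIV"
  using nn by (intro nonneg_bdd_above_summable_on) (auto intro!: bdd_aboveI2)
 then show "infsum h UNIV <= B" using le by (intro infsum_le_finite_sums) auto
qed

text \<open>The weight \<open>mag j\<close> makes the tails beyond \<open>K\<close> at most
  \<open>B / (K + 1)\<close> for all \<open>m\<close> at once, so the limit passes from finite sums
  to the full ones.\<close>

lemma infsum_limit_of_weighted_bound:
 fixes U :: "nat => int => complex"
 assumes lim: "!!j. (\<lambda>m. U m j) \<longlonglongrightarrow> V j"
  and B: "!!m n. (\<Sum>j\<in>modes n. mag j * cmod (U m j)) <= B"
 shows "(\<lambda>m. infsum (U m) UNIV) \<longlonglongrightarrow> infsum V UNIV"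
proof -
 have BV: "(\<Sum>j\<in>modes n. mag j * cmod (V j)) <= B" for n
  by (rule LIMSEQ_le_const2[OF tendsto_sum[OF tendsto_mult_left[OF tendsto_norm[OF lim]]]])
   (use B in auto)
 have sm: "(\<lambda>j. cmod (W j)) summable_on UNIV"
  and tail: "cmod (infsum W UNIV - (\<Sum>j\<in>modes K. W j)) <= B / (real K + 1)"
  if W: "!!n. (\<Sum>j\<in>modes n. mag j * cmod (W j)) <= B" for W :: "int => complex" and K
 proof -
  have s1: "(\<lambda>j. mag j * cmod (W j)) summable_on UNIV"
   "infsum (\<lambda>j. mag j * cmod (W j)) UNIV <= B"
   using modes_bounded[OF _ W] by auto
  \<comment> \<open>The weight vanishes at \<open>0\<close>; this one term is added again at the
    end.\<close>
  have "(\<lambda>j. mag j * cmod (W j)) summable_on - {0}"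
   by (rule summable_on_subset_banach[OF s1(1)]) simp
  then have "(\<lambda>j. cmod (W j)) summable_on - {0}"
  proof (rule summable_on_comparison_test)
   fix j :: int assume "j \<in> - {0}"
   then have "1 <= mag j" by auto
   then show "cmod (W j) <= mag j * cmod (W j)"
    using mult_right_mono[of 1 "mag j" "cmod (W j)"] by simp
  qed simp
  then have "(\<lambda>j. cmod (W j)) summable_on insert 0 (- {0})"
   by (simp add: summable_on_insert_iff)
  then show sm: "(\<lambda>j. cmod (W j)) summable_on UNIV" by (simp add: insert_absorb Compl_insert)
  have sW: "W summable_on UNIV" by (rule abs_summable_summable[OF sm])
  have "infsum W UNIV = infsum W (modes K) + infsum W (- modes K)"
   using infsum_Un_disjoint[of W "modes K" "- modes K"]
    summable_on_subset_banach[OF sW, of "modes K"] summable_on_subset_banach[OF sW, of "- modes K"]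
   by simp
  then have "infsum W UNIV - (\<Sum>j\<in>modes K. W j) = infsum W (- modes K)" by simp
  moreover have "cmod (infsum W (- modes K)) <= infsum (\<lambda>j. 1 / (real K + 1) * (mag j * cmod (W j))) (- modes K)"
  proof (rule norm_infsum_le)
   show "(W has_sum infsum W (- modes K)) (- modes K)"
    by (intro has_sum_infsum summable_on_subset_banach[OF sW]) simp
   show "((\<lambda>j. 1 / (real K + 1) * (mag j * cmod (W j))) has_sum
     infsum (\<lambda>j. 1 / (real K + 1) * (mag j * cmod (W j))) (- modes K)) (- modes K)"
    by (intro has_sum_infsum summable_on_cmult_right summable_on_subset_banach[OF s1(1)]) simp
   fix j assume "j \<in> - modes K"
   then have "real K + 1 <= mag j" by (simp add: mem_modes)
   then have "(real K + 1) * cmod (W j) <= mag j * cmod (W j)" by (rule mult_right_mono) simp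
   then show "cmod (W j) <= 1 / (real K + 1) * (mag j * cmod (W j))"
    by (simp add: field_simps)
  qed
  moreover have "infsum (\<lambda>j. 1 / (real K + 1) * (mag j * cmod (W j))) (- modes K) <= B / (real K + 1)"
  proof -
   have "infsum (\<lambda>j. mag j * cmod (W j)) (- modes K) <= infsum (\<lambda>j. mag j * cmod (W j)) UNIV"
    by (intro infsum_mono_neutral summable_on_subset_banach[OF s1(1)] s1) auto
   then have "infsum (\<lambda>j. mag j * cmod (W j)) (- modes K) <= B" using s1(2) by simp
   then show ?thesis
    by (subst infsum_cmult_right') (simp add: divide_right_mono)
  qed
  ultimately show "cmod (infsum W UNIV - (\<Sum>j\<in>modes K. W j)) <= B / (real K + 1)" by simp
 qed
 show ?thesis
 proof (rule LIMSEQ_I)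
  fix e :: real assume e: "e > 0"
  have B0: "B >= 0" using B[of 0 0] by (simp add: modes_def)
  obtain K :: nat where K: "B / (real K + 1) < e / 3"
  proof -
   obtain K :: nat where "3 * B / e < real K" using reals_Archimedean2 by blast
   then have "3 * B < real K * e" using e by (simp add: field_simps)
   then have "B / (real K + 1) < e / 3" using e by (simp add: field_simps)
   then show ?thesis by (rule that)
  qed
  have "(\<lambda>m. \<Sum>j\<in>modes K. U m j) \<longlonglongrightarrow> (\<Sum>j\<in>modes K. V j)" by (intro tendsto_sum lim)
  then obtain N where N: "!!m. m >= N ==> cmod ((\<Sum>j\<in>modes K. U m j) - (\<Sum>j\<in>modes K. V j)) < e / 3"
   using LIMSEQ_D[of _ _ "e / 3"] e by fastforce
  show "\<exists>N. \<forall>m\<ge>N. cmod (infsum (U m) UNIV - infsum V UNIV) < e"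
  proof (intro exI allI impI)
   fix m assume "m >= N"
   have "infsum (U m) UNIV - infsum V UNIV
    = (infsum (U m) UNIV - (\<Sum>j\<in>modes K. U m j)) + ((\<Sum>j\<in>modes K. U m j) - (\<Sum>j\<in>modes K. V j))
     - (infsum V UNIV - (\<Sum>j\<in>modes K. V j))" by simp
   then have "cmod (infsum (U m) UNIV - infsum V UNIV)
    <= cmod (infsum (U m) UNIV - (\<Sum>j\<in>modes K. U m j)) + cmod ((\<Sum>j\<in>modes K. U m j) - (\<Sum>j\<in>modes K. V j))
     + cmod (infsum V UNIV - (\<Sum>j\<in>modes K. V j))"
    by (metis (no_types, opaque_lifting) norm_triangle_ineq norm_triangle_ineq4 add_mono_thms_linordered_semiring(3) order_trans)
   then show "cmod (infsum (U m) UNIV - infsum V UNIV) < e"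
    using tail[OF B, of m K] tail[OF BV, of K] N[OF \<open>m >= N\<close>] K by linarith
  qed
 qed
qed

definition iconv :: "(int => complex) => (int => complex) => int => complex" where
 "iconv u h k = (INFSUM j. u (k - j) * h j)"

lemma gconv_eq_iconv:
 assumes "!!j. j \<notin> modes n ==> h j = 0"
 shows "gconv n u h k = iconv u h k"
proof -
 have "(INFSUM j. u (k - j) * h j) = (\<Sum>\<^sub>\<infinity>j\<in>modes n. u (k - j) * h j)"
  by (rule infsum_cong_neutral) (use assms in auto)
 then show ?thesis by (simp add: gconv_def iconv_def)
qed

lemma cmod_lin_le_cubic:
 assumes nn: "a3 >= 0" "a1 >= 0" "b3 >= 0" "b1 >= 0"
 shows "cmod (lin a3 a1 b3 b1 f g j) <= (a3 + a1 + b3 + b1) * (mag j ^ 3 * (cmod (f j) + cmod (g j)))"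
proof (cases "j = 0")
 case False
 define J y z where "J = mag j" and "y = cmod (f j)" and "z = cmod (g j)"
 have J1: "J >= 1" using False unfolding J_def by linarith
 have yz: "y >= 0" "z >= 0" by (simp_all add: y_def z_def)
 have "cmod (lin a3 a1 b3 b1 f g j) <= a3 * (J ^ 3 * y) + a1 * (J ^ 1 * y) + b3 * (J ^ 3 * z) + b1 * (J ^ 1 * z)"
  unfolding J_def y_def z_def by (rule cmod_lin_le[OF nn])
 also have "... <= a3 * (J ^ 3 * (y + z)) + a1 * (J ^ 3 * (y + z)) + b3 * (J ^ 3 * (y + z)) + b1 * (J ^ 3 * (y + z))"
  using J1 yz nn by (intro add_mono mult_left_mono mult_mono power_increasing) auto
 also have "... = (a3 + a1 + b3 + b1) * (J ^ 3 * (y + z))" by (simp only: distrib_right)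
 finally show ?thesis by (simp only: J_def y_def z_def)
qed (simp add: lin_def)

lemma qsum_shift_le:
 assumes Q: "!!n. qsum n 4 u <= Q"
 shows "(\<Sum>j\<in>modes n. real_of_int (k - j) ^ 4 * (cmod (u (k - j)))\<^sup>2) <= Q"
proof -
 have "(\<Sum>j\<in>modes n. real_of_int (k - j) ^ 4 * (cmod (u (k - j)))\<^sup>2)
   = (\<Sum>l\<in>(\<lambda>j. k - j) ` modes n. real_of_int l ^ 4 * (cmod (u l))\<^sup>2)"
  by (subst sum.reindex) (auto simp: inj_on_def)
 also have "... <= (\<Sum>l\<in>modes (n + nat \<bar>k\<bar>). real_of_int l ^ 4 * (cmod (u l))\<^sup>2)"
  by (intro sum_mono2) (auto simp: mem_modes)
 also have "... = qsum (n + nat \<bar>k\<bar>) 4 u" by (simp add: qsum_def wsum_def)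
 finally show ?thesis using Q order_trans by blast
qed

text \<open>For \<open>k = l + j\<close> with \<open>l \<noteq> 0\<close> one has \<open>|j| \<le> (|k| + 1) |l|\<close>; so two of the
 four derivatives on the second factor can be moved to the first one.\<close>

lemma convolution_tail_bound:
 assumes nn: "a3 >= 0" "a1 >= 0" "b3 >= 0" "b1 >= 0" and u0: "u 0 = 0"
  and Q: "!!n. qsum n 4 u <= Q" "!!n. qsum n 4 f <= Q" "!!n. qsum n 4 g <= Q"
 shows "(\<Sum>j\<in>modes n. mag j * cmod (u (k - j) * lin a3 a1 b3 b1 f g j))
  <= (a3 + a1 + b3 + b1) * (mag k + 1)\<^sup>2 * (2 * Q)"
proof -
 let ?S = "a3 + a1 + b3 + b1"
 have each: "mag j * cmod (u (k - j) * lin a3 a1 b3 b1 f g j)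
  <= ?S * (mag k + 1)\<^sup>2 * (real_of_int (k - j) ^ 4 * (cmod (u (k - j)))\<^sup>2
   + (mag j ^ 4 * (cmod (f j))\<^sup>2 + mag j ^ 4 * (cmod (g j))\<^sup>2) / 2)" for j
 proof (cases "j = 0 \<or> k - j = 0")
  case True
  then show ?thesis using nn u0 by (auto simp: lin_def)
 next
  case False
  define J L K where "J = mag j" and "L = \<bar>real_of_int (k - j)\<bar>" and "K = mag k"
  define x y z where "x = cmod (u (k - j))" and "y = cmod (f j)" and "z = cmod (g j)"
  have J1: "J >= 1" and L1: "L >= 1" using False unfolding J_def L_def by linarith+
  have xyz: "x >= 0" "y >= 0" "z >= 0" by (simp_all add: x_def y_def z_def)
  have "J <= K + L" unfolding J_def K_def L_def by linarith
  also have "... <= K * L + 1 * L" using L1 mult_left_mono[OF L1, of K] by (simp add: K_def)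
  finally have "J <= (K + 1) * L" by (simp add: algebra_simps)
  then have "J\<^sup>2 <= ((K + 1) * L)\<^sup>2" using J1 by (intro power_mono) auto
  then have J2: "J\<^sup>2 <= (K + 1)\<^sup>2 * L\<^sup>2" by (simp add: power_mult_distrib)
  have lin: "cmod (lin a3 a1 b3 b1 f g j) <= ?S * (J ^ 3 * (y + z))"
   unfolding J_def y_def z_def by (rule cmod_lin_le_cubic[OF nn])
  have "J * (x * cmod (lin a3 a1 b3 b1 f g j)) <= J * (x * (?S * (J ^ 3 * (y + z))))"
   using J1 xyz lin by (intro mult_left_mono) auto
  also have "... = ?S * (J\<^sup>2 * (x * (J\<^sup>2 * (y + z))))" by (simp add: eval_nat_numeral mult_ac)
  also have "... <= ?S * (((K + 1)\<^sup>2 * L\<^sup>2) * (x * (J\<^sup>2 * (y + z))))"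
   using nn xyz J2 by (intro mult_left_mono mult_right_mono) auto
  also have "... = ?S * (K + 1)\<^sup>2 * ((L\<^sup>2 * x) * (J\<^sup>2 * y) + (L\<^sup>2 * x) * (J\<^sup>2 * z))" by (simp add: algebra_simps)
  also have "... <= ?S * (K + 1)\<^sup>2 * (((L\<^sup>2 * x)\<^sup>2 + (J\<^sup>2 * y)\<^sup>2) / 2 + ((L\<^sup>2 * x)\<^sup>2 + (J\<^sup>2 * z)\<^sup>2) / 2)"
  proof (intro mult_left_mono add_mono)
   show "p * q <= (p\<^sup>2 + q\<^sup>2) / 2" for p q :: real using sum_squares_bound[of p q] by simp
   then show "L\<^sup>2 * x * (J\<^sup>2 * z) <= ((L\<^sup>2 * x)\<^sup>2 + (J\<^sup>2 * z)\<^sup>2) / 2" .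
  qed (use nn in auto)
  also have "... = ?S * (K + 1)\<^sup>2 * (L ^ 4 * x\<^sup>2 + (J ^ 4 * y\<^sup>2 + J ^ 4 * z\<^sup>2) / 2)"
   by (simp add: power_mult_distrib add_divide_distrib flip: power_mult)
  finally show ?thesis by (simp add: J_def L_def K_def x_def y_def z_def norm_mult)
 qed
 have "(\<Sum>j\<in>modes n. mag j * cmod (u (k - j) * lin a3 a1 b3 b1 f g j))
  <= (\<Sum>j\<in>modes n. ?S * (mag k + 1)\<^sup>2 * (real_of_int (k - j) ^ 4 * (cmod (u (k - j)))\<^sup>2
   + (mag j ^ 4 * (cmod (f j))\<^sup>2 + mag j ^ 4 * (cmod (g j))\<^sup>2) / 2))"
  by (intro sum_mono each)
 also have "... = ?S * (mag k + 1)\<^sup>2 * ((\<Sum>j\<in>modes n. real_of_int (k - j) ^ 4 * (cmod (u (k - j)))\<^sup>2)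
   + qsum2 n 4 f g / 2)"
  unfolding qsum_def wsum_def sum.distrib[symmetric] sum_divide_distrib sum_distrib_left[symmetric] by (rule refl)
 also have "... <= ?S * (mag k + 1)\<^sup>2 * (Q + (Q + Q) / 2)"
  using nn by (intro mult_left_mono add_mono divide_right_mono qsum_shift_le Q) auto
 finally show ?thesis by simp
qed

section \<open>Limits of norms and right-hand sides\<close>

lemma wsum_le_of_support:
 assumes "!!k. x k >= 0" "!!k. k \<notin> modes n ==> x k = 0"
 shows "wsum N p x <= wsum n p x"
proof -
 have "wsum N p x = (\<Sum>k\<in>modes N \<inter> modes n. mag k ^ p * x k)"
  unfolding wsum_def using assms(2) by (intro sum.mono_neutral_right) auto
 also have "... <= wsum n p x" unfolding wsum_def using assms(1) by (intro sum_mono2) auto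
 finally show ?thesis .
qed

lemma tendsto_asum:
 assumes "!!k. ((\<lambda>m. c m k) \<longlongrightarrow> d k) F" shows "((\<lambda>m. asum n p (c m)) \<longlongrightarrow> asum n p d) F"
 unfolding asum_def wsum_def by (intro tendsto_sum tendsto_mult_left tendsto_norm assms)

lemma tendsto_qsum:
 assumes "!!k. ((\<lambda>m. c m k) \<longlongrightarrow> d k) F" shows "((\<lambda>m. qsum n p (c m)) \<longlongrightarrow> qsum n p d) F"
 unfolding qsum_def wsum_def by (intro tendsto_sum tendsto_mult_left tendsto_power tendsto_norm assms)

lemma tendsto_lin:
 assumes "!!k. ((\<lambda>m. f m k) \<longlongrightarrow> f' k) F" "!!k. ((\<lambda>m. g m k) \<longlongrightarrow> g' k) F"
 shows "((\<lambda>m. lin a3 a1 b3 b1 (f m) (g m) k) \<longlongrightarrow> lin a3 a1 b3 b1 f' g' k) F"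
 unfolding lin_def by (intro tendsto_add tendsto_mult_left assms)

text \<open>Modewise convergence is enough because bounded energies provide the uniform weighted
  bound of \<open>convolution_tail_bound\<close>.\<close>

lemma tendsto_iconv_lin:
 assumes nn: "a3 >= 0" "a1 >= 0" "b3 >= 0" "b1 >= 0" and u0: "!!m::nat. u m 0 = 0"
  and Q: "!!m n. qsum n 4 (u m) <= Q" "!!m n. qsum n 4 (f m) <= Q" "!!m n. qsum n 4 (g m) <= Q"
  and lim: "!!k. (\<lambda>m. u m k) \<longlonglongrightarrow> u' k" "!!k. (\<lambda>m. f m k) \<longlonglongrightarrow> f' k" "!!k. (\<lambda>m. g m k) \<longlonglongrightarrow> g' k"
 shows "(\<lambda>m. iconv (u m) (lin a3 a1 b3 b1 (f m) (g m)) k) \<longlonglongrightarrow> iconv u' (lin a3 a1 b3 b1 f' g') k"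
 unfolding iconv_def
 by (rule infsum_limit_of_weighted_bound[OF tendsto_mult[OF lim(1) tendsto_lin[OF lim(2,3)]]
    convolution_tail_bound[OF nn u0 Q]])

context film
begin

definition "rhs_f f g k = - of_int k * (of_real mf * La f g k + iconv f (La f g) k)"
definition "rhs_g f g k = - of_int k * (of_real mg * Lb f g k + iconv g (Lb f g) k)"

abbreviation "power2s n f g \<equiv> wsum n 4 (\<lambda>k. cmod (f k) * cmod (rhs_f f g k))
 + wsum n 4 (\<lambda>k. cmod (g k) * cmod (rhs_g f g k))"

definition "coupling = Ag + br + A + b + 2 * Am + 2 * bm"
text \<open>A bound for the time derivative of the mode \<open>k\<close> in terms of
  \<open>a\<close> and the energy bound \<open>Q\<close>. It grows with \<open>k\<close> but is
  independent of the truncation, which is what equicontinuity mode by mode requires.\<close>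

definition "rate Q k = mag k * ((mf + mg) * (coupling * (mag k ^ 3 * a))
 + coupling * (mag k + 1)\<^sup>2 * (2 * Q))"

end

context galerkin
begin

lemma R_eq_rhs: "Rf t k = rhs_f (f t) (g t) k" "Rg t k = rhs_g (f t) (g t) k"
 unfolding Rf_def Rg_def rhs_f_def rhs_g_def
 by (subst gconv_eq_iconv; simp add: lin_def supp)+

lemma asum_support: "asum N p (f t) <= asum n p (f t)" "asum N p (g t) <= asum n p (g t)"
 unfolding asum_def by (rule wsum_le_of_support; simp add: supp)+

lemma qsum_support: "qsum N p (f t) <= qsum n p (f t)" "qsum N p (g t) <= qsum n p (g t)"
 unfolding qsum_def by (rule wsum_le_of_support; simp add: supp)+

lemma mode_le_a:
 assumes "t >= 0" shows "cmod (f t k) + cmod (g t k) <= a" "cmod (f t k) <= a" "cmod (g t k) <= a"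
proof -
 have *: "cmod (u t k) <= asum n 0 (u t)" if "u = f \<or> u = g" for u
 proof (cases "k \<in> modes n")
  case True then show ?thesis unfolding asum_def wsum_def
   using member_le_sum[of k "modes n" "\<lambda>k. mag k ^ 0 * cmod (u t k)"] by simp
 next
  case False then show ?thesis using that supp asum_nonneg by auto
 qed
 show 1: "cmod (f t k) + cmod (g t k) <= a"
  using *[of f] *[of g] V_le_and_integral_V4_le(1)[OF assms] by simp
 show "cmod (f t k) <= a" "cmod (g t k) <= a"
  using 1 norm_ge_zero[of "f t k"] norm_ge_zero[of "g t k"] by linarith+
qed

lemma E2_le:
 assumes "t >= 0" "exp KE * qsum2 n 4 (f 0) (g 0) <= Q"
 shows "qsum N 4 (f t) <= Q" "qsum N 4 (g t) <= Q" "qsum2 n 4 (f t) (g t) <= Q"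
  "2 * ka * tint t (\<lambda>s. qsum2 n 8 (f s) (g s)) <= Q"
proof -
 have I: "0 <= 2 * ka * tint t (\<lambda>s. qsum2 n 8 (f s) (g s))"
  using nn by (intro mult_nonneg_nonneg integral_nonneg continuous_integrable cont_E2)
   (auto simp: qsum_nonneg add_nonneg_nonneg)
 have q: "0 <= qsum n 4 (f t)" "0 <= qsum n 4 (g t)" by (rule qsum_nonneg)+
 note e = energy_estimate[OF assms(1)]
 show 1: "qsum2 n 4 (f t) (g t) <= Q" using e I assms(2) by argo
 show "2 * ka * tint t (\<lambda>s. qsum2 n 8 (f s) (g s)) <= Q" using e q assms(2) by argo
 show "qsum N 4 (f t) <= Q" "qsum N 4 (g t) <= Q"
  using qsum_support[of N 4 t] 1 q by linarith+
qed

lemma rate_bound: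
 assumes t: "t >= 0" and Q: "exp KE * qsum2 n 4 (f 0) (g 0) <= Q"
 shows "cmod (rhs_f (f t) (g t) k) <= rate Q k" "cmod (rhs_g (f t) (g t) k) <= rate Q k"
proof -
 let ?k = "mag k"
 have Q0: "Q >= 0" using E2_le(1)[OF t Q, of 0] qsum_nonneg[of 0 4 "f t"] by linarith
 have lin: "cmod (lin a3 a1 b3 b1 (f t) (g t) k) <= coupling * (?k ^ 3 * a)"
  if "a3 >= 0" "a1 >= 0" "b3 >= 0" "b1 >= 0" "a3 + a1 + b3 + b1 <= coupling" for a3 a1 b3 b1
 proof -
  have "cmod (lin a3 a1 b3 b1 (f t) (g t) k) <= (a3 + a1 + b3 + b1) * (?k ^ 3 * (cmod (f t k) + cmod (g t k)))"
   by (rule cmod_lin_le_cubic) (use that in auto)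
  also have "... <= coupling * (?k ^ 3 * a)"
   using that by (intro mult_mono mult_left_mono mode_le_a t) auto
  finally show ?thesis .
 qed
 have conv: "cmod (gconv n u (lin a3 a1 b3 b1 (f t) (g t)) k) <= coupling * (?k + 1)\<^sup>2 * (2 * Q)"
  if "a3 >= 0" "a1 >= 0" "b3 >= 0" "b1 >= 0" "a3 + a1 + b3 + b1 <= coupling" "u = f t \<or> u = g t" for u a3 a1 b3 b1
 proof -
  have "cmod (gconv n u (lin a3 a1 b3 b1 (f t) (g t)) k) <= (\<Sum>j\<in>modes n. cmod (u (k - j) * lin a3 a1 b3 b1 (f t) (g t) j))"
   unfolding gconv_def by (rule norm_sum)
  also have "... <= (\<Sum>j\<in>modes n. mag j * cmod (u (k - j) * lin a3 a1 b3 b1 (f t) (g t) j))"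
  proof (rule sum_mono)
   fix j
   show "cmod (u (k - j) * lin a3 a1 b3 b1 (f t) (g t) j) <= mag j * cmod (u (k - j) * lin a3 a1 b3 b1 (f t) (g t) j)"
   proof (cases "j = 0")
    case False
    then have "1 <= mag j" by linarith
    from mult_right_mono[OF this] show ?thesis by simp
   qed (simp add: lin_def)
  qed
  also have "... <= (a3 + a1 + b3 + b1) * (?k + 1)\<^sup>2 * (2 * Q)"
   by (rule convolution_tail_bound) (use that supp E2_le[OF t Q] in auto)
  also have "... <= coupling * (?k + 1)\<^sup>2 * (2 * Q)"
   using that Q0 by (intro mult_right_mono) auto
  finally show ?thesis .
 qed
 have c: "Ag + br + A + b <= coupling" "Am + bm + Am + bm <= coupling" and c0: "coupling >= 0"
  unfolding coupling_def using nn by auto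
 have mm: "mf * (coupling * (?k ^ 3 * a)) <= (mf + mg) * (coupling * (?k ^ 3 * a))"
  "mg * (coupling * (?k ^ 3 * a)) <= (mf + mg) * (coupling * (?k ^ 3 * a))"
  using nn c0 by (intro mult_right_mono mult_nonneg_nonneg; simp)+
 have "mf * cmod (La (f t) (g t) k) <= mf * (coupling * (?k ^ 3 * a))" "mg * cmod (Lb (f t) (g t) k) <= mg * (coupling * (?k ^ 3 * a))"
  by (intro mult_left_mono lin nn c)+
 then have A: "mf * cmod (La (f t) (g t) k) + cmod (gconv n (f t) (La (f t) (g t)) k)
   <= (mf + mg) * (coupling * (?k ^ 3 * a)) + coupling * (?k + 1)\<^sup>2 * (2 * Q)"
  and B: "mg * cmod (Lb (f t) (g t) k) + cmod (gconv n (g t) (Lb (f t) (g t)) k)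
   <= (mf + mg) * (coupling * (?k ^ 3 * a)) + coupling * (?k + 1)\<^sup>2 * (2 * Q)"
  using mm by (intro add_mono conv nn c; simp)+
 show "cmod (rhs_f (f t) (g t) k) <= rate Q k" "cmod (rhs_g (f t) (g t) k) <= rate Q k"
  using order_trans[OF cmod_R_le(1) mult_left_mono[OF A]] order_trans[OF cmod_R_le(2) mult_left_mono[OF B]]
  by (simp_all add: rate_def R_eq_rhs[symmetric])
qed

lemma cont_R: "cont_nonneg (\<lambda>t. rhs_f (f t) (g t) k)" "cont_nonneg (\<lambda>t. rhs_g (f t) (g t) k)"
 unfolding R_eq_rhs[symmetric] Rf_def Rg_def
 by (intro continuous_on_mult_left continuous_on_add cont_lin cont_gconv cont)+

lemma integral_equation:
 assumes "t >= 0" "k \<in> modes n"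
 shows "f t k = f 0 k + tint t (\<lambda>s. rhs_f (f s) (g s) k)"
  "g t k = g 0 k + tint t (\<lambda>s. rhs_g (f s) (g s) k)"
proof -
 have "((\<lambda>s. rhs_f (f s) (g s) k) has_integral f t k - f 0 k) {0..t}"
  "((\<lambda>s. rhs_g (f s) (g s) k) has_integral g t k - g 0 k) {0..t}"
  using derivative[of _ k] assms unfolding R_eq_rhs
  by (intro fundamental_theorem_of_calculus_interior continuous_on_subset[OF cont(1)] continuous_on_subset[OF cont(2)]; auto)+
 then show "f t k = f 0 k + tint t (\<lambda>s. rhs_f (f s) (g s) k)"
  "g t k = g 0 k + tint t (\<lambda>s. rhs_g (f s) (g s) k)"
  by (simp_all add: integral_unique)
qed

lemma lipschitz_in_time:
 assumes st: "0 <= s" "0 <= t" and Q: "exp KE * qsum2 n 4 (f 0) (g 0) <= Q"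
 shows "cmod (f t k - f s k) <= rate Q k * \<bar>t - s\<bar>" "cmod (g t k - g s k) <= rate Q k * \<bar>t - s\<bar>"
proof -
 have rate0: "rate Q k >= 0" using rate_bound(1)[OF st(1) Q, of k] norm_ge_zero order_trans by blast
 have *: "cmod (u y k - u x k) <= rate Q k * (y - x)"
  if xy: "0 <= x" "x < y" and u: "u = f \<or> u = g" and k: "k \<in> modes n" for u x y
 proof -
  define R where "R \<tau> = (if u = f then rhs_f (f \<tau>) (g \<tau>) k else rhs_g (f \<tau>) (g \<tau>) k)" for \<tau>
  have d: "((\<lambda>s. u s k) has_vector_derivative R \<tau>) (at \<tau>)" if "\<tau> > 0" for \<tau>
   using derivative[OF that k] u by (auto simp: R_def R_eq_rhs)
  have "\<exists>\<tau>\<in>{x<..<y}. cmod (u y k - u x k) <= cmod ((\<lambda>\<tau> h. h *\<^sub>R R \<tau>) \<tau> (y - x))"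
  proof (rule mvt_general[OF xy(2), of "\<lambda>s. u s k" "\<lambda>\<tau> h. h *\<^sub>R R \<tau>"])
   have "cont_nonneg (\<lambda>s. u s k)" using u cont by auto
   then show "continuous_on {x..y} (\<lambda>s. u s k)" by (rule continuous_on_subset) (use xy in auto)
   show "((\<lambda>s. u s k) has_derivative (\<lambda>h. h *\<^sub>R R \<tau>)) (at \<tau>)" if "x < \<tau>" "\<tau> < y" for \<tau>
    using d[of \<tau>] that xy by (simp add: has_vector_derivative_def)
  qed
  then obtain \<tau> where \<tau>: "x < \<tau>" "cmod (u y k - u x k) <= cmod ((y - x) *\<^sub>R R \<tau>)" by auto
  have "cmod (R \<tau>) <= rate Q k" using rate_bound[OF _ Q, of \<tau> k] \<tau> xy by (auto simp: R_def)
  then have "cmod ((y - x) *\<^sub>R R \<tau>) <= (y - x) * rate Q k" using xy by (simp add: mult_left_mono)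
  with \<tau>(2) show ?thesis by (simp add: mult.commute)
 qed
 have "cmod (u t k - u s k) <= rate Q k * \<bar>t - s\<bar>" if u: "u = f \<or> u = g" for u
 proof (cases "k \<in> modes n")
  case True
  then show ?thesis using *[of s t u] *[of t s u] st u rate0
   by (cases s t rule: linorder_cases) (auto simp: norm_minus_commute)
 next
  case False
  then show ?thesis using u supp rate0 by auto
 qed
 then show "cmod (f t k - f s k) <= rate Q k * \<bar>t - s\<bar>" "cmod (g t k - g s k) <= rate Q k * \<bar>t - s\<bar>" by auto
qed

end

section \<open>Existence for the infinite coefficient system\<close>

lemma (in film) galerkin_exists:
 assumes h: "hermitian f0" "hermitian g0" "f0 0 = 0" "g0 0 = 0" and V: "asum2 n 0 f0 g0 <= a"
 shows "\<exists>f g \<theta>. galerkin mf mg Ag A Am br b bm a dA dB ka n f g \<theta> \<and>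
  (\<forall>k\<in>modes n. f 0 k = f0 k \<and> g 0 k = g0 k)"
proof (rule truncated_system[OF pos(9) h refl refl, where n = n and ?p3.0 = Ag and ?p1.0 = br
   and ?q3.0 = A and ?q1.0 = b and ?r3.0 = Am and ?r1.0 = bm and ?s3.0 = Am and ?s1.0 = bm
   and ?m1.0 = mf and ?m2.0 = mg])
 fix f g :: "real => int => complex" and \<theta> :: "real => real"
 assume *: "!!t. hermitian (f t)" "!!t. hermitian (g t)"
  "!!t k. k = 0 \<or> k \<notin> modes n ==> f t k = 0" "!!t k. k = 0 \<or> k \<notin> modes n ==> g t k = 0"
  and init: "!!k. k \<in> modes n ==> f 0 k = f0 k" "!!k. k \<in> modes n ==> g 0 k = g0 k"
  and **: "!!k. cont_nonneg (\<lambda>t. f t k)" "!!k. cont_nonneg (\<lambda>t. g t k)"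
  "cont_nonneg \<theta>" "!!t. 0 <= \<theta> t" "!!t. \<theta> t <= 1"
  "!!t. \<theta> t * (wsum n 0 (\<lambda>k. cmod (f t k)) + wsum n 0 (\<lambda>k. cmod (g t k))) <= a"
  "!!t. wsum n 0 (\<lambda>k. cmod (f t k)) + wsum n 0 (\<lambda>k. cmod (g t k)) <= a ==> \<theta> t = 1"
  "!!t k. t > 0 ==> k \<in> modes n ==> ((\<lambda>s. f s k) has_vector_derivative
   - of_int k * (of_real mf * La (f t) (g t) k + of_real ((\<theta> t)\<^sup>2) * gconv n (f t) (La (f t) (g t)) k)) (at t)"
  "!!t k. t > 0 ==> k \<in> modes n ==> ((\<lambda>s. g s k) has_vector_derivative
   - of_int k * (of_real mg * Lb (f t) (g t) k + of_real ((\<theta> t)\<^sup>2) * gconv n (g t) (Lb (f t) (g t)) k)) (at t)"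
 have V0: "asum2 n 0 (f 0) (g 0) <= a"
  using V init by (simp add: asum_def wsum_def)
 have "galerkin mf mg Ag A Am br b bm a dA dB ka n f g \<theta>"
  by (intro galerkin.intro galerkin_axioms.intro film_axioms; (rule * ** V0 **[folded asum_def]; assumption?))
 then show ?thesis using init by blast
qed

lemma integral_limit_bounded:
 fixes h :: "nat => real => 'a::euclidean_space"
 assumes "!!m. cont_nonneg (h m)" "!!m s. s \<in> {0..t} ==> norm (h m s) <= C"
  "!!s. s \<in> {0..t} ==> (\<lambda>m. h m s) \<longlonglongrightarrow> h' s"
 shows "(\<lambda>m. tint t (h m)) \<longlonglongrightarrow> tint t h'"
 by (rule dominated_convergence(2)[of h "{0..t}" "\<lambda>s. C"])
  (use assms in \<open>auto intro: continuous_integrable\<close>)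

lemma wsum_bounded:
 assumes "!!k. k \<in> modes n ==> 0 <= x k" "!!k. k \<in> modes n ==> x k <= y k"
 shows "norm (wsum n p x) <= wsum n p y"
proof -
 have "0 <= wsum n p x" unfolding wsum_def using assms by (intro sum_nonneg) auto
 moreover have "wsum n p x <= wsum n p y" unfolding wsum_def using assms by (intro sum_mono mult_left_mono) auto
 ultimately show ?thesis by simp
qed

definition (in film) "power_bound Q = CD * (Q / (2 * ka) + Q * (a / dA))"

text \<open>What survives the limit. The bounds are stated for partial sums with arbitrary
  \<open>n\<close>, so that no summability is presupposed. The construction continues the modes to
  negative times as constants, whence continuity on \<open>UNIV\<close>; the equation itself is
  asked for \<open>t > 0\<close>.\<close>

locale film_solution = film +
 fixes f g :: "real => int => complex" and V0 Q :: real
 assumes herm: "hermitian (f t)" "hermitian (g t)"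
  and zero: "f t 0 = 0" "g t 0 = 0"
  and cont: "continuous_on UNIV (\<lambda>t. f t k)" "continuous_on UNIV (\<lambda>t. g t k)"
  and cont_iconv: "continuous_on UNIV (\<lambda>t. iconv (f t) (La (f t) (g t)) k)"
   "continuous_on UNIV (\<lambda>t. iconv (g t) (Lb (f t) (g t)) k)"
  and deriv: "t > 0 ==> ((\<lambda>s. f s k) has_vector_derivative rhs_f (f t) (g t) k) (at t)"
   "t > 0 ==> ((\<lambda>s. g s k) has_vector_derivative rhs_g (f t) (g t) k) (at t)"
  and V0: "V0 <= a"
  and V_le: "t >= 0 ==> asum2 n 0 (f t) (g t) <= V0 * exp (- (dA + dB) * t)"
  and int_V4: "t >= 0 ==> tint t (\<lambda>s. asum2 n 4 (f s) (g s)) <= a / dA"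
  and E_le: "t >= 0 ==> qsum n 4 (f t) + qsum n 4 (g t)
   + 2 * ka * tint t (\<lambda>s. qsum2 n 8 (f s) (g s)) <= Q"
  and power_le: "t >= 0 ==> tint t (\<lambda>s. power2s n (f s) (g s)) <= power_bound Q"

lemma (in galerkin) integral_power_le:
 assumes t: "t >= 0" and Q: "exp KE * qsum2 n 4 (f 0) (g 0) <= Q"
 shows "tint t (\<lambda>s. power2s N (f s) (g s)) <= power_bound Q"
proof -
 have Q0: "Q >= 0" using E2_le(1)[OF t Q, of 0] qsum_nonneg[of 0 4 "f t"] by linarith
 have CD0: "CD >= 0" unfolding CD_def using nn CE_nonneg by simp
 let ?V4 = "\<lambda>s. asum2 n 4 (f s) (g s)" and ?E8 = "\<lambda>s. qsum2 n 8 (f s) (g s)"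
 have c: "cont_nonneg (\<lambda>s. power2s N (f s) (g s))"
  unfolding wsum_def
  by (intro continuous_on_add continuous_on_sum continuous_on_mult_left continuous_on_mult continuous_on_norm cont cont_R)
 have c2: "cont_nonneg (\<lambda>s. CD * (?E8 s + Q * ?V4 s))"
  by (intro continuous_on_mult_left continuous_on_add cont_E2 cont_V4)
 have "tint t (\<lambda>s. power2s N (f s) (g s))
  <= tint t (\<lambda>s. CD * (?E8 s + Q * ?V4 s))"
 proof (rule integral_le)
  fix s assume s: "s \<in> {0..t}"
  have "power2s N (f s) (g s)
   <= power2s n (f s) (g s)"
   by (intro add_mono wsum_le_of_support) (simp_all add: supp)
  also have "... <= CD * (?E8 s + ?V4 s * qsum2 n 4 (f s) (g s))"
   using power_estimate[of s] s unfolding R_eq_rhs by simp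
  also have "... <= CD * (?E8 s + ?V4 s * Q)"
   using E2_le(3)[OF _ Q, of s] s CD0
   by (intro mult_left_mono add_mono) (auto simp: asum_nonneg)
  finally show "power2s N (f s) (g s)
   <= CD * (?E8 s + Q * ?V4 s)" by (simp only: mult.commute)
 qed (rule continuous_integrable, rule c c2)+
 also have "... = CD * (tint t ?E8 + Q * tint t ?V4)"
 proof -
  have "tint t (\<lambda>s. ?E8 s + Q * ?V4 s) = tint t ?E8 + tint t (\<lambda>s. Q * ?V4 s)"
   by (intro integral_add continuous_integrable continuous_on_mult_left cont_E2 cont_V4)
  then show ?thesis by simp
 qed
 also have "... <= CD * (Q / (2 * ka) + Q * (a / dA))"
 proof (intro mult_left_mono add_mono CD0 Q0)
  show "tint t ?E8 <= Q / (2 * ka)"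
   using E2_le(4)[OF t Q] pos by (simp add: field_simps)
  show "tint t ?V4 <= a / dA"
   using V_le_and_integral_V4_le(2)[OF t] pos by (simp add: field_simps)
 qed
 finally show ?thesis by (simp only: power_bound_def)
qed

theorem (in film) coefficient_solution:
 assumes h: "hermitian f0" "hermitian g0" "f0 0 = 0" "g0 0 = 0"
  and V: "!!n. asum2 n 0 f0 g0 <= V0" and V0a: "V0 <= a"
  and E: "!!n. qsum2 n 4 f0 g0 <= Q0"
 shows "\<exists>f g. film_solution mf mg Ag A Am br b bm a dA dB ka f g V0 (exp KE * Q0) \<and> f 0 = f0 \<and> g 0 = g0"
proof -
 define Q where "Q = exp KE * Q0"
 have "\<forall>n. \<exists>f g \<theta>. galerkin mf mg Ag A Am br b bm a dA dB ka n f g \<theta> \<and>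
  (\<forall>k\<in>modes n. f 0 k = f0 k \<and> g 0 k = g0 k)"
  using galerkin_exists[OF h order_trans[OF V V0a]] by (rule allI)
 from choice[OF this] obtain F where "\<forall>n. \<exists>g \<theta>. galerkin mf mg Ag A Am br b bm a dA dB ka n (F n) g \<theta> \<and>
  (\<forall>k\<in>modes n. F n 0 k = f0 k \<and> g 0 k = g0 k)" ..
 from choice[OF this] obtain G where "\<forall>n. \<exists>\<theta>. galerkin mf mg Ag A Am br b bm a dA dB ka n (F n) (G n) \<theta> \<and>
  (\<forall>k\<in>modes n. F n 0 k = f0 k \<and> G n 0 k = g0 k)" ..
 from choice[OF this] obtain \<Theta> where "\<forall>n. galerkin mf mg Ag A Am br b bm a dA dB ka n (F n) (G n) (\<Theta> n) \<and>
  (\<forall>k\<in>modes n. F n 0 k = f0 k \<and> G n 0 k = g0 k)" ..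
 then have gal: "!!n. galerkin mf mg Ag A Am br b bm a dA dB ka n (F n) (G n) (\<Theta> n)"
  and init: "!!n k. k \<in> modes n ==> F n 0 k = f0 k" "!!n k. k \<in> modes n ==> G n 0 k = g0 k" by auto
 have sums0: "asum2 n 0 (F n 0) (G n 0) <= V0" "qsum2 n 4 (F n 0) (G n 0) <= Q0" for n
  using V[of n] E[of n] init by (simp_all add: asum_def qsum_def wsum_def)
 have Qn: "exp KE * qsum2 n 4 (F n 0) (G n 0) <= Q" for n
  unfolding Q_def using sums0(2)[of n] by simp
 define H where "H s n = (if s then F n else G n)" for s :: bool and n
 have H_bound: "cmod (H s n t k) <= a" if "t >= 0" for s n t k
  using galerkin.mode_le_a[OF gal[of n] that] by (simp add: H_def)
 have H_lip: "cmod (H s n t k - H s n t' k) <= rate Q k * \<bar>t - t'\<bar>" if "t >= 0" "t' >= 0" for s n t t' k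
  using galerkin.lipschitz_in_time[OF gal[of n] that(2,1) Qn[of n]] by (simp add: H_def)
 \<comment> \<open>Rational times keep the index set countable; the common Lipschitz constants carry
   convergence over to all other times.\<close>
 define S where "S = {(s::bool, q::real, k::int). q \<in> \<rat> \<and> q >= 0}"
 have "countable ((UNIV::bool set) \<times> (\<rat>::real set) \<times> (UNIV::int set))"
  by (intro countable_SIGMA countable_rat) auto
 then have S: "countable S" by (rule countable_subset[rotated]) (auto simp: S_def)
 define h where "h n x = (case x of (s, q, k) => H s n q k)" for n and x :: "bool \<times> real \<times> int"
 have hb: "norm (h n x) <= a" if "x \<in> S" for n x
  using that H_bound by (auto simp: S_def h_def)
 obtain r where r: "strict_mono r"
  and conv: "!!x. x \<in> S ==> \<exists>l. (\<lambda>m. h (r m) x) \<longlonglongrightarrow> l"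
  using function_convergent_subsequence[of S h a, OF S hb] by blast
 have convq: "convergent (\<lambda>m. H s (r m) q k)" if "q \<in> \<rat>" "q >= 0" for s q k
  using conv[of "(s, q, k)"] that by (simp add: S_def convergent_def h_def)
 have convt: "convergent (\<lambda>m. H s (r m) t k)" if t: "t >= 0" for s t k
 proof -
  have "Cauchy (\<lambda>m. H s (r m) t k)"
  proof (rule CauchyI)
   fix e :: real assume e: "e > 0"
   \<comment> \<open>A positive substitute for the Lipschitz constant, by which \<open>e\<close> can
     be divided.\<close>
   define R where "R = \<bar>rate Q k\<bar> + 1"
   have R: "R > 0" "rate Q k <= R" by (auto simp: R_def)
   obtain q where q: "q \<in> \<rat>" "t < q" "q < t + e / (3 * R)"
    using Rats_dense_in_real[of t "t + e / (3 * R)"] e R by auto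
   have near: "cmod (H s n t k - H s n q k) < e / 3" for n
   proof -
    have "cmod (H s n t k - H s n q k) <= rate Q k * \<bar>t - q\<bar>" using H_lip[of t q s n k] t q by simp
    also have "... <= R * \<bar>t - q\<bar>" using R by (intro mult_right_mono) auto
    also have "... < R * (e / (3 * R))" using q R by (intro mult_strict_left_mono) auto
    also have "... = e / 3" using R by simp
    finally show ?thesis .
   qed
   have "Cauchy (\<lambda>m. H s (r m) q k)" using convq[of q s k] q t by (intro convergent_Cauchy) auto
   then obtain M where M: "!!m n. m >= M ==> n >= M ==> cmod (H s (r m) q k - H s (r n) q k) < e / 3"
    using CauchyD[of _ "e / 3"] e by fastforce
   show "\<exists>M. \<forall>m\<ge>M. \<forall>n\<ge>M. cmod (H s (r m) t k - H s (r n) t k) < e"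
   proof (intro exI allI impI)
    fix m n assume mn: "m >= M" "n >= M"
    have "H s (r m) t k - H s (r n) t k = (H s (r m) t k - H s (r m) q k) + (H s (r m) q k - H s (r n) q k)
     + - (H s (r n) t k - H s (r n) q k)" by simp
    then have "cmod (H s (r m) t k - H s (r n) t k) <= cmod (H s (r m) t k - H s (r m) q k)
     + cmod (H s (r m) q k - H s (r n) q k) + cmod (H s (r n) t k - H s (r n) q k)"
     by (metis (no_types, lifting) norm_triangle_ineq norm_minus_cancel add_right_mono order_trans)
    then show "cmod (H s (r m) t k - H s (r n) t k) < e"
     using near[of "r m"] near[of "r n"] M[OF mn] by linarith
   qed
  qed
  then show ?thesis by (simp add: Cauchy_convergent_iff)
 qed
 \<comment> \<open>Continuing by the initial value makes the modes Lipschitz on the whole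
   line.\<close>
 define u where "u s t k = lim (\<lambda>m. H s (r m) (max 0 t) k)" for s t k
 have lim: "(\<lambda>m. H s (r m) (max 0 t) k) \<longlonglongrightarrow> u s t k" for s t k
  unfolding u_def using convt[of "max 0 t" s k] by (simp add: convergent_LIMSEQ_iff)
 define f g where "f = u True" and "g = u False"
 have limf: "(\<lambda>m. F (r m) (max 0 t) k) \<longlonglongrightarrow> f t k" and limg: "(\<lambda>m. G (r m) (max 0 t) k) \<longlonglongrightarrow> g t k" for t k
  using lim[of True t k] lim[of False t k] by (simp_all add: H_def f_def g_def)

 \<comment> \<open>Symmetry, bounds and continuity of the limit\<close>
 have QN: "qsum N 4 (F n (max 0 t)) <= Q" "qsum N 4 (G n (max 0 t)) <= Q" for N n t
  using galerkin.E2_le[OF gal[of n] _ Qn[of n], of "max 0 t"] by auto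
 have qfg: "qsum N 4 (f t) <= Q" "qsum N 4 (g t) <= Q" for N t
  by (rule LIMSEQ_le_const2[OF tendsto_qsum[OF limf]], use QN in blast,
    rule LIMSEQ_le_const2[OF tendsto_qsum[OF limg]], use QN in blast)
 have zeroFG: "F n t 0 = 0" "G n t 0 = 0" for n t using galerkin.supp[OF gal[of n]] by auto
 have zero: "f t 0 = 0" "g t 0 = 0" for t
  using limf[of t 0] limg[of t 0] by (auto simp: zeroFG LIMSEQ_const_iff)
 have herm: "hermitian (f t)" "hermitian (g t)" for t
 proof -
  have "(\<lambda>m. cnj (F (r m) (max 0 t) k)) \<longlonglongrightarrow> f t (- k)" "(\<lambda>m. cnj (G (r m) (max 0 t) k)) \<longlonglongrightarrow> g t (- k)" for k
   using limf[of t "- k"] limg[of t "- k"] by (simp_all add: hermitianD[OF galerkin.herm(1)[OF gal]] hermitianD[OF galerkin.herm(2)[OF gal]])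
  then show "hermitian (f t)" "hermitian (g t)"
   unfolding hermitian_def using tendsto_cnj[OF limf] tendsto_cnj[OF limg] LIMSEQ_unique by blast+
 qed
 have lip: "cmod (u s t k - u s t' k) <= rate Q k * \<bar>t - t'\<bar>" for s t t' k
 proof (rule LIMSEQ_le_const2[OF tendsto_norm[OF tendsto_diff[OF lim lim]]])
  have rate0: "0 <= rate Q k" using order_trans[OF norm_ge_zero H_lip[of 0 1 s 0 k]] by simp
  have "cmod (H s (r m) (max 0 t) k - H s (r m) (max 0 t') k) <= rate Q k * \<bar>t - t'\<bar>" for m
  proof -
   have "cmod (H s (r m) (max 0 t) k - H s (r m) (max 0 t') k) <= rate Q k * \<bar>max 0 t - max 0 t'\<bar>"
    by (rule H_lip) auto
   also have "... <= rate Q k * \<bar>t - t'\<bar>" using rate0 by (intro mult_left_mono) (auto simp: max_def)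
   finally show ?thesis .
  qed
  then show "\<exists>N. \<forall>m\<ge>N. cmod (H s (r m) (max 0 t) k - H s (r m) (max 0 t') k) <= rate Q k * \<bar>t - t'\<bar>" by blast
 qed
 have cont_u: "continuous_on UNIV (\<lambda>t. u s t k)" for s k
 proof -
  have "0 <= rate Q k" using order_trans[OF norm_ge_zero lip[of s 0 k 1]] by simp
  then have "(rate Q k)-lipschitz_on UNIV (\<lambda>t. u s t k)"
   using lip by (intro lipschitz_onI) (auto simp: dist_norm)
  then show ?thesis by (rule lipschitz_on_continuous_on)
 qed
 have cont: "continuous_on UNIV (\<lambda>t. f t k)" "continuous_on UNIV (\<lambda>t. g t k)" for k
  unfolding f_def g_def by (rule cont_u)+
 have cont_seq: "(\<lambda>m. f (x m) k) \<longlonglongrightarrow> f y k" "(\<lambda>m. g (x m) k) \<longlonglongrightarrow> g y k" if "x \<longlonglongrightarrow> y" for x y k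
  using continuous_on_tendsto_compose[OF cont(1) that] continuous_on_tendsto_compose[OF cont(2) that] by simp_all
 have cont_iconv_lin: "continuous_on UNIV (\<lambda>t. iconv (w t) (lin a3 a1 b3 b1 (f t) (g t)) k)"
  if w: "w = f \<or> w = g" and c: "a3 >= 0" "a1 >= 0" "b3 >= 0" "b1 >= 0" for w a3 a1 b3 b1 k
 proof (rule continuous_on_sequentiallyI)
  fix x y assume x: "x \<longlonglongrightarrow> (y::real)"
  show "(\<lambda>m. iconv (w (x m)) (lin a3 a1 b3 b1 (f (x m)) (g (x m))) k) \<longlonglongrightarrow> iconv (w y) (lin a3 a1 b3 b1 (f y) (g y)) k"
  proof (rule tendsto_iconv_lin[OF c, where Q = Q])
   show "w (x m) 0 = 0" for m using w zero by auto
   show "qsum n 4 (w (x m)) <= Q" for n m using w qfg by auto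
   show "(\<lambda>m. w (x m) k) \<longlonglongrightarrow> w y k" for k using w cont_seq[OF x] by auto
  qed (use qfg cont_seq[OF x] in auto)
 qed
 have cont_iconv: "continuous_on UNIV (\<lambda>t. iconv (f t) (La (f t) (g t)) k)"
   "continuous_on UNIV (\<lambda>t. iconv (g t) (Lb (f t) (g t)) k)" for k
  using nn by (auto intro!: cont_iconv_lin)
 have cont_rhs: "cont_nonneg (\<lambda>t. rhs_f (f t) (g t) k)" "cont_nonneg (\<lambda>t. rhs_g (f t) (g t) k)" for k
  unfolding rhs_f_def rhs_g_def lin_def[of _ _ _ _ _ _ k]
  by (intro continuous_on_mult_left continuous_on_add continuous_on_subset[OF cont_iconv(1)]
    continuous_on_subset[OF cont_iconv(2)] continuous_on_subset[OF cont(1)] continuous_on_subset[OF cont(2)] subset_UNIV)+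

 \<comment> \<open>Passage to the limit in the equation\<close>
 have lim_rhs: "(\<lambda>m. rhs_f (F (r m) (max 0 t)) (G (r m) (max 0 t)) k) \<longlonglongrightarrow> rhs_f (f t) (g t) k"
  "(\<lambda>m. rhs_g (F (r m) (max 0 t)) (G (r m) (max 0 t)) k) \<longlonglongrightarrow> rhs_g (f t) (g t) k" for t k
 proof -
  have "(\<lambda>m. iconv (F (r m) (max 0 t)) (La (F (r m) (max 0 t)) (G (r m) (max 0 t))) k) \<longlonglongrightarrow> iconv (f t) (La (f t) (g t)) k"
   by (rule tendsto_iconv_lin[where Q = Q]) (use nn zeroFG QN limf limg in auto)
  then show "(\<lambda>m. rhs_f (F (r m) (max 0 t)) (G (r m) (max 0 t)) k) \<longlonglongrightarrow> rhs_f (f t) (g t) k"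
   unfolding rhs_f_def by (intro tendsto_mult_left tendsto_add tendsto_lin limf limg)
  have "(\<lambda>m. iconv (G (r m) (max 0 t)) (Lb (F (r m) (max 0 t)) (G (r m) (max 0 t))) k) \<longlonglongrightarrow> iconv (g t) (Lb (f t) (g t)) k"
   by (rule tendsto_iconv_lin[where Q = Q]) (use nn zeroFG QN limf limg in auto)
  then show "(\<lambda>m. rhs_g (F (r m) (max 0 t)) (G (r m) (max 0 t)) k) \<longlonglongrightarrow> rhs_g (f t) (g t) k"
   unfolding rhs_g_def by (intro tendsto_mult_left tendsto_add tendsto_lin limf limg)
 qed
 have rate_FG: "cmod (rhs_f (F n s) (G n s) k) <= rate Q k" "cmod (rhs_g (F n s) (G n s) k) <= rate Q k" if "s >= 0" for n s k
  using galerkin.rate_bound[OF gal[of n] that Qn[of n]] by auto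
 note cR = galerkin.cont_R[OF gal]
 have lim_f: "(\<lambda>m. F (r m) t k) \<longlonglongrightarrow> f t k" "(\<lambda>m. G (r m) t k) \<longlonglongrightarrow> g t k"
  "(\<lambda>m. rhs_f (F (r m) t) (G (r m) t) k) \<longlonglongrightarrow> rhs_f (f t) (g t) k"
  "(\<lambda>m. rhs_g (F (r m) t) (G (r m) t) k) \<longlonglongrightarrow> rhs_g (f t) (g t) k" if "t >= 0" for t k
  using limf[of t k] limg[of t k] lim_rhs[of t k] that by (simp_all add: max_absorb2)
 \<comment> \<open>A mode satisfies its equation only in truncations that contain it; along the
   subsequence this holds eventually.\<close>
 have ev: "\<forall>\<^sub>F m in sequentially. k \<in> modes (r m)" for k
 proof (rule eventually_sequentiallyI[of "nat \<bar>k\<bar>"])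
  fix m assume "nat \<bar>k\<bar> <= m"
  then show "k \<in> modes (r m)" using seq_suble[OF r, of m] by (simp add: mem_modes)
 qed
 have init_lim: "f 0 k = f0 k" "g 0 k = g0 k" for k
 proof -
  have "\<forall>\<^sub>F m in sequentially. F (r m) 0 k = f0 k" "\<forall>\<^sub>F m in sequentially. G (r m) 0 k = g0 k"
   using ev[of k] by (eventually_elim, simp add: init)+
  then have "(\<lambda>m. F (r m) 0 k) \<longlonglongrightarrow> f0 k" "(\<lambda>m. G (r m) 0 k) \<longlonglongrightarrow> g0 k" by (simp_all add: tendsto_eventually)
  then show "f 0 k = f0 k" "g 0 k = g0 k" using lim_f[of 0 k] LIMSEQ_unique by auto
 qed
 have int_eq: "f t k = f 0 k + tint t (\<lambda>s. rhs_f (f s) (g s) k)"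
  "g t k = g 0 k + tint t (\<lambda>s. rhs_g (f s) (g s) k)" if t: "t >= 0" for t k
 proof -
  have If: "(\<lambda>m. tint t (\<lambda>s. rhs_f (F (r m) s) (G (r m) s) k)) \<longlonglongrightarrow> tint t (\<lambda>s. rhs_f (f s) (g s) k)"
   and Ig: "(\<lambda>m. tint t (\<lambda>s. rhs_g (F (r m) s) (G (r m) s) k)) \<longlonglongrightarrow> tint t (\<lambda>s. rhs_g (f s) (g s) k)"
   by (rule integral_limit_bounded[where C = "rate Q k"]; use cR rate_FG lim_f in simp)+
  have "\<forall>\<^sub>F m in sequentially. F (r m) 0 k + tint t (\<lambda>s. rhs_f (F (r m) s) (G (r m) s) k) = F (r m) t k"
   "\<forall>\<^sub>F m in sequentially. G (r m) 0 k + tint t (\<lambda>s. rhs_g (F (r m) s) (G (r m) s) k) = G (r m) t k"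
   using ev[of k] by (eventually_elim, use galerkin.integral_equation[OF gal t] in simp)+
  then have "(\<lambda>m. F (r m) t k) \<longlonglongrightarrow> f 0 k + tint t (\<lambda>s. rhs_f (f s) (g s) k)"
   "(\<lambda>m. G (r m) t k) \<longlonglongrightarrow> g 0 k + tint t (\<lambda>s. rhs_g (f s) (g s) k)"
   using Lim_transform_eventually[OF tendsto_add[OF lim_f(1)[of 0 k] If]]
    Lim_transform_eventually[OF tendsto_add[OF lim_f(2)[of 0 k] Ig]] by auto
  then show "f t k = f 0 k + tint t (\<lambda>s. rhs_f (f s) (g s) k)"
   "g t k = g 0 k + tint t (\<lambda>s. rhs_g (f s) (g s) k)"
   using lim_f(1,2)[OF t, of k] LIMSEQ_unique by blast+
 qed
 have from_int: "((\<lambda>s. w s k) has_vector_derivative R t) (at t)"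
  if t: "t > 0" and cR: "cont_nonneg R" and eq: "!!t. t >= 0 ==> w t k = w 0 k + tint t R"
  for w :: "real => int => complex" and R t k
 proof -
  have "((\<lambda>s. w 0 k + tint s R) has_vector_derivative 0 + R t) (at t)"
   by (rule has_vector_derivative_add[OF has_vector_derivative_const FTC_atLeast[OF cR t]])
  then have "((\<lambda>s. w 0 k + tint s R) has_vector_derivative R t) (at t)" by simp
  then show ?thesis
   by (rule has_vector_derivative_transform_within_open[of _ _ _ "{0<..}"]) (use t in \<open>auto simp: eq[symmetric]\<close>)
 qed
 note cF = galerkin.cont(1)[OF gal] and cG = galerkin.cont(2)[OF gal]
 have mode_a: "cmod (F n s k) <= a" "cmod (G n s k) <= a" if "s >= 0" for n s k
  using galerkin.mode_le_a[OF gal[of n] that] by auto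

 \<comment> \<open>The bounds for the limit\<close>
 have "film_solution mf mg Ag A Am br b bm a dA dB ka f g V0 Q"
 proof unfold_locales
  show "hermitian (f t)" "hermitian (g t)" for t by (rule herm)+
  show "f t 0 = 0" "g t 0 = 0" for t by (rule zero)+
  show "continuous_on UNIV (\<lambda>t. f t k)" "continuous_on UNIV (\<lambda>t. g t k)" for k by (rule cont)+
  show "continuous_on UNIV (\<lambda>t. iconv (f t) (La (f t) (g t)) k)"
   "continuous_on UNIV (\<lambda>t. iconv (g t) (Lb (f t) (g t)) k)" for k by (rule cont_iconv)+
  show "((\<lambda>s. f s k) has_vector_derivative rhs_f (f t) (g t) k) (at t)"
   "((\<lambda>s. g s k) has_vector_derivative rhs_g (f t) (g t) k) (at t)" if "t > 0" for t k
   by (rule from_int[OF that cont_rhs(1) int_eq(1)], assumption, rule from_int[OF that cont_rhs(2) int_eq(2)], assumption)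
  show "V0 <= a" by (rule V0a)
  show "asum2 n 0 (f t) (g t) <= V0 * exp (- (dA + dB) * t)" if t: "t >= 0" for t n
  proof (rule LIMSEQ_le_const2[OF tendsto_add[OF tendsto_asum[OF lim_f(1)[OF t]] tendsto_asum[OF lim_f(2)[OF t]]]])
   have "asum2 n 0 (F m t) (G m t) <= V0 * exp (- (dA + dB) * t)" for m
   proof -
    have "0 <= tint t (\<lambda>s. exp ((dA + dB) * s) * asum2 m 4 (F m s) (G m s))"
    proof (intro integral_nonneg continuous_integrable)
     show "cont_nonneg (\<lambda>s. exp ((dA + dB) * s) * asum2 m 4 (F m s) (G m s))"
      by (rule continuous_on_mult[OF _ galerkin.cont_V4[OF gal]]) (intro continuous_intros)
    qed (simp add: asum_nonneg)
    then have "0 <= dA * tint t (\<lambda>s. exp ((dA + dB) * s) * asum2 m 4 (F m s) (G m s))"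
     using nn by (intro mult_nonneg_nonneg)
    then have "exp ((dA + dB) * t) * asum2 m 0 (F m t) (G m t) <= V0"
     using galerkin.wiener_estimate[OF gal t, of m] sums0(1)[of m] by argo
    then have "asum2 m 0 (F m t) (G m t) <= V0 * exp (- (dA + dB) * t)"
     by (simp only: mult_minus_left exp_minus) (simp add: field_simps)
    then show ?thesis using galerkin.asum_support[OF gal, of n 0 m t] by linarith
   qed
   then show "\<exists>N. \<forall>m\<ge>N. asum2 n 0 (F (r m) t) (G (r m) t) <= V0 * exp (- (dA + dB) * t)" by blast
  qed
  show "tint t (\<lambda>s. asum2 n 4 (f s) (g s)) <= a / dA" if t: "t >= 0" for t n
  proof (rule LIMSEQ_le_const2[OF integral_limit_bounded])
   show "cont_nonneg (\<lambda>s. asum2 n 4 (F (r m) s) (G (r m) s))" for m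
    by (intro continuous_on_add continuous_on_asum cF cG)
   \<comment> \<open>A crude majorant for dominated convergence in time; since \<open>n\<close> is
     fixed, it may depend on \<open>n\<close>.\<close>
   show "norm (asum2 n 4 (F (r m) s) (G (r m) s)) <= wsum n 4 (\<lambda>k. a) + wsum n 4 (\<lambda>k. a)"
    if "s \<in> {0..t}" for m s
    unfolding asum_def using that mode_a
    by (intro norm_triangle_le add_mono wsum_bounded) auto
   show "(\<lambda>m. asum2 n 4 (F (r m) s) (G (r m) s)) \<longlonglongrightarrow> asum2 n 4 (f s) (g s)" if "s \<in> {0..t}" for s
    using that by (intro tendsto_add tendsto_asum lim_f) auto
   \<comment> \<open>For fixed \<open>n\<close> the partial sum of the \<open>m\<close>th solution
     is at most its full sum, for which the bound is uniform in \<open>m\<close>. Thus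
     \<open>m\<close> tends to infinity with \<open>n\<close> fixed; the other bounds below follow
     the same pattern.\<close>
   have "tint t (\<lambda>s. asum2 n 4 (F m s) (G m s)) <= a / dA" for m
   proof -
    have "tint t (\<lambda>s. asum2 n 4 (F m s) (G m s)) <= tint t (\<lambda>s. asum2 m 4 (F m s) (G m s))"
     by (intro integral_le continuous_integrable continuous_on_add continuous_on_asum cF cG
       add_mono galerkin.asum_support[OF gal])
    also have "... <= a / dA"
     using galerkin.V_le_and_integral_V4_le(2)[OF gal t, of m] pos by (simp add: field_simps)
    finally show ?thesis .
   qed
   then show "\<exists>N. \<forall>m\<ge>N. tint t (\<lambda>s. asum2 n 4 (F (r m) s) (G (r m) s)) <= a / dA" by blast
  qed
  show "qsum n 4 (f t) + qsum n 4 (g t) + 2 * ka * tint t (\<lambda>s. qsum2 n 8 (f s) (g s)) <= Q"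
   if t: "t >= 0" for t n
  proof (rule LIMSEQ_le_const2[OF tendsto_add[OF tendsto_add[OF tendsto_qsum[OF lim_f(1)[OF t]]
      tendsto_qsum[OF lim_f(2)[OF t]]] tendsto_mult_left[OF integral_limit_bounded]]])
   show "cont_nonneg (\<lambda>s. qsum2 n 8 (F (r m) s) (G (r m) s))" for m
    by (intro continuous_on_add continuous_on_qsum cF cG)
   show "norm (qsum2 n 8 (F (r m) s) (G (r m) s)) <= wsum n 8 (\<lambda>k. a\<^sup>2) + wsum n 8 (\<lambda>k. a\<^sup>2)"
    if "s \<in> {0..t}" for m s
    unfolding qsum_def using that mode_a
    by (intro norm_triangle_le add_mono wsum_bounded power_mono) auto
   show "(\<lambda>m. qsum2 n 8 (F (r m) s) (G (r m) s)) \<longlonglongrightarrow> qsum2 n 8 (f s) (g s)" if "s \<in> {0..t}" for s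
    using that by (intro tendsto_add tendsto_qsum lim_f) auto
   have "qsum n 4 (F m t) + qsum n 4 (G m t) + 2 * ka * tint t (\<lambda>s. qsum2 n 8 (F m s) (G m s)) <= Q" for m
   proof -
    have "tint t (\<lambda>s. qsum2 n 8 (F m s) (G m s)) <= tint t (\<lambda>s. qsum2 m 8 (F m s) (G m s))"
     by (intro integral_le continuous_integrable continuous_on_add continuous_on_qsum cF cG
       add_mono galerkin.qsum_support[OF gal])
    then have "2 * ka * tint t (\<lambda>s. qsum2 n 8 (F m s) (G m s)) <= 2 * ka * tint t (\<lambda>s. qsum2 m 8 (F m s) (G m s))"
     using nn by (intro mult_left_mono) auto
    then show ?thesis
     using galerkin.energy_estimate[OF gal t, of m] galerkin.qsum_support[OF gal, of n 4 m t] Qn[of m] by argo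
   qed
   then show "\<exists>N. \<forall>m\<ge>N. qsum n 4 (F (r m) t) + qsum n 4 (G (r m) t)
    + 2 * ka * tint t (\<lambda>s. qsum2 n 8 (F (r m) s) (G (r m) s)) <= Q" by blast
  qed
  show "tint t (\<lambda>s. power2s n (f s) (g s)) <= power_bound Q" if t: "t >= 0" for t n
  proof (rule LIMSEQ_le_const2[OF integral_limit_bounded])
   show "cont_nonneg (\<lambda>s. power2s n (F (r m) s) (G (r m) s))" for m
    unfolding wsum_def
    by (intro continuous_on_add continuous_on_sum continuous_on_mult_left continuous_on_mult continuous_on_norm cF cG cR)
   show "norm (power2s n (F (r m) s) (G (r m) s))
    <= wsum n 4 (\<lambda>k. a * rate Q k) + wsum n 4 (\<lambda>k. a * rate Q k)"
    if "s \<in> {0..t}" for m s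
    using that mode_a rate_FG nn(9)
    by (intro norm_triangle_le add_mono wsum_bounded mult_mono) auto
   show "(\<lambda>m. power2s n (F (r m) s) (G (r m) s))
    \<longlonglongrightarrow> power2s n (f s) (g s)" if "s \<in> {0..t}" for s
    unfolding wsum_def using that
    by (intro tendsto_add tendsto_sum tendsto_mult_left tendsto_mult tendsto_norm lim_f) auto
   show "\<exists>N. \<forall>m\<ge>N. tint t (\<lambda>s. power2s n (F (r m) s) (G (r m) s)) <= power_bound Q"
    by (intro exI allI impI galerkin.integral_power_le[OF gal t Qn])
  qed
 qed
 moreover have "f 0 = f0" "g 0 = g0" using init_lim by auto
 ultimately show ?thesis unfolding Q_def by blast
qed

section \<open>Uniqueness of Fourier coefficients\<close>

text \<open>Along \<open>int_decode\<close> sums over the integers become series, for which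
  dominated convergence and integration term by term are available.\<close>

lemma infsum_int_eq_suminf:
 fixes f :: "int => 'a::banach"
 assumes "(\<lambda>k. norm (f k)) summable_on UNIV"
 shows "summable (\<lambda>n. norm (f (int_decode n)))" "infsum f UNIV = (\<Sum>n. f (int_decode n))"
proof -
 have s: "(\<lambda>n. norm (f (int_decode n))) summable_on UNIV"
  using summable_on_reindex_bij_betw[OF bij_int_decode, of "\<lambda>k. norm (f k)"] assms by simp
 then show 1: "summable (\<lambda>n. norm (f (int_decode n)))" by (rule summable_on_imp_summable)
 have "((\<lambda>n. f (int_decode n)) has_sum (\<Sum>n. f (int_decode n))) UNIV"
  by (rule norm_summable_imp_has_sum[OF 1]) (use summable_norm_cancel[OF 1] in \<open>auto simp: sums_iff\<close>)
 moreover have "infsum (\<lambda>n. f (int_decode n)) UNIV = infsum f UNIV"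
  by (rule infsum_reindex_bij_betw[OF bij_int_decode])
 ultimately show "infsum f UNIV = (\<Sum>n. f (int_decode n))" by (simp add: infsumI)
qed

lemma summable_on_int_iff_summable:
 fixes f :: "int => real"
 assumes "!!k. f k >= 0"
 shows "f summable_on UNIV \<longleftrightarrow> summable (\<lambda>n. f (int_decode n))"
 using summable_on_reindex_bij_betw[OF bij_int_decode, of f] assms
 by (simp add: summable_on_UNIV_nonneg_real_iff)

text \<open>Dominated convergence for sums. The filter is general because difference quotients,
  one-sided limits in time and sequences are all treated with it.\<close>

lemma infsum_tannery:
 fixes u :: "int => 'b => 'a::{real_normed_algebra, banach}"
 assumes lim: "!!k. ((\<lambda>t. u k t) \<longlongrightarrow> v k) F" and bound: "!!k t. norm (u k t) <= M k"
  and M: "M summable_on UNIV" and F: "F \<noteq> bot"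
 shows "((\<lambda>t. INFSUM k. u k t) \<longlongrightarrow> (INFSUM k. v k)) F"
proof -
 have M0: "M k >= 0" for k using bound[of k undefined] norm_ge_zero order_trans by blast
 have v: "norm (v k) <= M k" for k
  by (rule tendsto_upperbound[OF tendsto_norm[OF lim]]) (use bound F in auto)
 have su: "(\<lambda>k. norm (u k t)) summable_on UNIV" for t
  by (rule summable_on_comparison_test[OF M bound]) auto
 have sv: "(\<lambda>k. norm (v k)) summable_on UNIV"
  by (rule summable_on_comparison_test[OF M v]) auto
 have "((\<lambda>t. \<Sum>n. u (int_decode n) t) \<longlongrightarrow> (\<Sum>n. v (int_decode n))) F"
 proof -
  have "eventually (\<lambda>(k, t). norm (u (int_decode k) t) <= M (int_decode k)) (at_top \<times>\<^sub>F F)"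
   by (rule always_eventually) (use bound in auto)
  note ev = this
  have "summable (\<lambda>n. M (int_decode n))" using M by (simp add: summable_on_int_iff_summable[OF M0])
  from tannerys_theorem[of "\<lambda>n. u (int_decode n)", OF lim ev this F] show ?thesis by (elim conjE)
 qed
 then show ?thesis by (simp add: infsum_int_eq_suminf[OF su] infsum_int_eq_suminf[OF sv])
qed

lemma AE_summable_of_integral:
 fixes h :: "int => 'a => 'b::{banach, second_countable_topology}"
 assumes int: "!!k. integrable M (h k)" and S: "(\<lambda>k. \<integral>x. norm (h k x) \<partial>M) summable_on UNIV"
 shows "AE x in M. (\<lambda>k. norm (h k x)) summable_on UNIV"
proof -
 have S': "summable (\<lambda>n. \<integral>x. norm (h (int_decode n) x) \<partial>M)"
  using S by (subst (asm) summable_on_int_iff_summable) auto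
 have meas[measurable]: "h k \<in> borel_measurable M" for k using int by auto
 have "(\<integral>\<^sup>+x. (\<Sum>n. ennreal (norm (h (int_decode n) x))) \<partial>M) = (\<Sum>n. \<integral>\<^sup>+x. ennreal (norm (h (int_decode n) x)) \<partial>M)"
  by (rule nn_integral_suminf) measurable
 also have "... = (\<Sum>n. ennreal (\<integral>x. norm (h (int_decode n) x) \<partial>M))"
  by (intro suminf_cong nn_integral_eq_integral integrable_norm int) auto
 also have "... = ennreal (\<Sum>n. \<integral>x. norm (h (int_decode n) x) \<partial>M)"
  by (rule suminf_ennreal2) (use S' in auto)
 finally have "(\<integral>\<^sup>+x. (\<Sum>n. ennreal (norm (h (int_decode n) x))) \<partial>M) \<noteq> \<infinity>" by simp
 then have "AE x in M. (\<Sum>n. ennreal (norm (h (int_decode n) x))) \<noteq> \<infinity>"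
  by (intro nn_integral_PInf_AE) measurable
 then show ?thesis
 proof eventually_elim
  case (elim x)
  then have "summable (\<lambda>n. norm (h (int_decode n) x))"
   by (intro summable_suminf_not_top) auto
  then show ?case by (simp add: summable_on_int_iff_summable)
 qed
qed

lemma integral_infsum_int:
 fixes h :: "int => 'a => 'b::{banach, second_countable_topology}"
 assumes int: "!!k. integrable M (h k)" and S: "(\<lambda>k. \<integral>x. norm (h k x) \<partial>M) summable_on UNIV"
  and H: "H \<in> borel_measurable M" "AE x in M. H x = (INFSUM k. h k x)"
 shows "integrable M H" "(\<integral>x. H x \<partial>M) = (INFSUM k. \<integral>x. h k x \<partial>M)"
proof -
 have S': "summable (\<lambda>n. \<integral>x. norm (h (int_decode n) x) \<partial>M)"
  using S by (subst (asm) summable_on_int_iff_summable) auto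
 have AE: "AE x in M. (\<lambda>k. norm (h k x)) summable_on UNIV" by (rule AE_summable_of_integral[OF int S])
 then have AE': "AE x in M. summable (\<lambda>n. norm (h (int_decode n) x))"
  by eventually_elim (rule infsum_int_eq_suminf)
 have eq: "AE x in M. H x = (\<Sum>n. h (int_decode n) x)"
  using AE H(2) by eventually_elim (simp add: infsum_int_eq_suminf)
 note I = integrable_suminf[OF int AE' S'] integral_suminf[OF int AE' S']
 have m: "(\<lambda>x. \<Sum>n. h (int_decode n) x) \<in> borel_measurable M" using I(1) by auto
 show "integrable M H" using I(1) integrable_cong_AE[OF H(1) m eq] by simp
 have "(\<integral>x. H x \<partial>M) = (\<Sum>n. \<integral>x. h (int_decode n) x \<partial>M)"
  using I(2) integral_cong_AE[OF H(1) m eq] by simp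
 also have "... = (INFSUM k. \<integral>x. h k x \<partial>M)"
 proof (rule infsum_int_eq_suminf(2)[symmetric])
  show "(\<lambda>k. norm (\<integral>x. h k x \<partial>M)) summable_on UNIV"
   by (rule summable_on_comparison_test[OF S]) auto
 qed
 finally show "(\<integral>x. H x \<partial>M) = (INFSUM k. \<integral>x. h k x \<partial>M)" .
qed

text \<open>Lebesgue measure is complete, so a change on a null set keeps measurability; this
  handles limits that exist only almost everywhere.\<close>

lemma borel_measurable_lebesgue_on_AE:
 fixes f :: "'a::euclidean_space => 'b::euclidean_space"
 assumes S: "S \<in> sets lebesgue" and f: "f \<in> borel_measurable (lebesgue_on S)"
  and ae: "AE x in lebesgue_on S. f x = g x"
 shows "g \<in> borel_measurable (lebesgue_on S)"
proof -
 have "(\<lambda>x. if x \<in> S then f x else 0) \<in> borel_measurable lebesgue"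
  using borel_measurable_if[OF S] f by blast
 moreover have "AE x in lebesgue. (if x \<in> S then f x else 0) = (if x \<in> S then g x else 0)"
  using ae by (simp add: AE_restrict_space_iff S)
 ultimately have "(\<lambda>x. if x \<in> S then g x else 0) \<in> borel_measurable lebesgue"
  by (rule borel_measurable_AE)
 then show ?thesis using borel_measurable_if[OF S] by blast
qed

section \<open>Integrable functions orthogonal to all characters\<close>

lemma continuous_measurable:
 fixes f :: "real => 'b::euclidean_space"
 assumes "continuous_on UNIV f" shows "f \<in> borel_measurable (lebesgue_on S)"
proof -
 have "f \<in> borel_measurable borel" using assms by (rule borel_measurable_continuous_onI)
 then have "f \<in> borel_measurable lebesgue" by (simp add: measurable_completion)
 then show ?thesis by (rule measurable_restrict_space1)
qed

lemma emeasure_torus [simp]: "emeasure torus {-pi..pi} = ennreal (2 * pi)"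
 by (simp add: emeasure_restrict_space space_restrict_space)

lemma finite_measure_torus: "finite_measure torus"
 by (rule finite_measureI) (simp add: space_restrict_space)

lemma integrable_torus_continuous:
 fixes f :: "real => 'b::euclidean_space"
 assumes "continuous_on UNIV f" shows "integrable torus f"
 by (rule continuous_imp_integrable_real, rule continuous_on_subset[OF assms]) auto

lemma integrable_torus_bounded_mult:
 fixes w :: "real => complex" and \<phi> :: "real => complex"
 assumes "integrable torus w" "\<phi> \<in> borel_measurable torus" "!!x. cmod (\<phi> x) <= B"
 shows "integrable torus (\<lambda>x. w x * \<phi> x)"
proof (rule Bochner_Integration.integrable_bound)
 show "integrable torus (\<lambda>x. B * cmod (w x))" using assms(1) by auto
 show "(\<lambda>x. w x * \<phi> x) \<in> borel_measurable torus" using assms by measurable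
 have "cmod (w x * \<phi> x) <= \<bar>B * cmod (w x)\<bar>" for x
  using mult_left_mono[OF assms(3)[of x], of "cmod (w x)"] by (simp add: norm_mult mult.commute)
 then show "AE x in torus. cmod (w x * \<phi> x) <= norm (B * cmod (w x))" by simp
qed

lemma integral_cis:
 "(LINT x|torus. wave k x) = (if k = 0 then 2 * of_real pi else 0)"
proof -
 have "(LINT x|torus. wave k x) = integral {-pi..pi} (\<lambda>x. wave k x)"
  by (rule lebesgue_integral_eq_integral) (auto intro!: integrable_torus_continuous continuous_intros)
 also have "... = (if k = 0 then 2 * of_real pi else 0)"
 proof (cases "k = 0")
  case True
  then show ?thesis by (simp add: scaleR_conv_of_real)
 next
  case False
  have "((\<lambda>x. wave k x) has_integral
    wave k pi / (\<i> * of_int k) - cis (real_of_int k * - pi) / (\<i> * of_int k)) {-pi..pi}"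
  proof (rule fundamental_theorem_of_calculus)
   fix x
   have "((\<lambda>x. exp (\<i> * of_int k * of_real x) / (\<i> * of_int k)) has_vector_derivative exp (\<i> * of_int k * of_real x)) (at x within {-pi..pi})"
    using False by (auto intro!: derivative_eq_intros has_vector_derivative_real_field)
   then show "((\<lambda>x. wave k x / (\<i> * of_int k)) has_vector_derivative wave k x) (at x within {-pi..pi})"
    by (simp add: cis_conv_exp mult_ac)
  qed simp
  moreover have "wave k pi = cis (real_of_int k * - pi)"
   by (simp add: complex_eq_iff mult.commute[of _ pi])
  ultimately show ?thesis using False by (simp add: integral_unique)
 qed
 finally show ?thesis .
qed

text \<open>\<open>w\<close> annihilates all trigonometric polynomials; the set of \<open>\<psi>\<close> with the property below is
 stable under multiplication with polynomials in \<open>cis x\<close>.\<close>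

lemma polynomial_annihilation:
 fixes w :: "real => complex"
 assumes w: "integrable torus w" and P: "real_polynomial_function (P :: complex => real)"
  and \<psi>: "continuous_on UNIV \<psi>" "!!x. cmod (\<psi> x) <= B"
  and 0: "!!k. (LINT x|torus. w x * (\<psi> x * wave k x)) = 0"
 shows "(LINT x|torus. w x * (of_real (P (cis x)) * \<psi> x * wave k x)) = 0"
 using P \<psi> 0
proof (induction arbitrary: \<psi> B k)
 case (linear l)
 \<comment> \<open>On the circle a real linear form is a combination of \<open>cis x\<close> and
   \<open>cis (- x)\<close>; multiplication by it shifts the frequency by one in either direction,
   where the hypothesis applies again.\<close>
 have lc: "of_real (l (cis x)) = of_real (l 1) * ((cis x + cis (- x)) / 2) + of_real (l \<i>) * ((cis x - cis (- x)) / (2 * \<i>))" for x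
 proof -
  interpret bounded_linear l by (rule linear)
  have "cis x = cos x *\<^sub>R 1 + sin x *\<^sub>R \<i>" by (simp add: complex_eq_iff)
  then have "l (cis x) = cos x * l 1 + sin x * l \<i>" by (simp add: add scaleR)
  moreover have "(cis x + cis (- x)) / 2 = of_real (cos x)" "(cis x - cis (- x)) / (2 * \<i>) = of_real (sin x)"
   by (simp_all add: complex_eq_iff)
  ultimately show ?thesis by (simp add: mult.commute)
 qed
 define \<alpha> \<beta> where "\<alpha> = of_real (l 1) / 2 + of_real (l \<i>) / (2 * \<i>)" and "\<beta> = of_real (l 1) / 2 - of_real (l \<i>) / (2 * \<i>)"
 have lc': "of_real (l (cis x)) = \<alpha> * cis x + \<beta> * cis (- x)" for x
  unfolding lc \<alpha>_def \<beta>_def by (simp add: field_simps)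
 have int: "integrable torus (\<lambda>x. w x * (\<psi> x * wave j x))" for j
 proof (rule integrable_torus_bounded_mult[OF w, where B = B])
  show "(\<lambda>x. \<psi> x * wave j x) \<in> borel_measurable torus"
   by (intro continuous_measurable continuous_intros linear)
  show "cmod (\<psi> x * wave j x) <= B" for x using linear(3) by (simp add: norm_mult)
 qed
 have eq: "w x * (of_real (l (cis x)) * \<psi> x * wave k x)
   = \<alpha> * (w x * (\<psi> x * cis (real_of_int (k + 1) * x))) + \<beta> * (w x * (\<psi> x * cis (real_of_int (k - 1) * x)))" for x
 proof -
  have "cis (real_of_int (k + 1) * x) = cis x * wave k x"
   "cis (real_of_int (k - 1) * x) = cis (- x) * wave k x"
   by (simp_all add: cis_mult algebra_simps)
  then show ?thesis unfolding lc' by (simp only: distrib_right distrib_left mult_ac)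
 qed
 show ?case unfolding eq using int linear(4) by (simp del: of_int_add of_int_diff)
next
 case (const c)
 have eq: "w x * (of_real c * \<psi> x * wave k x) = of_real c * (w x * (\<psi> x * wave k x))" for x
  by simp
 show ?case unfolding eq using const by simp
next
 case (add P1 P2)
 have cP: "continuous_on UNIV (\<lambda>x. P (cis x))" "\<exists>C. \<forall>x. \<bar>P (cis x)\<bar> <= C"
  if "real_polynomial_function (P :: complex => real)" for P
 proof -
  have c: "continuous_on UNIV P" by (rule continuous_on_polymonial_function) (use that real_polynomial_function_eq in blast)
  then show "continuous_on UNIV (\<lambda>x. P (cis x))" by (rule continuous_on_compose2) (auto intro: continuous_intros)
  have "compact (P ` sphere 0 1)" by (intro compact_continuous_image continuous_on_subset[OF c]) auto
  then obtain C where "!!y. y \<in> P ` sphere 0 1 ==> norm y <= C" by (meson bounded_iff compact_imp_bounded)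
  then show "\<exists>C. \<forall>x. \<bar>P (cis x)\<bar> <= C" by (intro exI[of _ C]) auto
 qed
 have int: "integrable torus (\<lambda>x. w x * (of_real (P (cis x)) * \<psi> x * wave k x))"
  if P: "real_polynomial_function (P :: complex => real)" for P
 proof -
  obtain C where C: "!!x. \<bar>P (cis x)\<bar> <= C" using cP(2)[OF P] by blast
  show ?thesis
  proof (rule integrable_torus_bounded_mult[OF w, where B = "C * B"])
   show "(\<lambda>x. of_real (P (cis x)) * \<psi> x * wave k x) \<in> borel_measurable torus"
    by (intro continuous_measurable continuous_on_mult continuous_on_of_real cP(1)[OF P] add.prems)
     (intro continuous_intros)
   have "C >= 0" using C[of 0] by linarith
   then show "cmod (of_real (P (cis x)) * \<psi> x * wave k x) <= C * B" for x
    using C[of x] add.prems(2)[of x] by (auto simp: norm_mult intro!: mult_mono)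
  qed
 qed
 show ?case using int[OF add.hyps(1)] int[OF add.hyps(2)] add.IH(1)[OF add.prems] add.IH(2)[OF add.prems]
  by (simp add: distrib_left distrib_right)
next
 case (mult P1 P2)
 obtain C where C: "!!x. \<bar>P2 (cis x)\<bar> <= C"
 proof -
  have c: "continuous_on UNIV P2" by (rule continuous_on_polymonial_function) (use mult.hyps real_polynomial_function_eq in blast)
  have "compact (P2 ` sphere 0 1)" by (intro compact_continuous_image continuous_on_subset[OF c]) auto
  then obtain C where "!!y. y \<in> P2 ` sphere 0 1 ==> norm y <= C" by (meson bounded_iff compact_imp_bounded)
  then show ?thesis by (intro that[of C]) auto
 qed
 have c2: "continuous_on UNIV (\<lambda>x. P2 (cis x))"
  by (rule continuous_on_compose2[OF continuous_on_polymonial_function])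
   (use mult.hyps real_polynomial_function_eq in \<open>auto intro: continuous_intros\<close>)
 have "(LINT x|torus. w x * (of_real (P1 (cis x)) * (of_real (P2 (cis x)) * \<psi> x) * wave k x)) = 0"
 proof (rule mult.IH(1)[where B = "C * B"])
  show "continuous_on UNIV (\<lambda>x. of_real (P2 (cis x)) * \<psi> x)"
   by (intro continuous_on_mult continuous_on_of_real c2 mult.prems)
  have "C >= 0" using C[of 0] by linarith
  then show "cmod (of_real (P2 (cis x)) * \<psi> x) <= C * B" for x
   using C[of x] mult.prems(2)[of x] by (auto simp: norm_mult intro!: mult_mono)
  show "(LINT x|torus. w x * (of_real (P2 (cis x)) * \<psi> x * wave j x)) = 0" for j
   by (rule mult.IH(2)[OF mult.prems])
 qed
 then show ?case by (simp add: mult.assoc)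
qed

text \<open>Stone-Weierstrass on the unit circle: real polynomials are uniformly dense, and the
  error is at most its supremum times the integral of \<open>cmod w\<close>.\<close>

lemma continuous_annihilation:
 fixes w :: "real => complex" and \<Phi> :: "complex => real"
 assumes w: "integrable torus w" and 0: "!!k. (LINT x|torus. w x * wave k x) = 0"
  and \<Phi>: "continuous_on (sphere 0 1) \<Phi>"
 shows "(LINT x|torus. w x * of_real (\<Phi> (cis x))) = 0"
proof -
 have c\<Phi>: "continuous_on UNIV (\<lambda>x. \<Phi> (cis x))"
  by (rule continuous_on_compose2[OF \<Phi>]) (auto intro: continuous_intros)
 have bnd: "\<exists>C. \<forall>x. \<bar>\<Psi> (cis x)\<bar> <= C" if "continuous_on (sphere 0 1) \<Psi>" for \<Psi> :: "complex => real"
 proof -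
  have "compact (\<Psi> ` sphere 0 1)" by (intro compact_continuous_image that) auto
  then obtain C where "!!y. y \<in> \<Psi> ` sphere 0 1 ==> norm y <= C" by (meson bounded_iff compact_imp_bounded)
  then show ?thesis by (intro exI[of _ C]) auto
 qed
 have int: "integrable torus (\<lambda>x. w x * of_real (\<Psi> (cis x)))" if \<Psi>: "continuous_on (sphere 0 1) \<Psi>" for \<Psi> :: "complex => real"
 proof -
  obtain C where "!!x. \<bar>\<Psi> (cis x)\<bar> <= C" using bnd[OF \<Psi>] by blast
  moreover have "continuous_on UNIV (\<lambda>x. \<Psi> (cis x))"
   by (rule continuous_on_compose2[OF \<Psi>]) (auto intro: continuous_intros)
  ultimately show ?thesis
   by (intro integrable_torus_bounded_mult[OF w, where B = C] continuous_measurable continuous_on_of_real) auto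
 qed
 define I where "I = (LINT x|torus. cmod (w x))"
 have I0: "I >= 0" unfolding I_def by simp
 have "cmod (LINT x|torus. w x * of_real (\<Phi> (cis x))) <= 0 + e" if e: "e > 0" for e
 proof -
  define d where "d = e / (I + 1)"
  have d: "d > 0" using e I0 by (simp add: d_def)
  obtain P where P: "real_polynomial_function P" "!!z. z \<in> sphere 0 1 ==> \<bar>\<Phi> z - P z\<bar> < d"
   using Stone_Weierstrass_real_polynomial_function[OF compact_sphere \<Phi> d] by metis
  have cP: "continuous_on (sphere 0 1) P"
   using continuous_on_polymonial_function[of P] P(1) real_polynomial_function_eq continuous_on_subset by blast
  have P0: "(LINT x|torus. w x * of_real (P (cis x))) = 0"
   using polynomial_annihilation[OF w P(1), of "\<lambda>x. 1" 1 0] 0 by simp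
  have "(LINT x|torus. w x * of_real (\<Phi> (cis x))) = (LINT x|torus. w x * of_real (\<Phi> (cis x)) - w x * of_real (P (cis x)))"
   using P0 int[OF \<Phi>] int[OF cP] by simp
  also have "cmod ... <= (LINT x|torus. cmod (w x * of_real (\<Phi> (cis x)) - w x * of_real (P (cis x))))"
   by simp
  also have "... <= (LINT x|torus. d * cmod (w x))"
  proof (rule integral_mono)
   show "integrable torus (\<lambda>x. cmod (w x * of_real (\<Phi> (cis x)) - w x * of_real (P (cis x))))"
    using int[OF \<Phi>] int[OF cP] by auto
   show "integrable torus (\<lambda>x. d * cmod (w x))" using w by auto
   fix x
   have "w x * of_real (\<Phi> (cis x)) - w x * of_real (P (cis x)) = w x * of_real (\<Phi> (cis x) - P (cis x))"
    by (simp add: right_diff_distrib)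
   then show "cmod (w x * of_real (\<Phi> (cis x)) - w x * of_real (P (cis x))) <= d * cmod (w x)"
    using P(2)[of "cis x"] mult_left_mono[of "\<bar>\<Phi> (cis x) - P (cis x)\<bar>" d "cmod (w x)"]
    by (simp only: norm_mult norm_of_real) (simp add: mult.commute)
  qed
  also have "... = d * I" by (simp add: I_def)
  also have "... <= e" using e I0 by (simp add: d_def field_simps)
  finally show ?thesis by simp
 qed
 then have "cmod (LINT x|torus. w x * of_real (\<Phi> (cis x))) <= 0" by (rule field_le_epsilon)
 then show ?thesis by simp
qed

text \<open>An arc is where the cosine centred at its midpoint exceeds its value at the end points.
  So its indicator is a limit of continuous functions on the circle.\<close>

lemma cos_arc:
 fixes c d x :: real
 assumes "- pi <= c" "c < d" "d <= pi" "- pi <= x" "x <= pi"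
 shows "cos (x - (c + d) / 2) > cos ((d - c) / 2) \<longleftrightarrow> c < x \<and> x < d"
proof -
 define m h where "m = (c + d) / 2" and "h = (d - c) / 2"
 have h: "0 < h" "h <= pi" "m - h = c" "m + h = d" using assms by (auto simp: m_def h_def field_simps)
 have far: "cos y <= cos h" if "h <= y" "y <= 2 * pi - h" for y
 proof (cases "y <= pi")
  case True then show ?thesis using h that by (intro cos_monotone_0_pi_le) auto
 next
  case False
  have "cos (2 * pi - y) <= cos h" using h that False by (intro cos_monotone_0_pi_le) auto
  then show ?thesis by (simp add: cos_diff)
 qed
 have "cos (x - m) > cos h" if "c < x" "x < d"
 proof -
  have "\<bar>x - m\<bar> < h" using that h by (auto simp: abs_less_iff)
  then have "cos h < cos \<bar>x - m\<bar>" using h by (intro cos_monotone_0_pi) auto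
  then show ?thesis by simp
 qed
 moreover have "cos (x - m) <= cos h" if "x >= d" using far[of "x - m"] that h assms by simp
 moreover have "cos (x - m) <= cos h" if "x <= c"
 proof -
  have "cos (m - x) <= cos h" using far[of "m - x"] that h assms by simp
  then show ?thesis by (metis cos_minus minus_diff_eq)
 qed
 ultimately show ?thesis unfolding m_def h_def by (meson not_less)
qed

lemma interval_annihilation:
 fixes w :: "real => complex"
 assumes w: "integrable torus w" and 0: "!!k. (LINT x|torus. w x * wave k x) = 0"
  and cd: "- pi <= c" "c < d" "d <= pi"
 shows "(LINT x|torus. w x * of_real (indicator {c<..<d} x)) = 0"
proof -
 \<comment> \<open>Steep ramps in the quantity of \<open>cos_arc\<close>, cut off to
   \<open>[0, 1]\<close>; they tend to the indicator at every point, including the end points, where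
   they vanish.\<close>
 define \<Phi> :: "nat => complex => real" where "\<Phi> n z = min 1 (max 0 (real n * (Re (z * cis (- ((c + d) / 2))) - cos ((d - c) / 2))))" for n z
 have \<Phi>c: "continuous_on (sphere 0 1) (\<Phi> n)" for n unfolding \<Phi>_def[abs_def] by (intro continuous_intros)
 have \<Phi>cis: "\<Phi> n (cis x) = min 1 (max 0 (real n * (cos (x - (c + d) / 2) - cos ((d - c) / 2))))" for n x
  unfolding \<Phi>_def by (simp add: cis_mult)
 have lim: "(\<lambda>n. \<Phi> n (cis x)) \<longlonglongrightarrow> indicator {c<..<d} x" if x: "- pi <= x" "x <= pi" for x
 proof -
  define y where "y = cos (x - (c + d) / 2) - cos ((d - c) / 2)"
  show ?thesis
  proof (cases "y > 0")
   case True
   obtain N :: nat where N: "1 / y < real N" using reals_Archimedean2 by blast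
   have "\<Phi> n (cis x) = 1" if "n >= N" for n
   proof -
    have "1 / y < real n" using N that by linarith
    then have "1 < real n * y" using True by (simp add: field_simps)
    then show ?thesis unfolding \<Phi>cis y_def by simp
   qed
   then have "(\<lambda>n. \<Phi> n (cis x)) \<longlonglongrightarrow> 1" by (intro tendsto_eventually) (auto simp: eventually_sequentially)
   moreover have "indicator {c<..<d} x = (1::real)" using True cos_arc[OF cd x] by (simp add: y_def)
   ultimately show ?thesis by simp
  next
   case False
   then have "\<Phi> n (cis x) = 0" for n
    unfolding \<Phi>cis y_def[symmetric] using mult_nonneg_nonpos[of "real n" y] by (simp add: max_def min_def not_less)
   moreover have "indicator {c<..<d} x = (0::real)" using False cos_arc[OF cd x] by (simp add: y_def indicator_def)
   ultimately show ?thesis by simp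
  qed
 qed
 have mw[measurable]: "w \<in> borel_measurable torus" using w by auto
 have m\<Phi>: "(\<lambda>x. w x * of_real (\<Phi> n (cis x))) \<in> borel_measurable torus" for n
 proof -
  have "continuous_on UNIV (\<lambda>x. \<Phi> n (cis x))"
   by (rule continuous_on_compose2[OF \<Phi>c]) (auto intro: continuous_intros)
  then have [measurable]: "(\<lambda>x. complex_of_real (\<Phi> n (cis x))) \<in> borel_measurable torus"
   by (intro continuous_measurable continuous_on_of_real)
  show ?thesis by measurable
 qed
 have "(\<lambda>n. LINT x|torus. w x * of_real (\<Phi> n (cis x))) \<longlonglongrightarrow> (LINT x|torus. w x * of_real (indicator {c<..<d} x))"
 proof (rule integral_dominated_convergence[where w = "\<lambda>x. cmod (w x)"])
  have "(\<lambda>x::real. indicator {c<..<d} x :: real) \<in> borel_measurable torus"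
   by (intro measurable_restrict_space1 borel_measurable_indicator) auto
  then show "(\<lambda>x. w x * of_real (indicator {c<..<d} x)) \<in> borel_measurable torus" by measurable
  show "(\<lambda>x. w x * of_real (\<Phi> n (cis x))) \<in> borel_measurable torus" for n by (rule m\<Phi>)
  show "integrable torus (\<lambda>x. cmod (w x))" using w by auto
  show "AE x in torus. (\<lambda>n. w x * of_real (\<Phi> n (cis x))) \<longlonglongrightarrow> w x * of_real (indicator {c<..<d} x)"
   by (rule AE_I2) (auto intro!: tendsto_intros lim simp: space_restrict_space)
  have "cmod (w x * of_real (\<Phi> n (cis x))) <= cmod (w x)" for n x
   using mult_left_mono[of "\<bar>\<Phi> n (cis x)\<bar>" 1 "cmod (w x)"] by (simp add: norm_mult \<Phi>_def)
  then show "AE x in torus. cmod (w x * of_real (\<Phi> n (cis x))) <= cmod (w x)" for n by simp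
 qed
 moreover have "(LINT x|torus. w x * of_real (\<Phi> n (cis x))) = 0" for n
  by (rule continuous_annihilation[OF w 0 \<Phi>c])
 ultimately show ?thesis by (simp add: LIMSEQ_const_iff)
qed

text \<open>Positive and negative part of \<open>g\<close> define measures that agree and are finite
  on all half-lines, hence agree; densities are unique almost everywhere.\<close>

lemma AE_zero_of_halflines:
 fixes g :: "real => real"
 assumes g: "integrable lborel g" and 0: "!!x. (LINT y|lborel. g y * indicator {x<..} y) = 0"
 shows "AE x in lborel. g x = 0"
proof -
 have gm[measurable]: "g \<in> borel_measurable borel" using g by auto
 have ig: "integrable lborel (\<lambda>y. g y * indicator {x<..} y)" for x
  using integrable_mult_indicator[OF _ g, of "{x<..}"] by (simp add: mult.commute)
 have nn: "(\<integral>\<^sup>+y. ennreal (g y * indicator {x<..} y) \<partial>lborel) = (\<integral>\<^sup>+y. ennreal (- (g y * indicator {x<..} y)) \<partial>lborel)"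
  "(\<integral>\<^sup>+y. ennreal (g y * indicator {x<..} y) \<partial>lborel) < \<infinity>" for x
 proof -
  have fin: "(\<integral>\<^sup>+y. ennreal (g y * indicator {x<..} y) \<partial>lborel) < \<infinity>" "(\<integral>\<^sup>+y. ennreal (- (g y * indicator {x<..} y)) \<partial>lborel) < \<infinity>"
   using ig[of x] unfolding real_integrable_def by (simp_all add: top.not_eq_extremum)
  show "(\<integral>\<^sup>+y. ennreal (g y * indicator {x<..} y) \<partial>lborel) < \<infinity>" by (rule fin)
  have "enn2real (\<integral>\<^sup>+y. ennreal (g y * indicator {x<..} y) \<partial>lborel) = enn2real (\<integral>\<^sup>+y. ennreal (- (g y * indicator {x<..} y)) \<partial>lborel)"
   using 0[of x] real_lebesgue_integral_def[OF ig[of x]] by simp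
  then show "(\<integral>\<^sup>+y. ennreal (g y * indicator {x<..} y) \<partial>lborel) = (\<integral>\<^sup>+y. ennreal (- (g y * indicator {x<..} y)) \<partial>lborel)"
   using fin by (metis ennreal_enn2real infinity_ennreal_def)
 qed
 have em: "emeasure (density lborel (\<lambda>y. ennreal (h y))) {x<..} = (\<integral>\<^sup>+y. ennreal (h y * indicator {x<..} y) \<partial>lborel)"
  if "h \<in> borel_measurable borel" for h and x :: real
  using that by (subst emeasure_density) (auto intro!: nn_integral_cong simp: indicator_def)
 have "density lborel (\<lambda>y. ennreal (g y)) = density lborel (\<lambda>y. ennreal (- g y))"
  by (rule measure_eqI_lessThan) (use nn in \<open>auto simp: em\<close>)
 then have "AE x in lborel. ennreal (g x) = ennreal (- g x)"
  by (subst (asm) sigma_finite_measure.density_unique_iff[OF lborel.sigma_finite_measure_axioms]) auto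
 then show ?thesis
 proof eventually_elim
  case (elim x)
  then show ?case by (metis ennreal_eq_0_iff ennreal_neg le_numeral_extra(3) neg_le_0_iff_le linorder_not_le nle_le order_antisym_conv)
 qed
qed

lemma fourier_unique:
 fixes w :: "real => real"
 assumes w: "integrable torus w" and 0: "!!k. fourier w k = 0"
 shows "AE x in torus. w x = 0"
proof -
 define W where "W x = complex_of_real (w x)" for x
 have W: "integrable torus W" unfolding W_def[abs_def] using w by auto
 have W0: "(LINT x|torus. W x * wave k x) = 0" for k
 proof -
  have "exp (- \<i> * of_int (- k) * of_real x) = wave k x" for x
   by (simp add: cis_conv_exp mult_ac)
  then show ?thesis using 0[of "- k"] by (simp add: fourier_def W_def)
 qed
 define w0 where "w0 x = indicator {-pi..pi} x * w x" for x
 have w0: "integrable lebesgue w0"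
  using w unfolding w0_def[abs_def] by (subst (asm) integrable_restrict_space) auto
 \<comment> \<open>The function is only Lebesgue measurable; the argument with densities needs a
   Borel version.\<close>
 then have "w0 \<in> borel_measurable (completion lborel)" by auto
 then obtain g where g[measurable]: "g \<in> borel_measurable lborel" and wg: "AE x in lborel. w0 x = g x"
  using completion_ex_borel_measurable_real by blast
 have wgc: "AE x in lebesgue. w0 x = g x" by (rule AE_completion[OF wg])
 have gc: "g \<in> borel_measurable lebesgue" using g by (rule measurable_completion)
 have "integrable lebesgue g" using w0 wgc gc by (subst integrable_cong_AE[of _ _ w0]) (auto)
 then have ig: "integrable lborel g" using g by (simp add: integrable_completion)
 have tor: "(LINT y|lborel. g y * indicator S y) = (LINT y|torus. w y * indicator S y)" if S: "S \<in> sets borel" for S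
 proof -
  have m: "(\<lambda>y. g y * indicator S y) \<in> borel_measurable lborel" using S by measurable
  have "(LINT y|lborel. g y * indicator S y) = (LINT y|lebesgue. g y * indicator S y)"
   by (rule integral_completion[OF m, symmetric])
  also have "... = (LINT y|lebesgue. w0 y * indicator S y)"
  proof (rule integral_cong_AE)
   show "(\<lambda>y. g y * indicator S y) \<in> borel_measurable lebesgue" using m by (rule measurable_completion)
   have "(\<lambda>y. indicator S y :: real) \<in> borel_measurable lebesgue"
    using S by (intro borel_measurable_indicator) auto
   then show "(\<lambda>y. w0 y * indicator S y) \<in> borel_measurable lebesgue" using w0 by auto
   show "AE y in lebesgue. g y * indicator S y = w0 y * indicator S y" using wgc by eventually_elim simp
  qed
  also have "... = (LINT y|lebesgue. indicator {-pi..pi} y *\<^sub>R (w y * indicator S y))"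
   by (simp add: w0_def mult.assoc)
  also have "... = (LINT y|torus. w y * indicator S y)"
   by (rule integral_restrict_space[symmetric]) auto
  finally show ?thesis .
 qed
 have half: "(LINT y|torus. w y * indicator {x<..} y) = 0" for x
 proof (cases "x < pi")
  case False
  have "AE y in torus. y \<noteq> pi"
  proof -
   have "AE y in lebesgue. y \<noteq> pi" by (rule AE_completion[OF AE_lborel_singleton])
   then show ?thesis by (simp add: AE_restrict_space_iff) (auto elim: eventually_mono)
  qed
  have "(LINT y|torus. w y * indicator {x<..} y) = (LINT y|torus. 0)"
   by (rule Bochner_Integration.integral_cong) (use False in \<open>auto simp: space_restrict_space\<close>)
  then show ?thesis by simp
 next
  case True
  define c where "c = max x (- pi)"
  have c: "- pi <= c" "c < pi" using True by (auto simp: c_def)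
  have AE: "AE y in torus. y \<noteq> pi \<and> y \<noteq> - pi"
  proof -
   have "AE y in lebesgue. y \<noteq> pi" "AE y in lebesgue. y \<noteq> - pi" by (rule AE_completion[OF AE_lborel_singleton])+
   then have "AE y in lebesgue. y \<noteq> pi \<and> y \<noteq> - pi" by eventually_elim simp
   then show ?thesis by (simp add: AE_restrict_space_iff) (auto elim: eventually_mono)
  qed
  have ind: "(\<lambda>y. indicator {x<..} y :: real) \<in> borel_measurable torus" "(\<lambda>y. indicator {c<..<pi} y :: real) \<in> borel_measurable torus"
   by (intro measurable_restrict_space1 borel_measurable_indicator; auto)+
  have "(LINT y|torus. w y * indicator {x<..} y) = (LINT y|torus. w y * indicator {c<..<pi} y)"
  proof (rule integral_cong_AE)
   show "(\<lambda>y. w y * indicator {x<..} y) \<in> borel_measurable torus" "(\<lambda>y. w y * indicator {c<..<pi} y) \<in> borel_measurable torus"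
    using w ind by auto
   show "AE y in torus. w y * indicator {x<..} y = w y * indicator {c<..<pi} y"
    using AE AE_space by eventually_elim (auto simp: space_restrict_space indicator_def c_def)
  qed
  also have "complex_of_real ... = (LINT y|torus. W y * of_real (indicator {c<..<pi} y))"
   unfolding W_def by (subst integral_complex_of_real[symmetric]) simp
  also have "... = 0" by (rule interval_annihilation[OF W W0 c(1,2) order_refl])
  finally show ?thesis by simp
 qed
 have "AE x in lborel. g x = 0"
  by (rule AE_zero_of_halflines[OF ig]) (simp add: tor half)
 then have "AE x in lborel. w0 x = 0" using wg by eventually_elim simp
 then have "AE x in lebesgue. w0 x = 0" by (rule AE_completion)
 then show ?thesis by (simp add: AE_restrict_space_iff) (auto elim!: eventually_mono simp: w0_def)
qed

section \<open>Trigonometric series\<close>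

text \<open>Inhomogeneous, so that the weight is at least one also at \<open>k = 0\<close> and the
  spaces are nested in \<open>p\<close>.\<close>

definition wt :: "nat => int => real" where
 "wt p k = (1 + mag k) ^ p"

definition wsummable :: "nat => (int => complex) => bool" where
 "wsummable p c \<longleftrightarrow> (\<lambda>k. wt p k * cmod (c k)) summable_on UNIV"

definition wnorm :: "nat => (int => complex) => real" where
 "wnorm p c = (INFSUM k. wt p k * cmod (c k))"

definition ser :: "(int => complex) => real => complex" where
 "ser c x = (INFSUM k. c k * wave k x)"

text \<open>The real part makes the function real by definition; for Hermitian \<open>c\<close>
  nothing is lost (\<open>ser_real\<close>).\<close>

definition trg :: "(int => complex) => real => real" where
 "trg c x = Re (ser c x)"

definition dco :: "nat => (int => complex) => int => complex" where
 "dco j c k = (\<i> * of_int k) ^ j * c k"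

lemma wt_ge_1: "1 <= wt p k" by (simp add: wt_def one_le_power)

lemma wt_mono: "p <= q ==> wt p k <= wt q k"
 unfolding wt_def by (rule power_increasing) auto

lemma wt_0 [simp]: "wt 0 k = 1" by (simp add: wt_def)

lemma wsummable_mono: "wsummable q c ==> p <= q ==> wsummable p c"
 unfolding wsummable_def
 by (erule summable_on_comparison_test)
  (auto intro!: mult_right_mono wt_mono mult_nonneg_nonneg order_trans[OF zero_le_one wt_ge_1])

lemma wnorm_nonneg: "0 <= wnorm p c"
 unfolding wnorm_def
 by (intro infsum_nonneg mult_nonneg_nonneg order_trans[OF zero_le_one wt_ge_1]) auto

lemma wnorm_mono: "wsummable q c ==> p <= q ==> wnorm p c <= wnorm q c"
 unfolding wnorm_def using wsummable_mono[of q c p]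
 by (intro infsum_mono mult_right_mono wt_mono) (auto simp: wsummable_def)

lemma wsummable_le:
 assumes "wsummable p c" "!!k. cmod (d k) <= cmod (c k)"
 shows "wsummable p d" "wnorm p d <= wnorm p c"
proof -
 have le: "wt p k * cmod (d k) <= wt p k * cmod (c k)" for k
  by (intro mult_left_mono assms order_trans[OF zero_le_one wt_ge_1])
 show "wsummable p d" using assms(1) unfolding wsummable_def
  by (rule summable_on_comparison_test) (auto intro: le mult_nonneg_nonneg order_trans[OF zero_le_one wt_ge_1])
 then show "wnorm p d <= wnorm p c" using assms(1) unfolding wsummable_def wnorm_def
  by (rule infsum_mono) (rule le)
qed

lemma wsummable_add:
 assumes "wsummable p c" "wsummable p d"
 shows "wsummable p (\<lambda>k. c k + d k)" "wnorm p (\<lambda>k. c k + d k) <= wnorm p c + wnorm p d"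
proof -
 have le: "wt p k * cmod (c k + d k) <= wt p k * cmod (c k) + wt p k * cmod (d k)" for k
  using mult_left_mono[OF norm_triangle_ineq[of "c k" "d k"], of "wt p k"] wt_ge_1[of p k]
  by (simp add: distrib_left)
 have s: "(\<lambda>k. wt p k * cmod (c k) + wt p k * cmod (d k)) summable_on UNIV"
  using assms unfolding wsummable_def by (rule summable_on_add)
 then show 1: "wsummable p (\<lambda>k. c k + d k)" unfolding wsummable_def
  by (rule summable_on_comparison_test) (auto intro: le mult_nonneg_nonneg order_trans[OF zero_le_one wt_ge_1])
 have "wnorm p (\<lambda>k. c k + d k) <= infsum (\<lambda>k. wt p k * cmod (c k) + wt p k * cmod (d k)) UNIV"
  using 1 s unfolding wsummable_def wnorm_def by (rule infsum_mono) (rule le)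
 also have "... = wnorm p c + wnorm p d"
  using assms unfolding wsummable_def wnorm_def by (rule infsum_add)
 finally show "wnorm p (\<lambda>k. c k + d k) <= wnorm p c + wnorm p d" .
qed

lemma wsummable_uminus: "wsummable p (\<lambda>k. - c k) = wsummable p c" "wnorm p (\<lambda>k. - c k) = wnorm p c"
 by (simp_all add: wsummable_def wnorm_def)

lemma wsummable_diff:
 assumes "wsummable p c" "wsummable p d"
 shows "wsummable p (\<lambda>k. c k - d k)" "wnorm p (\<lambda>k. c k - d k) <= wnorm p c + wnorm p d"
proof -
 have d: "wsummable p (\<lambda>k. - d k)" "wnorm p (\<lambda>k. - d k) = wnorm p d"
  using assms(2) by (simp_all only: wsummable_uminus)
 show "wsummable p (\<lambda>k. c k - d k)" "wnorm p (\<lambda>k. c k - d k) <= wnorm p c + wnorm p d"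
  using wsummable_add[OF assms(1) d(1)] d(2) by (simp_all only: add_uminus_conv_diff)
qed

lemma wsummable_cmult:
 assumes "wsummable p c"
 shows "wsummable p (\<lambda>k. a * c k)" "wnorm p (\<lambda>k. a * c k) = cmod a * wnorm p c"
proof -
 have eq: "wt p k * cmod (a * c k) = cmod a * (wt p k * cmod (c k))" for k by (simp add: norm_mult)
 show "wsummable p (\<lambda>k. a * c k)" unfolding wsummable_def eq
  by (intro summable_on_cmult_right assms[unfolded wsummable_def])
 show "wnorm p (\<lambda>k. a * c k) = cmod a * wnorm p c" unfolding wnorm_def eq
  by (rule infsum_cmult_right')
qed

lemma wsummable_finite_support:
 assumes "!!k. k \<notin> modes n ==> c k = 0" shows "wsummable p c"
proof -
 have "(\<lambda>k. wt p k * cmod (c k)) summable_on modes n" by (rule summable_on_finite) simp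
 then show ?thesis unfolding wsummable_def
  by (subst summable_on_cong_neutral[of "modes n" UNIV _ "\<lambda>k. wt p k * cmod (c k)"]) (use assms in auto)
qed

lemma cmod_dco_le: "wt p k * cmod (dco j c k) <= wt (p + j) k * cmod (c k)"
proof -
 have "wt p k * cmod (dco j c k) = wt p k * (mag k ^ j * cmod (c k))"
  by (simp add: dco_def norm_mult norm_power)
 also have "... <= wt p k * ((1 + mag k) ^ j * cmod (c k))"
  by (intro mult_left_mono mult_right_mono power_mono order_trans[OF zero_le_one wt_ge_1]) auto
 finally show ?thesis by (simp add: wt_def power_add)
qed

lemma wsummable_dco:
 assumes "wsummable (p + j) c"
 shows "wsummable p (dco j c)" "wnorm p (dco j c) <= wnorm (p + j) c"
proof -
 show 1: "wsummable p (dco j c)" using assms unfolding wsummable_def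
  by (rule summable_on_comparison_test)
   (auto intro: cmod_dco_le mult_nonneg_nonneg order_trans[OF zero_le_one wt_ge_1])
 show "wnorm p (dco j c) <= wnorm (p + j) c" using 1 assms unfolding wsummable_def wnorm_def
  by (rule infsum_mono) (rule cmod_dco_le)
qed

lemma dco_0 [simp]: "dco 0 c = c" by (simp add: dco_def fun_eq_iff)

lemma dco_dco: "dco i (dco j c) = dco (i + j) c" by (simp add: dco_def fun_eq_iff power_add)

lemma hermitian_dco: "hermitian c ==> hermitian (dco j c)"
 by (simp add: hermitian_def dco_def)

section \<open>Pointwise sums, continuity and derivatives\<close>

lemma ser_abs_summable:
 assumes "wsummable 0 c" shows "(\<lambda>k. cmod (c k * wave k x)) summable_on UNIV"
 using assms by (simp add: wsummable_def norm_mult)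

lemma ser_summable:
 assumes "wsummable 0 c" shows "(\<lambda>k. c k * wave k x) summable_on UNIV"
 by (rule abs_summable_summable[OF ser_abs_summable[OF assms]])

lemma cmod_ser_le: assumes "wsummable 0 c" shows "cmod (ser c x) <= wnorm 0 c"
 unfolding ser_def wnorm_def using norm_infsum_bound[OF ser_abs_summable[OF assms, of x]]
 by (simp add: norm_mult)

lemma abs_trg_le: assumes "wsummable 0 c" shows "\<bar>trg c x\<bar> <= wnorm 0 c"
 unfolding trg_def using abs_Re_le_cmod[of "ser c x"] cmod_ser_le[OF assms, of x] by linarith

lemma ser_add: "wsummable 0 c ==> wsummable 0 d ==> ser (\<lambda>k. c k + d k) x = ser c x + ser d x"
 unfolding ser_def distrib_right by (intro infsum_add ser_summable)

lemma ser_cmult: "ser (\<lambda>k. a * c k) x = a * ser c x"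
 unfolding ser_def mult.assoc by (rule infsum_cmult_right')

lemma ser_diff:
 assumes "wsummable 0 c" "wsummable 0 d" shows "ser (\<lambda>k. c k - d k) x = ser c x - ser d x"
proof -
 have "ser (\<lambda>k. c k + (- 1) * d k) x = ser c x + ser (\<lambda>k. (- 1) * d k) x"
  by (intro ser_add assms wsummable_cmult)
 then show ?thesis using ser_cmult[of "- 1" d x] by simp
qed

lemma trg_add: "wsummable 0 c ==> wsummable 0 d ==> trg (\<lambda>k. c k + d k) x = trg c x + trg d x"
 by (simp add: trg_def ser_add)

lemma trg_diff: "wsummable 0 c ==> wsummable 0 d ==> trg (\<lambda>k. c k - d k) x = trg c x - trg d x"
 by (simp add: trg_def ser_diff)

lemma continuous_on_ser:
 assumes "wsummable 0 c" shows "continuous_on UNIV (ser c)"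
proof -
 have "(ser c \<longlongrightarrow> ser c x) (at x)" for x
  unfolding ser_def
 proof (rule infsum_tannery)
  show "((\<lambda>y. c k * wave k y) \<longlongrightarrow> c k * wave k x) (at x)" for k
   by (intro tendsto_intros)
  show "cmod (c k * wave k y) <= cmod (c k)" for k y by (simp add: norm_mult)
  show "(\<lambda>k. cmod (c k)) summable_on UNIV" using assms by (simp add: wsummable_def)
 qed simp
 then show ?thesis by (simp add: continuous_on_def)
qed

lemma continuous_on_trg: "wsummable 0 c ==> continuous_on UNIV (trg c)"
 unfolding trg_def[abs_def] by (intro continuous_on_Re continuous_on_ser)

lemma cmod_cis_diff_le: "cmod (cis a - cis b) <= \<bar>a - b\<bar>"
proof -
 have "(cmod (cis a - cis b))\<^sup>2 = (cos a - cos b)\<^sup>2 + (sin a - sin b)\<^sup>2" by (simp add: cmod_power2)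
 also have "... = 2 - 2 * cos (a - b)"
  using sin_cos_squared_add[of a] sin_cos_squared_add[of b]
  by (simp add: cos_diff power2_eq_square algebra_simps)
 also have "cos (a - b) = 1 - 2 * (sin ((a - b) / 2))\<^sup>2"
 proof -
  have e: "2 * ((a - b) / 2) = a - b" by simp
  show ?thesis using cos_double_sin[of "(a - b) / 2"] unfolding e .
 qed
 also have "2 - 2 * (1 - 2 * (sin ((a - b) / 2))\<^sup>2) = (2 * \<bar>sin ((a - b) / 2)\<bar>)\<^sup>2" by (simp add: power_mult_distrib)
 also have "... <= \<bar>a - b\<bar>\<^sup>2"
  using abs_sin_x_le_abs_x[of "(a - b) / 2"] by (intro power_mono) auto
 finally show ?thesis by (rule power2_le_imp_le) simp
qed

text \<open>The difference quotients of the character \<open>k\<close> have modulus at most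
  \<open>mag k\<close>, so \<open>infsum_tannery\<close> applies with the weight
  \<open>wt 1\<close>.\<close>

lemma trg_has_derivative:
 assumes "wsummable 1 c" shows "(trg c has_real_derivative trg (dco 1 c) x) (at x)"
proof -
 have c0: "wsummable 0 c" using wsummable_mono[OF assms] by simp
 have "((\<lambda>h. INFSUM k. c k * ((cis (real_of_int k * (x + h)) - wave k x) / of_real h))
   \<longlongrightarrow> (INFSUM k. dco 1 c k * wave k x)) (at 0)"
 proof (rule infsum_tannery)
  fix k
  have "((\<lambda>z. exp (\<i> * of_int k * z)) has_field_derivative \<i> * of_int k * exp (\<i> * of_int k * of_real x)) (at (of_real x))"
   by (auto intro!: derivative_eq_intros)
  then have lim: "((\<lambda>h. (exp (\<i> * of_int k * (of_real x + h)) - exp (\<i> * of_int k * of_real x)) / h)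
    \<longlongrightarrow> \<i> * of_int k * exp (\<i> * of_int k * of_real x)) (at 0)" by (simp add: DERIV_def)
  have fl: "filterlim complex_of_real (at 0) (at 0)"
   by (rule filterlim_atI) (auto intro!: tendsto_eq_intros simp: eventually_at_filter)
  have ce: "exp (\<i> * of_int k * of_real y) = wave k y" for y
   by (simp add: cis_conv_exp mult_ac)
  have "((\<lambda>h. (cis (real_of_int k * (x + h)) - wave k x) / of_real h)
    \<longlongrightarrow> \<i> * of_int k * wave k x) (at 0)"
   using filterlim_compose[OF lim fl] unfolding of_real_add[symmetric] ce .
  from tendsto_mult_left[OF this, of "c k"]
  show "((\<lambda>h. c k * ((cis (real_of_int k * (x + h)) - wave k x) / of_real h)) \<longlongrightarrow> dco 1 c k * wave k x) (at 0)"
   by (simp add: dco_def mult_ac)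
  show "cmod (c k * ((cis (real_of_int k * (x + h)) - wave k x) / of_real h)) <= wt 1 k * cmod (c k)" for h
  proof (cases "h = 0")
   case False
   have "cmod (cis (real_of_int k * (x + h)) - wave k x) <= mag k * \<bar>h\<bar>"
    using cmod_cis_diff_le[of "real_of_int k * (x + h)" "real_of_int k * x"] by (simp add: algebra_simps abs_mult)
   then have "cmod ((cis (real_of_int k * (x + h)) - wave k x) / of_real h) <= mag k"
    using False by (simp add: norm_divide divide_le_eq)
   also have "... <= wt 1 k" by (simp add: wt_def)
   finally have "cmod (c k) * cmod ((cis (real_of_int k * (x + h)) - wave k x) / of_real h) <= cmod (c k) * wt 1 k"
    by (rule mult_left_mono) simp
   then show ?thesis unfolding norm_mult by (simp only: mult.commute)
  qed (simp add: wt_def)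
  show "(\<lambda>k. wt 1 k * cmod (c k)) summable_on UNIV" using assms by (simp add: wsummable_def)
 qed simp
 note lim = this
 have eq: "(INFSUM k. c k * ((cis (real_of_int k * (x + h)) - wave k x) / of_real h))
   = (ser c (x + h) - ser c x) / of_real h" for h
 proof -
  have "ser c (x + h) - ser c x = (INFSUM k. c k * cis (real_of_int k * (x + h)) + - (c k * wave k x))"
   using infsum_add[OF ser_summable[OF c0, of "x + h"] summable_on_uminus[THEN iffD2, OF ser_summable[OF c0, of x]]]
   by (simp add: ser_def infsum_uminus)
  also have "... / of_real h = (INFSUM k. (c k * cis (real_of_int k * (x + h)) + - (c k * wave k x)) * inverse (of_real h))"
   by (subst infsum_cmult_left') (simp add: divide_inverse)
  finally show ?thesis by (simp add: divide_inverse algebra_simps)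
 qed
 have "((\<lambda>h. (ser c (x + h) - ser c x) / of_real h) \<longlongrightarrow> ser (dco 1 c) x) (at 0)"
  using lim unfolding eq ser_def[of "dco 1 c"] .
 from tendsto_Re[OF this] show ?thesis
  by (simp add: DERIV_def trg_def Re_divide_of_real)
qed

lemma trg_deriv_iterate:
 assumes "wsummable j c" "i <= j" shows "(deriv ^^ i) (trg c) = trg (dco i c)"
 using assms(2)
proof (induction i)
 case (Suc i)
 have "wsummable 1 (dco i c)" using wsummable_dco(1)[of 1 i c] wsummable_mono[OF assms(1), of "1 + i"] Suc by simp
 from trg_has_derivative[OF this] have "deriv (trg (dco i c)) = trg (dco (Suc i) c)"
  by (auto simp: fun_eq_iff dco_dco intro!: DERIV_imp_deriv)
 then show ?case using Suc by simp
qed simp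

lemma trg_field_differentiable:
 assumes "wsummable j c" "i < j" shows "(deriv ^^ i) (trg c) field_differentiable at x"
proof -
 have "wsummable 1 (dco i c)" using wsummable_dco(1)[of 1 i c] wsummable_mono[OF assms(1), of "1 + i"] assms by simp
 from trg_has_derivative[OF this] show ?thesis
  using trg_deriv_iterate[OF assms(1), of i] assms(2) by (auto simp: field_differentiable_def)
qed

lemma periodic_trg: "periodic (trg c)"
proof -
 have "cis (real_of_int k * (x + 2 * pi)) = wave k x" for k x
 proof -
  have "cis (real_of_int k * (x + 2 * pi)) = wave k x * cis (2 * pi * real_of_int k)"
   by (simp add: cis_mult algebra_simps)
  also have "cis (2 * pi * real_of_int k) = 1" by (rule cis_multiple_2pi) simp
  finally show ?thesis by simp
 qed
 then show ?thesis by (simp add: periodic_def trg_def ser_def)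
qed

lemma ser_real:
 assumes "hermitian c" shows "ser c x = of_real (trg c x)"
proof -
 have "cnj (ser c x) = (INFSUM k. cnj (c k * wave k x))" unfolding ser_def by (rule infsum_cnj[symmetric])
 also have "... = (INFSUM k. (\<lambda>k. c k * wave k x) (- k))"
  by (simp add: hermitianD[OF assms] cis_cnj)
 also have "... = ser c x" unfolding ser_def
  by (rule infsum_reindex_bij_betw) (auto intro!: bij_betw_byWitness[where f' = uminus])
 finally show ?thesis unfolding trg_def by (metis Reals_cnj_iff complex_is_Real_iff of_real_Re)
qed

lemma integral_ser:
 assumes c: "wsummable 0 c" and \<psi>: "integrable torus \<psi>"
 shows "integrable torus (\<lambda>x. ser c x * \<psi> x)"
  "(LINT x|torus. ser c x * \<psi> x) = (INFSUM k. c k * (LINT x|torus. wave k x * \<psi> x))"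
proof -
 have m: "(\<lambda>x. wave k x) \<in> borel_measurable torus" for k
  by (intro continuous_measurable continuous_intros)
 have i0: "integrable torus (\<lambda>x. wave k x * \<psi> x)" for k
  using integrable_torus_bounded_mult[OF \<psi> m, where B = 1] by (simp add: mult.commute)
 have i: "integrable torus (\<lambda>x. c k * wave k x * \<psi> x)" for k
  using i0[of k] by (simp add: mult.assoc)
 have S: "(\<lambda>k. \<integral>x. cmod (c k * wave k x * \<psi> x) \<partial>torus) summable_on UNIV"
  using c summable_on_cmult_left[of "\<lambda>k. cmod (c k)" UNIV "\<integral>x. cmod (\<psi> x) \<partial>torus"]
  by (simp add: norm_mult wsummable_def)
 have mm: "(\<lambda>x. ser c x * \<psi> x) \<in> borel_measurable torus"
  using continuous_measurable[OF continuous_on_ser[OF c]] \<psi> by (intro borel_measurable_times) auto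
 have eq: "ser c x * \<psi> x = (INFSUM k. c k * wave k x * \<psi> x)" for x
  unfolding ser_def by (rule infsum_cmult_left'[symmetric])
 note I = integral_infsum_int[OF i S mm AE_I2[OF eq]]
 show "integrable torus (\<lambda>x. ser c x * \<psi> x)" by (rule I(1))
 show "(LINT x|torus. ser c x * \<psi> x) = (INFSUM k. c k * (LINT x|torus. wave k x * \<psi> x))"
  unfolding I(2) mult.assoc using i0 by (intro infsum_cong) simp
qed

lemma fourier_trg:
 assumes c: "wsummable 0 c" and h: "hermitian c"
 shows "fourier (trg c) k = c k"
proof -
 have e: "exp (- \<i> * of_int k * of_real x) = cis (real_of_int (- k) * x)" for x
  by (simp add: cis_conv_exp mult_ac)
 have "(LINT x|torus. of_real (trg c x) * exp (- \<i> * of_int k * of_real x)) = (LINT x|torus. ser c x * cis (real_of_int (- k) * x))"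
  unfolding e ser_real[OF h] ..
 also have "... = (INFSUM j. c j * (LINT x|torus. wave j x * cis (real_of_int (- k) * x)))"
  by (rule integral_ser(2)[OF c]) (intro integrable_torus_continuous continuous_intros)
 also have "... = (INFSUM j. if j = k then c k * (2 * of_real pi) else 0)"
 proof (rule infsum_cong)
  fix j
  have "wave j x * cis (real_of_int (- k) * x) = cis (real_of_int (j - k) * x)" for x
   by (simp add: cis_mult left_diff_distrib)
  then show "c j * (LINT x|torus. wave j x * cis (real_of_int (- k) * x)) = (if j = k then c k * (2 * of_real pi) else 0)"
   by (simp only: integral_cis) auto
 qed
 also have "... = (\<Sum>\<^sub>\<infinity>j\<in>{k}. c k * (2 * of_real pi))"
  by (rule infsum_cong_neutral) auto
 finally show ?thesis by (simp add: fourier_def)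
qed

lemma integrable_trg: "wsummable 0 c ==> integrable torus (trg c)"
 by (intro integrable_torus_continuous continuous_on_trg)

lemma mean_eq_fourier: "of_real (mean u) = fourier u 0"
 by (simp add: mean_def fourier_def)

lemma mean_trg: "wsummable 0 c ==> hermitian c ==> c 0 = 0 ==> mean (trg c) = 0"
 using mean_eq_fourier[of "trg c"] by (simp add: fourier_trg)

lemma trg_in_L1: "wsummable 0 c ==> trg c \<in> fcarrier L1"
 by (simp add: L1_def periodic_trg integrable_trg)

section \<open>Integration by parts and weak derivatives of series\<close>

lemma periodic_by_parts:
 fixes u v u' v' :: "real => complex"
 assumes u: "!!x. (u has_vector_derivative u' x) (at x)" and v: "!!x. (v has_vector_derivative v' x) (at x)"
  and cu: "continuous_on UNIV u'" and cv: "continuous_on UNIV v'"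
  and per: "u pi * v pi = u (- pi) * v (- pi)"
 shows "(LINT x|torus. u x * v' x) = - (LINT x|torus. u' x * v x)"
proof -
 have c: "continuous_on UNIV u" "continuous_on UNIV v"
  using u v by (auto intro!: continuous_at_imp_continuous_on has_vector_derivative_continuous)
 have i: "integrable torus (\<lambda>x. u x * v' x)" "integrable torus (\<lambda>x. u' x * v x)"
  by (intro integrable_torus_continuous continuous_on_mult c cu cv)+
 have "((\<lambda>x. u x * v' x + u' x * v x) has_integral u pi * v pi - u (- pi) * v (- pi)) {-pi..pi}"
 proof (rule fundamental_theorem_of_calculus)
  show "((\<lambda>x. u x * v x) has_vector_derivative u x * v' x + u' x * v x) (at x within {-pi..pi})" for x
   by (rule has_vector_derivative_at_within[OF has_vector_derivative_mult[OF u v]])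
 qed simp
 then have "integral {-pi..pi} (\<lambda>x. u x * v' x + u' x * v x) = 0" using per by (simp add: integral_unique)
 moreover have "(LINT x|torus. u x * v' x + u' x * v x) = integral {-pi..pi} (\<lambda>x. u x * v' x + u' x * v x)"
  by (rule lebesgue_integral_eq_integral) (use i in auto)
 moreover have "(LINT x|torus. u x * v' x + u' x * v x) = (LINT x|torus. u x * v' x) + (LINT x|torus. u' x * v x)"
  using i by simp
 ultimately show ?thesis by (simp add: eq_neg_iff_add_eq_0)
qed

lemma periodic_by_parts_real:
 fixes u v u' v' :: "real => real"
 assumes u: "!!x. (u has_real_derivative u' x) (at x)" and v: "!!x. (v has_real_derivative v' x) (at x)"
  and cu: "continuous_on UNIV u'" and cv: "continuous_on UNIV v'" and per: "periodic u" "periodic v"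
 shows "(LINT x|torus. u x * v' x) = - (LINT x|torus. u' x * v x)"
proof -
 have p: "w pi = w (- pi)" if "periodic w" for w
  using that[unfolded periodic_def, rule_format, of "- pi"] by simp
 have d: "((\<lambda>x. complex_of_real (w x)) has_vector_derivative of_real (w' x)) (at x)"
  if "(w has_real_derivative w' x) (at x)" for w w' x
  using that by (simp add: has_real_derivative_iff_has_vector_derivative has_vector_derivative_of_real)
 have "(LINT x|torus. complex_of_real (u x) * of_real (v' x)) = - (LINT x|torus. of_real (u' x) * complex_of_real (v x))"
  by (rule periodic_by_parts) (use assms in \<open>auto intro!: d continuous_on_of_real simp: p\<close>)
 then have "complex_of_real (LINT x|torus. u x * v' x) = complex_of_real (- (LINT x|torus. u' x * v x))"
  unfolding of_real_mult[symmetric] integral_complex_of_real of_real_minus .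
 then show ?thesis by (simp only: of_real_eq_iff)
qed

lemma smooth_periodic_deriv:
 assumes "smooth_periodic \<phi>"
 shows "((deriv ^^ j) \<phi> has_real_derivative (deriv ^^ Suc j) \<phi> x) (at x)" "continuous_on UNIV ((deriv ^^ j) \<phi>)"
  "periodic ((deriv ^^ j) \<phi>)"
proof -
 show d: "((deriv ^^ j) \<phi> has_real_derivative (deriv ^^ Suc j) \<phi> x) (at x)" for j x
  using assms by (auto simp: smooth_periodic_def intro: field_differentiable_derivI)
 show "continuous_on UNIV ((deriv ^^ j) \<phi>)"
  using d by (auto intro!: continuous_at_imp_continuous_on DERIV_isCont)
 show "periodic ((deriv ^^ j) \<phi>)"
 proof (induction j)
  case 0 then show ?case using assms by (simp add: smooth_periodic_def)
 next
  case (Suc j)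
  have "(deriv ^^ Suc j) \<phi> (x + 2 * pi) = (deriv ^^ Suc j) \<phi> x" for x
  proof -
   have "((\<lambda>y. (deriv ^^ j) \<phi> (y + 2 * pi)) has_real_derivative (deriv ^^ Suc j) \<phi> (x + 2 * pi)) (at x)"
    using d[of j "x + 2 * pi"] by (simp add: DERIV_shift add.commute)
   moreover have "(\<lambda>y. (deriv ^^ j) \<phi> (y + 2 * pi)) = (deriv ^^ j) \<phi>" using Suc by (simp add: periodic_def)
   ultimately show ?thesis using d[of j x] DERIV_unique by metis
  qed
  then show ?case by (simp add: periodic_def)
 qed
qed

text \<open>One integration by parts per order, with \<open>deriv \<phi>\<close> as test function
  for the next lower order; periodicity removes the boundary terms.\<close>

lemma has_weak_deriv_trg:
 assumes "wsummable j c" shows "has_weak_deriv j (trg c) (trg (dco j c))"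
proof -
 have s: "wsummable 0 (dco i c)" if "i <= j" for i
  using wsummable_dco(1)[of 0 i c] wsummable_mono[OF assms that] by simp
 have "(LINT x|torus. trg c x * (deriv ^^ i) \<phi> x) = (- 1) ^ i * (LINT x|torus. trg (dco i c) x * \<phi> x)"
  if \<phi>: "smooth_periodic \<phi>" and "i <= j" for i \<phi>
  using that
 proof (induction i arbitrary: \<phi>)
  case (Suc i)
  have sm: "smooth_periodic (deriv \<phi>)"
   using Suc.prems(1) smooth_periodic_deriv(3)[OF Suc.prems(1), of 1]
   unfolding smooth_periodic_def by (metis One_nat_def funpow_0 funpow_Suc_right comp_def funpow_swap1 id_apply funpow.simps(2))
  have eq: "(deriv ^^ Suc i) \<phi> = (deriv ^^ i) (deriv \<phi>)" by (simp add: funpow_swap1)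
  have "(LINT x|torus. trg c x * (deriv ^^ Suc i) \<phi> x) = (- 1) ^ i * (LINT x|torus. trg (dco i c) x * deriv \<phi> x)"
   unfolding eq by (rule Suc.IH[OF sm]) (use Suc.prems in simp)
  also have "(LINT x|torus. trg (dco i c) x * deriv \<phi> x) = - (LINT x|torus. trg (dco (Suc i) c) x * \<phi> x)"
  proof (rule periodic_by_parts_real)
   have "wsummable 1 (dco i c)" using wsummable_dco(1)[of 1 i c] wsummable_mono[OF assms, of "1 + i"] Suc.prems by simp
   then show "(trg (dco i c) has_real_derivative trg (dco (Suc i) c) x) (at x)" for x
    using trg_has_derivative[of "dco i c"] by (simp add: dco_dco)
   show "(\<phi> has_real_derivative deriv \<phi> x) (at x)" for x using smooth_periodic_deriv(1)[OF Suc.prems(1), of 0] by simp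
   show "continuous_on UNIV (trg (dco (Suc i) c))" by (intro continuous_on_trg s Suc.prems)
   show "continuous_on UNIV (deriv \<phi>)" using smooth_periodic_deriv(2)[OF Suc.prems(1), of 1] by simp
   show "periodic \<phi>" using Suc.prems(1) by (simp add: smooth_periodic_def)
  qed (rule periodic_trg)
  finally show ?case by simp
 qed simp
 then show ?thesis
  unfolding has_weak_deriv_def using trg_in_L1[OF s[of 0]] trg_in_L1[OF s[of j]] by simp
qed

text \<open>The homogeneous Sobolev spaces contain mean-zero functions only, the other spaces do not
  ask for it; the flag lets one development serve both.\<close>

definition admissible :: "bool => (int => complex) => bool" where
 "admissible z c \<longleftrightarrow> hermitian c \<and> (z \<longrightarrow> c 0 = 0)"

lemma admissible_add: "admissible z c ==> admissible z d ==> admissible z (\<lambda>k. c k + d k)"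
 by (auto simp: admissible_def hermitian_def)

lemma admissible_diff: "admissible z c ==> admissible z d ==> admissible z (\<lambda>k. c k - d k)"
 by (auto simp: admissible_def hermitian_def)

text \<open>The flag \<open>z\<close> says that the zeroth coefficient must vanish.\<close>

locale series_space =
 fixes z :: bool and X :: fun_space and p :: nat and C :: real
 assumes C: "C >= 0"
  and carrier: "admissible z c ==> wsummable p c ==> trg c \<in> fcarrier X"
  and norm_nonneg: "admissible z c ==> wsummable p c ==> 0 <= fnorm X (trg c)"
  and norm_le: "admissible z c ==> wsummable p c ==> fnorm X (trg c) <= C * wnorm p c"
  and norm_add: "admissible z c ==> wsummable p c ==> admissible z d ==> wsummable p d ==>
   fnorm X (trg (\<lambda>k. c k + d k)) <= fnorm X (trg c) + fnorm X (trg d)"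

text \<open>Rounding the modulus and restoring the sign is odd. Therefore \<open>cround\<close>
  commutes with conjugation and rounded sequences stay Hermitian, which plain \<open>floor\<close>
  would spoil.\<close>

definition oround :: "nat => real => real" where
 "oround N x = sgn x * (of_int \<lfloor>real N * \<bar>x\<bar>\<rfloor> / real N)"

lemma oround_error:
 assumes "N > 0" shows "\<bar>oround N x - x\<bar> <= 1 / real N"
proof -
 have "\<bar>of_int \<lfloor>real N * \<bar>x\<bar>\<rfloor> / real N - \<bar>x\<bar>\<bar> <= 1 / real N"
 proof -
  have "\<bar>of_int \<lfloor>real N * \<bar>x\<bar>\<rfloor> - real N * \<bar>x\<bar>\<bar> <= 1" by linarith
  then have "\<bar>of_int \<lfloor>real N * \<bar>x\<bar>\<rfloor> - real N * \<bar>x\<bar>\<bar> / real N <= 1 / real N"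
   by (rule divide_right_mono) simp
  moreover have "\<bar>of_int \<lfloor>real N * \<bar>x\<bar>\<rfloor> - real N * \<bar>x\<bar>\<bar> / real N = \<bar>of_int \<lfloor>real N * \<bar>x\<bar>\<rfloor> / real N - \<bar>x\<bar>\<bar>"
  proof -
   have "of_int \<lfloor>real N * \<bar>x\<bar>\<rfloor> / real N - \<bar>x\<bar> = (of_int \<lfloor>real N * \<bar>x\<bar>\<rfloor> - real N * \<bar>x\<bar>) / real N"
    using assms by (simp add: diff_divide_distrib)
   then show ?thesis by (simp only: abs_divide abs_of_nat)
  qed
  ultimately show ?thesis by (simp only:)
 qed
 moreover have "\<bar>oround N x - x\<bar> = \<bar>of_int \<lfloor>real N * \<bar>x\<bar>\<rfloor> / real N - \<bar>x\<bar>\<bar> \<or> x = 0"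
  by (cases x "0::real" rule: linorder_cases) (auto simp: oround_def)
 ultimately show ?thesis by (auto simp: oround_def)
qed

definition cround :: "nat => complex => complex" where
 "cround N z = Complex (oround N (Re z)) (oround N (Im z))"

lemma cround_error: "N > 0 ==> cmod (z - cround N z) <= 2 / real N"
proof -
 assume N: "N > 0"
 have "cmod (z - cround N z) <= \<bar>Re (z - cround N z)\<bar> + \<bar>Im (z - cround N z)\<bar>" by (rule cmod_le)
 also have "... <= 1 / real N + 1 / real N"
  using oround_error[OF N, of "Re z"] oround_error[OF N, of "Im z"]
  by (intro add_mono) (simp_all add: cround_def abs_minus_commute)
 finally show ?thesis by simp
qed

lemma cround_cnj: "cround N (cnj z) = cnj (cround N z)"
 by (simp add: cround_def oround_def complex_eq_iff sgn_minus)

lemma cround_0 [simp]: "cround N 0 = 0"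
 by (simp add: cround_def oround_def complex_eq_iff)

lemma measurable_cround: "cround N \<in> borel_measurable borel"
proof -
 have [measurable]: "oround N \<in> borel_measurable borel" unfolding oround_def[abs_def] by measurable
 have "cround N = (\<lambda>z. of_real (oround N (Re z)) + \<i> * of_real (oround N (Im z)))"
  by (auto simp: cround_def complex_eq_iff)
 then show ?thesis by simp
qed

lemma finite_cround_ball: "finite (cround N ` {z. cmod z <= B})"
proof -
 define M where "M = \<lceil>real N * \<bar>B\<bar>\<rceil>"
 have r: "oround N x \<in> (\<lambda>i. of_int i / real N) ` {- M..M}" if "\<bar>x\<bar> <= B" for x
 proof -
  define i where "i = \<lfloor>real N * \<bar>x\<bar>\<rfloor>"
  have i: "0 <= i" "i <= M"
  proof -
   show "0 <= i" by (simp add: i_def)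
   have "real N * \<bar>x\<bar> <= real N * \<bar>B\<bar>" using that by (intro mult_left_mono) auto
   then show "i <= M" unfolding i_def M_def by linarith
  qed
  have "oround N x = of_int i / real N \<or> oround N x = of_int (- i) / real N \<or> oround N x = of_int 0 / real N"
   by (cases x "0::real" rule: linorder_cases) (auto simp: oround_def i_def)
  then show ?thesis
   using i by (elim disjE) (rule image_eqI[of _ _ i] image_eqI[of _ _ "- i"] image_eqI[of _ _ 0], assumption, simp)+
 qed
 have "cround N ` {z. cmod z <= B} \<subseteq> (\<lambda>(a, b). Complex a b) ` ((\<lambda>i. of_int i / real N) ` {- M..M} \<times> (\<lambda>i. of_int i / real N) ` {- M..M})"
 proof clarify
  fix z assume "cmod z <= B"
  then have "\<bar>Re z\<bar> <= B" "\<bar>Im z\<bar> <= B" using abs_Re_le_cmod[of z] abs_Im_le_cmod[of z] by linarith+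
  from this[THEN r] show "cround N z \<in> (\<lambda>(a, b). Complex a b) ` ((\<lambda>i. of_int i / real N) ` {- M..M} \<times> (\<lambda>i. of_int i / real N) ` {- M..M})"
   unfolding cround_def by (intro image_eqI[of _ _ "(oround N (Re z), oround N (Im z))"]) auto
 qed
 then show ?thesis by (rule finite_subset) auto
qed

text \<open>Finitely many modes, each with finitely many values as long as the coefficients are
  bounded: along a path in time this yields simple functions.\<close>

definition rounded :: "nat => nat => (int => complex) => int => complex" where
 "rounded n N c k = (if k \<in> modes n then cround N (c k) else 0)"

lemma admissible_rounded: "admissible z c ==> admissible z (rounded n N c)"
 by (auto simp: admissible_def hermitian_def rounded_def cround_cnj)

lemma wsummable_rounded: "wsummable p (rounded n N c)"
 by (rule wsummable_finite_support[of n]) (simp add: rounded_def)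

abbreviation "tail n c \<equiv> (\<lambda>k. if k \<in> modes n then 0 else c k)"

lemma wnorm_tail_tendsto:
 assumes "wsummable p c" shows "(\<lambda>n. wnorm p (tail n c)) \<longlonglongrightarrow> 0"
proof -
 have "(\<lambda>n. INFSUM k. wt p k * cmod (if k \<in> modes n then 0 else c k)) \<longlonglongrightarrow> (INFSUM k::int. (0::real))"
 proof (rule infsum_tannery)
  fix k
  have "\<forall>\<^sub>F n in sequentially. wt p k * cmod (if k \<in> modes n then 0 else c k) = 0"
   by (rule eventually_sequentiallyI[of "nat \<bar>k\<bar>"]) (auto simp: mem_modes)
  then show "(\<lambda>n. wt p k * cmod (if k \<in> modes n then 0 else c k)) \<longlonglongrightarrow> 0" by (rule tendsto_eventually)
  show "norm (wt p k * cmod (if k \<in> modes n then 0 else c k)) <= wt p k * cmod (c k)" for n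
   using wt_ge_1[of p k] by (auto simp: abs_mult)
  show "(\<lambda>k. wt p k * cmod (c k)) summable_on UNIV" using assms by (simp add: wsummable_def)
 qed simp
 then show ?thesis by (simp add: wnorm_def)
qed

lemma wnorm_rounded_le:
 assumes N: "N > 0" "2 * (real n + 1) * (\<Sum>k\<in>modes n. wt p k) <= real N" and c: "wsummable p c"
 shows "wnorm p (\<lambda>k. c k - rounded n N c k) <= 1 / (real n + 1) + wnorm p (tail n c)"
proof -
 define a where "a k = (if k \<in> modes n then c k - cround N (c k) else 0)" for k
 define b where "b k = (if k \<in> modes n then 0 else c k)" for k
 have eq: "(\<lambda>k. c k - rounded n N c k) = (\<lambda>k. a k + b k)" by (auto simp: a_def b_def rounded_def)
 have a: "wsummable p a" by (rule wsummable_finite_support[of n]) (simp add: a_def)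
 have b: "wsummable p b" by (rule wsummable_le(1)[OF c]) (simp add: b_def)
 have "wnorm p a = (\<Sum>k\<in>modes n. wt p k * cmod (a k))"
 proof -
  have "wnorm p a = (\<Sum>\<^sub>\<infinity>k\<in>modes n. wt p k * cmod (a k))"
   unfolding wnorm_def by (rule infsum_cong_neutral) (auto simp: a_def)
  then show ?thesis by simp
 qed
 also have "... <= (\<Sum>k\<in>modes n. wt p k * (2 / real N))"
  by (intro sum_mono mult_left_mono order_trans[OF zero_le_one wt_ge_1]) (simp add: a_def cround_error[OF N(1)])
 also have "... = (\<Sum>k\<in>modes n. wt p k) * (2 / real N)" by (simp only: sum_distrib_right)
 also have "... <= 1 / (real n + 1)" using N by (simp add: field_simps)
 finally have "wnorm p a <= 1 / (real n + 1)" .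
 then show ?thesis using wsummable_add(2)[OF a b] unfolding eq b_def[symmetric] by linarith
qed

lemma simple_function_family:
 assumes "finite J" "!!k. k \<in> J ==> simple_function M (\<sigma> k)"
 shows "simple_function M (\<lambda>t k. if k \<in> J then \<sigma> k t else 0)"
 using assms
proof (induction J rule: finite_induct)
 case empty
 then show ?case by simp
next
 case (insert j J)
 have "simple_function M (\<lambda>t. (\<lambda>h v. h(j := v)) (\<lambda>k. if k \<in> J then \<sigma> k t else 0) (\<sigma> j t))"
  by (rule simple_function_compose2[where h = "\<lambda>h v. h(j := v)"]) (use insert in auto)
 moreover have "(\<lambda>h v. h(j := v)) (\<lambda>k. if k \<in> J then \<sigma> k t else 0) (\<sigma> j t) = (\<lambda>k. if k \<in> insert j J then \<sigma> k t else 0)" for t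
  by auto
 ultimately show ?case by simp
qed

text \<open>Measurability is asked of single coefficients only; strong measurability in the function
  spaces is derived from it. Boundedness of each coefficient makes the rounded path finitely
  valued.\<close>

locale coefficient_path =
 fixes z :: bool and p :: nat and T :: real and c :: "real => int => complex"
 assumes adm: "t \<in> {0..T} ==> admissible z (c t)"
  and meas: "(\<lambda>t. c t k) \<in> borel_measurable (time T)"
  and bdd: "\<exists>B. \<forall>t\<in>{0..T}. cmod (c t k) <= B"
  and AE_summable: "AE t in time T. wsummable p (c t)"
begin

text \<open>So fine that the weighted rounding errors of all modes in the band sum to at most
  \<open>1 / (n + 1)\<close>; the added one keeps it positive.\<close>

definition "prec n = nat \<lceil>2 * (real n + 1) * (\<Sum>k\<in>modes n. wt p k)\<rceil> + 1"

lemma prec: "prec n > 0" "2 * (real n + 1) * (\<Sum>k\<in>modes n. wt p k) <= real (prec n)"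
 unfolding prec_def by (simp, linarith)

abbreviation "approx n t \<equiv> trg (rounded n (prec n) (c t))"

text \<open>\<open>G\<close> is arbitrary because any function of a finitely valued one is again
  simple. It will be the series itself and also its norm.\<close>

lemma simple_approx: "simple_function (time T) (\<lambda>t. G (rounded n (prec n) (c t)))"
proof -
 have s: "simple_function (time T) (\<lambda>t. cround (prec n) (c t k))" for k
 proof (rule simple_function_borel_measurable)
  show "(\<lambda>t. cround (prec n) (c t k)) \<in> borel_measurable (time T)"
   by (rule measurable_compose[OF meas measurable_cround])
  obtain B where B: "!!t. t \<in> {0..T} ==> cmod (c t k) <= B" using bdd[of k] by blast
  have "(\<lambda>t. cround (prec n) (c t k)) ` space (time T) \<subseteq> cround (prec n) ` {z. cmod z <= B}"
   using B by (auto simp: space_restrict_space)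
  then show "finite ((\<lambda>t. cround (prec n) (c t k)) ` space (time T))"
   by (rule finite_subset) (rule finite_cround_ball)
 qed
 have "simple_function (time T) (\<lambda>t. G (\<lambda>k. if k \<in> modes n then cround (prec n) (c t k) else 0))"
  by (rule simple_function_compose1[OF simple_function_family]) (use s in auto)
 then show ?thesis by (simp add: rounded_def[abs_def])
qed

lemma error_tendsto:
 assumes "wsummable p (c t)"
 shows "(\<lambda>n. wnorm p (\<lambda>k. c t k - rounded n (prec n) (c t) k)) \<longlonglongrightarrow> 0"
proof (rule tendsto_sandwich[OF _ _ tendsto_const])
 show "(\<lambda>n. 1 / (real n + 1) + wnorm p (\<lambda>k. if k \<in> modes n then 0 else c t k)) \<longlonglongrightarrow> 0"
  using tendsto_add[OF LIMSEQ_inverse_real_of_nat wnorm_tail_tendsto[OF assms]]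
  by (simp add: inverse_eq_divide add.commute)
qed (auto intro!: always_eventually wnorm_nonneg wnorm_rounded_le prec assms)

end

locale space_path = series_space + coefficient_path
begin

lemma AE_good: "AE t in time T. admissible z (c t) \<and> wsummable p (c t)"
 using AE_summable AE_space by eventually_elim (auto simp: adm space_restrict_space)

lemma diff_norm:
 assumes "admissible z a" "wsummable p a" "admissible z b" "wsummable p b"
 shows "fnorm X (\<lambda>x. trg a x - trg b x) = fnorm X (trg (\<lambda>k. a k - b k))"
proof -
 have "(\<lambda>x. trg a x - trg b x) = trg (\<lambda>k. a k - b k)"
  using trg_diff[of a b] wsummable_mono[OF assms(2), of 0] wsummable_mono[OF assms(4), of 0] by auto
 then show ?thesis by simp
qed

lemma strongly_measurable_series: "strongly_measurable T X (\<lambda>t. trg (c t))"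
 unfolding strongly_measurable_def
proof (intro exI[of _ approx] conjI allI)
 fix n
 show "simple_function (time T) (approx n)" by (rule simple_approx)
 show "approx n ` {0..T} \<subseteq> fcarrier X"
  using adm by (auto intro!: carrier admissible_rounded wsummable_rounded)
next
 show "AE t in time T. (\<lambda>n. fnorm X (\<lambda>x. trg (c t) x - approx n t x)) \<longlonglongrightarrow> 0"
  using AE_good
 proof eventually_elim
  case (elim t)
  have d: "admissible z (\<lambda>k. c t k - rounded n (prec n) (c t) k)" "wsummable p (\<lambda>k. c t k - rounded n (prec n) (c t) k)" for n
   using elim by (auto intro!: admissible_diff wsummable_diff admissible_rounded wsummable_rounded)
  have eq: "fnorm X (\<lambda>x. trg (c t) x - approx n t x) = fnorm X (trg (\<lambda>k. c t k - rounded n (prec n) (c t) k))" for n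
   using elim by (intro diff_norm admissible_rounded wsummable_rounded) auto
  show ?case unfolding eq
  proof (rule tendsto_sandwich[OF _ _ tendsto_const])
   show "(\<lambda>n. C * wnorm p (\<lambda>k. c t k - rounded n (prec n) (c t) k)) \<longlonglongrightarrow> 0"
    using tendsto_mult_left[OF error_tendsto, of t C] elim by simp
  qed (auto intro!: always_eventually norm_nonneg norm_le d)
 qed
qed

text \<open>For an abstract space only the triangle inequality and the domination by
  \<open>wnorm\<close> are known; they make the norm a limit, almost everywhere, of the norms of the
  simple approximations.\<close>

lemma measurable_norm: "(\<lambda>t. fnorm X (trg (c t))) \<in> borel_measurable (time T)"
proof (rule borel_measurable_lebesgue_on_AE)
 show "(\<lambda>t. lim (\<lambda>n. fnorm X (approx n t))) \<in> borel_measurable (time T)"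
  by (intro borel_measurable_lim_metric borel_measurable_simple_function simple_approx)
 show "AE t in time T. lim (\<lambda>n. fnorm X (approx n t)) = fnorm X (trg (c t))"
  using AE_good
 proof eventually_elim
  case (elim t)
  let ?r = "\<lambda>n. rounded n (prec n) (c t)"
  have r: "admissible z (?r n)" "wsummable p (?r n)" for n
   using elim by (auto intro!: admissible_rounded wsummable_rounded)
  have d: "admissible z (\<lambda>k. c t k - ?r n k)" "wsummable p (\<lambda>k. c t k - ?r n k)"
   "admissible z (\<lambda>k. ?r n k - c t k)" "wsummable p (\<lambda>k. ?r n k - c t k)" for n
   using elim r by (auto intro!: admissible_diff wsummable_diff)
  have sw: "wnorm p (\<lambda>k. ?r n k - c t k) = wnorm p (\<lambda>k. c t k - ?r n k)" for n
   unfolding wnorm_def by (simp add: norm_minus_commute)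
  have bd: "\<bar>fnorm X (approx n t) - fnorm X (trg (c t))\<bar> <= C * wnorm p (\<lambda>k. c t k - ?r n k)" for n
  proof -
   have "fnorm X (trg (c t)) <= fnorm X (trg (?r n)) + fnorm X (trg (\<lambda>k. c t k - ?r n k))"
   proof -
    have "(\<lambda>k. ?r n k + (c t k - ?r n k)) = c t" by auto
    with norm_add[OF r(1)[of n] r(2)[of n] d(1)[of n] d(2)[of n]] show ?thesis by simp
   qed
   moreover have "fnorm X (trg (?r n)) <= fnorm X (trg (c t)) + fnorm X (trg (\<lambda>k. ?r n k - c t k))"
   proof -
    have eq: "(\<lambda>k. c t k + (?r n k - c t k)) = ?r n" by auto
    show ?thesis using norm_add[OF conjunct1[OF elim] conjunct2[OF elim] d(3)[of n] d(4)[of n]] unfolding eq .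
   qed
   moreover note norm_le[OF d(1)[of n] d(2)[of n]] norm_le[OF d(3)[of n] d(4)[of n]]
   ultimately show ?thesis by (simp add: sw abs_le_iff)
  qed
  have lim: "(\<lambda>n. C * wnorm p (\<lambda>k. c t k - ?r n k)) \<longlonglongrightarrow> 0"
   using tendsto_mult_left[OF error_tendsto, of t C] elim by simp
  have "(\<lambda>n. fnorm X (approx n t) - fnorm X (trg (c t))) \<longlonglongrightarrow> 0"
   by (rule Lim_null_comparison[OF always_eventually lim]) (use bd in simp)
  then show ?case by (rule limI[OF LIM_zero_cancel])
 qed
qed simp

lemma Lp_time_series:
 assumes q: "q > 0" and h: "integrable (time T) (\<lambda>t. wnorm p (c t) powr q)"
 shows "(\<lambda>t. trg (c t)) \<in> Lp_time q T X"
proof -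
 have "AE t in time T. trg (c t) \<in> fcarrier X"
  using AE_good by eventually_elim (auto intro: carrier)
 moreover have "integrable (time T) (\<lambda>t. fnorm X (trg (c t)) powr q)"
 proof (rule Bochner_Integration.integrable_bound)
  show "integrable (time T) (\<lambda>t. C powr q * wnorm p (c t) powr q)" using h by auto
  show "(\<lambda>t. fnorm X (trg (c t)) powr q) \<in> borel_measurable (time T)"
   using measurable_norm by measurable
  show "AE t in time T. norm (fnorm X (trg (c t)) powr q) <= norm (C powr q * wnorm p (c t) powr q)"
   using AE_good
  proof eventually_elim
   case (elim t)
   have "fnorm X (trg (c t)) powr q <= (C * wnorm p (c t)) powr q"
    using elim q by (intro powr_mono2 norm_nonneg norm_le) auto
   then show ?case using C wnorm_nonneg by (simp add: powr_mult)
  qed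
 qed
 ultimately show ?thesis using strongly_measurable_series by (simp add: Lp_time_def)
qed

end

section \<open>Trigonometric series in the function spaces\<close>

lemma series_space_mono:
 assumes "series_space z X p C" "p <= q" shows "series_space z X q C"
proof -
 interpret series_space z X p C by (rule assms)
 have m: "wsummable p c" if "wsummable q c" for c using wsummable_mono[OF that assms(2)] .
 show ?thesis
 proof
  show "C >= 0" by (rule C)
 next
  fix c assume c: "admissible z c" "wsummable q c"
  show "trg c \<in> fcarrier X" by (rule carrier[OF c(1) m[OF c(2)]])
  show "0 <= fnorm X (trg c)" by (rule norm_nonneg[OF c(1) m[OF c(2)]])
  have "fnorm X (trg c) <= C * wnorm p c" by (rule norm_le[OF c(1) m[OF c(2)]])
  also have "... <= C * wnorm q c" by (rule mult_left_mono[OF wnorm_mono[OF c(2) assms(2)] C])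
  finally show "fnorm X (trg c) <= C * wnorm q c" .
 next
  fix c d assume c: "admissible z c" "wsummable q c" and d: "admissible z d" "wsummable q d"
  show "fnorm X (trg (\<lambda>k. c k + d k)) <= fnorm X (trg c) + fnorm X (trg d)"
   by (rule norm_add[OF c(1) m[OF c(2)] d(1) m[OF d(2)]])
 qed
qed

lemma coefficient_path_mono:
 assumes "coefficient_path z q T c" "p <= q" shows "coefficient_path z p T c"
proof -
 interpret coefficient_path z q T c by (rule assms)
 show ?thesis
 proof
  show "AE t in time T. wsummable p (c t)"
   using AE_summable by eventually_elim (rule wsummable_mono[OF _ assms(2)])
 qed (auto intro: adm meas bdd)
qed

lemma borel_measurable_trg: "wsummable 0 c ==> trg c \<in> borel_measurable torus"
 by (intro continuous_measurable continuous_on_trg)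

section \<open>Integrable and essentially bounded functions\<close>

lemma series_space_L1: "series_space False L1 0 (2 * pi)"
proof
 fix c assume "admissible False c" and c: "wsummable 0 c"
 show "trg c \<in> fcarrier L1" by (rule trg_in_L1[OF c])
 show "0 <= fnorm L1 (trg c)" by (simp add: L1_def)
 have "(LINT x|torus. \<bar>trg c x\<bar>) <= (LINT x|torus. wnorm 0 c)"
  by (rule integral_mono)
   (auto intro!: integrable_abs integrable_trg c abs_trg_le simp: finite_measure.integrable_const[OF finite_measure_torus])
 also have "... = 2 * pi * wnorm 0 c"
  by (simp add: measure_def space_restrict_space)
 finally show "fnorm L1 (trg c) <= 2 * pi * wnorm 0 c" by (simp add: L1_def)
next
 fix c d assume c: "wsummable 0 c" and d: "wsummable 0 d"
 have "(LINT x|torus. \<bar>trg (\<lambda>k. c k + d k) x\<bar>) <= (LINT x|torus. \<bar>trg c x\<bar> + \<bar>trg d x\<bar>)"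
  by (rule integral_mono) (auto intro!: integrable_trg c d Bochner_Integration.integrable_add wsummable_add simp: trg_add[OF c d])
 also have "... = (LINT x|torus. \<bar>trg c x\<bar>) + (LINT x|torus. \<bar>trg d x\<bar>)"
  by (rule Bochner_Integration.integral_add) (auto intro!: integrable_trg c d)
 finally show "fnorm L1 (trg (\<lambda>k. c k + d k)) <= fnorm L1 (trg c) + fnorm L1 (trg d)" by (simp add: L1_def)
qed simp

lemma esssup_trg:
 assumes c: "wsummable 0 c"
 shows "0 <= esssup torus (\<lambda>x. ereal \<bar>trg c x\<bar>)" "esssup torus (\<lambda>x. ereal \<bar>trg c x\<bar>) <= ereal (wnorm 0 c)"
proof -
 note [measurable] = borel_measurable_trg[OF c]
 have "esssup torus (\<lambda>x. 0::ereal) = 0" by (rule esssup_const) (simp add: space_restrict_space)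
 moreover have "esssup torus (\<lambda>x. 0::ereal) <= esssup torus (\<lambda>x. ereal \<bar>trg c x\<bar>)"
  by (rule esssup_mono) auto
 ultimately show "0 <= esssup torus (\<lambda>x. ereal \<bar>trg c x\<bar>)" by simp
 show "esssup torus (\<lambda>x. ereal \<bar>trg c x\<bar>) <= ereal (wnorm 0 c)"
  by (rule esssup_I) (auto simp: abs_trg_le c)
qed

lemma series_space_Linf: "series_space False Linf 0 1"
proof
 have e: "esssup torus (\<lambda>x. ereal \<bar>trg c x\<bar>) = ereal (fnorm Linf (trg c))" if "wsummable 0 c" for c
  using esssup_trg[OF that] by (cases "esssup torus (\<lambda>x. ereal \<bar>trg c x\<bar>)") (auto simp: Linf_def)
 {
  fix c assume "admissible False c" and c: "wsummable 0 c"
  have "esssup torus (\<lambda>x. ereal \<bar>trg c x\<bar>) < \<infinity>" using e[OF c] by simp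
  then show "trg c \<in> fcarrier Linf" using borel_measurable_trg[OF c] periodic_trg by (simp add: Linf_def)
  show "0 <= fnorm Linf (trg c)" "fnorm Linf (trg c) <= 1 * wnorm 0 c"
   using esssup_trg[OF c] unfolding e[OF c] by simp_all
 next
  fix c d assume c: "wsummable 0 c" and d: "wsummable 0 d"
  note [measurable] = borel_measurable_trg[OF c] borel_measurable_trg[OF d] borel_measurable_trg[OF wsummable_add(1)[OF c d]]
  have "esssup torus (\<lambda>x. ereal \<bar>trg (\<lambda>k. c k + d k) x\<bar>) <= esssup torus (\<lambda>x. ereal \<bar>trg c x\<bar> + ereal \<bar>trg d x\<bar>)"
   by (rule esssup_mono) (auto simp: trg_add[OF c d])
  also have "... <= esssup torus (\<lambda>x. ereal \<bar>trg c x\<bar>) + esssup torus (\<lambda>x. ereal \<bar>trg d x\<bar>)"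
   by (rule esssup_add)
  finally show "fnorm Linf (trg (\<lambda>k. c k + d k)) <= fnorm Linf (trg c) + fnorm Linf (trg d)"
   unfolding e[OF c] e[OF d] e[OF wsummable_add(1)[OF c d]] by simp
 }
qed simp

section \<open>Weak derivatives and Sobolev spaces of integer order\<close>

lemma smooth_periodic_trg:
 assumes "!!j. wsummable j c" shows "smooth_periodic (trg c)"
 unfolding smooth_periodic_def using trg_field_differentiable[OF assms] periodic_trg by blast

lemma trg_single: "trg (\<lambda>j. if j = k then a else 0) x = Re (a * wave k x)"
proof -
 have "ser (\<lambda>j. if j = k then a else 0) x = (\<Sum>\<^sub>\<infinity>j\<in>{k}. a * wave j x)"
  unfolding ser_def by (rule infsum_cong_neutral) auto
 then show ?thesis by (simp add: trg_def)
qed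

lemma smooth_periodic_single: "smooth_periodic (\<lambda>x. Re (a * wave k x))"
proof -
 have "smooth_periodic (trg (\<lambda>j. if j = k then a else 0))"
  by (rule smooth_periodic_trg, rule wsummable_finite_support[of "nat \<bar>k\<bar>"]) (auto simp: mem_modes)
 then show ?thesis by (simp add: trg_single[abs_def])
qed

text \<open>Real and imaginary parts of the characters are smooth test functions, so all Fourier
  coefficients of the difference vanish and \<open>fourier_unique\<close> applies.\<close>

lemma AE_eq_if_same_moments:
 assumes v: "integrable torus v" and w: "integrable torus w"
  and eq: "!!\<phi>. smooth_periodic \<phi> ==> (LINT x|torus. v x * \<phi> x) = (LINT x|torus. w x * \<phi> x)"
 shows "AE x in torus. v x = w x"
proof -
 define u where "u x = v x - w x" for x
 have u: "integrable torus u" unfolding u_def using v w by auto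
 have m: "integrable torus (\<lambda>x. h x * Re (a * wave k x))"
  if h: "integrable torus h" for h :: "real => real" and a k
 proof (rule Bochner_Integration.integrable_bound)
  show "integrable torus (\<lambda>x. cmod a * \<bar>h x\<bar>)" using h by auto
  have "(\<lambda>x. Re (a * wave k x)) \<in> borel_measurable torus"
   by (intro continuous_measurable continuous_intros)
  then show "(\<lambda>x. h x * Re (a * wave k x)) \<in> borel_measurable torus"
   using h by (intro borel_measurable_times) auto
  have "\<bar>Re (a * wave k x)\<bar> <= cmod a" for x
   using abs_Re_le_cmod[of "a * wave k x"] by (simp add: norm_mult)
  then have "\<bar>h x\<bar> * \<bar>Re (a * wave k x)\<bar> <= \<bar>h x\<bar> * cmod a" for x
   by (intro mult_left_mono) auto
  then show "AE x in torus. norm (h x * Re (a * wave k x)) <= norm (cmod a * \<bar>h x\<bar>)"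
   by (intro always_eventually allI) (simp only: real_norm_def abs_mult abs_norm_cancel abs_abs mult.commute[of "cmod a"])
 qed
 have 0: "(LINT x|torus. u x * Re (a * wave k x)) = 0" for a k
 proof -
  have "(LINT x|torus. u x * Re (a * wave k x))
    = (LINT x|torus. v x * Re (a * wave k x)) - (LINT x|torus. w x * Re (a * wave k x))"
   unfolding u_def left_diff_distrib by (rule Bochner_Integration.integral_diff[OF m[OF v] m[OF w]])
  then show ?thesis using eq[OF smooth_periodic_single[of a k]] by simp
 qed
 have "AE x in torus. u x = 0"
 proof (rule fourier_unique[OF u])
  fix k
  have e: "complex_of_real (u x) * exp (- \<i> * of_int k * of_real x)
    = of_real (u x * Re (1 * cis (real_of_int (- k) * x))) + \<i> * of_real (u x * Re (- \<i> * cis (real_of_int (- k) * x)))" for x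
  proof -
   have "exp (- \<i> * of_int k * of_real x) = cis (real_of_int (- k) * x)" by (simp add: cis_conv_exp mult_ac)
   then show ?thesis by (simp add: complex_eq_iff)
  qed
  have i: "complex_integrable torus (\<lambda>x. of_real (u x * Re (a * cis (real_of_int (- k) * x))))" for a
   by (rule integrable_of_real[OF m[OF u]])
  have z: "(LINT x|torus. complex_of_real (u x * Re (a * cis (real_of_int (- k) * x)))) = 0" for a
   by (simp only: integral_complex_of_real 0 of_real_0)
  have "(LINT x|torus. complex_of_real (u x) * exp (- \<i> * of_int k * of_real x))
    = (LINT x|torus. complex_of_real (u x * Re (1 * cis (real_of_int (- k) * x))))
     + (LINT x|torus. \<i> * complex_of_real (u x * Re (- \<i> * cis (real_of_int (- k) * x))))"
   unfolding e by (rule Bochner_Integration.integral_add[OF i integrable_mult_right[OF i]])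
  also have "... = 0" by (simp only: integral_mult_right_zero z mult_zero_right add_0)
  finally have "(LINT x|torus. complex_of_real (u x) * exp (- \<i> * of_int k * of_real x)) = 0" .
  then show "fourier u k = 0" by (simp add: fourier_def)
 qed
 then show ?thesis by (simp add: u_def)
qed

text \<open>\<open>weak_deriv\<close> is an arbitrary choice among the weak derivatives; their
  uniqueness up to null sets identifies it with the differentiated series.\<close>

lemma weak_deriv_trg:
 assumes c: "wsummable j c"
 shows "weak_deriv j (trg c) \<in> fcarrier L1" "AE x in torus. weak_deriv j (trg c) x = trg (dco j c) x"
proof -
 have d: "has_weak_deriv j (trg c) (trg (dco j c))" by (rule has_weak_deriv_trg[OF c])
 have w: "has_weak_deriv j (trg c) (weak_deriv j (trg c))"
  unfolding weak_deriv_def by (rule someI[of "has_weak_deriv j (trg c)", OF d])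
 then show "weak_deriv j (trg c) \<in> fcarrier L1" by (simp add: has_weak_deriv_def)
 show "AE x in torus. weak_deriv j (trg c) x = trg (dco j c) x"
 proof (rule AE_eq_if_same_moments)
  show "integrable torus (weak_deriv j (trg c))" "integrable torus (trg (dco j c))"
   using d w by (auto simp: has_weak_deriv_def L1_def)
  fix \<phi> assume \<phi>: "smooth_periodic \<phi>"
  have eq: "(LINT x|torus. trg c x * (deriv ^^ j) \<phi> x) = (- 1) ^ j * (LINT x|torus. v x * \<phi> x)"
   if "has_weak_deriv j (trg c) v" for v
   using that \<phi> unfolding has_weak_deriv_def by blast
  have "(- 1) ^ j * (LINT x|torus. weak_deriv j (trg c) x * \<phi> x) = (- 1) ^ j * (LINT x|torus. trg (dco j c) x * \<phi> x)"
   using eq[OF w] eq[OF d] by (simp only:)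
  then show "(LINT x|torus. weak_deriv j (trg c) x * \<phi> x) = (LINT x|torus. trg (dco j c) x * \<phi> x)" by simp
 qed
qed

text \<open>The condition \<open>inv\<close> bridges the choice in \<open>weak_deriv\<close>: the
  norm of \<open>Y\<close> must not see null sets, so that it can be computed from the
  differentiated series.\<close>

lemma series_space_W:
 assumes Y: "series_space False Y 0 C"
  and inv: "!!u v. u \<in> fcarrier L1 ==> v \<in> fcarrier L1 ==> AE x in torus. u x = v x ==> fnorm Y u = fnorm Y v"
 shows "series_space False (W p Y) p ((real p + 1) * C)"
proof -
 interpret Y: series_space False Y 0 C by (rule Y)
 have s: "wsummable 0 (dco j c)" "wnorm 0 (dco j c) <= wnorm p c" "wsummable j c" if "wsummable p c" "j <= p" for j c
  using wsummable_dco[of 0 j c] wsummable_mono[OF that] wnorm_mono[OF that] by auto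
 have a: "admissible False (dco j c)" if "admissible False c" for j c
  using that by (simp add: admissible_def hermitian_dco)
 have n: "fnorm (W p Y) (trg c) = (\<Sum>j\<le>p. fnorm Y (trg (dco j c)))" if c: "wsummable p c" for c
 proof -
  have "fnorm Y (weak_deriv j (trg c)) = fnorm Y (trg (dco j c))" if "j <= p" for j
   by (rule inv[OF weak_deriv_trg(1) trg_in_L1 weak_deriv_trg(2)]) (use s[OF c that] in auto)
  then show ?thesis by (simp add: W_def)
 qed
 have d0: "dco 0 c = c" for c by (auto simp: dco_def)
 show ?thesis
 proof
  show "0 <= (real p + 1) * C" using Y.C by simp
 next
  fix c assume h: "admissible False c" and c: "wsummable p c"
  have "trg c \<in> fcarrier Y" using Y.carrier[OF h wsummable_mono[OF c]] by simp
  moreover have "\<exists>v\<in>fcarrier Y. has_weak_deriv j (trg c) v" if "j <= p" for j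
   using Y.carrier[OF a[OF h] s(1)[OF c that]] has_weak_deriv_trg[OF s(3)[OF c that]] by blast
  ultimately show "trg c \<in> fcarrier (W p Y)" by (simp add: W_def)
  show "0 <= fnorm (W p Y) (trg c)"
   unfolding n[OF c] by (intro sum_nonneg Y.norm_nonneg a[OF h] s(1)[OF c]) simp
  have "fnorm (W p Y) (trg c) <= (\<Sum>j\<le>p. C * wnorm p c)"
   unfolding n[OF c]
  proof (rule sum_mono)
   fix j assume j: "j \<in> {..p}"
   then have "fnorm Y (trg (dco j c)) <= C * wnorm 0 (dco j c)" by (intro Y.norm_le a[OF h] s(1)[OF c]) simp
   also have "... <= C * wnorm p c" using j by (intro mult_left_mono s(2)[OF c] Y.C) simp
   finally show "fnorm Y (trg (dco j c)) <= C * wnorm p c" .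
  qed
  then show "fnorm (W p Y) (trg c) <= (real p + 1) * C * wnorm p c" by (simp add: algebra_simps)
 next
  fix c d assume h: "admissible False c" "admissible False d" and c: "wsummable p c" and d: "wsummable p d"
  have "fnorm Y (trg (dco j (\<lambda>k. c k + d k))) <= fnorm Y (trg (dco j c)) + fnorm Y (trg (dco j d))" if "j <= p" for j
  proof -
   have "dco j (\<lambda>k. c k + d k) = (\<lambda>k. dco j c k + dco j d k)" by (auto simp: dco_def algebra_simps)
   then show ?thesis
    using Y.norm_add[OF a[OF h(1)] s(1)[OF c that] a[OF h(2)] s(1)[OF d that]] by simp
  qed
  then show "fnorm (W p Y) (trg (\<lambda>k. c k + d k)) <= fnorm (W p Y) (trg c) + fnorm (W p Y) (trg d)"
   unfolding n[OF c] n[OF d] n[OF wsummable_add(1)[OF c d]] sum.distrib[symmetric]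
   by (intro sum_mono) simp
 qed
qed

lemma series_space_W_L1: "series_space False (W p L1) p ((real p + 1) * (2 * pi))"
 by (rule series_space_W[OF series_space_L1])
  (auto simp: L1_def intro!: integral_cong_AE borel_measurable_abs borel_measurable_integrable elim: eventually_mono)

lemma series_space_W_Linf: "series_space False (W p Linf) p ((real p + 1) * 1)"
proof (rule series_space_W[OF series_space_Linf])
 fix u v assume u: "u \<in> fcarrier L1" and v: "v \<in> fcarrier L1" and "AE x in torus. u x = v x"
 then have "AE x in torus. ereal \<bar>u x\<bar> = ereal \<bar>v x\<bar>" by (auto elim: eventually_mono)
 then have "esssup torus (\<lambda>x. ereal \<bar>u x\<bar>) = esssup torus (\<lambda>x. ereal \<bar>v x\<bar>)"
  using u v by (intro esssup_AE_cong) (auto simp: L1_def)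
 then show "fnorm Linf u = fnorm Linf v" by (simp add: Linf_def)
qed

section \<open>Square sums and homogeneous Sobolev spaces\<close>

lemma infsum_square_le:
 fixes x :: "int => real"
 assumes "!!k. x k >= 0" "x summable_on UNIV"
 shows "(\<lambda>k. (x k)\<^sup>2) summable_on UNIV" "(INFSUM k. (x k)\<^sup>2) <= (INFSUM k. x k)\<^sup>2"
proof -
 have "x k <= (INFSUM k. x k)" for k using finite_sum_le_infsum[OF assms(2), of "{k}"] assms(1) by simp
 then have le: "(x k)\<^sup>2 <= (INFSUM k. x k) * x k" for k
  unfolding power2_eq_square by (rule mult_right_mono[OF _ assms(1)])
 have s: "(\<lambda>k. (INFSUM k. x k) * x k) summable_on UNIV" by (rule summable_on_cmult_right[OF assms(2)])
 show sq: "(\<lambda>k. (x k)\<^sup>2) summable_on UNIV" by (rule summable_on_comparison_test[OF s le]) simp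
 show "(INFSUM k. (x k)\<^sup>2) <= (INFSUM k. x k)\<^sup>2"
  using infsum_mono[OF sq s le] by (simp add: infsum_cmult_right' power2_eq_square)
qed

lemma infsum_minkowski:
 fixes a b c :: "int => real"
 assumes a: "(\<lambda>k. (a k)\<^sup>2) summable_on UNIV" and b: "(\<lambda>k. (b k)\<^sup>2) summable_on UNIV"
  and c: "!!k. 0 <= c k" "!!k. c k <= a k + b k"
 shows "(\<lambda>k. (c k)\<^sup>2) summable_on UNIV"
  "sqrt (INFSUM k. (c k)\<^sup>2) <= sqrt (INFSUM k. (a k)\<^sup>2) + sqrt (INFSUM k. (b k)\<^sup>2)"
proof -
 have "(c k)\<^sup>2 <= 2 * (a k)\<^sup>2 + 2 * (b k)\<^sup>2" for k
 proof -
  have "(c k)\<^sup>2 <= (a k + b k)\<^sup>2" by (rule power_mono[OF c(2) c(1)])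
  also have "... <= 2 * (a k)\<^sup>2 + 2 * (b k)\<^sup>2"
   using zero_le_power2[of "a k - b k"] by (simp add: power2_eq_square algebra_simps)
  finally show ?thesis .
 qed
 then show s: "(\<lambda>k. (c k)\<^sup>2) summable_on UNIV"
  by (intro summable_on_comparison_test[OF summable_on_add[OF summable_on_cmult_right[OF a] summable_on_cmult_right[OF b]]]) auto
 have "(INFSUM k. (c k)\<^sup>2) <= (sqrt (INFSUM k. (a k)\<^sup>2) + sqrt (INFSUM k. (b k)\<^sup>2))\<^sup>2"
 proof (rule infsum_le_finite_sums[OF s])
  fix F :: "int set" assume F: "finite F"
  have L: "L2_set h F <= sqrt (INFSUM k. (h k)\<^sup>2)" if "(\<lambda>k. (h k)\<^sup>2) summable_on UNIV" for h :: "int => real"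
   unfolding L2_set_def by (rule real_sqrt_le_mono, rule finite_sum_le_infsum[OF that F]) auto
  have "L2_set c F <= L2_set (\<lambda>k. a k + b k) F" by (rule L2_set_mono) (auto intro: c)
  also have "... <= L2_set a F + L2_set b F" by (rule L2_set_triangle_ineq)
  also have "... <= sqrt (INFSUM k. (a k)\<^sup>2) + sqrt (INFSUM k. (b k)\<^sup>2)" by (intro add_mono L a b)
  finally have "(L2_set c F)\<^sup>2 <= (sqrt (INFSUM k. (a k)\<^sup>2) + sqrt (INFSUM k. (b k)\<^sup>2))\<^sup>2"
   by (rule power_mono) simp
  then show "(\<Sum>k\<in>F. (c k)\<^sup>2) <= (sqrt (INFSUM k. (a k)\<^sup>2) + sqrt (INFSUM k. (b k)\<^sup>2))\<^sup>2"
   by (simp add: L2_set_def sum_nonneg)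
 qed
 then show "sqrt (INFSUM k. (c k)\<^sup>2) <= sqrt (INFSUM k. (a k)\<^sup>2) + sqrt (INFSUM k. (b k)\<^sup>2)"
  by (intro real_le_lsqrt add_nonneg_nonneg real_sqrt_ge_zero infsum_nonneg) auto
qed

definition sobolev :: "real => (int => complex) => real" where
 "sobolev s c = (INFSUM k. mag k powr (2 * s) * (cmod (c k))\<^sup>2)"

lemma sobolev_term: "mag k powr (2 * s) * (cmod w)\<^sup>2 = (mag k powr s * cmod w)\<^sup>2"
 by (simp add: power_mult_distrib power2_eq_square flip: powr_add)

lemma Hdot_trg:
 assumes c: "admissible True c" "wsummable 0 c"
  and s: "(\<lambda>k. mag k powr (2 * s) * (cmod (c k))\<^sup>2) summable_on UNIV"
 shows "trg c \<in> fcarrier (Hdot s)"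
proof -
 have h: "hermitian c" "c 0 = 0" using c by (auto simp: admissible_def)
 have "(\<lambda>k. (cmod (c k))\<^sup>2) summable_on UNIV"
  using infsum_square_le(1)[of "\<lambda>k. cmod (c k)"] c(2) by (simp add: wsummable_def)
 from summable_on_add[OF this s]
 have "(\<lambda>k. (1 + mag k powr (2 * s)) * (cmod (fourier (trg c) k))\<^sup>2) summable_on UNIV"
  by (simp add: fourier_trg[OF c(2) h(1)] algebra_simps)
 moreover have "integrable torus (\<lambda>x. (trg c x)\<^sup>2)"
  by (intro integrable_torus_continuous continuous_intros continuous_on_trg c)
 ultimately show ?thesis
  using periodic_trg borel_measurable_trg[OF c(2)] mean_trg[OF c(2) h] by (simp add: Hdot_def)
qed

lemma fnorm_Hdot:
 assumes "hermitian c" "wsummable 0 c" shows "fnorm (Hdot s) (trg c) = sqrt (sobolev s c)"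
 by (simp add: Hdot_def sobolev_def fourier_trg[OF assms(2,1)])

lemma sobolev_nonneg: "0 <= sobolev s c"
 unfolding sobolev_def by (rule infsum_nonneg) simp

text \<open>A sum of nonnegative terms dominates the root of the sum of their squares, so the
  embedding constant is one; the triangle inequality is that of Minkowski.\<close>

lemma series_space_Hdot:
 assumes s: "0 <= s" "s <= real p" shows "series_space True (Hdot s) p 1"
proof -
 have w: "mag k powr s <= wt p k" for k
 proof -
  have "mag k powr s <= (1 + mag k) powr s" by (rule powr_mono2) (use s in auto)
  also have "... <= (1 + mag k) powr real p" by (rule powr_mono) (use s in auto)
  finally show ?thesis by (simp add: wt_def powr_realpow)
 qed
 have le: "mag k powr s * cmod (c k) <= wt p k * cmod (c k)" for k and c :: "int => complex"
  by (intro mult_right_mono w) simp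
 have 1: "(\<lambda>k. mag k powr s * cmod (c k)) summable_on UNIV"
  "(INFSUM k. mag k powr s * cmod (c k)) <= wnorm p c" if "wsummable p c" for c
 proof -
  show "(\<lambda>k. mag k powr s * cmod (c k)) summable_on UNIV"
   using that unfolding wsummable_def by (rule summable_on_comparison_test) (auto intro: le)
  then show "(INFSUM k. mag k powr s * cmod (c k)) <= wnorm p c"
   using that unfolding wsummable_def wnorm_def by (rule infsum_mono) (rule le)
 qed
 have 2: "(\<lambda>k. (mag k powr s * cmod (c k))\<^sup>2) summable_on UNIV" if "wsummable p c" for c
  by (rule infsum_square_le(1)[OF _ 1(1)[OF that]]) simp
 show ?thesis
 proof
  fix c assume a: "admissible True c" and c: "wsummable p c"
  have c0: "wsummable 0 c" using wsummable_mono[OF c] by simp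
  have h: "hermitian c" using a by (simp add: admissible_def)
  show "trg c \<in> fcarrier (Hdot s)" by (rule Hdot_trg[OF a c0]) (use 2[OF c] in \<open>simp add: sobolev_term\<close>)
  show "0 <= fnorm (Hdot s) (trg c)" by (simp add: fnorm_Hdot[OF h c0] sobolev_nonneg)
  have "sobolev s c <= (INFSUM k. mag k powr s * cmod (c k))\<^sup>2"
   unfolding sobolev_def sobolev_term by (rule infsum_square_le(2)[OF _ 1(1)[OF c]]) simp
  also have "... <= (wnorm p c)\<^sup>2" by (intro power_mono 1(2)[OF c] infsum_nonneg) simp
  finally show "fnorm (Hdot s) (trg c) <= 1 * wnorm p c"
   by (simp add: fnorm_Hdot[OF h c0] real_le_lsqrt wnorm_nonneg)
 next
  fix c d assume h: "admissible True c" "admissible True d" and c: "wsummable p c" and d: "wsummable p d"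
  have c0: "wsummable 0 c" and d0: "wsummable 0 d" using wsummable_mono[OF c] wsummable_mono[OF d] by auto
  have hh: "hermitian c" "hermitian d" "hermitian (\<lambda>k. c k + d k)"
   using h admissible_add[OF h] by (auto simp: admissible_def)
  show "fnorm (Hdot s) (trg (\<lambda>k. c k + d k)) <= fnorm (Hdot s) (trg c) + fnorm (Hdot s) (trg d)"
   unfolding fnorm_Hdot[OF hh(1) c0] fnorm_Hdot[OF hh(2) d0] fnorm_Hdot[OF hh(3) wsummable_add(1)[OF c0 d0]]
    sobolev_def sobolev_term
  proof (rule infsum_minkowski(2)[OF 2[OF c] 2[OF d]])
   fix k
   show "mag k powr s * cmod (c k + d k) <= mag k powr s * cmod (c k) + mag k powr s * cmod (d k)"
    unfolding distrib_left[symmetric] by (intro mult_left_mono norm_triangle_ineq) simp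
  qed simp
 qed simp
qed

section \<open>Hoelder spaces\<close>

lemma trg_lipschitz:
 assumes "wsummable 1 c" shows "\<bar>trg c x - trg c y\<bar> <= wnorm 1 c * \<bar>x - y\<bar>"
proof -
 have "wsummable 0 (dco 1 c)" "wnorm 0 (dco 1 c) <= wnorm 1 c" using wsummable_dco[of 0 1 c] assms by auto
 then have b: "norm (trg (dco 1 c) z) <= wnorm 1 c" for z using abs_trg_le[of "dco 1 c" z] by simp
 have "norm (trg c x - trg c y) <= wnorm 1 c * norm (x - y)"
  by (rule field_differentiable_bound[OF convex_UNIV, where f' = "trg (dco 1 c)"])
   (use trg_has_derivative[OF assms] b in auto)
 then show ?thesis by simp
qed

text \<open>For distances \<open>r \<le> 1\<close> the Lipschitz bound suffices, as
  \<open>r \<le> r powr \<alpha>\<close>; beyond that, twice the supremum does.\<close>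

lemma trg_holder:
 assumes c: "wsummable 1 c" and \<alpha>: "0 <= \<alpha>" "\<alpha> <= 1" and xy: "x \<noteq> y"
 shows "\<bar>trg c x - trg c y\<bar> / \<bar>x - y\<bar> powr \<alpha> <= 2 * wnorm 1 c"
proof -
 define r where "r = \<bar>x - y\<bar>"
 have r: "r > 0" using xy by (simp add: r_def)
 have "\<bar>trg c x - trg c y\<bar> <= 2 * wnorm 1 c * r powr \<alpha>"
 proof (cases "r <= 1")
  case True
  have "\<bar>trg c x - trg c y\<bar> <= wnorm 1 c * r" using trg_lipschitz[OF c] by (simp add: r_def)
  also have "r <= r powr \<alpha>" using powr_mono'[of \<alpha> 1 r] \<alpha> True r by simp
  also have "wnorm 1 c * r powr \<alpha> <= 2 * wnorm 1 c * r powr \<alpha>" by (intro mult_right_mono) (auto simp: wnorm_nonneg)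
  finally show ?thesis by (simp add: wnorm_nonneg mult_left_mono)
 next
  case False
  have "wsummable 0 c" "wnorm 0 c <= wnorm 1 c" using wsummable_mono[OF c, of 0] wnorm_mono[OF c, of 0] by auto
  then have "\<bar>trg c x - trg c y\<bar> <= 2 * wnorm 1 c * 1"
   using abs_trg_le[of c x] abs_trg_le[of c y] by linarith
  also have "... <= 2 * wnorm 1 c * r powr \<alpha>"
   using False \<alpha> by (intro mult_left_mono ge_one_powr_ge_zero) (auto simp: wnorm_nonneg)
  finally show ?thesis .
 qed
 then show ?thesis using r by (simp add: pos_divide_le_eq flip: r_def)
qed

lemma SUP_abs_add_le:
 fixes f g h :: "'a => real"
 assumes "I \<noteq> {}" "!!i. i \<in> I ==> f i <= B" "!!i. i \<in> I ==> g i <= B'" "!!i. i \<in> I ==> h i <= f i + g i"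
 shows "(SUP i\<in>I. h i) <= (SUP i\<in>I. f i) + (SUP i\<in>I. g i)"
proof (rule cSUP_least[OF assms(1)])
 fix i assume i: "i \<in> I"
 have "f i <= (SUP i\<in>I. f i)" by (rule cSUP_upper[OF i]) (use assms(2) in \<open>auto intro!: bdd_aboveI2\<close>)
 moreover have "g i <= (SUP i\<in>I. g i)" by (rule cSUP_upper[OF i]) (use assms(3) in \<open>auto intro!: bdd_aboveI2\<close>)
 ultimately show "h i <= (SUP i\<in>I. f i) + (SUP i\<in>I. g i)" using assms(4)[OF i] by linarith
qed

lemma SUP_nonneg_le:
 fixes f :: "'a => real"
 assumes "I \<noteq> {}" "!!i. i \<in> I ==> 0 <= f i" "!!i. i \<in> I ==> f i <= B"
 shows "0 <= (SUP i\<in>I. f i)" "(SUP i\<in>I. f i) <= B"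
proof -
 obtain i where i: "i \<in> I" using assms(1) by blast
 have "f i <= (SUP i\<in>I. f i)" by (rule cSUP_upper[OF i]) (use assms(3) in \<open>auto intro!: bdd_aboveI2\<close>)
 then show "0 <= (SUP i\<in>I. f i)" using assms(2)[OF i] by linarith
 show "(SUP i\<in>I. f i) <= B" by (rule cSUP_least[OF assms(1,3)])
qed

text \<open>The constant counts \<open>p + 1\<close> suprema and 2 for the Hoelder quotient. That
  quotient is controlled by one further derivative, hence \<open>Suc p\<close>; four summable
  derivatives give three Hoelder continuous ones.\<close>

lemma series_space_Holder:
 assumes \<alpha>: "0 <= \<alpha>" "\<alpha> <= 1" shows "series_space False (Holder p \<alpha>) (Suc p) (real p + 3)"
proof -
 let ?I = "{(x, y). x \<noteq> (y::real)}"
 have s: "wsummable 0 (dco j c)" "wnorm 0 (dco j c) <= wnorm (Suc p) c" if "wsummable (Suc p) c" "j <= p" for j c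
  using wsummable_dco[of 0 j c] wsummable_mono[OF that(1), of j] wnorm_mono[OF that(1), of j] that(2) by auto
 have s1: "wsummable 1 (dco p c)" "wnorm 1 (dco p c) <= wnorm (Suc p) c" if "wsummable (Suc p) c" for c
  using wsummable_dco[of 1 p c] that by auto
 have it: "(deriv ^^ j) (trg c) = trg (dco j c)" if "wsummable (Suc p) c" "j <= p" for j c
  using trg_deriv_iterate[OF that(1), of j] that(2) by simp
 define Q where "Q c i = (case i of (x, y) => \<bar>trg (dco p c) x - trg (dco p c) y\<bar> / \<bar>x - y\<bar> powr \<alpha>)" for c and i :: "real \<times> real"
 have n: "fnorm (Holder p \<alpha>) (trg c) = (\<Sum>j\<le>p. SUP x. \<bar>trg (dco j c) x\<bar>) + (SUP i\<in>?I. Q c i)" if c: "wsummable (Suc p) c" for c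
  unfolding Holder_def Q_def using it[OF c] by simp
 have "(0, 1) \<in> ?I" by simp
 then have I: "?I \<noteq> {}" by blast
 have Q: "0 <= Q c i" "Q c i <= 2 * wnorm (Suc p) c" if c: "wsummable (Suc p) c" and i: "i \<in> ?I" for c i
 proof -
  obtain x y where xy: "i = (x, y)" "x \<noteq> y" using i by auto
  show "0 <= Q c i" by (simp add: Q_def xy)
  show "Q c i <= 2 * wnorm (Suc p) c"
   using trg_holder[OF s1(1)[OF c] \<alpha> xy(2)] s1(2)[OF c] by (simp add: Q_def xy)
 qed
 have S: "0 <= (SUP i\<in>?I. Q c i)" "(SUP i\<in>?I. Q c i) <= 2 * wnorm (Suc p) c" if c: "wsummable (Suc p) c" for c
  by (rule SUP_nonneg_le[OF I, where f = "Q c"], rule Q[OF c], assumption, rule Q[OF c], assumption)+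
 have D: "\<bar>trg (dco j c) x\<bar> <= wnorm (Suc p) c" if "wsummable (Suc p) c" "j <= p" for j c x
  using abs_trg_le[OF s(1)[OF that], of x] s(2)[OF that] by linarith
 show ?thesis
 proof
  show "0 <= real p + 3" by simp
 next
  fix c assume "admissible False c" and c: "wsummable (Suc p) c"
  have "\<bar>(deriv ^^ p) (trg c) x - (deriv ^^ p) (trg c) y\<bar> / \<bar>x - y\<bar> powr \<alpha> <= 2 * wnorm (Suc p) c" if "x \<noteq> y" for x y
   using Q(2)[OF c, of "(x, y)"] that by (simp add: Q_def it[OF c])
  moreover have "continuous_on UNIV ((deriv ^^ p) (trg c))"
   unfolding it[OF c order_refl] by (rule continuous_on_trg[OF s(1)[OF c order_refl]])
  moreover have "(deriv ^^ j) (trg c) field_differentiable at x" if "j < p" for j x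
   by (rule trg_field_differentiable[OF c]) (use that in simp)
  ultimately show "trg c \<in> fcarrier (Holder p \<alpha>)"
   unfolding Holder_def using periodic_trg by auto
  have "0 <= (\<Sum>j\<le>p. SUP x. \<bar>trg (dco j c) x\<bar>)"
   by (intro sum_nonneg SUP_nonneg_le(1)[where B = "wnorm (Suc p) c"]) (auto intro: D[OF c])
  then show "0 <= fnorm (Holder p \<alpha>) (trg c)" unfolding n[OF c] using S(1)[OF c] by simp
  have "(\<Sum>j\<le>p. SUP x. \<bar>trg (dco j c) x\<bar>) <= (\<Sum>j\<le>p. wnorm (Suc p) c)"
   by (intro sum_mono SUP_nonneg_le(2)) (auto intro: D[OF c])
  then show "fnorm (Holder p \<alpha>) (trg c) <= (real p + 3) * wnorm (Suc p) c"
   unfolding n[OF c] using S(2)[OF c] by (simp add: algebra_simps)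
 next
  fix c d assume c: "wsummable (Suc p) c" and d: "wsummable (Suc p) d"
  have eq: "dco j (\<lambda>k. c k + d k) = (\<lambda>k. dco j c k + dco j d k)" for j by (auto simp: dco_def algebra_simps)
  have t: "trg (dco j (\<lambda>k. c k + d k)) x = trg (dco j c) x + trg (dco j d) x" if "j <= p" for j x
   unfolding eq by (rule trg_add[OF s(1)[OF c that] s(1)[OF d that]])
  have "(\<Sum>j\<le>p. SUP x. \<bar>trg (dco j (\<lambda>k. c k + d k)) x\<bar>) <= (\<Sum>j\<le>p. (SUP x. \<bar>trg (dco j c) x\<bar>) + (SUP x. \<bar>trg (dco j d) x\<bar>))"
   by (intro sum_mono SUP_abs_add_le[where B = "wnorm (Suc p) c" and B' = "wnorm (Suc p) d"])
    (auto intro: D[OF c] D[OF d] simp: t)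
  moreover have "(SUP i\<in>?I. Q (\<lambda>k. c k + d k) i) <= (SUP i\<in>?I. Q c i) + (SUP i\<in>?I. Q d i)"
  proof (rule SUP_abs_add_le[OF I Q(2)[OF c] Q(2)[OF d]])
   fix i :: "real \<times> real"
   obtain x y where xy: "i = (x, y)" by (cases i)
   show "Q (\<lambda>k. c k + d k) i <= Q c i + Q d i"
    unfolding Q_def xy by (simp add: t flip: add_divide_distrib) (rule divide_right_mono, linarith, simp)
  qed
  ultimately show "fnorm (Holder p \<alpha>) (trg (\<lambda>k. c k + d k)) <= fnorm (Holder p \<alpha>) (trg c) + fnorm (Holder p \<alpha>) (trg d)"
   unfolding n[OF c] n[OF d] n[OF wsummable_add(1)[OF c d]] sum.distrib by simp
 qed
qed

section \<open>Products and time integrals of trigonometric series\<close>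

lemma infsum_int_shift:
 fixes h :: "int => 'a::{comm_monoid_add, t2_space}"
 shows "(\<lambda>k. h (k - j)) summable_on UNIV \<longleftrightarrow> h summable_on UNIV" "(INFSUM k. h (k - j)) = (INFSUM k. h k)"
proof -
 have b: "bij_betw (\<lambda>k::int. k - j) UNIV UNIV"
  by (rule bij_betw_byWitness[where f' = "\<lambda>k. k + j"]) auto
 show "(\<lambda>k. h (k - j)) summable_on UNIV \<longleftrightarrow> h summable_on UNIV" by (rule summable_on_reindex_bij_betw[OF b])
 show "(INFSUM k. h (k - j)) = (INFSUM k. h k)" by (rule infsum_reindex_bij_betw[OF b])
qed

text \<open>Fubini for the absolutely summable double family \<open>c (k - j) * d j\<close>. The
  identity for the plain sums turns into the product rule \<open>ser_iconv\<close> once the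
  characters are inserted.\<close>

lemma wsummable_iconv:
 assumes c: "wsummable 0 c" and d: "wsummable 0 d"
 shows "wsummable 0 (iconv c d)" "wnorm 0 (iconv c d) <= wnorm 0 c * wnorm 0 d"
  "infsum (iconv c d) UNIV = infsum c UNIV * infsum d UNIV"
proof -
 have c': "(\<lambda>k. cmod (c k)) summable_on UNIV" and d': "(\<lambda>k. cmod (d k)) summable_on UNIV"
  using c d by (simp_all add: wsummable_def)
 define F where "F = (\<lambda>(j, k). c (k - j) * d j)"
 have F: "F (j, k) = c (k - j) * d j" for j k by (simp add: F_def)
 have row: "(\<lambda>k. cmod (F (j, k))) summable_on UNIV" for j
  unfolding F norm_mult using infsum_int_shift(1)[of "\<lambda>k. cmod (c k)" j] c'
  by (intro summable_on_cmult_left) simp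
 have rowsum: "(INFSUM k. cmod (F (j, k))) = wnorm 0 c * cmod (d j)" for j
  unfolding F norm_mult infsum_cmult_left' by (subst infsum_int_shift(2)[of "\<lambda>k. cmod (c k)"]) (simp add: wnorm_def)
 have A: "(\<lambda>x. norm (F x)) summable_on (UNIV \<times> UNIV)"
 proof (rule Infinite_Sum.abs_summable_on_Sigma_iff[THEN iffD2], intro conjI ballI row)
  show "(\<lambda>j. norm (INFSUM k. norm (F (j, k)))) summable_on UNIV"
   unfolding rowsum by (simp add: abs_mult wnorm_nonneg summable_on_cmult_right[OF d'])
 qed
 have B: "(\<lambda>x. norm (F (prod.swap x))) summable_on (UNIV \<times> UNIV)"
  using A by (subst summable_on_reindex_bij_betw[where B = "UNIV \<times> UNIV"]) (auto intro!: bij_betw_byWitness[where f' = prod.swap])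
 have col: "(\<lambda>j. cmod (F (j, k))) summable_on UNIV" "(\<lambda>k. INFSUM j. cmod (F (j, k))) summable_on UNIV" for k
 proof -
  have *: "\<forall>k\<in>UNIV. (\<lambda>j. norm (F (prod.swap (k, j)))) summable_on UNIV"
   "(\<lambda>k. norm (INFSUM j. norm (F (prod.swap (k, j))))) summable_on UNIV"
   using B Infinite_Sum.abs_summable_on_Sigma_iff[where f = "\<lambda>x. F (prod.swap x)" and A = UNIV and B = "\<lambda>_. UNIV"] by blast+
  show "(\<lambda>j. cmod (F (j, k))) summable_on UNIV" using *(1) by simp
  show "(\<lambda>k. INFSUM j. cmod (F (j, k))) summable_on UNIV" using *(2) by (simp add: infsum_nonneg)
 qed
 have le: "cmod (iconv c d k) <= (INFSUM j. cmod (F (j, k)))" for k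
  using norm_infsum_bound[of "\<lambda>j. F (j, k)" UNIV] col(1)[of k] by (simp add: iconv_def F)
 have s: "(\<lambda>k. cmod (iconv c d k)) summable_on UNIV"
  by (rule summable_on_comparison_test[OF col(2)]) (auto intro: le)
 then show "wsummable 0 (iconv c d)" by (simp add: wsummable_def)
 have "wnorm 0 (iconv c d) <= (INFSUM k. INFSUM j. cmod (F (j, k)))"
  unfolding wnorm_def wt_0 mult_1 by (rule infsum_mono[OF s col(2) le])
 also have "... = (INFSUM j. INFSUM k. cmod (F (j, k)))"
  by (rule infsum_swap_banach[symmetric]) (use A in \<open>simp add: case_prod_unfold\<close>)
 also have "... = wnorm 0 c * wnorm 0 d" by (simp add: rowsum infsum_cmult_right' wnorm_def)
 finally show "wnorm 0 (iconv c d) <= wnorm 0 c * wnorm 0 d" .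
 have "infsum (iconv c d) UNIV = (INFSUM k. INFSUM j. F (j, k))"
  by (rule infsum_cong) (simp add: iconv_def F)
 also have "... = (INFSUM j. INFSUM k. F (j, k))"
  by (rule infsum_swap_banach[symmetric]) (use abs_summable_summable[OF A] in \<open>simp add: case_prod_unfold\<close>)
 also have "... = infsum c UNIV * infsum d UNIV"
  unfolding F infsum_cmult_left' infsum_int_shift(2)[of c] infsum_cmult_right' ..
 finally show "infsum (iconv c d) UNIV = infsum c UNIV * infsum d UNIV" .
qed

lemma ser_iconv:
 assumes c: "wsummable 0 c" and d: "wsummable 0 d" shows "ser (iconv c d) x = ser c x * ser d x"
proof -
 let ?e = "\<lambda>k. wave k x"
 have "iconv c d k * ?e k = iconv (\<lambda>k. c k * ?e k) (\<lambda>k. d k * ?e k) k" for k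
 proof -
  have "c (k - j) * d j * ?e k = c (k - j) * ?e (k - j) * (d j * ?e j)" for j
  proof -
   have "?e k = ?e (k - j) * ?e j" by (simp add: cis_mult algebra_simps)
   then show ?thesis by (simp only: mult_ac)
  qed
  then show ?thesis unfolding iconv_def infsum_cmult_left'[symmetric] by (simp only:)
 qed
 then have "ser (iconv c d) x = infsum (iconv (\<lambda>k. c k * ?e k) (\<lambda>k. d k * ?e k)) UNIV"
  by (simp add: ser_def)
 also have "... = ser c x * ser d x"
  unfolding ser_def by (rule wsummable_iconv(3)) (use c d in \<open>simp_all add: wsummable_def norm_mult\<close>)
 finally show ?thesis .
qed

lemma hermitian_iconv:
 assumes "hermitian c" "hermitian d" shows "hermitian (iconv c d)"
 unfolding hermitian_def
proof
 fix k
 have b: "bij_betw uminus (UNIV :: int set) UNIV" by (rule bij_betw_byWitness[where f' = uminus]) auto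
 have "iconv c d (- k) = (INFSUM j. c (- k - (- j)) * d (- j))"
  unfolding iconv_def by (rule infsum_reindex_bij_betw[OF b, symmetric])
 also have "... = (INFSUM j. cnj (c (k - j) * d j))"
 proof (rule infsum_cong)
  fix j
  have "c (- k - (- j)) = cnj (c (k - j))" using hermitianD[OF assms(1), of "k - j"] by simp
  then show "c (- k - (- j)) * d (- j) = cnj (c (k - j) * d j)" using hermitianD[OF assms(2), of j] by simp
 qed
 also have "... = cnj (iconv c d k)" by (simp only: infsum_cnj iconv_def)
 finally show "iconv c d (- k) = cnj (iconv c d k)" .
qed

text \<open>The subtracted term makes the induction work: the two new summands are bounded by a
  telescoping difference.\<close>

lemma sum_inverse_square_modes: "(\<Sum>k\<in>modes n. (1 / (1 + mag k))\<^sup>2) <= 3 - 2 / (real n + 1)"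
proof (induction n)
 case 0
 have "modes 0 = {0}" by (auto simp: modes_def)
 then show ?case by simp
next
 case (Suc n)
 have "modes (Suc n) = insert (int n + 1) (insert (- int n - 1) (modes n))" by (auto simp: modes_def)
 then have "(\<Sum>k\<in>modes (Suc n). (1 / (1 + mag k))\<^sup>2)
   = 2 * (1 / (real n + 2))\<^sup>2 + (\<Sum>k\<in>modes n. (1 / (1 + mag k))\<^sup>2)"
  by (simp add: mem_modes add.commute)
 also have "... <= 2 * (1 / (real n + 2))\<^sup>2 + (3 - 2 / (real n + 1))" using Suc by simp
 also have "2 * (1 / (real n + 2))\<^sup>2 <= 2 / (real n + 1) - 2 / (real n + 2)"
 proof -
  have "(1 / (real n + 2))\<^sup>2 <= 1 / ((real n + 1) * (real n + 2))"
   unfolding power2_eq_square by (simp add: divide_simps)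
  also have "... = 1 / (real n + 1) - 1 / (real n + 2)" by (simp add: divide_simps)
  finally show ?thesis by argo
 qed
 finally show ?case by (simp add: add.commute)
qed

text \<open>Cauchy-Schwarz against \<open>1 / (1 + mag k)\<close>, whose squares sum to at most 3.
  It trades one derivative for absolute summability, both for the initial data and for the norm of
  \<open>W 3 Linf\<close>.\<close>

lemma wnorm_le_l2:
 assumes s: "(\<lambda>k. (wt (Suc p) k * cmod (c k))\<^sup>2) summable_on UNIV"
 shows "wsummable p c" "wnorm p c <= sqrt 3 * sqrt (INFSUM k. (wt (Suc p) k * cmod (c k))\<^sup>2)"
proof -
 have "(\<Sum>k\<in>modes n. wt p k * cmod (c k)) <= sqrt 3 * sqrt (INFSUM k. (wt (Suc p) k * cmod (c k))\<^sup>2)" for n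
 proof -
  have "wt p k * cmod (c k) = \<bar>1 / (1 + mag k)\<bar> * \<bar>wt (Suc p) k * cmod (c k)\<bar>" for k
   by (simp add: wt_def abs_mult field_simps)
  then have "(\<Sum>k\<in>modes n. wt p k * cmod (c k))
    <= L2_set (\<lambda>k. 1 / (1 + mag k)) (modes n) * L2_set (\<lambda>k. wt (Suc p) k * cmod (c k)) (modes n)"
   by (simp only: L2_set_mult_ineq)
  also have "... <= sqrt 3 * sqrt (INFSUM k. (wt (Suc p) k * cmod (c k))\<^sup>2)"
  proof (rule mult_mono)
   have "(\<Sum>k\<in>modes n. (1 / (1 + mag k))\<^sup>2) <= 3"
    using sum_inverse_square_modes[of n] divide_nonneg_nonneg[of 2 "real n + 1"] by linarith
   then show "L2_set (\<lambda>k. 1 / (1 + mag k)) (modes n) <= sqrt 3"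
    unfolding L2_set_def by (rule real_sqrt_le_mono)
   show "L2_set (\<lambda>k. wt (Suc p) k * cmod (c k)) (modes n) <= sqrt (INFSUM k. (wt (Suc p) k * cmod (c k))\<^sup>2)"
    unfolding L2_set_def by (rule real_sqrt_le_mono, rule finite_sum_le_infsum[OF s]) auto
  qed simp_all
  finally show ?thesis .
 qed
 note b = this
 have nn: "0 <= wt p k * cmod (c k)" for k using wt_ge_1[of p k] by simp
 show "wsummable p c" unfolding wsummable_def by (rule modes_bounded(1)[OF nn b])
 show "wnorm p c <= sqrt 3 * sqrt (INFSUM k. (wt (Suc p) k * cmod (c k))\<^sup>2)"
  unfolding wnorm_def by (rule modes_bounded(2)[OF nn b])
qed

section \<open>Exchange of sums and time integrals\<close>

lemma measurable_infsum_int: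
 fixes h :: "int => real => 'a::euclidean_space"
 assumes S: "S \<in> sets lebesgue" and h: "!!k. h k \<in> borel_measurable (lebesgue_on S)"
  and s: "AE t in lebesgue_on S. (\<lambda>k. norm (h k t)) summable_on UNIV"
 shows "(\<lambda>t. INFSUM k. h k t) \<in> borel_measurable (lebesgue_on S)"
proof (rule borel_measurable_lebesgue_on_AE[OF S])
 show "(\<lambda>t. \<Sum>n. h (int_decode n) t) \<in> borel_measurable (lebesgue_on S)"
  by (rule borel_measurable_suminf[OF h])
 show "AE t in lebesgue_on S. (\<Sum>n. h (int_decode n) t) = (INFSUM k. h k t)"
  using s by eventually_elim (rule infsum_int_eq_suminf(2)[symmetric])
qed

lemma monotone_time_series:
 fixes h :: "int => real => real"
 assumes S: "S \<in> sets lebesgue" and int: "!!k. integrable (lebesgue_on S) (h k)" and nn: "!!k t. 0 <= h k t"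
  and B: "!!n. (\<Sum>k\<in>modes n. LINT t|lebesgue_on S. h k t) <= B"
 shows "(\<lambda>k. LINT t|lebesgue_on S. h k t) summable_on UNIV" "(INFSUM k. LINT t|lebesgue_on S. h k t) <= B"
  "AE t in lebesgue_on S. (\<lambda>k. h k t) summable_on UNIV" "integrable (lebesgue_on S) (\<lambda>t. INFSUM k. h k t)"
  "(LINT t|lebesgue_on S. (INFSUM k. h k t)) = (INFSUM k. LINT t|lebesgue_on S. h k t)"
proof -
 have i: "0 <= (LINT t|lebesgue_on S. h k t)" for k by (rule Bochner_Integration.integral_nonneg) (rule nn)
 show 1: "(\<lambda>k. LINT t|lebesgue_on S. h k t) summable_on UNIV" "(INFSUM k. LINT t|lebesgue_on S. h k t) <= B"
  using modes_bounded[OF i B] by auto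
 have 2: "(\<lambda>k. LINT t|lebesgue_on S. norm (h k t)) summable_on UNIV" using 1(1) nn by simp
 have 3: "AE t in lebesgue_on S. (\<lambda>k. norm (h k t)) summable_on UNIV" by (rule AE_summable_of_integral[OF int 2])
 then show "AE t in lebesgue_on S. (\<lambda>k. h k t) summable_on UNIV" using nn by simp
 have m: "(\<lambda>t. INFSUM k. h k t) \<in> borel_measurable (lebesgue_on S)"
  by (rule measurable_infsum_int[OF S _ 3]) (use int in auto)
 show "integrable (lebesgue_on S) (\<lambda>t. INFSUM k. h k t)"
  "(LINT t|lebesgue_on S. (INFSUM k. h k t)) = (INFSUM k. LINT t|lebesgue_on S. h k t)"
  using integral_infsum_int[OF int 2 m] by simp_all
qed

text \<open>The multipliers \<open>m t k\<close> will be moments of test functions, which are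
  bounded uniformly in \<open>k\<close>; so summability of the time integrals of the coefficients
  alone justifies the exchange. Measurability of \<open>H\<close> is inherited from the
  series.\<close>

lemma integral_time_series:
 fixes c m :: "real => int => complex" and H :: "real => real"
 assumes S: "S \<in> sets lebesgue" and int: "!!k. integrable (lebesgue_on S) (\<lambda>t. c t k)"
  and sum: "(\<lambda>k. LINT t|lebesgue_on S. cmod (c t k)) summable_on UNIV"
  and m: "!!k. (\<lambda>t. m t k) \<in> borel_measurable (lebesgue_on S)" "!!t k. t \<in> S ==> cmod (m t k) <= K"
  and H: "AE t in lebesgue_on S. of_real (H t) = (INFSUM k. c t k * m t k)"
 shows "of_real (LINT t|lebesgue_on S. H t) = (INFSUM k. LINT t|lebesgue_on S. c t k * m t k)"
  "(\<lambda>k. cmod (LINT t|lebesgue_on S. c t k * m t k)) summable_on UNIV"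
  "!!k. integrable (lebesgue_on S) (\<lambda>t. c t k * m t k)"
proof -
 have le: "AE t in lebesgue_on S. cmod (c t k * m t k) <= K * cmod (c t k)" for k
 proof (rule AE_I2)
  fix t assume "t \<in> space (lebesgue_on S)"
  then have "cmod (m t k) <= K" using m(2) by (simp add: space_restrict_space)
  then show "cmod (c t k * m t k) <= K * cmod (c t k)"
   unfolding norm_mult by (subst mult.commute) (rule mult_right_mono, auto)
 qed
 show int': "integrable (lebesgue_on S) (\<lambda>t. c t k * m t k)" for k
 proof (rule Bochner_Integration.integrable_bound)
  show "integrable (lebesgue_on S) (\<lambda>t. K * cmod (c t k))" using int by auto
  show "(\<lambda>t. c t k * m t k) \<in> borel_measurable (lebesgue_on S)" using int m(1) by (intro borel_measurable_times) auto
  show "AE t in lebesgue_on S. norm (c t k * m t k) <= norm (K * cmod (c t k))"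
   using le[of k] by eventually_elim simp
 qed
 have le': "(LINT t|lebesgue_on S. cmod (c t k * m t k)) <= K * (LINT t|lebesgue_on S. cmod (c t k))" for k
 proof -
  have "(LINT t|lebesgue_on S. cmod (c t k * m t k)) <= (LINT t|lebesgue_on S. K * cmod (c t k))"
   by (rule integral_mono_AE[OF _ _ le]) (use int int' in auto)
  then show ?thesis by simp
 qed
 have s: "(\<lambda>k. LINT t|lebesgue_on S. cmod (c t k * m t k)) summable_on UNIV"
  by (rule summable_on_comparison_test[OF summable_on_cmult_right[OF sum] le']) simp
 show "(\<lambda>k. cmod (LINT t|lebesgue_on S. c t k * m t k)) summable_on UNIV"
  by (rule summable_on_comparison_test[OF s]) (auto intro: integral_norm_bound)
 have ae: "AE t in lebesgue_on S. (\<lambda>k. norm (c t k * m t k)) summable_on UNIV"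
  by (rule AE_summable_of_integral[OF int' s])
 have meas: "(\<lambda>t. complex_of_real (H t)) \<in> borel_measurable (lebesgue_on S)"
 proof (rule borel_measurable_lebesgue_on_AE[OF S])
  show "(\<lambda>t. INFSUM k. c t k * m t k) \<in> borel_measurable (lebesgue_on S)"
   by (rule measurable_infsum_int[OF S _ ae]) (use int' in auto)
  show "AE t in lebesgue_on S. (INFSUM k. c t k * m t k) = of_real (H t)" using H by eventually_elim simp
 qed
 show "of_real (LINT t|lebesgue_on S. H t) = (INFSUM k. LINT t|lebesgue_on S. c t k * m t k)"
  using integral_infsum_int(2)[OF int' s meas H] by simp
qed

text \<open>\<open>2 * pi\<close> times the Fourier coefficient of \<open>\<psi>\<close> at
  \<open>- k\<close>, that is, the pairing of \<open>\<psi>\<close> with the character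
  \<open>k\<close>.\<close>

definition moment :: "(real => real) => int => complex" where
 "moment \<psi> k = (LINT x|torus. wave k x * of_real (\<psi> x))"

lemma integral_trg_mult:
 assumes h: "hermitian c" and c: "wsummable 0 c" and \<psi>: "integrable torus \<psi>"
 shows "of_real (LINT x|torus. trg c x * \<psi> x) = (INFSUM k. c k * moment \<psi> k)"
proof -
 have "of_real (LINT x|torus. trg c x * \<psi> x) = (LINT x|torus. ser c x * of_real (\<psi> x))"
  by (simp add: ser_real[OF h] flip: integral_complex_of_real)
 also have "... = (INFSUM k. c k * moment \<psi> k)"
  unfolding moment_def using \<psi> by (intro integral_ser(2)[OF c] integrable_of_real)
 finally show ?thesis .
qed

lemma cmod_moment_le_L1: "cmod (moment \<psi> k) <= (LINT x|torus. \<bar>\<psi> x\<bar>)"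
proof -
 have "cmod (moment \<psi> k) <= (LINT x|torus. cmod (wave k x * of_real (\<psi> x)))"
  unfolding moment_def by (rule integral_norm_bound)
 also have "... = (LINT x|torus. \<bar>\<psi> x\<bar>)" by (simp add: norm_mult)
 finally show ?thesis .
qed

lemma cmod_moment_le:
 assumes \<psi>: "integrable torus \<psi>" and B: "!!x. x \<in> {-pi..pi} ==> \<bar>\<psi> x\<bar> <= B"
 shows "cmod (moment \<psi> k) <= 2 * pi * B"
proof -
 note cmod_moment_le_L1[of \<psi> k]
 also have "(LINT x|torus. \<bar>\<psi> x\<bar>) <= (LINT x|torus. B)"
  by (rule integral_mono) (use \<psi> B in \<open>auto simp: space_restrict_space finite_measure.integrable_const[OF finite_measure_torus]\<close>)
 also have "... = 2 * pi * B" by (simp add: measure_def space_restrict_space)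
 finally show ?thesis .
qed

text \<open>The flux in the definition of a weak solution is built with \<open>weak_deriv\<close>,
  known only almost everywhere in space, whereas strong measurability is proved for series.\<close>

lemma Lp_time_L1_cong:
 assumes u: "u \<in> Lp_time 1 T L1"
  and F: "AE t in time T. F t \<in> fcarrier L1 \<and> (AE x in torus. F t x = u t x)"
 shows "F \<in> Lp_time 1 T L1"
proof -
 have eq: "fnorm L1 v = fnorm L1 w" if "v \<in> borel_measurable torus" "w \<in> borel_measurable torus" "AE x in torus. v x = w x" for v w
  unfolding L1_def using that by (auto intro!: integral_cong_AE elim: eventually_mono)
 have uL: "AE t in time T. u t \<in> fcarrier L1" using u by (simp add: Lp_time_def)
 obtain s where s: "!!n. simple_function (time T) (s n)" "!!n. s n ` {0..T} \<subseteq> fcarrier L1"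
  and lim: "AE t in time T. (\<lambda>n. fnorm L1 (\<lambda>x. u t x - s n t x)) \<longlonglongrightarrow> 0"
  using u unfolding Lp_time_def strongly_measurable_def by blast
 have "AE t in time T. (\<lambda>n. fnorm L1 (\<lambda>x. F t x - s n t x)) \<longlonglongrightarrow> 0"
  using F uL lim AE_space
 proof eventually_elim
  case (elim t)
  have "fnorm L1 (\<lambda>x. F t x - s n t x) = fnorm L1 (\<lambda>x. u t x - s n t x)" for n
  proof (rule eq)
   have "s n t \<in> fcarrier L1" using s(2)[of n] elim(4) by (auto simp: space_restrict_space)
   then show "(\<lambda>x. F t x - s n t x) \<in> borel_measurable torus" "(\<lambda>x. u t x - s n t x) \<in> borel_measurable torus"
    using elim by (auto simp: L1_def)
   show "AE x in torus. F t x - s n t x = u t x - s n t x" using conjunct2[OF elim(1)] by eventually_elim simp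
  qed
  then show ?case using elim(3) by simp
 qed
 then have sm: "strongly_measurable T L1 F" unfolding strongly_measurable_def using s by blast
 have n: "AE t in time T. fnorm L1 (u t) powr 1 = fnorm L1 (F t) powr 1"
  using F uL
 proof eventually_elim
  case (elim t)
  have "fnorm L1 (F t) = fnorm L1 (u t)" by (rule eq) (use elim in \<open>auto simp: L1_def\<close>)
  then show ?case by simp
 qed
 have i: "integrable (time T) (\<lambda>t. fnorm L1 (u t) powr 1)" using u by (simp add: Lp_time_def)
 have "(\<lambda>t. fnorm L1 (F t) powr 1) \<in> borel_measurable (time T)"
  by (rule borel_measurable_lebesgue_on_AE[OF _ borel_measurable_integrable[OF i] n]) simp
 then have "integrable (time T) (\<lambda>t. fnorm L1 (F t) powr 1)"
  using integrable_cong_AE_imp[OF i _ n] by simp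
 moreover have "AE t in time T. F t \<in> fcarrier L1" using F by eventually_elim simp
 ultimately show ?thesis using sm by (simp add: Lp_time_def)
qed

section \<open>Regularity of a path of trigonometric series\<close>

lemma wsum_eq_integrals:
 fixes h :: "int => real => real"
 assumes "!!k. continuous_on UNIV (h k)"
 shows "(\<Sum>k\<in>modes n. LINT t|time T. mag k ^ p * h k t) = tint T (\<lambda>t. wsum n p (\<lambda>k. h k t))"
proof -
 have c: "continuous_on {0..T} (\<lambda>t. mag k ^ p * h k t)" for k
  by (intro continuous_intros continuous_on_subset[OF assms]) auto
 have "(\<Sum>k\<in>modes n. LINT t|time T. mag k ^ p * h k t)
   = (\<Sum>k\<in>modes n. tint T (\<lambda>t. mag k ^ p * h k t))"
  by (intro sum.cong refl lebesgue_integral_eq_integral continuous_imp_integrable_real c) auto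
 also have "... = tint T (\<lambda>t. wsum n p (\<lambda>k. h k t))"
  unfolding wsum_def by (rule integral_sum[symmetric]) (auto intro: integrable_continuous_real c)
 finally show ?thesis .
qed

lemma weighted_time_series:
 fixes h :: "int => real => real"
 assumes c: "!!k. continuous_on UNIV (h k)" and nn: "!!k t. 0 <= h k t"
  and B: "!!n. tint T (\<lambda>t. wsum n p (\<lambda>k. h k t)) <= B"
 shows "(\<lambda>k. LINT t|time T. mag k ^ p * h k t) summable_on UNIV"
  "AE t in time T. (\<lambda>k. mag k ^ p * h k t) summable_on UNIV"
  "integrable (time T) (\<lambda>t. INFSUM k. mag k ^ p * h k t)"
  "(LINT t|time T. (INFSUM k. mag k ^ p * h k t)) <= B"
proof -
 have i: "integrable (time T) (\<lambda>t. mag k ^ p * h k t)" for k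
  by (intro continuous_imp_integrable_real continuous_intros continuous_on_subset[OF c]) auto
 have b: "(\<Sum>k\<in>modes n. LINT t|time T. mag k ^ p * h k t) <= B" for n
  unfolding wsum_eq_integrals[OF c] by (rule B)
 have n: "0 <= mag k ^ p * h k t" for k t using nn by simp
 have S: "{0..T} \<in> sets lebesgue" by simp
 note m = monotone_time_series[OF S i n b]
 show "(\<lambda>k. LINT t|time T. mag k ^ p * h k t) summable_on UNIV"
  "AE t in time T. (\<lambda>k. mag k ^ p * h k t) summable_on UNIV"
  "integrable (time T) (\<lambda>t. INFSUM k. mag k ^ p * h k t)" by (rule m)+
 show "(LINT t|time T. (INFSUM k. mag k ^ p * h k t)) <= B"
  unfolding m(5) by (rule m(2))
qed

lemma wt_le_power: "k \<noteq> 0 ==> wt p k <= 2 ^ p * mag k ^ p"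
 unfolding wt_def power_mult_distrib[symmetric] by (rule power_mono) auto

lemma infsum_finite_sum:
 fixes a :: "'b => int => real"
 assumes "finite P" "!!B. B \<in> P ==> a B summable_on UNIV"
 shows "(\<lambda>k. \<Sum>B\<in>P. a B k) summable_on UNIV \<and> (INFSUM k. \<Sum>B\<in>P. a B k) = (\<Sum>B\<in>P. infsum (a B) UNIV)"
 using assms
proof (induction P rule: finite_induct)
 case (insert B P)
 then have "(\<lambda>k. \<Sum>B\<in>P. a B k) summable_on UNIV" "a B summable_on UNIV" by auto
 with insert show ?case by (simp add: infsum_add summable_on_add)
qed simp

lemma powr_four_thirds_le:
 assumes "0 <= (x::real)" shows "x powr (4/3) <= 1 + x\<^sup>2"
proof (cases "x <= 1")
 case True
 then have "x powr (4/3) <= 1 powr (4/3)" using assms by (intro powr_mono2) auto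
 also have "... <= 1 + x\<^sup>2" by simp
 finally show ?thesis .
next
 case False
 then have "x powr (4/3) <= x powr 2" by (intro powr_mono) auto
 also have "... <= 1 + x\<^sup>2" using assms by simp
 finally show ?thesis .
qed

text \<open>One component by itself, with \<open>R\<close> its time derivative. \<open>B4\<close>,
  \<open>Q8\<close> and \<open>P\<close> bound time integrals over every interval
  \<open>[0, t]\<close>; the regularity of the component is drawn from these bounds on partial
  sums.\<close>

locale regular_path =
 fixes u R :: "real => int => complex" and V B4 Q Q8 P :: real
 assumes herm: "hermitian (u t)" and zero: "u t 0 = 0"
  and cont: "continuous_on UNIV (\<lambda>t. u t k)" and cont_R: "continuous_on UNIV (\<lambda>t. R t k)"
  and deriv: "t > 0 ==> ((\<lambda>s. u s k) has_vector_derivative R t k) (at t)"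
  and V_le: "t >= 0 ==> asum n 0 (u t) <= V"
  and int_le: "t >= 0 ==> tint t (\<lambda>s. asum n 4 (u s)) <= B4"
  and Q_le: "t >= 0 ==> qsum n 4 (u t) <= Q"
  and Q8_le: "t >= 0 ==> tint t (\<lambda>s. qsum n 8 (u s)) <= Q8"
  and P_le: "t >= 0 ==> tint t (\<lambda>s. wsum n 4 (\<lambda>k. cmod (u s k) * cmod (R s k))) <= P"
begin

abbreviation "U t \<equiv> trg (u t)"

lemma admissible_u: "admissible z (u t)"
 using herm zero by (simp add: admissible_def)

lemma wsummable_0: "t >= 0 ==> wsummable 0 (u t)" "t >= 0 ==> wnorm 0 (u t) <= V"
proof -
 assume t: "t >= 0"
 have b: "(\<Sum>k\<in>modes n. wt 0 k * cmod (u t k)) <= V" for n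
  using V_le[OF t, of n] by (simp add: asum_def wsum_def)
 have n: "0 <= wt 0 k * cmod (u t k)" for k by simp
 show "wsummable 0 (u t)" unfolding wsummable_def by (rule modes_bounded(1)[OF n b])
 show "wnorm 0 (u t) <= V" unfolding wnorm_def by (rule modes_bounded(2)[OF n b])
qed

lemma sobolev_2: "t >= 0 ==> (\<lambda>k. mag k powr (2 * 2) * (cmod (u t k))\<^sup>2) summable_on UNIV"
 "t >= 0 ==> sobolev 2 (u t) <= Q"
proof -
 assume t: "t >= 0"
 have b: "(\<Sum>k\<in>modes n. mag k powr (2 * 2) * (cmod (u t k))\<^sup>2) <= Q" for n
  using Q_le[OF t, of n] by (simp add: qsum_def wsum_def)
 have n: "0 <= mag k powr (2 * 2) * (cmod (u t k))\<^sup>2" for k by simp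
 show "(\<lambda>k. mag k powr (2 * 2) * (cmod (u t k))\<^sup>2) summable_on UNIV"
  by (rule modes_bounded(1)[OF n b])
 show "sobolev 2 (u t) <= Q" unfolding sobolev_def by (rule modes_bounded(2)[OF n b])
qed

lemma wt_u_le: "wt p k * cmod (u t k) <= 2 ^ p * (mag k ^ p * cmod (u t k))"
proof (cases "k = 0")
 case True
 then show ?thesis by (simp add: zero)
next
 case False
 then show ?thesis using mult_right_mono[OF wt_le_power[OF False, of p], of "cmod (u t k)"] by (simp add: mult.assoc)
qed

lemma cont_cmod: "continuous_on UNIV (\<lambda>t. cmod (u t k))" "continuous_on UNIV (\<lambda>t. (cmod (u t k))\<^sup>2)"
 by (intro continuous_intros cont)+

lemma integrable_u: "integrable (time T) (\<lambda>t. u t k)" "integrable (time T) (\<lambda>t. cmod (u t k))"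
 by (intro continuous_imp_integrable_real continuous_on_subset[OF cont] continuous_on_subset[OF cont_cmod(1)]; simp)+

lemma time_integrals:
 assumes T: "T >= 0"
 shows "(\<lambda>k. wt 4 k * (LINT t|time T. cmod (u t k))) summable_on UNIV"
  "integrable (time T) (\<lambda>t. wnorm 4 (u t))"
  "AE t in time T. wsummable 4 (u t)"
proof -
 have i: "integrable (time T) (\<lambda>t. wt 4 k * cmod (u t k))" for k
  by (intro integrable_mult_right integrable_u)
 have n: "0 <= wt 4 k * cmod (u t k)" for k t using wt_ge_1[of 4 k] by simp
 have b: "(\<Sum>k\<in>modes n. LINT t|time T. wt 4 k * cmod (u t k)) <= 2 ^ 4 * B4" for n
 proof -
  have "(\<Sum>k\<in>modes n. LINT t|time T. wt 4 k * cmod (u t k))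
    <= (\<Sum>k\<in>modes n. 2 ^ 4 * (LINT t|time T. mag k ^ 4 * cmod (u t k)))"
  proof (rule sum_mono)
   fix k
   have "(LINT t|time T. wt 4 k * cmod (u t k)) <= (LINT t|time T. 2 ^ 4 * (mag k ^ 4 * cmod (u t k)))"
    by (rule integral_mono) (intro i integrable_mult_right integrable_u wt_u_le)+
   then show "(LINT t|time T. wt 4 k * cmod (u t k)) <= 2 ^ 4 * (LINT t|time T. mag k ^ 4 * cmod (u t k))"
    by (simp only: integral_mult_right_zero)
  qed
  also have "... = 2 ^ 4 * tint T (\<lambda>s. asum n 4 (u s))"
   unfolding sum_distrib_left[symmetric] asum_def wsum_eq_integrals[OF cont_cmod(1)] ..
  also have "... <= 2 ^ 4 * B4" by (intro mult_left_mono int_le T) simp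
  finally show ?thesis .
 qed
 have S: "{0..T} \<in> sets lebesgue" by simp
 note m = monotone_time_series[OF S i n b]
 show "(\<lambda>k. wt 4 k * (LINT t|time T. cmod (u t k))) summable_on UNIV" using m(1) by simp
 show "integrable (time T) (\<lambda>t. wnorm 4 (u t))" unfolding wnorm_def by (rule m(4))
 show "AE t in time T. wsummable 4 (u t)" unfolding wsummable_def by (rule m(3))
qed

lemma coefficient_path_u:
 assumes "T >= 0" shows "coefficient_path z 4 T u"
proof
 show "\<exists>B. \<forall>t\<in>{0..T}. cmod (u t k) <= B" for k
 proof -
  have "bounded ((\<lambda>t. u t k) ` {0..T})"
   by (intro compact_imp_bounded compact_continuous_image continuous_on_subset[OF cont]) auto
  then show ?thesis by (auto simp: bounded_iff)
 qed
qed (auto intro: admissible_u continuous_measurable cont time_integrals(3) assms)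

lemma Lp_time_1:
 assumes "T >= 0" "series_space z X 4 C" shows "U \<in> Lp_time 1 T X"
proof -
 interpret X: series_space z X 4 C by (rule assms)
 interpret c: coefficient_path z 4 T u by (rule coefficient_path_u[OF assms(1)])
 interpret space_path z X 4 C T u ..
 show ?thesis by (rule Lp_time_series) (use time_integrals(2)[OF assms(1)] wnorm_nonneg in simp_all)
qed

lemma sobolev_4:
 assumes T: "T >= 0"
 shows "AE t in time T. (\<lambda>k. mag k ^ 8 * (cmod (u t k))\<^sup>2) summable_on UNIV"
  "integrable (time T) (\<lambda>t. sobolev 4 (u t))" "(LINT t|time T. sobolev 4 (u t)) <= Q8"
proof -
 have b: "tint T (\<lambda>t. wsum n 8 (\<lambda>k. (cmod (u t k))\<^sup>2)) <= Q8" for n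
  using Q8_le[OF T] by (simp add: qsum_def)
 have e: "sobolev 4 (u t) = (INFSUM k. mag k ^ 8 * (cmod (u t k))\<^sup>2)" for t by (simp add: sobolev_def)
 note m = weighted_time_series[where h = "\<lambda>k t. (cmod (u t k))\<^sup>2", OF cont_cmod(2) zero_le_power2 b]
 show "AE t in time T. (\<lambda>k. mag k ^ 8 * (cmod (u t k))\<^sup>2) summable_on UNIV"
  "integrable (time T) (\<lambda>t. sobolev 4 (u t))" "(LINT t|time T. sobolev 4 (u t)) <= Q8"
  unfolding e using m by auto
qed

lemma integrable_sobolev_2:
 assumes T: "T >= 0" shows "integrable (time T) (\<lambda>t. sobolev 2 (u t))"
proof -
 have b: "tint T (\<lambda>t. wsum n 4 (\<lambda>k. (cmod (u t k))\<^sup>2)) <= T * Q" for n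
 proof -
  have "tint T (\<lambda>t. qsum n 4 (u t)) <= tint T (\<lambda>t. Q)"
   unfolding qsum_def wsum_def
   by (rule integral_le)
    (use Q_le in \<open>auto simp: qsum_def wsum_def intro!: integrable_continuous_real continuous_intros continuous_on_subset[OF cont_cmod(2)]\<close>)
  then show ?thesis using T by (simp add: qsum_def)
 qed
 have e: "sobolev 2 (u t) = (INFSUM k. mag k ^ 4 * (cmod (u t k))\<^sup>2)" for t by (simp add: sobolev_def)
 show ?thesis unfolding e by (rule weighted_time_series(3)[where h = "\<lambda>k t. (cmod (u t k))\<^sup>2", OF cont_cmod(2) zero_le_power2 b])
qed

lemma Lp_time_2_Hdot:
 assumes T: "T >= 0" and s: "0 <= s" "s <= 4" and i: "integrable (time T) (\<lambda>t. sobolev s (u t))"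
 shows "U \<in> Lp_time 2 T (Hdot s)"
proof -
 interpret X: series_space True "Hdot s" 4 1 by (rule series_space_Hdot) (use s in auto)
 interpret c: coefficient_path True 4 T u by (rule coefficient_path_u[OF T])
 interpret space_path True "Hdot s" 4 1 T u ..
 have "AE t in time T. U t \<in> fcarrier (Hdot s)"
  using AE_good by eventually_elim (auto intro: X.carrier)
 moreover have "integrable (time T) (\<lambda>t. fnorm (Hdot s) (U t) powr 2)"
 proof -
  have "fnorm (Hdot s) (U t) powr 2 = sobolev s (u t)" if "t \<in> {0..T}" for t
   using fnorm_Hdot[OF herm wsummable_0(1), of t s] that by (simp add: sobolev_nonneg)
  then show ?thesis
   using i by (subst Bochner_Integration.integrable_cong[OF refl]) (auto simp: space_restrict_space)
 qed
 ultimately show ?thesis using strongly_measurable_series by (simp add: Lp_time_def)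
qed

text \<open>By \<open>wnorm_le_l2\<close> three derivatives in the Wiener norm cost four in the
  square norm, which is square integrable in time; the exponent 4/3 is then covered by
  \<open>x powr (4/3) \<le> 1 + x\<^sup>2\<close>.\<close>

lemma Lp_time_W_Linf:
 assumes T: "T >= 0" shows "U \<in> Lp_time (4/3) T (W 3 Linf)"
proof -
 interpret X: series_space False "W 3 Linf" 3 "(real 3 + 1) * 1" by (rule series_space_W_Linf)
 interpret c: coefficient_path False 3 T u by (rule coefficient_path_mono[OF coefficient_path_u[OF T]]) simp
 interpret space_path False "W 3 Linf" 3 "(real 3 + 1) * 1" T u ..
 have le: "AE t in time T. (wnorm 3 (u t))\<^sup>2 <= 3 * (2 ^ 8 * sobolev 4 (u t))"
  using sobolev_4(1)[OF T]
 proof eventually_elim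
  case (elim t)
  have b: "(wt (Suc 3) k * cmod (u t k))\<^sup>2 <= 2 ^ 8 * (mag k ^ 8 * (cmod (u t k))\<^sup>2)" for k
  proof -
   have "(wt 4 k * cmod (u t k))\<^sup>2 <= (2 ^ 4 * (mag k ^ 4 * cmod (u t k)))\<^sup>2"
    by (rule power_mono[OF wt_u_le]) (use wt_ge_1[of 4 k] in simp)
   also have "... = 2 ^ 8 * (mag k ^ 8 * (cmod (u t k))\<^sup>2)"
    by (simp add: power_mult_distrib flip: power_mult)
   finally show ?thesis by simp
  qed
  have s: "(\<lambda>k. (wt (Suc 3) k * cmod (u t k))\<^sup>2) summable_on UNIV"
   by (rule summable_on_comparison_test[OF summable_on_cmult_right[OF elim] b]) simp
  have "(INFSUM k. (wt (Suc 3) k * cmod (u t k))\<^sup>2) <= (INFSUM k. 2 ^ 8 * (mag k ^ 8 * (cmod (u t k))\<^sup>2))"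
   by (rule infsum_mono[OF s summable_on_cmult_right[OF elim] b])
  also have "... = 2 ^ 8 * sobolev 4 (u t)" by (simp add: sobolev_def infsum_cmult_right')
  finally have l: "(INFSUM k. (wt (Suc 3) k * cmod (u t k))\<^sup>2) <= 2 ^ 8 * sobolev 4 (u t)" .
  have "(wnorm 3 (u t))\<^sup>2 <= (sqrt 3 * sqrt (INFSUM k. (wt (Suc 3) k * cmod (u t k))\<^sup>2))\<^sup>2"
   by (rule power_mono[OF wnorm_le_l2(2)[OF s] wnorm_nonneg])
  also have "... = 3 * (INFSUM k. (wt (Suc 3) k * cmod (u t k))\<^sup>2)"
   by (simp add: power_mult_distrib infsum_nonneg)
  finally show ?case using l by linarith
 qed
 have meas: "(\<lambda>t. wnorm 3 (u t)) \<in> borel_measurable (time T)"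
  unfolding wnorm_def
 proof (rule measurable_infsum_int)
  show "(\<lambda>t. wt 3 k * cmod (u t k)) \<in> borel_measurable (time T)" for k
   by (intro borel_measurable_integrable integrable_mult_right integrable_u)
  have n: "norm (wt 3 k * cmod w) = wt 3 k * cmod w" for k w using wt_ge_1[of 3 k] by (simp add: abs_mult)
  show "AE t in time T. (\<lambda>k. norm (wt 3 k * cmod (u t k))) summable_on UNIV"
   unfolding n using c.AE_summable by (simp only: wsummable_def)
 qed simp
 show ?thesis
 proof (rule Lp_time_series)
  show "integrable (time T) (\<lambda>t. wnorm 3 (u t) powr (4/3))"
  proof (rule Bochner_Integration.integrable_bound)
   show "integrable (time T) (\<lambda>t. 1 + 3 * (2 ^ 8 * sobolev 4 (u t)))"
    by (intro Bochner_Integration.integrable_add integrable_mult_right sobolev_4(2)[OF T] continuous_imp_integrable_real continuous_intros)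
   show "(\<lambda>t. wnorm 3 (u t) powr (4/3)) \<in> borel_measurable (time T)" using meas by measurable
   show "AE t in time T. norm (wnorm 3 (u t) powr (4/3)) <= norm (1 + 3 * (2 ^ 8 * sobolev 4 (u t)))"
    using le
   proof eventually_elim
    case (elim t)
    have "wnorm 3 (u t) powr (4/3) <= 1 + (wnorm 3 (u t))\<^sup>2" by (rule powr_four_thirds_le[OF wnorm_nonneg])
    then show ?case using elim sobolev_nonneg[of 4 "u t"] by simp
   qed
  qed
 qed simp
qed

lemma trg_partial_sums:
 assumes c: "wsummable 0 c" shows "(\<lambda>n. Re (\<Sum>k\<in>modes n. c k * wave k x)) \<longlonglongrightarrow> trg c x"
proof -
 have "(\<lambda>n. trg c x - trg (tail n c) x) \<longlonglongrightarrow> trg c x - 0"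
 proof (intro tendsto_diff tendsto_const)
  show "(\<lambda>n. trg (tail n c) x) \<longlonglongrightarrow> 0"
  proof (rule Lim_null_comparison[OF always_eventually wnorm_tail_tendsto[OF c]], rule allI)
   fix n
   have "wsummable 0 (tail n c)" by (rule wsummable_le(1)[OF c]) simp
   from abs_trg_le[OF this] show "norm (trg (tail n c) x) <= wnorm 0 (tail n c)"
    by simp
  qed
 qed
 moreover have "trg c x - trg (tail n c) x = Re (\<Sum>k\<in>modes n. c k * wave k x)" for n
 proof -
  have t: "wsummable 0 (tail n c)" by (rule wsummable_le(1)[OF c]) simp
  have "ser c x - ser (tail n c) x = ser (\<lambda>k. if k \<in> modes n then c k else 0) x"
   unfolding ser_diff[OF c t, symmetric] by (rule arg_cong[where f = "\<lambda>c. ser c x"]) auto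
  also have "... = (\<Sum>\<^sub>\<infinity>k\<in>modes n. c k * wave k x)"
   unfolding ser_def by (rule infsum_cong_neutral) auto
  finally show ?thesis unfolding trg_def by (simp flip: minus_complex.simps(1))
 qed
 ultimately show ?thesis by simp
qed

text \<open>Joint measurability comes from the partial sums, which are continuous in time and space
  together.\<close>

lemma Linf_spacetime_U: "U \<in> Linf_spacetime T"
proof -
 let ?M = "lebesgue_on ({0..T} \<times> {-pi..pi})"
 have sp: "space ?M = {0..T} \<times> {-pi..pi}" by (simp add: space_restrict_space)
 have m: "(\<lambda>(t, x). U t x) \<in> borel_measurable ?M"
 proof (rule borel_measurable_LIMSEQ_metric)
  fix n
  have "continuous_on UNIV (\<lambda>p. Re (\<Sum>k\<in>modes n. u (fst p) k * cis (real_of_int k * snd p)))"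
   by (intro continuous_intros continuous_on_compose2[OF cont]) auto
  then have "(\<lambda>p. Re (\<Sum>k\<in>modes n. u (fst p) k * cis (real_of_int k * snd p))) \<in> borel_measurable borel"
   by (rule borel_measurable_continuous_onI)
  then have "(\<lambda>p. Re (\<Sum>k\<in>modes n. u (fst p) k * cis (real_of_int k * snd p))) \<in> borel_measurable lebesgue"
   by (simp add: measurable_completion)
  then show "(\<lambda>p. Re (\<Sum>k\<in>modes n. u (fst p) k * cis (real_of_int k * snd p))) \<in> borel_measurable ?M"
   by (rule measurable_restrict_space1)
 next
  fix p assume "p \<in> space ?M"
  then have "fst p >= 0" by (auto simp: sp)
  from trg_partial_sums[OF wsummable_0(1)[OF this]]
  show "(\<lambda>n. Re (\<Sum>k\<in>modes n. u (fst p) k * cis (real_of_int k * snd p))) \<longlonglongrightarrow> (case p of (t, x) => U t x)"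
   by (simp add: case_prod_unfold)
 qed
 have "esssup ?M (\<lambda>(t, x). ereal \<bar>U t x\<bar>) <= ereal V"
 proof (rule esssup_I)
  show "(\<lambda>(t, x). ereal \<bar>U t x\<bar>) \<in> borel_measurable ?M"
   using m by (simp add: case_prod_unfold)
  show "AE p in ?M. (case p of (t, x) => ereal \<bar>U t x\<bar>) <= ereal V"
  proof (rule AE_I2)
   fix p assume "p \<in> space ?M"
   then have "fst p >= 0" by (auto simp: sp)
   then show "(case p of (t, x) => ereal \<bar>U t x\<bar>) <= ereal V"
    using abs_trg_le[OF wsummable_0(1), of "fst p" "snd p"] wsummable_0(2)[of "fst p"] by (simp add: case_prod_unfold)
  qed
 qed
 then show ?thesis using m by (auto simp: Linf_spacetime_def)
qed

text \<open>The squared modulus has derivative at most twice the product of the moduli of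
  \<open>u\<close> and \<open>R\<close>. Integrating that product up to \<open>T\<close> gives a
  majorant that serves all times at once.\<close>

lemma square_mode_le:
 assumes t: "0 <= t" "t <= T"
 shows "(cmod (u t k))\<^sup>2 <= (cmod (u 0 k))\<^sup>2 + 2 * tint T (\<lambda>s. cmod (u s k) * cmod (R s k))"
proof -
 have cp: "continuous_on S (\<lambda>s. cmod (u s k) * cmod (R s k))" for S
  by (intro continuous_intros continuous_on_subset[OF cont] continuous_on_subset[OF cont_R]) auto
 have ci: "continuous_on S (\<lambda>s. u s k \<bullet> R s k + R s k \<bullet> u s k)" for S
  by (intro continuous_intros continuous_on_subset[OF cont] continuous_on_subset[OF cont_R]) auto
 have "((\<lambda>s. u s k \<bullet> R s k + R s k \<bullet> u s k) has_integral (u t k \<bullet> u t k - u 0 k \<bullet> u 0 k)) {0..t}"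
 proof (rule fundamental_theorem_of_calculus_interior)
  show "continuous_on {0..t} (\<lambda>s. u s k \<bullet> u s k)"
   by (intro continuous_intros continuous_on_subset[OF cont]) auto
  fix s assume "s \<in> {0<..<t}"
  then show "((\<lambda>s. u s k \<bullet> u s k) has_vector_derivative u s k \<bullet> R s k + R s k \<bullet> u s k) (at s)"
   by (intro bounded_bilinear.has_vector_derivative[OF bounded_bilinear_inner] deriv) auto
 qed (use t in simp)
 then have "(cmod (u t k))\<^sup>2 - (cmod (u 0 k))\<^sup>2 = tint t (\<lambda>s. u s k \<bullet> R s k + R s k \<bullet> u s k)"
  by (simp add: power2_norm_eq_inner integral_unique)
 also have "... <= tint t (\<lambda>s. 2 * (cmod (u s k) * cmod (R s k)))"
 proof (rule integral_le)
  fix s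
  show "u s k \<bullet> R s k + R s k \<bullet> u s k <= 2 * (cmod (u s k) * cmod (R s k))"
   using norm_cauchy_schwarz[of "u s k" "R s k"] by (simp add: inner_commute)
 qed (intro integrable_continuous_real ci continuous_on_mult_left cp)+
 also have "... = 2 * tint t (\<lambda>s. cmod (u s k) * cmod (R s k))" by simp
 also have "... <= 2 * tint T (\<lambda>s. cmod (u s k) * cmod (R s k))"
  using t by (intro mult_left_mono integral_subset_le integrable_continuous_real cp) auto
 finally show ?thesis by simp
qed

text \<open>Each mode is continuous; dominated convergence of the sum over modes needs a majorant
  \<open>M\<close> uniform in time, and \<open>square_mode_le\<close> supplies one with sum at most
  \<open>Q + 2 * P\<close>.\<close>

lemma C_time_U:
 assumes T: "T >= 0" shows "U \<in> C_time T (Hdot 2)"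
proof -
 define M where "M k = mag k ^ 4 * ((cmod (u 0 k))\<^sup>2 + 2 * tint T (\<lambda>s. cmod (u s k) * cmod (R s k)))" for k
 have M0: "0 <= M k" for k unfolding M_def by (intro mult_nonneg_nonneg add_nonneg_nonneg integral_nonneg integrable_continuous_real continuous_intros continuous_on_subset[OF cont] continuous_on_subset[OF cont_R]) auto
 have "(\<Sum>k\<in>modes n. M k) <= Q + 2 * P" for n
 proof -
  have c: "continuous_on UNIV (\<lambda>s. cmod (u s k) * cmod (R s k))" for k by (intro continuous_intros cont cont_R)
  have "(\<Sum>k\<in>modes n. M k) = qsum n 4 (u 0) + 2 * (\<Sum>k\<in>modes n. mag k ^ 4 * tint T (\<lambda>s. cmod (u s k) * cmod (R s k)))"
   by (simp add: M_def qsum_def wsum_def sum.distrib sum_distrib_left distrib_left mult_ac)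
  also have "(\<Sum>k\<in>modes n. mag k ^ 4 * tint T (\<lambda>s. cmod (u s k) * cmod (R s k)))
    = tint T (\<lambda>s. wsum n 4 (\<lambda>k. cmod (u s k) * cmod (R s k)))"
   unfolding wsum_eq_integrals[OF c, symmetric]
  proof (rule sum.cong[OF refl])
   fix k
   have "tint T (\<lambda>s. cmod (u s k) * cmod (R s k)) = (LINT s|time T. cmod (u s k) * cmod (R s k))"
    by (rule lebesgue_integral_eq_integral[symmetric]) (auto intro!: continuous_imp_integrable_real continuous_on_subset[OF c])
   then show "mag k ^ 4 * tint T (\<lambda>s. cmod (u s k) * cmod (R s k))
     = (LINT s|time T. mag k ^ 4 * (cmod (u s k) * cmod (R s k)))"
    by (simp only: integral_mult_right_zero)
  qed
  also have "... <= P" by (rule P_le[OF T])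
  finally show ?thesis using Q_le[of 0 n] by simp
 qed
 then have M: "M summable_on UNIV" by (rule modes_bounded(1)[OF M0])
 have sup: "mag k ^ 4 * (cmod (u t k))\<^sup>2 <= M k" if "t \<in> {0..T}" for t k
  unfolding M_def using that by (intro mult_left_mono square_mode_le) auto
 have "U t \<in> fcarrier (Hdot 2) \<and> ((\<lambda>s. fnorm (Hdot 2) (\<lambda>x. U s x - U t x)) \<longlongrightarrow> 0) (at t within {0..T})"
  if t: "t \<in> {0..T}" for t
 proof
  show "U t \<in> fcarrier (Hdot 2)"
   using t by (intro Hdot_trg admissible_u wsummable_0(1) sobolev_2(1)) auto
  have eq: "fnorm (Hdot 2) (\<lambda>x. U s x - U t x) = sqrt (sobolev 2 (\<lambda>k. u s k - u t k))" if s: "s \<in> {0..T}" for s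
  proof -
   have w: "wsummable 0 (u s)" "wsummable 0 (u t)" using s t by (auto intro: wsummable_0)
   have "(\<lambda>x. U s x - U t x) = trg (\<lambda>k. u s k - u t k)" using trg_diff[OF w] by auto
   moreover have "hermitian (\<lambda>k. u s k - u t k)" using herm[of s] herm[of t] by (simp add: hermitian_def)
   ultimately show ?thesis using fnorm_Hdot wsummable_diff(1)[OF w] by simp
  qed
  \<comment> \<open>Set to zero outside \<open>[0, T]\<close>, because \<open>infsum_tannery\<close>
    asks for the majorant at every argument.\<close>
  define D where "D k s = (if s \<in> {0..T} then (mag k) ^ 4 * (cmod (u s k - u t k))\<^sup>2 else 0)" for k s
  have lim: "((\<lambda>s. INFSUM k. D k s) \<longlongrightarrow> 0) (at t within {0..T})"
  proof (cases "at t within {0..T} = bot")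
   case False
   have "((\<lambda>s. INFSUM k. D k s) \<longlongrightarrow> (INFSUM k::int. 0)) (at t within {0..T})"
   proof (rule infsum_tannery[OF _ _ _ False])
    fix k
    have "((\<lambda>s. u s k) \<longlongrightarrow> u t k) (at t within {0..T})"
     using continuous_on_subset[OF cont, of "{0..T}" k] t by (auto simp: continuous_on_def)
    then have "((\<lambda>s. mag k ^ 4 * (cmod (u s k - u t k))\<^sup>2) \<longlongrightarrow> mag k ^ 4 * (cmod (u t k - u t k))\<^sup>2) (at t within {0..T})"
     by (intro tendsto_intros)
    moreover have "\<forall>\<^sub>F s in at t within {0..T}. mag k ^ 4 * (cmod (u s k - u t k))\<^sup>2 = D k s"
     unfolding eventually_at_filter D_def by simp
    ultimately show "(D k \<longlongrightarrow> 0) (at t within {0..T})"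
     using Lim_transform_eventually by fastforce
    show "norm (D k s) <= 4 * M k" for s
    proof (cases "s \<in> {0..T}")
     case True
     have "(cmod (u s k - u t k))\<^sup>2 <= (cmod (u s k) + cmod (u t k))\<^sup>2"
      by (rule power_mono[OF norm_triangle_ineq4]) simp
     also have "... <= 2 * (cmod (u s k))\<^sup>2 + 2 * (cmod (u t k))\<^sup>2"
      using zero_le_power2[of "cmod (u s k) - cmod (u t k)"] by (simp add: power2_eq_square algebra_simps)
     finally have "mag k ^ 4 * (cmod (u s k - u t k))\<^sup>2 <= mag k ^ 4 * (2 * (cmod (u s k))\<^sup>2 + 2 * (cmod (u t k))\<^sup>2)"
      by (rule mult_left_mono) simp
     also have "... <= 4 * M k" using sup[OF True, of k] sup[OF t, of k] by (simp add: algebra_simps)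
     finally show ?thesis using True by (simp add: D_def)
    next
     case False
     then have "D k s = 0" unfolding D_def by (rule if_not_P)
     then show ?thesis using M0[of k] by simp
    qed
    show "(\<lambda>k. 4 * M k) summable_on UNIV" by (rule summable_on_cmult_right[OF M])
   qed
   then show ?thesis by simp
  qed simp
  have "((\<lambda>s. sqrt (INFSUM k. D k s)) \<longlongrightarrow> 0) (at t within {0..T})" using tendsto_real_sqrt[OF lim] by simp
  moreover have "\<forall>\<^sub>F s in at t within {0..T}. sqrt (INFSUM k. D k s) = fnorm (Hdot 2) (\<lambda>x. U s x - U t x)"
   unfolding eventually_at_filter by (intro always_eventually allI impI) (simp add: eq D_def sobolev_def)
  ultimately show "((\<lambda>s. fnorm (Hdot 2) (\<lambda>x. U s x - U t x)) \<longlongrightarrow> 0) (at t within {0..T})"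
   by (rule Lim_transform_eventually)
 qed
 then show ?thesis by (simp add: C_time_def)
qed

definition coefficient_measure :: "real set => int => complex" where
 "coefficient_measure B k = (LINT t|lebesgue_on B. u t k)"

text \<open>The path is integrable in time with values in the Wiener space of order four, so the
  measure has it as density. For every Borel set the coefficients of the measure are dominated by
  the single summable family \<open>w\<close>; this gives the values in \<open>W 4 Linf\<close> and
  countable additivity by dominated convergence of sums.\<close>

lemma M_time_U:
 assumes T: "T >= 0" shows "U \<in> M_time T (W 4 Linf)"
proof -
 interpret X: series_space False "W 4 Linf" 4 "(real 4 + 1) * 1" by (rule series_space_W_Linf)
 let ?S = "sets (restrict_space borel {0..T})" and ?I = coefficient_measure
 define w where "w k = (LINT t|time T. cmod (u t k))" for k
 have w: "(\<lambda>k. wt 4 k * w k) summable_on UNIV" unfolding w_def by (rule time_integrals(1)[OF T])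
 have S: "B \<in> sets lebesgue" "B \<subseteq> {0..T}" if "B \<in> ?S" for B
  using that by (auto simp: sets_restrict_space_iff)
 have LS: "(LINT t|lebesgue_on B. h t) = (LINT t:B|lebesgue. h t)" if "B \<in> ?S" for B and h :: "real => 'a::{banach, second_countable_topology}"
  using S(1)[OF that] by (simp add: integral_restrict_space set_lebesgue_integral_def)
 have si: "set_integrable lebesgue B (\<lambda>t. u t k)" "set_integrable lebesgue B (\<lambda>t. cmod (u t k))" if "B \<in> ?S" for B k
 proof -
  have "set_integrable lebesgue {0..T} (\<lambda>t. u t k)" "set_integrable lebesgue {0..T} (\<lambda>t. cmod (u t k))"
   using integrable_u[of T k] by (simp_all add: set_integrable_eq)
  then show "set_integrable lebesgue B (\<lambda>t. u t k)" "set_integrable lebesgue B (\<lambda>t. cmod (u t k))"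
   using S[OF that] by (auto intro: set_integrable_subset)
 qed
 have iB: "integrable (lebesgue_on B) (\<lambda>t. u t k)" "integrable (lebesgue_on B) (\<lambda>t. cmod (u t k))" if "B \<in> ?S" for B k
  using si[OF that, of k] S(1)[OF that] by (simp_all add: set_integrable_eq)
 have mono: "(LINT t|lebesgue_on B. cmod (u t k)) <= w k" if B: "B \<in> ?S" for B k
 proof -
  have T': "{0..T} \<in> ?S" by (simp add: sets_restrict_space_iff)
  show ?thesis
   unfolding w_def LS[OF B] LS[OF T'] set_lebesgue_integral_def
   using si(2)[OF B, of k] si(2)[OF T', of k] unfolding set_integrable_def
   by (rule integral_mono) (use S(2)[OF B] in \<open>auto simp: indicator_def\<close>)
 qed
 have Ib: "cmod (?I B k) <= (LINT t|lebesgue_on B. cmod (u t k))" for B k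
  unfolding coefficient_measure_def by (rule integral_norm_bound)
 have le: "wt 4 k * cmod (?I B k) <= wt 4 k * w k" if "B \<in> ?S" for B k
  using order_trans[OF Ib mono[OF that]] wt_ge_1[of 4 k] by (intro mult_left_mono) auto
 have Is: "wsummable 4 (?I B)" if "B \<in> ?S" for B
  unfolding wsummable_def
  by (rule summable_on_comparison_test[OF w le[OF that]]) (use order_trans[OF zero_le_one wt_ge_1] in simp)
 have Ia: "admissible False (?I B)" for B
 proof -
  have "?I B (- k) = cnj (?I B k)" for k
   unfolding coefficient_measure_def integral_cnj[symmetric] using hermitianD[OF herm] by simp
  then show ?thesis by (simp add: admissible_def hermitian_def)
 qed
 have Iw: "wsummable 0 (?I B)" if "B \<in> ?S" for B using wsummable_mono[OF Is[OF that], of 0] by simp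
 have add: "trg (?I (A \<union> B)) x = trg (?I A) x + trg (?I B) x" if A: "A \<in> ?S" and B: "B \<in> ?S" and d: "A \<inter> B = {}" for A B x
 proof -
  have "?I (A \<union> B) k = ?I A k + ?I B k" for k
   unfolding coefficient_measure_def LS[OF A] LS[OF B] LS[OF sets.Un[OF A B]]
   by (rule set_integral_Un[OF d si(1)[OF A] si(1)[OF B]])
  then have "?I (A \<union> B) = (\<lambda>k. ?I A k + ?I B k)" by auto
  then show ?thesis using trg_add[OF Iw[OF A] Iw[OF B]] by simp
 qed
 have "vector_measure T (W 4 Linf) (\<lambda>B. trg (?I B))"
  unfolding vector_measure_def
 proof (intro conjI ballI allI impI)
  fix B assume "B \<in> ?S"
  then show "trg (?I B) \<in> fcarrier (W 4 Linf)" by (intro X.carrier Ia Is)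
 next
  fix F :: "nat => real set" assume "range F \<subseteq> ?S \<and> disjoint_family F"
  then have df: "disjoint_family F" and F: "F i \<in> ?S" for i by auto
  define G where "G n = (\<Union>i<n. F i)" for n
  have G: "G n \<in> ?S" for n unfolding G_def using F by (intro sets.finite_UN) auto
  have UG: "(\<Union>i. F i) = (\<Union>n. G n)" unfolding G_def by (auto intro: lessI)
  have US: "(\<Union>n. G n) \<in> ?S" using G by (intro sets.countable_UN) auto
  have sum: "(\<Sum>i<n. trg (?I (F i)) x) = trg (?I (G n)) x" for n x
  proof (induction n)
   case 0
   have "?I (G 0) = (\<lambda>k. 0)" unfolding coefficient_measure_def G_def by (auto simp: integral_eq_zero_null_sets)
   then show ?case by (simp add: trg_def ser_def)
  next
   case (Suc n)
   have "F i \<inter> F n = {}" if "i < n" for i using df that by (simp add: disjoint_family_on_def)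
   then have "G n \<inter> F n = {}" unfolding G_def by blast
   moreover have "G (Suc n) = G n \<union> F n" unfolding G_def by (auto simp: less_Suc_eq)
   ultimately show ?case using Suc add[OF G F] by simp
  qed
  have s: "wsummable 4 (\<lambda>k. ?I (\<Union>n. G n) k - ?I (G n) k)" for n by (intro wsummable_diff Is US G)
  have h: "admissible False (\<lambda>k. ?I (\<Union>n. G n) k - ?I (G n) k)" for n by (intro admissible_diff Ia)
  have eq: "(\<lambda>x. trg (?I (\<Union>i. F i)) x - (\<Sum>i<n. trg (?I (F i)) x)) = trg (\<lambda>k. ?I (\<Union>n. G n) k - ?I (G n) k)" for n
   unfolding sum UG using trg_diff[OF Iw[OF US] Iw[OF G]] by auto
  have lim: "(\<lambda>n. wnorm 4 (\<lambda>k. ?I (\<Union>n. G n) k - ?I (G n) k)) \<longlonglongrightarrow> (INFSUM k::int. 0)"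
   unfolding wnorm_def
  proof (rule infsum_tannery)
   fix k
   have "(\<lambda>n. ?I (G n) k) \<longlonglongrightarrow> ?I (\<Union>n. G n) k"
    unfolding coefficient_measure_def LS[OF G] LS[OF US]
   proof (rule set_integral_cont_up[OF _ _ si(1)[OF US]])
    show "incseq G" unfolding incseq_def G_def by force
   qed (rule S(1)[OF G])
   then have "(\<lambda>n. wt 4 k * cmod (?I (\<Union>n. G n) k - ?I (G n) k)) \<longlonglongrightarrow> wt 4 k * cmod (?I (\<Union>n. G n) k - ?I (\<Union>n. G n) k)"
    by (intro tendsto_intros)
   then show "(\<lambda>n. wt 4 k * cmod (?I (\<Union>n. G n) k - ?I (G n) k)) \<longlonglongrightarrow> 0" by simp
   show "norm (wt 4 k * cmod (?I (\<Union>n. G n) k - ?I (G n) k)) <= 2 * (wt 4 k * w k)" for n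
   proof -
    have "wt 4 k * cmod (?I (\<Union>n. G n) k - ?I (G n) k) <= wt 4 k * (cmod (?I (\<Union>n. G n) k) + cmod (?I (G n) k))"
     by (intro mult_left_mono norm_triangle_ineq4) (use order_trans[OF zero_le_one wt_ge_1] in simp)
    also have "... <= 2 * (wt 4 k * w k)" using le[OF US, of k] le[OF G[of n], of k] by (simp add: distrib_left)
    finally show ?thesis using wt_ge_1[of 4 k] by (simp add: abs_mult)
   qed
   show "(\<lambda>k. 2 * (wt 4 k * w k)) summable_on UNIV" by (rule summable_on_cmult_right[OF w])
  qed simp
  show "(\<lambda>n. fnorm (W 4 Linf) (\<lambda>x. trg (?I (\<Union>i. F i)) x - (\<Sum>i<n. trg (?I (F i)) x))) \<longlonglongrightarrow> 0"
   unfolding eq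
  proof (rule tendsto_sandwich[OF _ _ tendsto_const])
   show "(\<lambda>n. (real 4 + 1) * 1 * wnorm 4 (\<lambda>k. ?I (\<Union>n. G n) k - ?I (G n) k)) \<longlonglongrightarrow> 0"
    using tendsto_mult_left[OF lim, of "(real 4 + 1) * 1"] by simp
  qed (intro always_eventually allI X.norm_nonneg[OF h s] X.norm_le[OF h s])+
 next
  show "\<exists>V. \<forall>P. finite P \<and> P \<subseteq> ?S \<and> disjoint P \<longrightarrow> (\<Sum>B\<in>P. fnorm (W 4 Linf) (trg (?I B))) <= V"
  proof (intro exI allI impI)
   fix P assume "finite P \<and> P \<subseteq> ?S \<and> disjoint P"
   then have P: "finite P" "disjoint P" and PS: "!!B. B \<in> P ==> B \<in> ?S" by auto
   \<comment> \<open>Integrals of the moduli over disjoint sets add up to at most the integral over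
     \<open>[0, T]\<close>, so the bound on the variation does not depend on the partition.\<close>
   define a where "a B k = wt 4 k * (LINT t|lebesgue_on B. cmod (u t k))" for B k
   have w0: "0 <= wt 4 k" for k using wt_ge_1[of 4 k] by simp
   have a: "a B summable_on UNIV" if "B \<in> P" for B
    by (rule summable_on_comparison_test[OF w])
     (auto simp: a_def w0 intro!: mult_left_mono mono PS that)
   have UP: "\<Union>P \<in> ?S" using P PS by (intro sets.finite_Union) auto
   have "(\<Sum>B\<in>P. fnorm (W 4 Linf) (trg (?I B))) <= (\<Sum>B\<in>P. 5 * infsum (a B) UNIV)"
   proof (rule sum_mono)
    fix B assume B: "B \<in> P"
    have "fnorm (W 4 Linf) (trg (?I B)) <= (real 4 + 1) * 1 * wnorm 4 (?I B)" by (rule X.norm_le[OF Ia Is[OF PS[OF B]]])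
    moreover have "wnorm 4 (?I B) <= infsum (a B) UNIV"
     unfolding wnorm_def
     by (rule infsum_mono[OF Is[OF PS[OF B], unfolded wsummable_def] a[OF B]])
      (auto simp: a_def w0 intro!: mult_left_mono Ib)
    ultimately show "fnorm (W 4 Linf) (trg (?I B)) <= 5 * infsum (a B) UNIV" by simp
   qed
   also have "... = 5 * (INFSUM k. \<Sum>B\<in>P. a B k)"
    using infsum_finite_sum[OF P(1) a] by (simp add: sum_distrib_left)
   also have "(INFSUM k. \<Sum>B\<in>P. a B k) <= (INFSUM k. wt 4 k * w k)"
   proof (rule infsum_mono)
    show "(\<lambda>k. \<Sum>B\<in>P. a B k) summable_on UNIV" using infsum_finite_sum[OF P(1) a] by simp
    show "(\<lambda>k. wt 4 k * w k) summable_on UNIV" by (rule w)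
    fix k
    have "(\<Sum>B\<in>P. LINT t|lebesgue_on B. cmod (u t k)) = (\<Sum>B\<in>P. LINT t:B|lebesgue. cmod (u t k))"
     by (intro sum.cong refl LS PS)
    also have "... = (LINT t:(\<Union>B\<in>P. B)|lebesgue. cmod (u t k))"
     by (rule set_integral_finite_Union[symmetric, OF P(1)])
      (use P(2) in \<open>auto simp: disjoint_family_on_def disjoint_def intro!: si(2) S(1) PS\<close>)
    also have "... = (LINT t|lebesgue_on (\<Union>P). cmod (u t k))" unfolding LS[OF UP] by simp
    also have "... <= w k" by (rule mono[OF UP])
    finally show "(\<Sum>B\<in>P. a B k) <= wt 4 k * w k"
     unfolding a_def sum_distrib_left[symmetric] by (rule mult_left_mono[OF _ w0])
   qed
   finally show "(\<Sum>B\<in>P. fnorm (W 4 Linf) (trg (?I B))) <= 5 * (INFSUM k. wt 4 k * w k)" by simp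
  qed
 qed
 moreover have "(LINT x|torus. trg (?I B) x * \<psi> x) = (LINT t|lebesgue_on B. LINT x|torus. U t x * \<psi> x)"
  if B: "B \<in> ?S" and \<psi>: "smooth_periodic \<psi>" for B \<psi>
 proof -
  have i: "integrable torus \<psi>" using smooth_periodic_deriv(2)[OF \<psi>, of 0] by (intro integrable_torus_continuous) simp
  have h: "hermitian (?I B)" using Ia[of B] by (simp add: admissible_def)
  have sm: "(\<lambda>k. LINT t|lebesgue_on B. cmod (u t k)) summable_on UNIV"
  proof (rule summable_on_comparison_test[OF w])
   fix k
   have "1 * w k <= wt 4 k * w k" by (rule mult_right_mono[OF wt_ge_1]) (simp add: w_def)
   then show "(LINT t|lebesgue_on B. cmod (u t k)) <= wt 4 k * w k" using mono[OF B, of k] by simp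
  qed simp
  have H: "AE t in lebesgue_on B. of_real (LINT x|torus. U t x * \<psi> x) = (INFSUM k. u t k * moment \<psi> k)"
  proof (rule AE_I2)
   fix t assume "t \<in> space (lebesgue_on B)"
   then have "t >= 0" using S(2)[OF B] by (auto simp: space_restrict_space)
   then show "of_real (LINT x|torus. U t x * \<psi> x) = (INFSUM k. u t k * moment \<psi> k)"
    by (intro integral_trg_mult herm wsummable_0 i)
  qed
  have "complex_of_real (LINT t|lebesgue_on B. LINT x|torus. U t x * \<psi> x) = (INFSUM k. LINT t|lebesgue_on B. u t k * moment \<psi> k)"
   by (rule integral_time_series(1)[OF S(1)[OF B] iB(1)[OF B] sm _ cmod_moment_le_L1 H]) simp
  also have "... = (INFSUM k. ?I B k * moment \<psi> k)" by (simp add: coefficient_measure_def)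
  also have "... = of_real (LINT x|torus. trg (?I B) x * \<psi> x)" by (rule integral_trg_mult[OF h Iw[OF B] i, symmetric])
  finally show ?thesis by (simp only: of_real_eq_iff)
 qed
 moreover have "U \<in> Lp_time 1 T L1" by (rule Lp_time_1[OF T series_space_mono[OF series_space_L1]]) simp
 ultimately show ?thesis unfolding M_time_def by blast
qed

end

section \<open>The weak equation\<close>

lemma cis_shift_period: "wave k pi = cis (real_of_int k * (- pi))"
proof -
 have "wave k pi = cis (real_of_int k * (- pi)) * cis (2 * pi * real_of_int k)"
  by (simp add: cis_mult algebra_simps)
 then show ?thesis by (simp add: cis_multiple_2pi)
qed

lemma fourier_determines:
 assumes u: "integrable torus u" and c: "hermitian c" "wsummable 0 c" and k: "!!k. fourier u k = c k"
 shows "AE x in torus. u x = trg c x"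
proof -
 let ?e = "\<lambda>k x. exp (- \<i> * of_int k * of_real x)"
 have e: "?e k x = cis (real_of_int (- k) * x)" for k x by (simp add: cis_conv_exp mult_ac)
 have i: "complex_integrable torus (\<lambda>x. complex_of_real (v x) * ?e k x)" if "integrable torus v" for v k
  unfolding e using that
  by (intro integrable_torus_bounded_mult[where B = 1] integrable_of_real)
   (auto intro!: continuous_measurable continuous_intros)
 have "fourier (\<lambda>x. u x - trg c x) k = fourier u k - fourier (trg c) k" for k
  unfolding fourier_def of_real_diff left_diff_distrib
  by (subst Bochner_Integration.integral_diff[OF i[OF u] i[OF integrable_trg[OF c(2)]]]) (simp add: diff_divide_distrib)
 then have "AE x in torus. u x - trg c x = 0"
  using u integrable_trg[OF c(2)] by (intro fourier_unique Bochner_Integration.integrable_diff) (simp_all add: k fourier_trg[OF c(2,1)])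
 then show ?thesis by simp
qed

lemma moment_eq_integral:
 assumes "continuous_on {-pi..pi} \<psi>"
 shows "moment \<psi> k = integral (cbox (- pi) pi) (\<lambda>x. wave k x * of_real (\<psi> x))"
 unfolding moment_def cbox_interval
proof (rule lebesgue_integral_eq_integral[OF continuous_imp_integrable_real])
 show "continuous_on {- pi..pi} (\<lambda>x. wave k x * complex_of_real (\<psi> x))"
  by (intro continuous_on_mult continuous_on_of_real continuous_on_cis continuous_on_id continuous_on_const assms)
qed simp

locale test_function =
 fixes T :: real and \<phi> \<phi>t \<phi>x :: "real => real => real"
 assumes T: "T > 0" and test: "test_fun T \<phi> \<phi>t \<phi>x"
begin

lemma per: "t \<in> {0..<T} ==> periodic (\<phi> t)"
 and dt: "t \<in> {0..<T} ==> ((\<lambda>s. \<phi> s x) has_real_derivative \<phi>t t x) (at t within {0..<T})"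
 and dx: "t \<in> {0..<T} ==> ((\<lambda>y. \<phi> t y) has_real_derivative \<phi>x t x) (at x)"
 and ct: "continuous_on ({0..<T} \<times> UNIV) (\<lambda>p. \<phi>t (fst p) (snd p))"
 and cx: "continuous_on ({0..<T} \<times> UNIV) (\<lambda>p. \<phi>x (fst p) (snd p))"
 using test by (simp_all add: test_fun_def case_prod_unfold)

text \<open>Strictly later than the time \<open>T'\<close> from which \<open>\<phi>\<close>
  vanishes: then \<open>\<phi>\<close> is zero in a whole neighbourhood of every time in
  \<open>[S, T)\<close>, the left end included, and its derivatives vanish there too.\<close>

definition "S = (SOME S. 0 < S \<and> S < T \<and> (\<exists>T'<S. \<forall>t\<in>{0..<T}. T' <= t \<longrightarrow> (\<forall>x. \<phi> t x = 0)))"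

lemma S: "0 < S" "S < T" "\<exists>T'<S. \<forall>t\<in>{0..<T}. T' <= t \<longrightarrow> (\<forall>x. \<phi> t x = 0)"
proof -
 obtain T' where T': "T' < T" "\<forall>t\<in>{0..<T}. T' <= t \<longrightarrow> (\<forall>x. \<phi> t x = 0)"
  using test by (auto simp: test_fun_def)
 have "0 < (max T' 0 + T) / 2 \<and> (max T' 0 + T) / 2 < T \<and> T' < (max T' 0 + T) / 2" using T T'(1) by auto
 with T'(2) have "\<exists>S. 0 < S \<and> S < T \<and> (\<exists>T'<S. \<forall>t\<in>{0..<T}. T' <= t \<longrightarrow> (\<forall>x. \<phi> t x = 0))" by blast
 from someI_ex[OF this] show "0 < S" "S < T" "\<exists>T'<S. \<forall>t\<in>{0..<T}. T' <= t \<longrightarrow> (\<forall>x. \<phi> t x = 0)"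
  unfolding S_def by auto
qed

lemma continuous_slice:
 assumes c: "continuous_on ({0..<T} \<times> UNIV) (\<lambda>p. v (fst p) (snd p))" and t: "t \<in> {0..<T}"
 shows "continuous_on UNIV (v t)"
proof -
 have "continuous_on UNIV (\<lambda>x. v (fst (t, x)) (snd (t, x)))"
  by (rule continuous_on_compose2[OF c]) (use t in \<open>auto intro!: continuous_on_Pair continuous_on_const continuous_on_id\<close>)
 then show ?thesis by simp
qed

lemma cont_slices:
 assumes t: "t \<in> {0..<T}"
 shows "continuous_on UNIV (\<phi> t)" "continuous_on UNIV (\<phi>t t)" "continuous_on UNIV (\<phi>x t)"
proof -
 show "continuous_on UNIV (\<phi> t)" using dx[OF t] by (intro DERIV_continuous_on) auto
 show "continuous_on UNIV (\<phi>t t)" "continuous_on UNIV (\<phi>x t)"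
  by (rule continuous_slice[OF ct t] continuous_slice[OF cx t])+
qed

lemma late:
 assumes t: "t \<in> {S..<T}" shows "\<phi> t x = 0" "\<phi>t t x = 0" "\<phi>x t x = 0"
proof -
 obtain T' where T': "T' < S" "!!t x. t \<in> {0..<T} ==> T' <= t ==> \<phi> t x = 0" using S(3) by blast
 have t0: "t \<in> {0..<T}" using t S by auto
 have z: "\<phi> t x = 0" for x using T' t t0 by auto
 then show "\<phi> t x = 0" .
 have "\<phi> t = (\<lambda>x. 0)" using z by auto
 then show "\<phi>x t x = 0" using DERIV_unique[OF dx[OF t0, of x], of 0] by simp
 have "at t within {0..<T} = at t"
  by (rule at_within_open_subset[where S = "{0<..<T}"]) (use t S in auto)
 then have 1: "((\<lambda>s. \<phi> s x) has_real_derivative \<phi>t t x) (at t)"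
  using dt[OF t0, of x] by (simp only:)
 have "((\<lambda>s. \<phi> s x) has_real_derivative 0) (at t)"
 proof (rule has_field_derivative_transform_within_open[where f = "\<lambda>_. 0"])
  show "open ({T'<..<T} \<inter> {0<..})" by (intro open_Int) auto
  show "t \<in> {T'<..<T} \<inter> {0<..}" using t T' S by auto
 qed (use T' in auto)
 with 1 show "\<phi>t t x = 0" by (rule DERIV_unique)
qed

text \<open>Nothing is known of test functions from time \<open>T\<close> on; the value zero
  continues the moments, which vanish from \<open>S\<close> on, to the closed interval.\<close>

definition mom :: "(real => real => real) => real => int => complex" where
 "mom v t k = (if t < T then moment (v t) k else 0)"

lemma mom_x:
 assumes t: "t \<in> {0..<T}" shows "mom \<phi>x t k = - (\<i> * of_int k) * mom \<phi> t k"
proof -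
 have "(LINT x|torus. wave k x * of_real (\<phi>x t x)) = - (LINT x|torus. (\<i> * of_int k * wave k x) * of_real (\<phi> t x))"
 proof (rule periodic_by_parts)
  show "((\<lambda>x. wave k x) has_vector_derivative \<i> * of_int k * wave k x) (at x)" for x
  proof -
   have "((\<lambda>z. exp (\<i> * of_int k * z)) has_field_derivative exp (\<i> * of_int k * of_real x) * (\<i> * of_int k)) (at (of_real x))"
    by (auto intro!: derivative_eq_intros)
   from has_vector_derivative_real_field[OF this]
   show ?thesis by (simp add: cis_conv_exp mult_ac)
  qed
  show "((\<lambda>x. complex_of_real (\<phi> t x)) has_vector_derivative of_real (\<phi>x t x)) (at x)" for x
   using dx[OF t, of x] by (intro bounded_linear.has_vector_derivative[OF bounded_linear_of_real])
    (simp add: has_real_derivative_iff_has_vector_derivative)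
  show "continuous_on UNIV (\<lambda>x. \<i> * of_int k * wave k x)" by (intro continuous_intros)
  show "continuous_on UNIV (\<lambda>x. complex_of_real (\<phi>x t x))" using cont_slices(3)[OF t] by (intro continuous_intros) auto
  have "\<phi> t (- pi + 2 * pi) = \<phi> t (- pi)" using per[OF t] unfolding periodic_def by blast
  then show "wave k pi * of_real (\<phi> t pi) = cis (real_of_int k * - pi) * of_real (\<phi> t (- pi))"
   using cis_shift_period[of k] by simp
 qed
 also have "(LINT x|torus. (\<i> * of_int k * wave k x) * of_real (\<phi> t x)) = \<i> * of_int k * moment (\<phi> t) k"
  unfolding moment_def integral_mult_right_zero[symmetric] by (simp only: mult.assoc)
 finally show ?thesis using t by (simp add: mom_def moment_def)
qed

lemma mom_late: "t \<in> {S..T} ==> mom \<phi> t k = 0 \<and> mom \<phi>t t k = 0 \<and> mom \<phi>x t k = 0"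
 unfolding mom_def moment_def using late by (auto simp: less_le)

lemma continuous_mom:
 assumes c: "continuous_on ({0..<T} \<times> UNIV) (\<lambda>p. v (fst p) (snd p))" and late: "!!t. t \<in> {S..T} ==> mom v t k = 0"
 shows "continuous_on {0..T} (\<lambda>t. mom v t k)"
proof -
 let ?m = "\<lambda>t. integral (cbox (- pi) pi) (\<lambda>x. wave k x * complex_of_real (v t x))"
 have "continuous_on ({0..<T} \<times> cbox (- pi) pi) (\<lambda>(t, x). wave k x * complex_of_real (v t x))"
  unfolding case_prod_unfold by (intro continuous_intros continuous_on_subset[OF c]) auto
 then have "continuous_on {0..<T} ?m" by (rule integral_continuous_on_param)
 then have m: "continuous_on {0..S} ?m" by (rule continuous_on_subset) (use S in auto)
 have eq: "mom v t k = ?m t" if "t \<in> {0..S}" for t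
 proof -
  have "continuous_on {-pi..pi} (v t)"
   by (rule continuous_on_subset[OF continuous_slice[OF c]]) (use that S in auto)
  then show ?thesis using that S by (simp add: mom_def moment_eq_integral)
 qed
 have c': "continuous_on ({0..S} \<union> {S..T}) (\<lambda>t. if t <= S then ?m t else 0)"
 proof (rule continuous_on_If[OF _ _ m])
  fix t assume "t \<in> {S..T}" "t <= S"
  then have "t = S" by simp
  then show "?m t = 0" using eq[of S] late[of S] S by simp
 qed auto
 have U: "{0..S} \<union> {S..T} = {0..T}" using S by auto
 have "(if t <= S then ?m t else 0) = mom v t k" if "t \<in> {0..T}" for t using that eq[of t] late[of t] by auto
 then show ?thesis by (rule continuous_on_eq[OF c'[unfolded U]])
qed

lemma mom_deriv_within:
 assumes t: "t \<in> {0..<T}" shows "((\<lambda>s. mom \<phi> s k) has_vector_derivative mom \<phi>t t k) (at t within {0..<T})"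
proof -
 let ?f = "\<lambda>v t. integral (cbox (- pi) pi) (\<lambda>x. wave k x * complex_of_real (v t x))"
 have eq: "mom v s k = ?f v s" if "s \<in> {0..<T}" "continuous_on UNIV (v s)" for v s
  using that continuous_on_subset[OF that(2), of "{-pi..pi}"] by (simp add: mom_def moment_eq_integral)
 have "(?f \<phi> has_vector_derivative ?f \<phi>t t) (at t within {0..<T})"
 proof (rule leibniz_rule_vector_derivative)
  fix s x assume s: "s \<in> {0..<T}"
  have bl: "bounded_linear (\<lambda>r::real. wave k x * complex_of_real r)"
   by (rule bounded_linear_compose[OF bounded_linear_mult_right bounded_linear_of_real])
  show "((\<lambda>s. wave k x * complex_of_real (\<phi> s x)) has_vector_derivative wave k x * complex_of_real (\<phi>t s x)) (at s within {0..<T})"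
   using dt[OF s, of x] by (intro bounded_linear.has_vector_derivative[OF bl]) (simp add: has_real_derivative_iff_has_vector_derivative)
 next
  fix s assume s: "s \<in> {0..<T}"
  show "(\<lambda>x. wave k x * complex_of_real (\<phi> s x)) integrable_on cbox (- pi) pi"
   by (intro integrable_continuous continuous_intros continuous_on_subset[OF cont_slices(1)[OF s]]) auto
 next
  show "continuous_on ({0..<T} \<times> cbox (- pi) pi) (\<lambda>(s, x). wave k x * complex_of_real (\<phi>t s x))"
   unfolding case_prod_unfold by (intro continuous_intros continuous_on_subset[OF ct]) auto
 qed (use t in auto)
 then have "((\<lambda>s. mom \<phi> s k) has_vector_derivative ?f \<phi>t t) (at t within {0..<T})"
  by (rule has_vector_derivative_transform[OF t, rotated]) (simp add: eq cont_slices(1))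
 then show ?thesis using eq[of t \<phi>t, OF t cont_slices(2)[OF t]] by simp
qed

lemma mom_deriv:
 assumes t: "0 < t" "t < T" shows "((\<lambda>s. mom \<phi> s k) has_vector_derivative mom \<phi>t t k) (at t)"
proof -
 have "at t within {0..<T} = at t"
  by (rule at_within_open_subset[where S = "{0<..<T}"]) (use t in auto)
 then show ?thesis using mom_deriv_within[of t k] t by simp
qed

lemma continuous_phi: "continuous_on {0..T} (\<lambda>t. mom \<phi> t k)"
proof -
 have "continuous_on {0..<T} (\<lambda>t. mom \<phi> t k)"
  unfolding continuous_on_eq_continuous_within by (blast intro: has_vector_derivative_continuous mom_deriv_within)
 then have m: "continuous_on {0..S} (\<lambda>t. mom \<phi> t k)" by (rule continuous_on_subset) (use S in auto)
 have c: "continuous_on ({0..S} \<union> {S..T}) (\<lambda>t. if t <= S then mom \<phi> t k else 0)"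
 proof (rule continuous_on_If[OF _ _ m])
  fix t assume "t \<in> {S..T}" "t <= S"
  then show "mom \<phi> t k = 0" using mom_late[of t k] by simp
 qed auto
 have U: "{0..S} \<union> {S..T} = {0..T}" using S by auto
 have "(if t <= S then mom \<phi> t k else 0) = mom \<phi> t k" if "t \<in> {0..T}" for t using that mom_late[of t k] by auto
 then show ?thesis by (rule continuous_on_eq[OF c[unfolded U]])
qed

lemma continuous_mom_t: "continuous_on {0..T} (\<lambda>t. mom \<phi>t t k)"
 by (rule continuous_mom[OF ct]) (use mom_late in blast)

lemma continuous_mom_x: "continuous_on {0..T} (\<lambda>t. mom \<phi>x t k)"
 by (rule continuous_mom[OF cx]) (use mom_late in blast)

text \<open>The bound is uniform in \<open>k\<close>, as the exchange of sum and time integral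
  requires; it comes from compactness of \<open>[0, S]\<close> times one period.\<close>

lemma mom_bounded:
 assumes c: "continuous_on ({0..<T} \<times> UNIV) (\<lambda>p. v (fst p) (snd p))"
  and late: "!!t k. t \<in> {S..T} ==> mom v t k = 0"
 shows "\<exists>K. \<forall>t\<in>{0..T}. \<forall>k. cmod (mom v t k) <= K"
proof -
 have "compact ((\<lambda>p. v (fst p) (snd p)) ` ({0..S} \<times> {-pi..pi}))"
  by (intro compact_continuous_image continuous_on_subset[OF c] compact_Times) (use S in auto)
 then obtain K where K: "!!t x. t \<in> {0..S} ==> x \<in> {-pi..pi} ==> \<bar>v t x\<bar> <= K"
  using compact_imp_bounded by (force simp: bounded_iff)
 have "cmod (mom v t k) <= \<bar>2 * pi * K\<bar>" if t: "t \<in> {0..T}" for t k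
 proof (cases "t <= S")
  case True
  have "continuous_on UNIV (v t)"
   by (rule continuous_slice[OF c]) (use t True S in auto)
  then have "cmod (moment (v t) k) <= 2 * pi * K"
   by (intro cmod_moment_le integrable_torus_continuous K) (use t True in auto)
  then show ?thesis using True S by (simp add: mom_def)
 next
  case False
  then show ?thesis using late[of t k] t by simp
 qed
 then show ?thesis by blast
qed

end

section \<open>The weak equation for a path with integrable flux\<close>

lemma AE_lebesgue_on_less: "AE t in lebesgue_on {0..T::real}. 0 <= t \<and> t < T"
proof -
 have "{T} \<in> null_sets lebesgue" using negligible_sing[of T] by (simp add: negligible_iff_null_sets)
 then have "AE t in lebesgue. t \<notin> {T}" by (rule AE_not_in)
 then show ?thesis by (subst AE_restrict_space_iff) (auto elim: eventually_mono)
qed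

text \<open>\<open>Fh\<close> are the Fourier coefficients of the flux, and \<open>R_eq\<close> is
  the conservation law read off mode by mode.\<close>

locale flux_path = regular_path +
 fixes Fh :: "real => int => complex"
 assumes F_herm: "hermitian (Fh t)" and F_cont: "continuous_on UNIV (\<lambda>t. Fh t k)"
  and R_eq: "R t k = - (\<i> * of_int k) * Fh t k"
  and F_sum: "T >= 0 ==> (\<lambda>k. LINT t|time T. cmod (Fh t k)) summable_on UNIV"
begin

lemma integrable_F: "integrable (time T) (\<lambda>t. Fh t k)"
 by (intro continuous_imp_integrable_real continuous_on_subset[OF F_cont]) auto

lemma AE_F:
 assumes T: "T >= 0" shows "AE t in time T. wsummable 0 (Fh t)"
 using AE_summable_of_integral[OF integrable_F F_sum[OF T]] by (simp add: wsummable_def)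

lemma Lp_time_F:
 assumes T: "T >= 0" shows "(\<lambda>t. trg (Fh t)) \<in> Lp_time 1 T L1"
proof -
 interpret X: series_space False L1 0 "2 * pi" by (rule series_space_L1)
 interpret c: coefficient_path False 0 T Fh
 proof
  show "\<exists>B. \<forall>t\<in>{0..T}. cmod (Fh t k) <= B" for k
  proof -
   have "bounded ((\<lambda>t. Fh t k) ` {0..T})"
    by (intro compact_imp_bounded compact_continuous_image continuous_on_subset[OF F_cont]) auto
   then show ?thesis by (auto simp: bounded_iff)
  qed
 qed (auto simp: admissible_def intro: F_herm continuous_measurable F_cont AE_F T)
 interpret space_path False L1 0 "2 * pi" T Fh ..
 have S: "{0..T} \<in> sets lebesgue" by simp
 have i: "integrable (time T) (\<lambda>t. cmod (Fh t k))" for k by (rule integrable_norm[OF integrable_F])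
 have b: "(\<Sum>k\<in>modes n. LINT t|time T. cmod (Fh t k)) <= (INFSUM k. LINT t|time T. cmod (Fh t k))" for n
  by (rule finite_sum_le_infsum[OF F_sum[OF T]]) auto
 have "integrable (time T) (\<lambda>t. wnorm 0 (Fh t))"
  unfolding wnorm_def wt_0 mult_1 by (rule monotone_time_series(4)[OF S i norm_ge_zero b])
 then show ?thesis by (intro Lp_time_series) (simp_all add: wnorm_nonneg)
qed

lemma weak_equation_U:
 assumes T: "T > 0" and u0: "integrable torus u0" "!!k. fourier u0 k = u 0 k"
  and F: "AE t in time T. F t \<in> fcarrier L1 \<and> (AE x in torus. F t x = trg (Fh t) x)"
 shows "weak_equation T u0 U F"
 unfolding weak_equation_def
proof (intro conjI allI impI)
 have T0: "T >= 0" using T by simp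
 show "F \<in> Lp_time 1 T L1" by (rule Lp_time_L1_cong[OF Lp_time_F[OF T0] F])
 fix \<phi> \<phi>t \<phi>x assume "test_fun T \<phi> \<phi>t \<phi>x"
 with T interpret test_function T \<phi> \<phi>t \<phi>x by unfold_locales
 let ?L = "time T"
 have St: "{0..T} \<in> sets lebesgue" by simp
 have z: "(0::real) \<in> {0..<T}" using T by simp
 have cint: "integrable ?L h" if "continuous_on {0..T} h" for h :: "real => complex"
  using that by (rule continuous_imp_integrable_real)
 have cu: "continuous_on {0..T} (\<lambda>t. u t k)" "continuous_on {0..T} (\<lambda>t. Fh t k)" "continuous_on {0..T} (\<lambda>t. R t k)" for k
  by (auto intro: continuous_on_subset[OF cont] continuous_on_subset[OF F_cont] continuous_on_subset[OF cont_R])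
 have u_sum: "(\<lambda>k. LINT t|?L. cmod (u t k)) summable_on UNIV"
 proof (rule summable_on_comparison_test[OF time_integrals(1)[OF T0]])
  fix k
  show "(LINT t|?L. cmod (u t k)) <= wt 4 k * (LINT t|?L. cmod (u t k))"
   using mult_right_mono[OF wt_ge_1[of 4 k], of "LINT t|?L. cmod (u t k)"] by simp
 qed simp
 obtain Kt where Kt: "!!t k. t \<in> {0..T} ==> cmod (mom \<phi>t t k) <= Kt"
  using mom_bounded[OF ct] mom_late by blast
 obtain Kx where Kx: "!!t k. t \<in> {0..T} ==> cmod (mom \<phi>x t k) <= Kx"
  using mom_bounded[OF cx] mom_late by blast
 have m: "(\<lambda>t. mom \<phi>t t k) \<in> borel_measurable ?L" "(\<lambda>t. mom \<phi>x t k) \<in> borel_measurable ?L" for k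
  using continuous_mom_t continuous_mom_x by (auto intro: continuous_imp_measurable_on_sets_lebesgue)
 have H1: "AE t in ?L. of_real (LINT x|torus. U t x * \<phi>t t x) = (INFSUM k. u t k * mom \<phi>t t k)"
  using AE_lebesgue_on_less
 proof eventually_elim
  case (elim t)
  then have "integrable torus (\<phi>t t)" by (intro integrable_torus_continuous cont_slices) auto
  then show ?case using elim integral_trg_mult[OF herm wsummable_0(1)] by (simp add: mom_def)
 qed
 have H2: "AE t in ?L. of_real (LINT x|torus. F t x * \<phi>x t x) = (INFSUM k. Fh t k * mom \<phi>x t k)"
  using AE_lebesgue_on_less F AE_F[OF T0]
 proof eventually_elim
  case (elim t)
  then have c: "continuous_on UNIV (\<phi>x t)" by (intro cont_slices) auto
  then have i: "integrable torus (\<phi>x t)" by (rule integrable_torus_continuous)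
  have "(LINT x|torus. F t x * \<phi>x t x) = (LINT x|torus. trg (Fh t) x * \<phi>x t x)"
  proof (rule integral_cong_AE)
   show "(\<lambda>x. F t x * \<phi>x t x) \<in> borel_measurable torus" "(\<lambda>x. trg (Fh t) x * \<phi>x t x) \<in> borel_measurable torus"
    using elim i borel_measurable_trg[of "Fh t"] by (auto simp: L1_def intro!: borel_measurable_times)
   show "AE x in torus. F t x * \<phi>x t x = trg (Fh t) x * \<phi>x t x"
    using conjunct2[OF elim(2)] by eventually_elim simp
  qed
  then show ?case using elim integral_trg_mult[OF F_herm elim(3) i] by (simp add: mom_def)
 qed
 note I1 = integral_time_series[OF St integrable_u(1) u_sum m(1) Kt H1]
 note I2 = integral_time_series[OF St integrable_F F_sum[OF T0] m(2) Kx H2]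
 have E1: "complex_of_real (LINT t|?L. LINT x|torus. U t x * \<phi>t t x) = (INFSUM k. LINT t|?L. u t k * mom \<phi>t t k)"
  by (rule I1(1))
 have E2: "complex_of_real (LINT t|?L. LINT x|torus. F t x * \<phi>x t x) = (INFSUM k. LINT t|?L. Fh t k * mom \<phi>x t k)"
  by (rule I2(1))
 have c0: "continuous_on UNIV (\<phi> 0)" by (rule cont_slices(1)[OF z])
 have i0: "integrable torus (\<phi> 0)" by (rule integrable_torus_continuous[OF c0])
 have w0: "wsummable 0 (u 0)" by (rule wsummable_0(1)) simp
 have "(LINT x|torus. u0 x * \<phi> 0 x) = (LINT x|torus. U 0 x * \<phi> 0 x)"
 proof (rule integral_cong_AE)
  show "(\<lambda>x. u0 x * \<phi> 0 x) \<in> borel_measurable torus" "(\<lambda>x. U 0 x * \<phi> 0 x) \<in> borel_measurable torus"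
   using u0(1) i0 borel_measurable_trg[OF w0] by (auto intro!: borel_measurable_times)
  show "AE x in torus. u0 x * \<phi> 0 x = U 0 x * \<phi> 0 x"
   using fourier_determines[OF u0(1) herm w0 u0(2)] by eventually_elim simp
 qed
 then have I0: "of_real (LINT x|torus. u0 x * \<phi> 0 x) = (INFSUM k. u 0 k * mom \<phi> 0 k)"
  using integral_trg_mult[OF herm w0 i0] T by (simp add: mom_def)
 \<comment> \<open>The boundary term at \<open>T\<close> vanishes with \<open>\<phi>\<close>. The
   factor \<open>- (\<i> * of_int k)\<close> between flux and \<open>R\<close> is the same as that
   between the moments of \<open>\<phi>\<close> and of its space derivative (\<open>mom_x\<close>),
   so it can be moved over.\<close>
 have mode: "- (u 0 k * mom \<phi> 0 k) = (LINT t|?L. u t k * mom \<phi>t t k) + (LINT t|?L. Fh t k * mom \<phi>x t k)" for k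
 proof -
  have c1: "continuous_on {0..T} (\<lambda>t. u t k * mom \<phi>t t k)" and c2: "continuous_on {0..T} (\<lambda>t. Fh t k * mom \<phi>x t k)"
   and c3: "continuous_on {0..T} (\<lambda>t. u t k * mom \<phi> t k)" and c4: "continuous_on {0..T} (\<lambda>t. u t k * mom \<phi>t t k + R t k * mom \<phi> t k)"
   by (intro continuous_intros cu continuous_mom_t continuous_mom_x continuous_phi)+
  have "((\<lambda>t. u t k * mom \<phi>t t k + R t k * mom \<phi> t k) has_integral (u T k * mom \<phi> T k - u 0 k * mom \<phi> 0 k)) {0..T}"
  proof (rule fundamental_theorem_of_calculus_interior[OF T0 c3])
   fix t assume "t \<in> {0<..<T}"
   then show "((\<lambda>t. u t k * mom \<phi> t k) has_vector_derivative u t k * mom \<phi>t t k + R t k * mom \<phi> t k) (at t)"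
    by (intro has_vector_derivative_mult deriv mom_deriv) auto
  qed
  then have "- (u 0 k * mom \<phi> 0 k) = tint T (\<lambda>t. u t k * mom \<phi>t t k + R t k * mom \<phi> t k)"
   using mom_late[of T k] S by (simp add: integral_unique)
  also have "... = tint T (\<lambda>t. u t k * mom \<phi>t t k + Fh t k * mom \<phi>x t k)"
  proof (rule integral_cong)
   fix t assume t: "t \<in> {0..T}"
   show "u t k * mom \<phi>t t k + R t k * mom \<phi> t k = u t k * mom \<phi>t t k + Fh t k * mom \<phi>x t k"
   proof (cases "t < T")
    case True
    then show ?thesis using mom_x[of t k] t by (simp add: R_eq)
   next
    case False
    then show ?thesis by (simp add: mom_def)
   qed
  qed
  also have "... = (LINT t|?L. u t k * mom \<phi>t t k + Fh t k * mom \<phi>x t k)"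
   by (rule lebesgue_integral_eq_integral[symmetric]) (auto intro!: cint continuous_on_add c1 c2)
  also have "... = (LINT t|?L. u t k * mom \<phi>t t k) + (LINT t|?L. Fh t k * mom \<phi>x t k)"
   by (rule Bochner_Integration.integral_add[OF cint[OF c1] cint[OF c2]])
  finally show ?thesis .
 qed
 have "- complex_of_real (LINT x|torus. u0 x * \<phi> 0 x) = (INFSUM k. - (u 0 k * mom \<phi> 0 k))"
  unfolding I0 by (rule infsum_uminus[symmetric])
 also have "... = of_real (LINT t|?L. LINT x|torus. U t x * \<phi>t t x) + of_real (LINT t|?L. LINT x|torus. F t x * \<phi>x t x)"
  unfolding mode E1 E2
  by (rule infsum_add[OF abs_summable_summable[OF I1(2)] abs_summable_summable[OF I2(2)]])
 finally have "complex_of_real (- (LINT x|torus. u0 x * \<phi> 0 x) - (LINT t|?L. LINT x|torus. U t x * \<phi>t t x))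
   = of_real (LINT t|?L. LINT x|torus. F t x * \<phi>x t x)" by simp
 then show "- (LINT x|torus. u0 x * \<phi> 0 x) - (LINT t|?L. LINT x|torus. U t x * \<phi>t t x)
   = (LINT t|?L. LINT x|torus. F t x * \<phi>x t x)" by (simp only: of_real_eq_iff)
qed

end

section \<open>The flux\<close>

text \<open>The factor left out in \<open>lin\<close> is restored, which makes the sequence
  Hermitian for Hermitian \<open>f\<close> and \<open>g\<close>.\<close>

definition grad :: "real => real => real => real => (int => complex) => (int => complex) => int => complex" where
 "grad a3 a1 b3 b1 f g k = - \<i> * lin a3 a1 b3 b1 f g k"

text \<open>Fourier side of the product of \<open>h\<close> with the thickness, whose mean
  \<open>m\<close> has been split off from \<open>u\<close>.\<close>

definition flux :: "real => (int => complex) => (int => complex) => int => complex" where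
 "flux m u h k = of_real m * h k + iconv u h k"

lemma flux_grad: "flux m u (grad a3 a1 b3 b1 f g) k
  = - \<i> * (of_real m * lin a3 a1 b3 b1 f g k + iconv u (lin a3 a1 b3 b1 f g) k)"
proof -
 have "u (k - j) * (- \<i> * lin a3 a1 b3 b1 f g j) = - \<i> * (u (k - j) * lin a3 a1 b3 b1 f g j)" for j
  by (simp only: mult_ac)
 then have "iconv u (grad a3 a1 b3 b1 f g) k = - \<i> * iconv u (lin a3 a1 b3 b1 f g) k"
  unfolding iconv_def grad_def by (simp only: infsum_cmult_right')
 then show ?thesis unfolding flux_def by (simp add: grad_def algebra_simps)
qed

lemma hermitian_grad:
 assumes "hermitian f" "hermitian g" shows "hermitian (grad a3 a1 b3 b1 f g)"
 using assms by (simp add: hermitian_def grad_def lin_def algebra_simps)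

lemma hermitian_flux: "hermitian u ==> hermitian h ==> hermitian (flux m u h)"
 using hermitian_iconv[of u h] by (simp add: hermitian_def flux_def)

lemma wsummable_grad:
 assumes nn: "a3 >= 0" "a1 >= 0" "b3 >= 0" "b1 >= 0" and f: "wsummable 4 f" and g: "wsummable 4 g"
 shows "wsummable 0 (grad a3 a1 b3 b1 f g)"
  "wnorm 0 (grad a3 a1 b3 b1 f g) <= (a3 + a1 + b3 + b1) * (wnorm 4 f + wnorm 4 g)"
proof -
 let ?K = "a3 + a1 + b3 + b1"
 have f': "(\<lambda>k. wt 4 k * cmod (f k)) summable_on UNIV" and g': "(\<lambda>k. wt 4 k * cmod (g k)) summable_on UNIV"
  using f g by (simp_all add: wsummable_def)
 have le: "cmod (grad a3 a1 b3 b1 f g k) <= ?K * (wt 4 k * cmod (f k) + wt 4 k * cmod (g k))" for k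
 proof -
  have "mag k ^ 3 <= (1 + mag k) ^ 3" by (rule power_mono) auto
  also have "... <= wt 4 k" unfolding wt_def by (rule power_increasing) auto
  finally have p: "mag k ^ 3 <= wt 4 k" .
  have "cmod (grad a3 a1 b3 b1 f g k) <= ?K * (mag k ^ 3 * (cmod (f k) + cmod (g k)))"
   using cmod_lin_le_cubic[OF nn, of f g k] by (simp add: grad_def norm_mult)
  also have "... <= ?K * (wt 4 k * (cmod (f k) + cmod (g k)))"
   by (intro mult_left_mono mult_right_mono p) (use nn in auto)
  finally show ?thesis by (simp only: distrib_left)
 qed
 have s: "(\<lambda>k. ?K * (wt 4 k * cmod (f k) + wt 4 k * cmod (g k))) summable_on UNIV"
  by (rule summable_on_cmult_right[OF summable_on_add[OF f' g']])
 have s0: "(\<lambda>k. cmod (grad a3 a1 b3 b1 f g k)) summable_on UNIV"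
  by (rule summable_on_comparison_test[OF s le]) simp
 then show "wsummable 0 (grad a3 a1 b3 b1 f g)" by (simp add: wsummable_def)
 have "wnorm 0 (grad a3 a1 b3 b1 f g) <= (INFSUM k. ?K * (wt 4 k * cmod (f k) + wt 4 k * cmod (g k)))"
  unfolding wnorm_def wt_0 mult_1 by (rule infsum_mono[OF s0 s le])
 also have "... = ?K * (wnorm 4 f + wnorm 4 g)"
  unfolding infsum_cmult_right' wnorm_def by (simp only: infsum_add[OF f' g'])
 finally show "wnorm 0 (grad a3 a1 b3 b1 f g) <= ?K * (wnorm 4 f + wnorm 4 g)" .
qed

lemma wsummable_flux:
 assumes u: "wsummable 0 u" and h: "wsummable 0 h" and m: "m >= 0"
 shows "wsummable 0 (flux m u h)" "wnorm 0 (flux m u h) <= (m + wnorm 0 u) * wnorm 0 h"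
proof -
 have mh: "wsummable 0 (\<lambda>k. of_real m * h k)" "wnorm 0 (\<lambda>k. of_real m * h k) = m * wnorm 0 h"
  using wsummable_cmult[OF h, of "of_real m"] m by simp_all
 show "wsummable 0 (flux m u h)"
  unfolding flux_def[abs_def] by (rule wsummable_add(1)[OF mh(1) wsummable_iconv(1)[OF u h]])
 have "wnorm 0 (flux m u h) <= wnorm 0 (\<lambda>k. of_real m * h k) + wnorm 0 (iconv u h)"
  unfolding flux_def[abs_def] by (rule wsummable_add(2)[OF mh(1) wsummable_iconv(1)[OF u h]])
 then show "wnorm 0 (flux m u h) <= (m + wnorm 0 u) * wnorm 0 h"
  using mh(2) wsummable_iconv(2)[OF u h] by (simp add: distrib_right)
qed

lemma trg_flux:
 assumes u: "wsummable 0 u" and h: "wsummable 0 h" and hu: "hermitian u" and hh: "hermitian h"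
 shows "trg (flux m u h) x = (trg u x + m) * trg h x"
proof -
 have "ser (flux m u h) x = of_real m * ser h x + ser u x * ser h x"
  unfolding flux_def[abs_def] ser_add[OF wsummable_cmult(1)[OF h] wsummable_iconv(1)[OF u h]] ser_cmult ser_iconv[OF u h] ..
 then show ?thesis unfolding trg_def[of "flux m u h"] ser_real[OF hu] ser_real[OF hh] by (simp add: algebra_simps)
qed

lemma trg_grad:
 assumes f: "wsummable 4 f" and g: "wsummable 4 g"
 shows "trg (grad a3 a1 b3 b1 f g) x
  = a3 * trg (dco 3 f) x + b3 * trg (dco 3 g) x - a1 * trg (dco 1 f) x - b1 * trg (dco 1 g) x"
proof -
 have s: "wsummable 0 (dco j c)" if "wsummable 4 c" "j <= 4" for j c
  using wsummable_dco(1)[of 0 j c] wsummable_mono[OF that] by simp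
 note w = s[OF f, of 3] s[OF f, of 1] s[OF g, of 3] s[OF g, of 1]
 have c: "wsummable 0 (\<lambda>k. a * c k)" if "wsummable 0 c" for a c using wsummable_cmult(1)[OF that] .
 have "grad a3 a1 b3 b1 f g k = (of_real a3 * dco 3 f k + of_real b3 * dco 3 g k)
   - (of_real a1 * dco 1 f k + of_real b1 * dco 1 g k)" for k
  by (simp add: grad_def lin_def dco_def power_mult_distrib power3_eq_cube algebra_simps)
 then have "ser (grad a3 a1 b3 b1 f g) x = ser (\<lambda>k. (of_real a3 * dco 3 f k + of_real b3 * dco 3 g k)
   - (of_real a1 * dco 1 f k + of_real b1 * dco 1 g k)) x" by (rule arg_cong[where f = "\<lambda>c. ser c x", OF ext])
 also have "... = (of_real a3 * ser (dco 3 f) x + of_real b3 * ser (dco 3 g) x)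
   - (of_real a1 * ser (dco 1 f) x + of_real b1 * ser (dco 1 g) x)"
  using w by (simp add: ser_diff ser_add ser_cmult c wsummable_add(1))
 finally show ?thesis by (simp add: trg_def)
qed

text \<open>Both equations of (M) have this form: \<open>u\<close> is \<open>f\<close> in the first
  and \<open>g\<close> in the second, whence the third set of bounds.\<close>

locale coupled_path =
 f: regular_path f Rf Vf Bf Qf Q8f Pf + g: regular_path g Rg Vg Bg Qg Q8g Pg + u: regular_path u R V B4 Q Q8 P
 for f g u Rf Rg R Vf Bf Qf Q8f Pf Vg Bg Qg Q8g Pg V B4 Q Q8 P +
 fixes m a3 a1 b3 b1 :: real
 assumes nn: "m >= 0" "a3 >= 0" "a1 >= 0" "b3 >= 0" "b1 >= 0"
  and R: "R t k = - of_int k * (of_real m * lin a3 a1 b3 b1 (f t) (g t) k + iconv (u t) (lin a3 a1 b3 b1 (f t) (g t)) k)"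
  and cont_iconv: "continuous_on UNIV (\<lambda>t. iconv (u t) (lin a3 a1 b3 b1 (f t) (g t)) k)"
begin

abbreviation "D t \<equiv> grad a3 a1 b3 b1 (f t) (g t)"

lemma cont_flux: "continuous_on UNIV (\<lambda>t. flux m (u t) (D t) k)"
 unfolding flux_grad lin_def
 by (intro continuous_on_mult_left continuous_on_add f.cont g.cont cont_iconv[unfolded lin_def])

sublocale flux_path u R V B4 Q Q8 P "\<lambda>t. flux m (u t) (D t)"
proof
 show "hermitian (flux m (u t) (D t))" for t by (intro hermitian_flux hermitian_grad u.herm f.herm g.herm)
 show "continuous_on UNIV (\<lambda>t. flux m (u t) (D t) k)" for k by (rule cont_flux)
 show "R t k = - (\<i> * of_int k) * flux m (u t) (D t) k" for t k
 proof -
  have "- (\<i> * of_int k) * (- \<i> * z) = - of_int k * z" for z :: complex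
   by (simp add: complex_eq_iff algebra_simps)
  then show ?thesis by (simp only: R flux_grad)
 qed
 fix T :: real assume T: "T >= 0"
 \<comment> \<open>Bound for the thickness times the sum of the coefficients: it reduces
   integrability of the flux in time to that of the fourth-order Wiener norms of \<open>f\<close>
   and \<open>g\<close>.\<close>
 define K where "K = (m + V) * (a3 + a1 + b3 + b1)"
 have V0: "V >= 0" using u.wsummable_0(2)[of 0] wnorm_nonneg[of 0 "u 0"] by simp
 have i: "integrable (time T) (\<lambda>t. cmod (flux m (u t) (D t) k))" for k
  by (intro continuous_imp_integrable_real continuous_on_norm continuous_on_subset[OF cont_flux] subset_UNIV)
 have ae: "AE t in time T. (\<Sum>k\<in>modes n. cmod (flux m (u t) (D t) k)) <= K * (wnorm 4 (f t) + wnorm 4 (g t))" for n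
  using f.time_integrals(3)[OF T] g.time_integrals(3)[OF T] AE_lebesgue_on_less
 proof eventually_elim
  case (elim t)
  have t: "t >= 0" using elim by simp
  note D = wsummable_grad[OF nn(2-5) elim(1,2)]
  note F = wsummable_flux[OF u.wsummable_0(1)[OF t] D(1) nn(1)]
  have "(\<Sum>k\<in>modes n. cmod (flux m (u t) (D t) k)) <= wnorm 0 (flux m (u t) (D t))"
   unfolding wnorm_def using F(1) unfolding wsummable_def
   by (simp add: finite_sum_le_infsum)
  also have "... <= (m + wnorm 0 (u t)) * wnorm 0 (D t)" by (rule F(2))
  also have "... <= (m + V) * ((a3 + a1 + b3 + b1) * (wnorm 4 (f t) + wnorm 4 (g t)))"
   by (intro mult_mono add_left_mono u.wsummable_0(2)[OF t] D(2)) (use nn V0 wnorm_nonneg in auto)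
  finally show ?case by (simp only: K_def mult.assoc)
 qed
 have b: "(\<Sum>k\<in>modes n. LINT t|time T. cmod (flux m (u t) (D t) k))
   <= (LINT t|time T. K * (wnorm 4 (f t) + wnorm 4 (g t)))" for n
 proof -
  have "(\<Sum>k\<in>modes n. LINT t|time T. cmod (flux m (u t) (D t) k))
    = (LINT t|time T. (\<Sum>k\<in>modes n. cmod (flux m (u t) (D t) k)))"
   by (rule Bochner_Integration.integral_sum[symmetric]) (rule i)
  also have "... <= (LINT t|time T. K * (wnorm 4 (f t) + wnorm 4 (g t)))"
   by (rule integral_mono_AE[OF _ _ ae])
    (intro Bochner_Integration.integrable_sum Bochner_Integration.integrable_add integrable_mult_right i
     f.time_integrals(2)[OF T] g.time_integrals(2)[OF T])+
  finally show ?thesis .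
 qed
 show "(\<lambda>k. LINT t|time T. cmod (flux m (u t) (D t) k)) summable_on UNIV"
  by (rule modes_bounded(1)[OF _ b]) simp
qed

lemma weak_equation_coupled:
 assumes T: "T > 0" and u0: "integrable torus u0" "!!k. fourier u0 k = u 0 k"
 shows "weak_equation T u0 (\<lambda>t. trg (u t)) (\<lambda>t x. (trg (u t) x + m) *
  (a3 * weak_deriv 3 (trg (f t)) x + b3 * weak_deriv 3 (trg (g t)) x
   - a1 * weak_deriv 1 (trg (f t)) x - b1 * weak_deriv 1 (trg (g t)) x))"
proof (rule weak_equation_U[OF T u0])
 have T0: "T >= 0" using T by simp
 show "AE t in time T. (\<lambda>x. (trg (u t) x + m) *
  (a3 * weak_deriv 3 (trg (f t)) x + b3 * weak_deriv 3 (trg (g t)) x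
   - a1 * weak_deriv 1 (trg (f t)) x - b1 * weak_deriv 1 (trg (g t)) x)) \<in> fcarrier L1 \<and>
  (AE x in torus. (trg (u t) x + m) *
  (a3 * weak_deriv 3 (trg (f t)) x + b3 * weak_deriv 3 (trg (g t)) x
   - a1 * weak_deriv 1 (trg (f t)) x - b1 * weak_deriv 1 (trg (g t)) x) = trg (flux m (u t) (D t)) x)"
  using f.time_integrals(3)[OF T0] g.time_integrals(3)[OF T0] AE_lebesgue_on_less
 proof eventually_elim
  case (elim t)
  have t: "t >= 0" using elim by simp
  let ?F = "\<lambda>x. (trg (u t) x + m) *
   (a3 * weak_deriv 3 (trg (f t)) x + b3 * weak_deriv 3 (trg (g t)) x
    - a1 * weak_deriv 1 (trg (f t)) x - b1 * weak_deriv 1 (trg (g t)) x)"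
  have w: "wsummable j (f t)" "wsummable j (g t)" if "j <= 4" for j
   using wsummable_mono[OF elim(1) that] wsummable_mono[OF elim(2) that] by auto
  note D = wsummable_grad[OF nn(2-5) elim(1,2)]
  have u0: "wsummable 0 (u t)" by (rule u.wsummable_0(1)[OF t])
  note F = wsummable_flux(1)[OF u0 D(1) nn(1)]
  have w3: "weak_deriv 3 (trg (f t)) \<in> fcarrier L1" "AE x in torus. weak_deriv 3 (trg (f t)) x = trg (dco 3 (f t)) x"
   "weak_deriv 3 (trg (g t)) \<in> fcarrier L1" "AE x in torus. weak_deriv 3 (trg (g t)) x = trg (dco 3 (g t)) x"
   and w1: "weak_deriv 1 (trg (f t)) \<in> fcarrier L1" "AE x in torus. weak_deriv 1 (trg (f t)) x = trg (dco 1 (f t)) x"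
   "weak_deriv 1 (trg (g t)) \<in> fcarrier L1" "AE x in torus. weak_deriv 1 (trg (g t)) x = trg (dco 1 (g t)) x"
   by (intro weak_deriv_trg w; simp)+
  have eq: "trg (flux m (u t) (D t)) x = (trg (u t) x + m) *
   (a3 * trg (dco 3 (f t)) x + b3 * trg (dco 3 (g t)) x - a1 * trg (dco 1 (f t)) x - b1 * trg (dco 1 (g t)) x)" for x
   unfolding trg_flux[OF u0 D(1) u.herm hermitian_grad[OF f.herm g.herm]] trg_grad[OF elim(1,2)] ..
  have ae: "AE x in torus. trg (flux m (u t) (D t)) x = ?F x"
   using w3(2,4) w1(2,4) by eventually_elim (simp add: eq)
  have meas: "?F \<in> borel_measurable torus"
   using w3(1,3) w1(1,3) borel_measurable_trg[OF u0]
   by (auto simp: L1_def intro!: borel_measurable_times borel_measurable_add borel_measurable_diff borel_measurable_const)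
  have "integrable torus ?F" by (rule integrable_cong_AE_imp[OF integrable_trg[OF F] meas ae])
  moreover have "periodic ?F"
   using w3(1,3) w1(1,3) periodic_trg[of "u t"] by (simp add: L1_def periodic_def)
  moreover have "AE x in torus. ?F x = trg (flux m (u t) (D t)) x" using ae by eventually_elim simp
  ultimately show ?case by (simp add: L1_def)
 qed
qed

end

section \<open>Properties of the solution\<close>

lemma powr_le_one_plus: "0 <= y ==> 0 <= \<theta> ==> \<theta> <= 1 ==> y powr \<theta> <= 1 + (y::real)"
proof -
 assume *: "0 <= y" "0 <= \<theta>" "\<theta> <= 1"
 have "y powr \<theta> <= (1 + y) powr \<theta>" by (rule powr_mono2) (use * in auto)
 also have "... <= (1 + y) powr 1" by (rule powr_mono) (use * in auto)
 finally show ?thesis using * by simp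
qed

text \<open>Interpolation in additive form: \<open>y powr \<theta> \<le> 1 + y\<close> with
  \<open>\<theta> = s / 2\<close> and \<open>y\<close> the fourth power of the frequency divided by
  \<open>lam\<close>. The parameter is free and will be taken to grow in time.\<close>

lemma sobolev_interpolation:
 assumes c: "c 0 = 0" "wsummable 0 c" and s2: "(\<lambda>k. mag k powr (2 * 2) * (cmod (c k))\<^sup>2) summable_on UNIV"
  and s: "0 <= s" "s < 2" and lam: "lam > 0"
 shows "sobolev s c <= lam powr (s / 2) * ((wnorm 0 c)\<^sup>2 + sobolev 2 c / lam)"
proof -
 have q: "(\<lambda>k. (cmod (c k))\<^sup>2) summable_on UNIV" "(INFSUM k. (cmod (c k))\<^sup>2) <= (wnorm 0 c)\<^sup>2"
  using infsum_square_le[of "\<lambda>k. cmod (c k)"] c(2) by (simp_all add: wsummable_def wnorm_def)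
 have le: "mag k powr (2 * s) * (cmod (c k))\<^sup>2
   <= lam powr (s / 2) * ((cmod (c k))\<^sup>2 + (1 / lam) * (mag k powr (2 * 2) * (cmod (c k))\<^sup>2))" for k
 proof (cases "k = 0")
  case False
  define x where "x = mag k powr 4"
  have x: "x >= 0" by (simp add: x_def)
  have "4 * (s / 2) = 2 * s" by simp
  then have "mag k powr (2 * s) = x powr (s / 2)" by (simp only: x_def powr_powr)
  also have "... = (lam * (x / lam)) powr (s / 2)" using lam by simp
  also have "... = lam powr (s / 2) * (x / lam) powr (s / 2)" by (rule powr_mult)
  also have "... <= lam powr (s / 2) * (1 + x / lam)"
   using s lam x by (intro mult_left_mono powr_le_one_plus) auto
  finally have "mag k powr (2 * s) * (cmod (c k))\<^sup>2 <= lam powr (s / 2) * (1 + x / lam) * (cmod (c k))\<^sup>2"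
   by (rule mult_right_mono) simp
  then show ?thesis by (simp add: x_def algebra_simps)
 qed (simp add: c)
 have r: "(\<lambda>k. lam powr (s / 2) * ((cmod (c k))\<^sup>2 + (1 / lam) * (mag k powr (2 * 2) * (cmod (c k))\<^sup>2))) summable_on UNIV"
  by (intro summable_on_cmult_right summable_on_add q(1) s2)
 have "(\<lambda>k. mag k powr (2 * s) * (cmod (c k))\<^sup>2) summable_on UNIV"
  by (rule summable_on_comparison_test[OF r le]) simp
 then have "sobolev s c <= (INFSUM k. lam powr (s / 2) * ((cmod (c k))\<^sup>2 + (1 / lam) * (mag k powr (2 * 2) * (cmod (c k))\<^sup>2)))"
  unfolding sobolev_def by (rule infsum_mono[OF _ r le])
 also have "... = lam powr (s / 2) * ((INFSUM k. (cmod (c k))\<^sup>2) + (1 / lam) * sobolev 2 c)"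
  unfolding infsum_cmult_right' infsum_add[OF q(1) summable_on_cmult_right[OF s2]] sobolev_def ..
 also have "... <= lam powr (s / 2) * ((wnorm 0 c)\<^sup>2 + sobolev 2 c / lam)"
  using q(2) by (intro mult_left_mono) auto
 finally show ?thesis .
qed

lemma fnorm_Linf_trg_le: "hermitian c ==> wsummable 0 c ==> fnorm Linf (trg c) <= wnorm 0 c"
 using series_space.norm_le[OF series_space_Linf, of c] by (simp add: admissible_def)

context film_solution
begin

lemma cont_lin_solution: "continuous_on UNIV (\<lambda>t. lin a3 a1 b3 b1 (f t) (g t) k)"
 unfolding lin_def by (intro continuous_on_add continuous_on_mult_left cont)

lemma cont_rhs: "continuous_on UNIV (\<lambda>t. rhs_f (f t) (g t) k)" "continuous_on UNIV (\<lambda>t. rhs_g (f t) (g t) k)"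
 unfolding rhs_f_def rhs_g_def
 by (intro continuous_on_mult_left continuous_on_add cont_lin_solution cont_iconv)+

lemma V0_nonneg: "V0 >= 0"
 using V_le[of 0 0] asum_nonneg[of 0 0 "f 0"] asum_nonneg[of 0 0 "g 0"] by simp

lemma wsum_cont:
 fixes h :: "real => int => real"
 assumes "!!k. continuous_on UNIV (\<lambda>t. h t k)" shows "(\<lambda>t. wsum n p (h t)) integrable_on {0..T}"
 unfolding wsum_def
 by (intro integrable_continuous_real continuous_on_sum continuous_on_mult_left continuous_on_subset[OF assms]) auto

lemma asum_qsum_integrable:
 "(\<lambda>t. asum n p (f t)) integrable_on {0..T}" "(\<lambda>t. asum n p (g t)) integrable_on {0..T}"
 "(\<lambda>t. qsum n p (f t)) integrable_on {0..T}" "(\<lambda>t. qsum n p (g t)) integrable_on {0..T}"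
 unfolding asum_def qsum_def by (intro wsum_cont continuous_intros cont)+

text \<open>All contributions are nonnegative, so each component inherits the bound of the sum;
  continuity of the modes allows the integrals to be split.\<close>

lemma integral_parts:
 assumes t: "t >= 0"
 shows "tint t (\<lambda>s. asum n 4 (f s)) <= a / dA" "tint t (\<lambda>s. asum n 4 (g s)) <= a / dA"
  "qsum n 4 (f t) <= Q" "qsum n 4 (g t) <= Q"
  "tint t (\<lambda>s. qsum n 8 (f s)) <= Q / (2 * ka)" "tint t (\<lambda>s. qsum n 8 (g s)) <= Q / (2 * ka)"
  "tint t (\<lambda>s. wsum n 4 (\<lambda>k. cmod (f s k) * cmod (rhs_f (f s) (g s) k))) <= power_bound Q"
  "tint t (\<lambda>s. wsum n 4 (\<lambda>k. cmod (g s k) * cmod (rhs_g (f s) (g s) k))) <= power_bound Q"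
proof -
 have n: "0 <= tint t (\<lambda>s. asum n 4 (f s))" "0 <= tint t (\<lambda>s. asum n 4 (g s))"
  "0 <= tint t (\<lambda>s. qsum n 8 (f s))" "0 <= tint t (\<lambda>s. qsum n 8 (g s))"
  by (intro Henstock_Kurzweil_Integration.integral_nonneg asum_qsum_integrable asum_nonneg qsum_nonneg)+
 have "tint t (\<lambda>s. asum2 n 4 (f s) (g s)) = tint t (\<lambda>s. asum n 4 (f s)) + tint t (\<lambda>s. asum n 4 (g s))"
  by (intro Henstock_Kurzweil_Integration.integral_add asum_qsum_integrable)
 with n int_V4[OF t, of n] show "tint t (\<lambda>s. asum n 4 (f s)) <= a / dA" "tint t (\<lambda>s. asum n 4 (g s)) <= a / dA"
  by linarith+
 have "tint t (\<lambda>s. qsum2 n 8 (f s) (g s)) = tint t (\<lambda>s. qsum n 8 (f s)) + tint t (\<lambda>s. qsum n 8 (g s))"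
  by (intro Henstock_Kurzweil_Integration.integral_add asum_qsum_integrable)
 then have E: "qsum n 4 (f t) + qsum n 4 (g t) + (2 * ka * tint t (\<lambda>s. qsum n 8 (f s)) + 2 * ka * tint t (\<lambda>s. qsum n 8 (g s))) <= Q"
  using E_le[OF t, of n] by (simp only: distrib_left)
 have q: "0 <= qsum n 4 (f t)" "0 <= qsum n 4 (g t)" by (rule qsum_nonneg)+
 have k: "0 <= 2 * ka * tint t (\<lambda>s. qsum n 8 (f s))" "0 <= 2 * ka * tint t (\<lambda>s. qsum n 8 (g s))"
  using n nn by simp_all
 show "qsum n 4 (f t) <= Q" "qsum n 4 (g t) <= Q" using E q k by linarith+
 have "2 * ka * tint t (\<lambda>s. qsum n 8 (f s)) <= Q" "2 * ka * tint t (\<lambda>s. qsum n 8 (g s)) <= Q"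
  using E q k by linarith+
 then show "tint t (\<lambda>s. qsum n 8 (f s)) <= Q / (2 * ka)" "tint t (\<lambda>s. qsum n 8 (g s)) <= Q / (2 * ka)"
  using pos(12) by (simp_all add: pos_le_divide_eq mult.commute)
 have i: "(\<lambda>s. wsum n 4 (\<lambda>k. cmod (f s k) * cmod (rhs_f (f s) (g s) k))) integrable_on {0..t}"
  "(\<lambda>s. wsum n 4 (\<lambda>k. cmod (g s k) * cmod (rhs_g (f s) (g s) k))) integrable_on {0..t}"
  by (intro wsum_cont continuous_intros cont cont_rhs)+
 have w: "0 <= wsum n 4 (\<lambda>k. cmod (x k) * cmod (y k))" for x y :: "int => complex" by (rule wsum_nonneg) simp
 have "0 <= tint t (\<lambda>s. wsum n 4 (\<lambda>k. cmod (f s k) * cmod (rhs_f (f s) (g s) k)))"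
  "0 <= tint t (\<lambda>s. wsum n 4 (\<lambda>k. cmod (g s k) * cmod (rhs_g (f s) (g s) k)))"
  by (intro Henstock_Kurzweil_Integration.integral_nonneg i w)+
 moreover have "tint t (\<lambda>s. wsum n 4 (\<lambda>k. cmod (f s k) * cmod (rhs_f (f s) (g s) k)))
   + tint t (\<lambda>s. wsum n 4 (\<lambda>k. cmod (g s k) * cmod (rhs_g (f s) (g s) k))) <= power_bound Q"
  using power_le[OF t, of n] by (simp only: Henstock_Kurzweil_Integration.integral_add[OF i])
 ultimately show "tint t (\<lambda>s. wsum n 4 (\<lambda>k. cmod (f s k) * cmod (rhs_f (f s) (g s) k))) <= power_bound Q"
  "tint t (\<lambda>s. wsum n 4 (\<lambda>k. cmod (g s k) * cmod (rhs_g (f s) (g s) k))) <= power_bound Q"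
  by linarith+
qed

lemma asum_0_le:
 assumes t: "t >= 0" shows "asum n 0 (f t) <= V0" "asum n 0 (g t) <= V0"
proof -
 have "0 <= (dA + dB) * t" by (rule mult_nonneg_nonneg) (use nn t in auto)
 then have "- (dA + dB) * t <= 0" by (simp only: mult_minus_left neg_le_0_iff_le)
 then have "exp (- (dA + dB) * t) <= 1" by (simp only: exp_le_one_iff)
 then have "V0 * exp (- (dA + dB) * t) <= V0 * 1" by (rule mult_left_mono[OF _ V0_nonneg])
 with V_le[OF t, of n] asum_nonneg[of n 0 "f t"] asum_nonneg[of n 0 "g t"]
 show "asum n 0 (f t) <= V0" "asum n 0 (g t) <= V0" by linarith+
qed

sublocale F: regular_path f "\<lambda>t. rhs_f (f t) (g t)" V0 "a / dA" Q "Q / (2 * ka)" "power_bound Q"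
proof
 fix t :: real and k :: int and n :: nat
 show "hermitian (f t)" "f t 0 = 0" by (rule herm zero)+
 show "continuous_on UNIV (\<lambda>t. f t k)" by (rule cont)
 show "continuous_on UNIV (\<lambda>t. rhs_f (f t) (g t) k)" by (rule cont_rhs)
 show "((\<lambda>s. f s k) has_vector_derivative rhs_f (f t) (g t) k) (at t)" if "t > 0" using that by (rule deriv)
 assume t: "t >= 0"
 show "asum n 0 (f t) <= V0" using t by (rule asum_0_le)
 show "tint t (\<lambda>s. asum n 4 (f s)) <= a / dA" "qsum n 4 (f t) <= Q"
  "tint t (\<lambda>s. qsum n 8 (f s)) <= Q / (2 * ka)"
  "tint t (\<lambda>s. wsum n 4 (\<lambda>k. cmod (f s k) * cmod (rhs_f (f s) (g s) k))) <= power_bound Q"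
  by (rule integral_parts[OF t])+
qed

sublocale G: regular_path g "\<lambda>t. rhs_g (f t) (g t)" V0 "a / dA" Q "Q / (2 * ka)" "power_bound Q"
proof
 fix t :: real and k :: int and n :: nat
 show "hermitian (g t)" "g t 0 = 0" by (rule herm zero)+
 show "continuous_on UNIV (\<lambda>t. g t k)" by (rule cont)
 show "continuous_on UNIV (\<lambda>t. rhs_g (f t) (g t) k)" by (rule cont_rhs)
 show "((\<lambda>s. g s k) has_vector_derivative rhs_g (f t) (g t) k) (at t)" if "t > 0" using that by (rule deriv)
 assume t: "t >= 0"
 show "asum n 0 (g t) <= V0" using t by (rule asum_0_le)
 show "tint t (\<lambda>s. asum n 4 (g s)) <= a / dA" "qsum n 4 (g t) <= Q"
  "tint t (\<lambda>s. qsum n 8 (g s)) <= Q / (2 * ka)"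
  "tint t (\<lambda>s. wsum n 4 (\<lambda>k. cmod (g s k) * cmod (rhs_g (f s) (g s) k))) <= power_bound Q"
  by (rule integral_parts[OF t])+
qed

lemma coupled_f: "coupled_path f g f (\<lambda>t. rhs_f (f t) (g t)) (\<lambda>t. rhs_g (f t) (g t)) (\<lambda>t. rhs_f (f t) (g t))
  V0 (a / dA) Q (Q / (2 * ka)) (power_bound Q) V0 (a / dA) Q (Q / (2 * ka)) (power_bound Q)
  V0 (a / dA) Q (Q / (2 * ka)) (power_bound Q) mf Ag br A b"
 by unfold_locales (use nn cont_iconv in \<open>simp_all add: rhs_f_def\<close>)

lemma coupled_g: "coupled_path f g g (\<lambda>t. rhs_f (f t) (g t)) (\<lambda>t. rhs_g (f t) (g t)) (\<lambda>t. rhs_g (f t) (g t))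
  V0 (a / dA) Q (Q / (2 * ka)) (power_bound Q) V0 (a / dA) Q (Q / (2 * ka)) (power_bound Q)
  V0 (a / dA) Q (Q / (2 * ka)) (power_bound Q) mg Am bm Am bm"
 by unfold_locales (use nn cont_iconv in \<open>simp_all add: rhs_g_def\<close>)

lemma weak_solution_series:
 assumes T: "T > 0" and u0: "integrable torus u0" "!!k. fourier u0 k = f 0 k" and v0: "integrable torus v0" "!!k. fourier v0 k = g 0 k"
 shows "weak_solution A Am Ag b bm br mf mg u0 v0 T F.U G.U"
proof -
 have T0: "T >= 0" using T by simp
 have X: "series_space False (W 3 L1) 4 ((real 3 + 1) * (2 * pi))" by (rule series_space_mono[OF series_space_W_L1]) simp
 have "AE t in time T. mean (F.U t) = 0 \<and> mean (G.U t) = 0"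
  using AE_lebesgue_on_less
  by eventually_elim (simp add: mean_trg F.wsummable_0 G.wsummable_0 herm zero)
 then show ?thesis
  unfolding weak_solution_def
  using F.Lp_time_1[OF T0 X] G.Lp_time_1[OF T0 X] coupled_path.weak_equation_coupled[OF coupled_f T u0]
   coupled_path.weak_equation_coupled[OF coupled_g T v0]
  by simp
qed

lemma wnorm_decay:
 assumes t: "t >= 0" shows "wnorm 0 (f t) + wnorm 0 (g t) <= V0 * exp (- (dA + dB) * t)"
proof -
 have b: "(\<Sum>k\<in>modes n. cmod (f t k) + cmod (g t k)) <= V0 * exp (- (dA + dB) * t)" for n
  using V_le[OF t, of n] by (simp add: asum_def wsum_def sum.distrib)
 have n: "0 <= cmod (f t k) + cmod (g t k)" for k by simp
 have "(\<lambda>k. cmod (f t k)) summable_on UNIV" "(\<lambda>k. cmod (g t k)) summable_on UNIV"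
  using F.wsummable_0(1)[OF t] G.wsummable_0(1)[OF t] by (simp_all add: wsummable_def)
 from infsum_add[OF this] modes_bounded(2)[OF n b] show ?thesis by (simp add: wnorm_def)
qed

lemma Linf_decay:
 assumes t: "t >= 0" shows "fnorm Linf (F.U t) + fnorm Linf (G.U t) <= V0 * exp (- (dA + dB) * t)"
 using fnorm_Linf_trg_le[OF herm(1) F.wsummable_0(1)[OF t]] fnorm_Linf_trg_le[OF herm(2) G.wsummable_0(1)[OF t]] wnorm_decay[OF t]
 by linarith

lemma E_eq: "t >= 0 ==> E s (F.U t) (G.U t) = sobolev s (f t) + sobolev s (g t)"
 by (simp add: E_def fnorm_Hdot herm F.wsummable_0 G.wsummable_0 sobolev_nonneg)

lemma Q_nonneg: "Q >= 0"
 using integral_parts(3)[of 0 0] qsum_nonneg[of 0 4 "f 0"] by simp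

text \<open>The constant 3: \<open>Q\<close> bounds the \<open>Hdot 2\<close> part of either
  component, and once more the dissipated energy.\<close>

lemma energy_bound:
 assumes T: "T > 0" shows "E 2 (F.U T) (G.U T) + ka * (LINT s|time T. E 4 (F.U s) (G.U s)) <= 3 * Q"
proof -
 have T0: "T >= 0" using T by simp
 have "(LINT s|time T. E 4 (F.U s) (G.U s)) = (LINT s|time T. sobolev 4 (f s) + sobolev 4 (g s))"
  by (rule Bochner_Integration.integral_cong) (auto simp: space_restrict_space E_eq)
 also have "... = (LINT s|time T. sobolev 4 (f s)) + (LINT s|time T. sobolev 4 (g s))"
  by (rule Bochner_Integration.integral_add[OF F.sobolev_4(2)[OF T0] G.sobolev_4(2)[OF T0]])
 also have "... <= Q / (2 * ka) + Q / (2 * ka)" by (intro add_mono F.sobolev_4(3)[OF T0] G.sobolev_4(3)[OF T0])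
 finally have "ka * (LINT s|time T. E 4 (F.U s) (G.U s)) <= ka * (Q / (2 * ka) + Q / (2 * ka))"
  using pos(12) by (intro mult_left_mono) auto
 also have "... = Q" using pos(12) by (simp add: field_simps)
 finally show ?thesis using F.sobolev_2(2)[OF T0] G.sobolev_2(2)[OF T0] unfolding E_eq[OF T0] by linarith
qed

lemma sobolev_decay:
 assumes t: "t >= 0" and s: "0 <= s" "s < 2"
 shows "E s (F.U t) (G.U t) <= (2 * V0\<^sup>2 + 2 * Q + 1) * exp (- (2 * (dA + dB) * (1 - s / 2)) * t)"
proof -
 define e where "e = exp (- (2 * (dA + dB)) * t)"
 \<comment> \<open>With this growth both terms of the interpolation decay like \<open>e\<close>. The
   prefactor \<open>lam powr (s / 2)\<close> takes back the share \<open>s / 2\<close> of the rate,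
   which leaves a positive rate for \<open>s < 2\<close>.\<close>
 define lam where "lam = exp (2 * (dA + dB) * t)"
 have "- (2 * (dA + dB)) * t = - (2 * (dA + dB) * t)" by (rule mult_minus_left)
 then have le: "e = 1 / lam" unfolding e_def lam_def by (simp only: exp_minus inverse_eq_divide)
 have lam: "lam > 0" by (simp add: lam_def)
 have e: "e = (exp (- (dA + dB) * t))\<^sup>2" unfolding e_def by (simp add: exp_of_nat_mult[symmetric] algebra_simps flip: exp_double)
 have sq: "(wnorm 0 c)\<^sup>2 <= V0\<^sup>2 * e" if "wnorm 0 c <= V0 * exp (- (dA + dB) * t)" for c
  unfolding e power_mult_distrib[symmetric] by (rule power_mono[OF that wnorm_nonneg])
 have b: "sobolev s c <= lam powr (s / 2) * ((V0\<^sup>2 + Q) * e)"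
  if c: "c 0 = 0" "wsummable 0 c" "(\<lambda>k. mag k powr (2 * 2) * (cmod (c k))\<^sup>2) summable_on UNIV"
   "sobolev 2 c <= Q" "wnorm 0 c <= V0 * exp (- (dA + dB) * t)" for c
 proof -
  have "sobolev s c <= lam powr (s / 2) * ((wnorm 0 c)\<^sup>2 + sobolev 2 c / lam)"
   by (rule sobolev_interpolation[OF c(1-3) s lam])
  also have "... <= lam powr (s / 2) * (V0\<^sup>2 * e + Q * e)"
   using sq[OF c(5)] divide_right_mono[OF c(4), of lam] lam by (intro mult_left_mono add_mono) (auto simp: le)
  finally show ?thesis by (simp only: distrib_right)
 qed
 have w: "wnorm 0 (f t) <= V0 * exp (- (dA + dB) * t)" "wnorm 0 (g t) <= V0 * exp (- (dA + dB) * t)"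
  using wnorm_decay[OF t] wnorm_nonneg[of 0 "f t"] wnorm_nonneg[of 0 "g t"] by linarith+
 have x: "lam powr (s / 2) * e = exp (- (2 * (dA + dB) * (1 - s / 2)) * t)"
  unfolding lam_def e_def by (simp add: powr_def exp_add[symmetric] algebra_simps)
 have "E s (F.U t) (G.U t) <= 2 * (lam powr (s / 2) * ((V0\<^sup>2 + Q) * e))"
  using b[OF zero(1) F.wsummable_0(1)[OF t] F.sobolev_2[OF t] w(1)] b[OF zero(2) G.wsummable_0(1)[OF t] G.sobolev_2[OF t] w(2)]
  unfolding E_eq[OF t] by linarith
 also have "... = (2 * V0\<^sup>2 + 2 * Q) * (lam powr (s / 2) * e)" by (simp add: algebra_simps)
 also have "... <= (2 * V0\<^sup>2 + 2 * Q + 1) * (lam powr (s / 2) * e)"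
  by (rule mult_right_mono) (auto simp: e_def)
 finally show ?thesis unfolding x .
qed

end

section \<open>Initial data and parameters\<close>

lemma hermitian_fourier: "hermitian (fourier u)"
proof -
 have "fourier u (- k) = cnj (fourier u k)" for k
 proof -
  define h where "h x = complex_of_real (u x) * exp (- \<i> * of_int k * of_real x)" for x
  have "fourier u (- k) = (LINT x|torus. cnj (h x)) / (2 * pi)"
   unfolding fourier_def h_def by (simp add: exp_cnj)
  also have "... = cnj ((LINT x|torus. h x) / (2 * pi))" by (simp add: integral_cnj)
  also have "... = cnj (fourier u k)" by (simp only: fourier_def h_def)
  finally show ?thesis .
 qed
 then show ?thesis by (simp add: hermitian_def)
qed

lemma Hdot_2_data:
 assumes u: "u \<in> fcarrier (Hdot 2)"
 shows "integrable torus u" "fourier u 0 = 0" "wsummable 0 (fourier u)" "fnorm (Adot 0) u = wnorm 0 (fourier u)"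
  "qsum n 4 (fourier u) <= sobolev 2 (fourier u)"
proof -
 have m: "u \<in> borel_measurable torus" and sq: "integrable torus (\<lambda>x. (u x)\<^sup>2)" and mean: "mean u = 0"
  and s: "(\<lambda>k. (1 + mag k powr (2 * 2)) * (cmod (fourier u k))\<^sup>2) summable_on UNIV"
  using u by (auto simp: Hdot_def)
 have s': "(\<lambda>k. (1 + mag k ^ 4) * (cmod (fourier u k))\<^sup>2) summable_on UNIV"
  using s by simp
 show "integrable torus u"
 proof (rule Bochner_Integration.integrable_bound[OF _ m])
  show "integrable torus (\<lambda>x. 1 + (u x)\<^sup>2)"
   using sq by (intro Bochner_Integration.integrable_add sq integrable_torus_continuous continuous_on_const)
  have "\<bar>y\<bar> <= 1 + y\<^sup>2" for y :: real
   using powr_le_one_plus[of "y\<^sup>2" "1/2"] by (simp add: powr_half_sqrt)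
  then show "AE x in torus. norm (u x) <= norm (1 + (u x)\<^sup>2)" by simp
 qed
 show z: "fourier u 0 = 0" using mean_eq_fourier[of u] mean by simp
 have "(\<lambda>k. (wt (Suc 0) k * cmod (fourier u k))\<^sup>2) summable_on UNIV"
 proof (rule summable_on_comparison_test[OF summable_on_cmult_right[OF s', of 4]])
  fix k
  have "(1 + x)\<^sup>2 <= 4 * (1 + x ^ 4)" for x :: real
  proof -
   \<comment> \<open>The difference of the two sides, written with squares.\<close>
   have "0 <= (1 - x)\<^sup>2 + (1 - x\<^sup>2)\<^sup>2 + 3 * (x\<^sup>2)\<^sup>2 + 1" by simp
   then show ?thesis by (simp add: power2_eq_square power4_eq_xxxx algebra_simps)
  qed
  from mult_right_mono[OF this[of "mag k"] zero_le_power2, of "cmod (fourier u k)"]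
  show "(wt (Suc 0) k * cmod (fourier u k))\<^sup>2 <= 4 * ((1 + mag k ^ 4) * (cmod (fourier u k))\<^sup>2)"
   unfolding wt_def power_mult_distrib power_Suc0_right mult.assoc .
 qed simp
 then show w: "wsummable 0 (fourier u)" by (rule wnorm_le_l2(1))
 \<comment> \<open>At \<open>k = 0\<close> the two weights differ, since
   \<open>0 powr 0 = 0\<close>; the coefficient vanishes there.\<close>
 have "mag k powr 0 * cmod (fourier u k) = wt 0 k * cmod (fourier u k)" for k
  by (cases "k = 0") (simp_all add: z)
 then show "fnorm (Adot 0) u = wnorm 0 (fourier u)" unfolding Adot_def wnorm_def by (simp only: fun_space.simps)
 have "(\<lambda>k. mag k powr (2 * 2) * (cmod (fourier u k))\<^sup>2) summable_on UNIV"
  by (rule summable_on_comparison_test[OF s]) (auto intro: mult_right_mono)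
 then have "(\<Sum>k\<in>modes n. mag k powr (2 * 2) * (cmod (fourier u k))\<^sup>2) <= sobolev 2 (fourier u)"
  unfolding sobolev_def by (rule finite_sum_le_infsum) auto
 then show "qsum n 4 (fourier u) <= sobolev 2 (fourier u)" by (simp add: qsum_def wsum_def)
qed

lemma asum_le_wnorm: "wsummable 0 c ==> asum n 0 c <= wnorm 0 c"
 unfolding asum_def wsum_def wsummable_def wnorm_def by (simp add: finite_sum_le_infsum)

text \<open>The hypotheses are strict at \<open>V\<close>, so they persist with \<open>V\<close> replaced by a slightly larger
 \<open>a\<close>, which must be positive even when the data vanish.\<close>

lemma film_parameters:
 fixes mf mg Ag A Am br b bm V sb :: real
 assumes pos: "mf > 0" "mg > 0" "Ag > 0" "A > 0" "Am > 0" "br > 0" "b > 0" "bm > 0" and V: "V >= 0" and sb: "sb > 0"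
  and s1A: "mf * Ag - mg * Am - (Am + 2 * Ag + 2 * A) * V > 0"
  and s1b: "mf * br - mg * bm - V * (2 * br + 2 * b + 4 * bm) >= sb"
  and s2b: "mg * bm - mf * b - V * (2 * br + 2 * b + 4 * bm) >= sb"
  and h1: "mg * Am - (mf * A + mg * Am) / 2 - (Ag + 13/4 * A + 17/4 * Am) * V > 0"
  and h2: "mf * Ag - (mf * A + mg * Am) / 2 - (Ag + 13/4 * A + 17/4 * Am) * V > 0"
 shows "\<exists>a dA ka. V <= a \<and> film mf mg Ag A Am br b bm a dA (sb / 2) ka"
proof -
 define r where "r = Min {mf * Ag - mg * Am - (Am + 2 * Ag + 2 * A) * V, sb,
  mg * Am - (mf * A + mg * Am) / 2 - (Ag + 13/4 * A + 17/4 * Am) * V,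
  mf * Ag - (mf * A + mg * Am) / 2 - (Ag + 13/4 * A + 17/4 * Am) * V}"
 have r: "r > 0" unfolding r_def using sb s1A h1 h2 by simp
 have rl: "r <= mf * Ag - mg * Am - (Am + 2 * Ag + 2 * A) * V" "r <= sb"
  "r <= mg * Am - (mf * A + mg * Am) / 2 - (Ag + 13/4 * A + 17/4 * Am) * V"
  "r <= mf * Ag - (mf * A + mg * Am) / 2 - (Ag + 13/4 * A + 17/4 * Am) * V"
  unfolding r_def by simp_all
 define K where "K = 4 * (Ag + A + Am + br + b + bm)"
 have K: "K > 0" using pos by (simp add: K_def)
 \<comment> \<open>\<open>K\<close> is at least every coefficient of \<open>a\<close> in the
   conditions, so passing from \<open>V\<close> to \<open>V + \<epsilon>\<close> costs at most half
   of the margin \<open>r\<close>. The other half pays for the rates.\<close>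
 define \<epsilon> where "\<epsilon> = r / (2 * K)"
 have \<epsilon>: "\<epsilon> > 0" "K * \<epsilon> = r / 2" using r K by (simp_all add: \<epsilon>_def)
 have up: "x * (V + \<epsilon>) <= x * V + r / 2" if "x <= K" for x
  using mult_right_mono[OF that, of \<epsilon>] \<epsilon> by (simp add: distrib_left)
 have le: "x * V <= y * V" if "x <= y" for x y using mult_right_mono[OF that V] .
 have "film mf mg Ag A Am br b bm (V + \<epsilon>) (r / 4) (sb / 2) (r / 4)"
 proof
  show "mf > 0" "mg > 0" "Ag > 0" "A > 0" "Am > 0" "br > 0" "b > 0" "bm > 0" by (fact pos)+
  show "V + \<epsilon> > 0" "r / 4 > 0" "sb / 2 > 0" using V \<epsilon> r sb by auto
  have "(2 * Ag + A + Am) * (V + \<epsilon>) <= (2 * Ag + A + Am) * V + r / 2" by (rule up) (use pos in \<open>simp add: K_def\<close>)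
  moreover have "(2 * Ag + A + Am) * V <= (Am + 2 * Ag + 2 * A) * V" by (rule le) (use pos in simp)
  ultimately show "mf * Ag - mg * Am - (2 * Ag + A + Am) * (V + \<epsilon>) >= 2 * (r / 4)" using rl(1) by linarith
  have "(A + 2 * Am) * (V + \<epsilon>) <= (A + 2 * Am) * V + r / 2" by (rule up) (use pos in \<open>simp add: K_def\<close>)
  moreover have "(A + 2 * Am) * V <= (Ag + 13/4 * A + 17/4 * Am) * V" by (rule le) (use pos in simp)
  moreover have "0 <= (Ag + 13/4 * A + 17/4 * Am) * V" using pos V by simp
  \<comment> \<open>Here \<open>mg * Am - (mf * A + mg * Am) / 2\<close> is half of
    \<open>mg * Am - mf * A\<close>, so \<open>h1\<close>, in the form of the third bound on
    \<open>r\<close>, yields the claim.\<close>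
  ultimately show "mg * Am - mf * A - (A + 2 * Am) * (V + \<epsilon>) >= 2 * (r / 4)" using rl(3) r unfolding add_divide_distrib by linarith
  have "(2 * br + b + bm) * (V + \<epsilon>) <= (2 * br + b + bm) * V + r / 2" by (rule up) (use pos in \<open>simp add: K_def\<close>)
  moreover have "(2 * br + b + bm) * V <= (2 * br + 2 * b + 4 * bm) * V" by (rule le) (use pos in simp)
  ultimately show "mf * br - mg * bm - (2 * br + b + bm) * (V + \<epsilon>) >= sb / 2"
   using s1b rl(2) unfolding mult.commute[of V] by linarith
  have "(b + 2 * bm) * (V + \<epsilon>) <= (b + 2 * bm) * V + r / 2" by (rule up) (use pos in \<open>simp add: K_def\<close>)
  moreover have "(b + 2 * bm) * V <= (2 * br + 2 * b + 4 * bm) * V" by (rule le) (use pos in simp)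
  ultimately show "mg * bm - mf * b - (b + 2 * bm) * (V + \<epsilon>) >= sb / 2"
   using s2b rl(2) unfolding mult.commute[of V] by linarith
  have "(Ag + A / 2 + Am / 2) * (V + \<epsilon>) <= (Ag + A / 2 + Am / 2) * V + r / 2" by (rule up) (use pos in \<open>simp add: K_def\<close>)
  moreover have "(Ag + A / 2 + Am / 2) * V <= (Ag + 13/4 * A + 17/4 * Am) * V" by (rule le) (use pos in simp)
  ultimately show "mf * Ag - (mf * A + mg * Am) / 2 - (Ag + A / 2 + Am / 2) * (V + \<epsilon>) >= 2 * (r / 4)" using rl(4) by linarith
  have "(A / 2 + 3 / 2 * Am) * (V + \<epsilon>) <= (A / 2 + 3 / 2 * Am) * V + r / 2" by (rule up) (use pos in \<open>simp add: K_def\<close>)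
  moreover have "(A / 2 + 3 / 2 * Am) * V <= (Ag + 13/4 * A + 17/4 * Am) * V" by (rule le) (use pos in simp)
  ultimately show "mg * Am - (mf * A + mg * Am) / 2 - (A / 2 + 3 / 2 * Am) * (V + \<epsilon>) >= 2 * (r / 4)" using rl(3) by linarith
 qed
 then show ?thesis using \<epsilon>(1) by (intro exI[of _ "V + \<epsilon>"] exI[of _ "r / 4"]) simp
qed

lemma (in film_solution) solution_properties:
 assumes u0: "integrable torus u0" "!!k. fourier u0 k = f 0 k" and v0: "integrable torus v0" "!!k. fourier v0 k = g 0 k"
 shows "(\<forall>T>0. weak_solution A Am Ag b bm br mf mg u0 v0 T F.U G.U) \<and>
  (\<forall>T>0. \<forall>\<alpha>\<in>{0..<1/2}. {F.U, G.U} \<subseteq>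
   Linf_spacetime T \<inter> Lp_time (4/3) T (W 3 Linf) \<inter> Lp_time 1 T (Holder 3 \<alpha>) \<inter>
   M_time T (W 4 Linf) \<inter> Lp_time 2 T (Hdot 2)) \<and>
  (AE T in lebesgue. T > 0 \<longrightarrow> fnorm Linf (F.U T) + fnorm Linf (G.U T) <= V0 * exp (- (dA + dB) * T)) \<and>
  (\<forall>T>0. {F.U, G.U} \<subseteq> C_time T (Hdot 2) \<inter> Lp_time 2 T (Hdot 4)) \<and>
  (\<forall>T>0. E 2 (F.U T) (G.U T) + ka * (LINT s|time T. E 4 (F.U s) (G.U s)) <= 3 * Q + 1) \<and>
  (\<forall>T>0. \<forall>s\<in>{0..<2}. E s (F.U T) (G.U T) <= (2 * V0\<^sup>2 + 2 * Q + 1) * exp (- (2 * (dA + dB) * (1 - s / 2)) * T))"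
proof (intro conjI allI impI ballI)
 fix T :: real assume T: "T > 0"
 then have T0: "T >= 0" by simp
 show "weak_solution A Am Ag b bm br mf mg u0 v0 T F.U G.U" by (rule weak_solution_series[OF T u0 v0])
 show "{F.U, G.U} \<subseteq> Linf_spacetime T \<inter> Lp_time (4/3) T (W 3 Linf) \<inter> Lp_time 1 T (Holder 3 \<alpha>) \<inter>
   M_time T (W 4 Linf) \<inter> Lp_time 2 T (Hdot 2)" if \<alpha>: "\<alpha> \<in> {0..<1/2}" for \<alpha>
 proof -
  have "Suc 3 = 4" by simp
  then have X: "series_space False (Holder 3 \<alpha>) 4 (real 3 + 3)" using series_space_Holder[of \<alpha> 3] \<alpha> by auto
  have "u \<in> Linf_spacetime T \<inter> Lp_time (4/3) T (W 3 Linf) \<inter> Lp_time 1 T (Holder 3 \<alpha>) \<inter>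
   M_time T (W 4 Linf) \<inter> Lp_time 2 T (Hdot 2)" if "u = F.U \<or> u = G.U" for u
   using that F.Linf_spacetime_U G.Linf_spacetime_U F.Lp_time_W_Linf[OF T0] G.Lp_time_W_Linf[OF T0]
    F.Lp_time_1[OF T0 X] G.Lp_time_1[OF T0 X] F.M_time_U[OF T0] G.M_time_U[OF T0]
    F.Lp_time_2_Hdot[OF T0 _ _ F.integrable_sobolev_2[OF T0]] G.Lp_time_2_Hdot[OF T0 _ _ G.integrable_sobolev_2[OF T0]]
   by (elim disjE) simp_all
  then show ?thesis by blast
 qed
 have "u \<in> C_time T (Hdot 2) \<inter> Lp_time 2 T (Hdot 4)" if "u = F.U \<or> u = G.U" for u
  using that F.C_time_U[OF T0] G.C_time_U[OF T0]
   F.Lp_time_2_Hdot[OF T0 _ _ F.sobolev_4(2)[OF T0]] G.Lp_time_2_Hdot[OF T0 _ _ G.sobolev_4(2)[OF T0]]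
  by (elim disjE) simp_all
 then show "{F.U, G.U} \<subseteq> C_time T (Hdot 2) \<inter> Lp_time 2 T (Hdot 4)" by blast
 show "E 2 (F.U T) (G.U T) + ka * (LINT s|time T. E 4 (F.U s) (G.U s)) <= 3 * Q + 1"
  using energy_bound[OF T] by linarith
 show "E s (F.U T) (G.U T) <= (2 * V0\<^sup>2 + 2 * Q + 1) * exp (- (2 * (dA + dB) * (1 - s / 2)) * T)" if "s \<in> {0..<2}" for s
  by (rule sobolev_decay[OF T0]) (use that in auto)
next
 show "AE T in lebesgue. T > 0 \<longrightarrow> fnorm Linf (F.U T) + fnorm Linf (G.U T) <= V0 * exp (- (dA + dB) * T)"
  by (intro always_eventually allI impI Linf_decay) simp
qed

theorem theorem3:
  fixes f\<^sub>0 g\<^sub>0 :: "real \<Rightarrow> real"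
    and f\<^sub>0' g\<^sub>0' :: "real \<Rightarrow> real"
    and mf mg :: real
    and \<mu>p \<mu>m \<rho>p \<rho>m b b\<^sub>\<mu> b\<^sub>\<rho> :: real
  assumes phys: "\<mu>p > 0" "\<mu>m > 0" "\<rho>p > 0" "\<rho>m > 0"
    and b: "b = \<rho>p" and b_mu: "b\<^sub>\<mu> = \<mu>m / \<mu>p * b" and b_rho: "b\<^sub>\<rho> = \<rho>m / \<rho>p * b"
    and data: "periodic f\<^sub>0" "periodic g\<^sub>0" "\<And>x. f\<^sub>0 x > 0" "\<And>x. g\<^sub>0 x > 0"
    and means: "mf = mean f\<^sub>0" "mg = mean g\<^sub>0"
    and fluctuations: "f\<^sub>0' = (\<lambda>x. f\<^sub>0 x - mf)" "g\<^sub>0' = (\<lambda>x. g\<^sub>0 x - mg)"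
    and regular: "f\<^sub>0' \<in> fcarrier (Hdot 2)" "g\<^sub>0' \<in> fcarrier (Hdot 2)"
    and small: "calE 0 f\<^sub>0' g\<^sub>0' < min mf mg"
  shows
    "\<exists>\<delta>\<^sub>b>0. \<forall>G \<gamma>f \<gamma>h A A\<^sub>\<mu> A\<^sub>\<gamma> \<sigma>\<^sub>1\<^sub>A \<sigma>\<^sub>2\<^sub>A \<sigma>\<^sub>1\<^sub>b \<sigma>\<^sub>2\<^sub>b.
       G > 0 \<and> \<gamma>f > 0 \<and> \<gamma>h > 0 \<and>
       A = \<gamma>h / G \<and> A\<^sub>\<mu> = \<mu>m / \<mu>p * A \<and> A\<^sub>\<gamma> = (\<gamma>f + \<gamma>h) / \<gamma>h * A \<and>
       \<sigma>\<^sub>1\<^sub>A = mf * A\<^sub>\<gamma> - mg * A\<^sub>\<mu> - (A\<^sub>\<mu> + 2 * A\<^sub>\<gamma> + 2 * A) * calE 0 f\<^sub>0' g\<^sub>0' \<and>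
       \<sigma>\<^sub>2\<^sub>A = mg * A\<^sub>\<mu> - mf * A - (A\<^sub>\<mu> + 2 * A\<^sub>\<gamma> + 2 * A) * calE 0 f\<^sub>0' g\<^sub>0' \<and>
       \<sigma>\<^sub>1\<^sub>b = mf * b\<^sub>\<rho> - mg * b\<^sub>\<mu> - calE 0 f\<^sub>0' g\<^sub>0' * (2 * b\<^sub>\<rho> + 2 * b + 4 * b\<^sub>\<mu>) \<and>
       \<sigma>\<^sub>2\<^sub>b = mg * b\<^sub>\<mu> - mf * b - calE 0 f\<^sub>0' g\<^sub>0' * (2 * b\<^sub>\<rho> + 2 * b + 4 * b\<^sub>\<mu>) \<and>
       Min {\<sigma>\<^sub>1\<^sub>A, \<sigma>\<^sub>2\<^sub>A, \<sigma>\<^sub>1\<^sub>b, \<sigma>\<^sub>2\<^sub>b} > 0 \<and>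
       mg * A\<^sub>\<mu> - (mf * A + mg * A\<^sub>\<mu>) / 2 - (A\<^sub>\<gamma> + 13/4 * A + 17/4 * A\<^sub>\<mu>) * calE 0 f\<^sub>0' g\<^sub>0' > 0 \<and>
       mf * A\<^sub>\<gamma> - (mf * A + mg * A\<^sub>\<mu>) / 2 - (A\<^sub>\<gamma> + 13/4 * A + 17/4 * A\<^sub>\<mu>) * calE 0 f\<^sub>0' g\<^sub>0' > 0
       \<longrightarrow>
       (\<exists>\<delta>\<^sub>A>0. \<exists>c\<^sub>1>0. \<exists>c\<^sub>2>0. \<exists>c\<^sub>3>0. \<exists>c :: real \<Rightarrow> real. (\<forall>s\<in>{0..<2}. c s > 0) \<and>
        (\<exists>f g :: real \<Rightarrow> real \<Rightarrow> real.
          (\<forall>T>0. weak_solution A A\<^sub>\<mu> A\<^sub>\<gamma> b b\<^sub>\<mu> b\<^sub>\<rho> mf mg f\<^sub>0' g\<^sub>0' T f g) \<and>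
          (\<forall>T>0. \<forall>\<alpha>\<in>{0..<1/2}. {f, g} \<subseteq>
             Linf_spacetime T \<inter> Lp_time (4/3) T (W 3 Linf) \<inter> Lp_time 1 T (Holder 3 \<alpha>) \<inter>
             M_time T (W 4 Linf) \<inter> Lp_time 2 T (Hdot 2)) \<and>
          (AE T in lebesgue. T > 0 \<longrightarrow>
             fnorm Linf (f T) + fnorm Linf (g T) \<le> calE 0 f\<^sub>0' g\<^sub>0' * exp (- (\<delta>\<^sub>A + \<delta>\<^sub>b) * T)) \<and>
          (\<forall>T>0. {f, g} \<subseteq> C_time T (Hdot 2) \<inter> Lp_time 2 T (Hdot 4)) \<and>
          (\<forall>T>0. E 2 (f T) (g T) + c\<^sub>1 * (LINT s|lebesgue_on {0..T}. E 4 (f s) (g s)) \<le> c\<^sub>2) \<and>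
          (\<forall>T>0. \<forall>s\<in>{0..<2}. E s (f T) (g T) \<le> c\<^sub>3 * exp (- c s * T))))"
proof -
 define V where "V = calE 0 f\<^sub>0' g\<^sub>0'"
 note F0 = Hdot_2_data[OF regular(1)] and G0 = Hdot_2_data[OF regular(2)]
 let ?f = "fourier f\<^sub>0'" and ?g = "fourier g\<^sub>0'"
 have V: "V = wnorm 0 ?f + wnorm 0 ?g" by (simp add: V_def calE_def F0(4) G0(4))
 have V0: "V >= 0" unfolding V by (intro add_nonneg_nonneg wnorm_nonneg)
 have m: "mf > 0" "mg > 0" using small V0 by (auto simp: V_def)
 have bpos: "b > 0" "b\<^sub>\<mu> > 0" "b\<^sub>\<rho> > 0" using phys by (simp_all add: b b_mu b_rho)
 define sb where "sb = min (mf * b\<^sub>\<rho> - mg * b\<^sub>\<mu> - V * (2 * b\<^sub>\<rho> + 2 * b + 4 * b\<^sub>\<mu>)) (mg * b\<^sub>\<mu> - mf * b - V * (2 * b\<^sub>\<rho> + 2 * b + 4 * b\<^sub>\<mu>))"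
 \<comment> \<open>This rate is fixed before gravity and surface tension are, so it may be built
   only from the conditions on densities and viscosities. If \<open>sb\<close> is not positive, the
   premise fails and any positive value will do.\<close>
 define \<delta>b where "\<delta>b = (if sb > 0 then sb / 2 else 1)"
 show ?thesis
 proof (rule exI[of _ \<delta>b], intro conjI allI impI, goal_cases)
  case 1
  show ?case by (simp add: \<delta>b_def)
 next
  case (2 G \<gamma>f \<gamma>h A A\<^sub>\<mu> A\<^sub>\<gamma> \<sigma>\<^sub>1\<^sub>A \<sigma>\<^sub>2\<^sub>A \<sigma>\<^sub>1\<^sub>b \<sigma>\<^sub>2\<^sub>b)
  note H = 2
  have A: "A > 0" "A\<^sub>\<mu> > 0" "A\<^sub>\<gamma> > 0" using H phys by auto
  have "Min {\<sigma>\<^sub>1\<^sub>A, \<sigma>\<^sub>2\<^sub>A, \<sigma>\<^sub>1\<^sub>b, \<sigma>\<^sub>2\<^sub>b} > 0" using H by blast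
  then have "\<sigma>\<^sub>1\<^sub>A > 0" "\<sigma>\<^sub>1\<^sub>b > 0" "\<sigma>\<^sub>2\<^sub>b > 0" by simp_all
  moreover have "\<sigma>\<^sub>1\<^sub>A = mf * A\<^sub>\<gamma> - mg * A\<^sub>\<mu> - (A\<^sub>\<mu> + 2 * A\<^sub>\<gamma> + 2 * A) * V"
   "\<sigma>\<^sub>1\<^sub>b = mf * b\<^sub>\<rho> - mg * b\<^sub>\<mu> - V * (2 * b\<^sub>\<rho> + 2 * b + 4 * b\<^sub>\<mu>)"
   "\<sigma>\<^sub>2\<^sub>b = mg * b\<^sub>\<mu> - mf * b - V * (2 * b\<^sub>\<rho> + 2 * b + 4 * b\<^sub>\<mu>)"
   unfolding V_def using H by blast+
  ultimately have s1A: "mf * A\<^sub>\<gamma> - mg * A\<^sub>\<mu> - (A\<^sub>\<mu> + 2 * A\<^sub>\<gamma> + 2 * A) * V > 0" and sb: "sb > 0"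
   unfolding sb_def by simp_all
  have sbl: "mf * b\<^sub>\<rho> - mg * b\<^sub>\<mu> - V * (2 * b\<^sub>\<rho> + 2 * b + 4 * b\<^sub>\<mu>) >= sb"
   "mg * b\<^sub>\<mu> - mf * b - V * (2 * b\<^sub>\<rho> + 2 * b + 4 * b\<^sub>\<mu>) >= sb"
   unfolding sb_def by simp_all
  have h: "mg * A\<^sub>\<mu> - (mf * A + mg * A\<^sub>\<mu>) / 2 - (A\<^sub>\<gamma> + 13/4 * A + 17/4 * A\<^sub>\<mu>) * V > 0"
   "mf * A\<^sub>\<gamma> - (mf * A + mg * A\<^sub>\<mu>) / 2 - (A\<^sub>\<gamma> + 13/4 * A + 17/4 * A\<^sub>\<mu>) * V > 0"
   unfolding V_def using H by blast+
  have db: "\<delta>b = sb / 2" using sb by (simp add: \<delta>b_def)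
  obtain a dA ka where a: "V <= a" and film: "film mf mg A\<^sub>\<gamma> A A\<^sub>\<mu> b\<^sub>\<rho> b b\<^sub>\<mu> a dA \<delta>b ka"
   using film_parameters[OF m A(3,1,2) bpos(3,1,2) V0 sb s1A sbl h] unfolding db by blast
  have "asum n 0 ?f + asum n 0 ?g <= V" for n
   unfolding V by (intro add_mono asum_le_wnorm F0(3) G0(3))
  moreover have "qsum n 4 ?f + qsum n 4 ?g <= sobolev 2 ?f + sobolev 2 ?g" for n
   by (intro add_mono F0(5) G0(5))
  ultimately obtain Q f g where sol: "film_solution mf mg A\<^sub>\<gamma> A A\<^sub>\<mu> b\<^sub>\<rho> b b\<^sub>\<mu> a dA \<delta>b ka f g V Q" and init: "f 0 = ?f" "g 0 = ?g"
   using film.coefficient_solution[OF film hermitian_fourier hermitian_fourier F0(2) G0(2) _ a] by blast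
  interpret film_solution mf mg A\<^sub>\<gamma> A A\<^sub>\<mu> b\<^sub>\<rho> b b\<^sub>\<mu> a dA \<delta>b ka f g V Q by (rule sol)
  have rate: "\<forall>s\<in>{0..<2}. 2 * (dA + \<delta>b) * (1 - s / 2) > 0" using pos(10,11) by simp
  \<comment> \<open>The added ones keep the constants positive even for vanishing data.\<close>
  have c: "dA > 0" "ka > 0" "3 * Q + 1 > 0" "2 * V\<^sup>2 + 2 * Q + 1 > 0"
   using pos(10,12) Q_nonneg zero_le_power2[of V] by linarith+
  note props = solution_properties[OF F0(1) _ G0(1), unfolded init, OF refl refl]
  show ?case
   unfolding V_def[symmetric]
   by (rule exI[of _ dA], rule conjI, rule c(1), rule exI[of _ ka], rule conjI, rule c(2),
     rule exI[of _ "3 * Q + 1"], rule conjI, rule c(3), rule exI[of _ "2 * V\<^sup>2 + 2 * Q + 1"], rule conjI, rule c(4),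
     rule exI[of _ "\<lambda>s. 2 * (dA + \<delta>b) * (1 - s / 2)"], rule conjI, rule rate,
     rule exI[of _ "\<lambda>t. trg (f t)"], rule exI[of _ "\<lambda>t. trg (g t)"], rule props)
 qed
qed

end
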